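(* (Hochster's theorem for convex polytopes.) Let $F_1,\dots,F_m$ be the facets of a convex polytope $P$. Then $$\beta^{-i,2j}(P)=\sum_{\omega\subseteq[m],\ |\omega|=j}\dim_{\mathbb{Z}}\tilde H^{j-i-1}(F_\omega;\mathbb{Z}),$$ where $F_\omega=\bigcup_{i\in\omega}F_i\subseteq P$.
   Context: $[m]=\{1,\dots,m\}$, and $P$ is a convex polytope, not necessarily simple. $K_P$ is the simplicial complex on $[m]$ whose simplices are the empty set and all $\{i_1,\dots,i_k\}$ with $F_{i_1}\cap\dots\cap F_{i_k}\ne\varnothing$. For a simplicial complex $K$ on $[m]$, $\mathbb{Z}[K]$ is its Stanley–Reisner ring, the quotient of $\mathbb{Z}[v_1,\dots,v_m]$ by the ideal generated by the monomials $v_{i_1}\cdots v_{i_k}$ with $\{i_1,\dots,i_k\}\notin K$. The Betti numbers are $$\beta^{-i,2j}(K)=\dim_{\mathbb{Z}}\mathrm{Tor}^{-i,2j}_{\mathbb{Z}[v_1,\dots,v_m]}(\mathbb{Z}[K],\mathbb{Z}),\quad 0\leqslant i,j\leqslant m,$$ where $\mathbb{Z}[K]$ is a module via the projection, $\mathbb{Z}$ is a module via the augmentation $v_k\mapsto0$, the index $-i$ is the (negated) homological degree of the resolution, and $2j$ is the internal grading with $\deg v_k=2$. For a polytope, $\beta^{-i,2j}(P)=\beta^{-i,2j}(K_P)$. Here $\dim_{\mathbb{Z}}$ denotes the rank of an abelian group, and $\tilde H^{*}$ is reduced cohomology with $\tilde H^{-1}(\varnothing;\mathbb{Z})=\mathbb{Z}$.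 *)

theory Defs
  imports "HOL-Analysis.Analysis" "HOL-Algebra.Algebra" "HOL-Homology.Homology"
begin

section \<open>Rank of an abelian group\<close>

text \<open>The rank takes values in \<open>enat\<close>, so that a group of infinite rank gets no
  spurious finite value.\<close>

definition int_independent :: "('a, 'b) monoid_scheme \<Rightarrow> 'a set \<Rightarrow> bool" where
  "int_independent G S \<longleftrightarrow> finite S \<and> S \<subseteq> carrier G \<and>
     (\<forall>c :: 'a \<Rightarrow> int. finprod G (\<lambda>x. x [^]\<^bsub>G\<^esub> c x) S = \<one>\<^bsub>G\<^esub> \<longrightarrow> (\<forall>x\<in>S. c x = 0))"

definition abelian_rank :: "('a, 'b) monoid_scheme \<Rightarrow> enat" where
  "abelian_rank G = (SUP S\<in>{S. int_independent G S}. enat (card S))"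


section \<open>Reduced singular cohomology with integer coefficients\<close>

text \<open>The standard \<open>(-1)\<close>-simplex is empty, and \<open>\<lambda>x. undefined\<close> is the only function in
  \<open>extensional {}\<close>. It is thus the unique singular \<open>(-1)\<close>-simplex, which generates the
  augmentation term of the singular chain complex.\<close>

definition aug_simplex_set :: "int \<Rightarrow> 'a topology \<Rightarrow> ((nat \<Rightarrow> real) \<Rightarrow> 'a) set" where
  "aug_simplex_set n T =
     (if n \<ge> 0 then singular_simplex_set (nat n) T
      else if n = -1 then {\<lambda>x. undefined} else {})"

definition aug_chain_group :: "int \<Rightarrow> 'a topology \<Rightarrow> 'a chain monoid" where
  "aug_chain_group n T = free_Abelian_group (aug_simplex_set n T)"

definition aug_boundary :: "int \<Rightarrow> 'a chain \<Rightarrow> 'a chain" where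
  "aug_boundary n c =
     (if n \<ge> 1 then chain_boundary (nat n) c
      else if n = 0 then frag_extend (\<lambda>s. frag_of (\<lambda>x. undefined)) c
      else 0)"

definition hom_group ::
  "('a, 'c) monoid_scheme \<Rightarrow> ('b, 'd) monoid_scheme \<Rightarrow> ('a \<Rightarrow> 'b) monoid" where
  "hom_group G H =
     \<lparr>carrier = hom G H \<inter> extensional (carrier G),
      monoid.mult = (\<lambda>f g. \<lambda>x\<in>carrier G. f x \<otimes>\<^bsub>H\<^esub> g x),
      one = (\<lambda>x\<in>carrier G. \<one>\<^bsub>H\<^esub>)\<rparr>"

definition aug_cochain_group :: "int \<Rightarrow> 'a topology \<Rightarrow> ('a chain \<Rightarrow> int) monoid" where
  "aug_cochain_group n T = hom_group (aug_chain_group n T) integer_group"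

definition coboundary :: "int \<Rightarrow> 'a topology \<Rightarrow> ('a chain \<Rightarrow> int) \<Rightarrow> ('a chain \<Rightarrow> int)" where
  "coboundary n T f = (\<lambda>c\<in>carrier (aug_chain_group (n + 1) T). f (aug_boundary (n + 1) c))"

definition reduced_cohomology_group ::
  "int \<Rightarrow> 'a topology \<Rightarrow> ('a chain \<Rightarrow> int) set monoid" where
  "reduced_cohomology_group n T =
     subgroup_generated (aug_cochain_group n T)
       (kernel (aug_cochain_group n T) (aug_cochain_group (n + 1) T) (coboundary n T))
     Mod (coboundary (n - 1) T ` carrier (aug_cochain_group (n - 1) T))"


section \<open>Graded modules, tensor products and Tor\<close>

text \<open>A grading of a module is given by the family of its homogeneous components.\<close>

definition module_hom ::
  "('r, 'z) ring_scheme \<Rightarrow> ('r, 'a, 'x) module_scheme \<Rightarrow> ('r, 'b, 'y) module_scheme \<Rightarrow>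
     ('a \<Rightarrow> 'b) set" where
  "module_hom R M N =
     {f \<in> carrier M \<rightarrow> carrier N.
        (\<forall>x\<in>carrier M. \<forall>y\<in>carrier M. f (x \<oplus>\<^bsub>M\<^esub> y) = f x \<oplus>\<^bsub>N\<^esub> f y) \<and>
        (\<forall>r\<in>carrier R. \<forall>x\<in>carrier M. f (r \<odot>\<^bsub>M\<^esub> x) = r \<odot>\<^bsub>N\<^esub> f x)}"

definition graded_hom ::
  "('r, 'z) ring_scheme \<Rightarrow> ('r, 'a, 'x) module_scheme \<Rightarrow> (nat \<Rightarrow> 'a set) \<Rightarrow>
     ('r, 'b, 'y) module_scheme \<Rightarrow> (nat \<Rightarrow> 'b set) \<Rightarrow> ('a \<Rightarrow> 'b) set" where
  "graded_hom R M MG N NG = {f \<in> module_hom R M N. \<forall>n. f ` MG n \<subseteq> NG n}"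

text \<open>A ring \<open>A\<close> as a module over the source of a ring homomorphism \<open>h\<close> into \<open>A\<close>.\<close>

definition module_via :: "('a, 'z) ring_scheme \<Rightarrow> ('r \<Rightarrow> 'a) \<Rightarrow> ('r, 'a) module" where
  "module_via A h =
     \<lparr>carrier = carrier A, monoid.mult = monoid.mult A, monoid.one = monoid.one A,
      ring.zero = ring.zero A, ring.add = ring.add A,
      smult = (\<lambda>r x. h r \<otimes>\<^bsub>A\<^esub> x)\<rparr>"

text \<open>The free module with basis \<open>B\<close>, and its grading in which the basis element \<open>b\<close> has
  degree \<open>\<delta> b\<close>. The ring structure of the underlying record is irrelevant.\<close>

definition free_module :: "('r, 'z) ring_scheme \<Rightarrow> 'b set \<Rightarrow> ('r, 'b \<Rightarrow> 'r) module" where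
  "free_module R B =
     \<lparr>carrier = {f. (\<forall>b\<in>B. f b \<in> carrier R) \<and> (\<forall>b. b \<notin> B \<longrightarrow> f b = \<zero>\<^bsub>R\<^esub>) \<and>
                    finite {b. f b \<noteq> \<zero>\<^bsub>R\<^esub>}},
      monoid.mult = undefined, one = undefined,
      ring.zero = (\<lambda>b. \<zero>\<^bsub>R\<^esub>), ring.add = (\<lambda>f g b. f b \<oplus>\<^bsub>R\<^esub> g b),
      smult = (\<lambda>r f b. r \<otimes>\<^bsub>R\<^esub> f b)\<rparr>"

definition free_grading ::
  "('r, 'z) ring_scheme \<Rightarrow> (nat \<Rightarrow> 'r set) \<Rightarrow> 'b set \<Rightarrow> ('b \<Rightarrow> nat) \<Rightarrow> nat \<Rightarrow> ('b \<Rightarrow> 'r) set"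
  where
  "free_grading R RG B \<delta> n =
     {f \<in> carrier (free_module R B).
        \<forall>b\<in>B. if \<delta> b \<le> n then f b \<in> RG (n - \<delta> b) else f b = \<zero>\<^bsub>R\<^esub>}"

text \<open>The tensor product \<open>M \<otimes>\<^sub>R N\<close> is the free abelian group on pairs modulo the bilinear
  relations, written multiplicatively as a quotient group. Degree \<open>n\<close> is generated by
  \<open>x \<otimes> y\<close> with \<open>x\<close> and \<open>y\<close> homogeneous of total degree \<open>n\<close>.\<close>

definition pair_group ::
  "('r, 'a, 'x) module_scheme \<Rightarrow> ('r, 'b, 'y) module_scheme \<Rightarrow> ('a \<times> 'b \<Rightarrow>\<^sub>0 int) monoid" where
  "pair_group M N = free_Abelian_group (carrier M \<times> carrier N)"

definition tensor_relations ::
  "('r, 'z) ring_scheme \<Rightarrow> ('r, 'a, 'x) module_scheme \<Rightarrow> ('r, 'b, 'y) module_scheme \<Rightarrow>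
     ('a \<times> 'b \<Rightarrow>\<^sub>0 int) set" where
  "tensor_relations R M N = generate (pair_group M N)
     ({frag_of (x \<oplus>\<^bsub>M\<^esub> x', y) - frag_of (x, y) - frag_of (x', y) | x x' y.
         x \<in> carrier M \<and> x' \<in> carrier M \<and> y \<in> carrier N} \<union>
      {frag_of (x, y \<oplus>\<^bsub>N\<^esub> y') - frag_of (x, y) - frag_of (x, y') | x y y'.
         x \<in> carrier M \<and> y \<in> carrier N \<and> y' \<in> carrier N} \<union>
      {frag_of (r \<odot>\<^bsub>M\<^esub> x, y) - frag_of (x, r \<odot>\<^bsub>N\<^esub> y) | r x y.
         r \<in> carrier R \<and> x \<in> carrier M \<and> y \<in> carrier N})"

definition tensor_group ::
  "('r, 'z) ring_scheme \<Rightarrow> ('r, 'a, 'x) module_scheme \<Rightarrow> ('r, 'b, 'y) module_scheme \<Rightarrow>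
     ('a \<times> 'b \<Rightarrow>\<^sub>0 int) set monoid" where
  "tensor_group R M N = pair_group M N Mod tensor_relations R M N"

definition tensor_elem ::
  "('r, 'z) ring_scheme \<Rightarrow> ('r, 'a, 'x) module_scheme \<Rightarrow> ('r, 'b, 'y) module_scheme \<Rightarrow>
     'a \<Rightarrow> 'b \<Rightarrow> ('a \<times> 'b \<Rightarrow>\<^sub>0 int) set" where
  "tensor_elem R M N x y = tensor_relations R M N #>\<^bsub>pair_group M N\<^esub> frag_of (x, y)"

definition tensor_grading ::
  "('r, 'z) ring_scheme \<Rightarrow> ('r, 'a, 'x) module_scheme \<Rightarrow> (nat \<Rightarrow> 'a set) \<Rightarrow>
     ('r, 'b, 'y) module_scheme \<Rightarrow> (nat \<Rightarrow> 'b set) \<Rightarrow> nat \<Rightarrow> ('a \<times> 'b \<Rightarrow>\<^sub>0 int) set set" where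
  "tensor_grading R M MG N NG n = generate (tensor_group R M N)
     {tensor_elem R M N x y | x y. \<exists>k l. k + l = n \<and> x \<in> MG k \<and> y \<in> NG l}"

text \<open>The homomorphism \<open>f \<otimes> id : M \<otimes> N \<rightarrow> M' \<otimes> N\<close>, evaluated at a coset \<open>C\<close>: the image of
  \<open>C\<close> under \<open>(x, y) \<mapsto> (f x, y)\<close> lies in a single coset, which the product with the
  relations of \<open>M' \<otimes> N\<close> fills up.\<close>

definition tensor_map ::
  "('r, 'z) ring_scheme \<Rightarrow> ('r, 'b, 'y) module_scheme \<Rightarrow> ('r, 'c, 'w) module_scheme \<Rightarrow>
     ('a \<Rightarrow> 'b) \<Rightarrow> ('a \<times> 'c \<Rightarrow>\<^sub>0 int) set \<Rightarrow> ('b \<times> 'c \<Rightarrow>\<^sub>0 int) set" where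
  "tensor_map R M' N f C =
     tensor_relations R M' N <#>\<^bsub>pair_group M' N\<^esub>
       frag_extend (\<lambda>(x, y). frag_of (f x, y)) ` C"

text \<open>Graded free resolutions \<open>\<dots> \<rightarrow> F\<^sub>1 \<rightarrow> F\<^sub>0 \<rightarrow> M \<rightarrow> 0\<close>, where \<open>F\<^sub>i\<close> has basis
  \<open>res_basis i\<close> with degrees \<open>res_deg i\<close>, and \<open>res_diff i\<close> maps \<open>F\<^sub>i\<^sub>+\<^sub>1\<close> to \<open>F\<^sub>i\<close>.
  Bases are taken inside \<open>nat\<close>: a countable graded module over a countable graded ring,
  such as a Stanley-Reisner ring over the integers, has a resolution of this form.\<close>

record ('r, 'a) resolution =
  res_basis :: "nat \<Rightarrow> nat set"
  res_deg :: "nat \<Rightarrow> nat \<Rightarrow> nat"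
  res_diff :: "nat \<Rightarrow> (nat \<Rightarrow> 'r) \<Rightarrow> (nat \<Rightarrow> 'r)"
  res_aug :: "(nat \<Rightarrow> 'r) \<Rightarrow> 'a"

definition res_module ::
  "('r, 'z) ring_scheme \<Rightarrow> ('r, 'a) resolution \<Rightarrow> nat \<Rightarrow> ('r, nat \<Rightarrow> 'r) module" where
  "res_module R F i = free_module R (res_basis F i)"

definition res_grading ::
  "('r, 'z) ring_scheme \<Rightarrow> (nat \<Rightarrow> 'r set) \<Rightarrow> ('r, 'a) resolution \<Rightarrow> nat \<Rightarrow> nat \<Rightarrow>
     (nat \<Rightarrow> 'r) set" where
  "res_grading R RG F i = free_grading R RG (res_basis F i) (res_deg F i)"

definition graded_free_resolution ::
  "('r, 'z) ring_scheme \<Rightarrow> (nat \<Rightarrow> 'r set) \<Rightarrow> ('r, 'a, 'x) module_scheme \<Rightarrow> (nat \<Rightarrow> 'a set) \<Rightarrow>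
     ('r, 'a) resolution \<Rightarrow> bool" where
  "graded_free_resolution R RG M MG F \<longleftrightarrow>
     res_aug F \<in> graded_hom R (res_module R F 0) (res_grading R RG F 0) M MG \<and>
     (\<forall>i. res_diff F i \<in> graded_hom R
        (res_module R F (Suc i)) (res_grading R RG F (Suc i))
        (res_module R F i) (res_grading R RG F i)) \<and>
     res_aug F ` carrier (res_module R F 0) = carrier M \<and>
     res_diff F 0 ` carrier (res_module R F 1) =
       {x \<in> carrier (res_module R F 0). res_aug F x = \<zero>\<^bsub>M\<^esub>} \<and>
     (\<forall>i. res_diff F (Suc i) ` carrier (res_module R F (Suc (Suc i))) =
       {x \<in> carrier (res_module R F (Suc i)). res_diff F i x = \<zero>\<^bsub>res_module R F i\<^esub>})"

text \<open>Homology of \<open>F \<otimes> N\<close> in homological degree \<open>i\<close> and internal degree \<open>n\<close>.\<close>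

definition tensor_cycles ::
  "('r, 'z) ring_scheme \<Rightarrow> (nat \<Rightarrow> 'r set) \<Rightarrow> ('r, 'a) resolution \<Rightarrow>
     ('r, 'b, 'y) module_scheme \<Rightarrow> (nat \<Rightarrow> 'b set) \<Rightarrow> nat \<Rightarrow> nat \<Rightarrow>
     ((nat \<Rightarrow> 'r) \<times> 'b \<Rightarrow>\<^sub>0 int) set set" where
  "tensor_cycles R RG F N NG i n =
     {z \<in> tensor_grading R (res_module R F i) (res_grading R RG F i) N NG n.
        case i of 0 \<Rightarrow> True
        | Suc k \<Rightarrow> tensor_map R (res_module R F k) N (res_diff F k) z =
                    \<one>\<^bsub>tensor_group R (res_module R F k) N\<^esub>}"

definition tensor_boundaries ::
  "('r, 'z) ring_scheme \<Rightarrow> (nat \<Rightarrow> 'r set) \<Rightarrow> ('r, 'a) resolution \<Rightarrow>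
     ('r, 'b, 'y) module_scheme \<Rightarrow> (nat \<Rightarrow> 'b set) \<Rightarrow> nat \<Rightarrow> nat \<Rightarrow>
     ((nat \<Rightarrow> 'r) \<times> 'b \<Rightarrow>\<^sub>0 int) set set" where
  "tensor_boundaries R RG F N NG i n =
     tensor_map R (res_module R F i) N (res_diff F i) `
       tensor_grading R (res_module R F (Suc i)) (res_grading R RG F (Suc i)) N NG n"

definition resolution_homology ::
  "('r, 'z) ring_scheme \<Rightarrow> (nat \<Rightarrow> 'r set) \<Rightarrow> ('r, 'a) resolution \<Rightarrow>
     ('r, 'b, 'y) module_scheme \<Rightarrow> (nat \<Rightarrow> 'b set) \<Rightarrow> nat \<Rightarrow> nat \<Rightarrow>
     ((nat \<Rightarrow> 'r) \<times> 'b \<Rightarrow>\<^sub>0 int) set set monoid" where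
  "resolution_homology R RG F N NG i n =
     subgroup_generated (tensor_group R (res_module R F i) N) (tensor_cycles R RG F N NG i n)
     Mod tensor_boundaries R RG F N NG i n"

text \<open>As usual, \<open>Tor\<close> is computed from a chosen resolution of the first argument; up to
  isomorphism it does not depend on the choice.\<close>

definition graded_Tor ::
  "('r, 'z) ring_scheme \<Rightarrow> (nat \<Rightarrow> 'r set) \<Rightarrow> ('r, 'a, 'x) module_scheme \<Rightarrow> (nat \<Rightarrow> 'a set) \<Rightarrow>
     ('r, 'b, 'y) module_scheme \<Rightarrow> (nat \<Rightarrow> 'b set) \<Rightarrow> nat \<Rightarrow> nat \<Rightarrow>
     ((nat \<Rightarrow> 'r) \<times> 'b \<Rightarrow>\<^sub>0 int) set set monoid" where
  "graded_Tor R RG M MG N NG i n =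
     resolution_homology R RG (SOME F. graded_free_resolution R RG M MG F) N NG i n"


section \<open>Stanley--Reisner rings and Betti numbers\<close>

type_synonym int_mpoly = "(nat \<Rightarrow>\<^sub>0 nat) \<Rightarrow>\<^sub>0 int"

definition mpoly_ring :: "nat \<Rightarrow> int_mpoly ring" where
  "mpoly_ring m =
     \<lparr>carrier = {p. \<forall>t\<in>Poly_Mapping.keys p. Poly_Mapping.keys t \<subseteq> {1..m}},
      monoid.mult = (*), one = 1, ring.zero = 0, ring.add = (+)\<rparr>"

definition poly_var :: "nat \<Rightarrow> int_mpoly" where
  "poly_var k = Poly_Mapping.single (Poly_Mapping.single k 1) 1"

text \<open>Each variable has degree 2.\<close>

definition mpoly_grading :: "nat \<Rightarrow> nat \<Rightarrow> int_mpoly set" where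
  "mpoly_grading m n =
     {p \<in> carrier (mpoly_ring m). \<forall>t\<in>Poly_Mapping.keys p.
        2 * (\<Sum>k\<in>Poly_Mapping.keys t. Poly_Mapping.lookup t k) = n}"

definition SR_ideal :: "nat \<Rightarrow> nat set set \<Rightarrow> int_mpoly set" where
  "SR_ideal m K = Idl\<^bsub>mpoly_ring m\<^esub> {\<Prod>k\<in>s. poly_var k | s. s \<subseteq> {1..m} \<and> s \<notin> K}"

definition SR_ring :: "nat \<Rightarrow> nat set set \<Rightarrow> int_mpoly set ring" where
  "SR_ring m K = mpoly_ring m Quot SR_ideal m K"

definition SR_proj :: "nat \<Rightarrow> nat set set \<Rightarrow> int_mpoly \<Rightarrow> int_mpoly set" where
  "SR_proj m K p = SR_ideal m K +>\<^bsub>mpoly_ring m\<^esub> p"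

definition SR_module :: "nat \<Rightarrow> nat set set \<Rightarrow> (int_mpoly, int_mpoly set) module" where
  "SR_module m K = module_via (SR_ring m K) (SR_proj m K)"

definition SR_grading :: "nat \<Rightarrow> nat set set \<Rightarrow> nat \<Rightarrow> int_mpoly set set" where
  "SR_grading m K n = SR_proj m K ` mpoly_grading m n"

text \<open>The augmentation, sending every variable to 0, takes the constant coefficient.\<close>

definition augmentation :: "int_mpoly \<Rightarrow> int" where
  "augmentation p = Poly_Mapping.lookup p 0"

definition int_module :: "(int_mpoly, int) module" where
  "int_module = module_via \<Z> augmentation"

definition int_grading :: "nat \<Rightarrow> int set" where
  "int_grading n = (if n = 0 then UNIV else {0})"

text \<open>\<open>betti m K i j\<close> is \<open>\<beta>\<^sup>-\<^sup>i\<^sup>,\<^sup>2\<^sup>j(K)\<close>.\<close>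

definition betti :: "nat \<Rightarrow> nat set set \<Rightarrow> nat \<Rightarrow> nat \<Rightarrow> enat" where
  "betti m K i j = abelian_rank
     (graded_Tor (mpoly_ring m) (mpoly_grading m) (SR_module m K) (SR_grading m K)
        int_module int_grading i (2 * j))"

definition facet_complex :: "nat \<Rightarrow> (nat \<Rightarrow> 'a set) \<Rightarrow> nat set set" where
  "facet_complex m F = insert {} {s. s \<noteq> {} \<and> s \<subseteq> {1..m} \<and> (\<Inter>k\<in>s. F k) \<noteq> {}}"

text \<open>The Betti numbers of a polytope depend only on its facets \<open>F 1, \<dots>, F m\<close>.\<close>

definition polytope_betti :: "nat \<Rightarrow> (nat \<Rightarrow> 'a set) \<Rightarrow> nat \<Rightarrow> nat \<Rightarrow> enat" where
  "polytope_betti m F = betti m (facet_complex m F)"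

end

theory Submission
  imports Defs
begin

text \<open>Both sides are ranks of subquotients of groups of integer-valued functions on a basis.

  On the topological side the facets are compact and convex, so small open neighbourhoods of them have
  the same nerve, and their union deforms onto \<open>F\<^sub>\<omega>\<close>. Small singular simplices and acyclic carriers
  identify the reduced cohomology of \<open>F\<^sub>\<omega>\<close> with that of the full subcomplex of \<open>K\<^sub>P\<close> on \<open>\<omega>\<close>.

  On the algebraic side any two graded free resolutions of \<open>\<int>[K]\<close> are chain homotopy equivalent, so the
  chosen one can be replaced by the Koszul resolution with basis \<open>u\<^sub>I \<otimes> v\<^sup>t\<close>, where \<open>v\<^sup>t\<close> is a monomial
  of \<open>\<int>[K]\<close>. Tensored with \<open>\<int>\<close> it splits by multidegree. A multidegree that is not squarefree contributes
  nothing. In the squarefree multidegree \<open>\<omega>\<close> the element \<open>u\<^sub>I \<otimes> v\<^sup>\<sigma>\<close> with \<open>I = \<omega> - \<sigma>\<close> corresponds, up to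
  sign, to the dual of the simplex \<open>\<sigma>\<close> of the full subcomplex; so \<open>|I| = i\<close> and \<open>|\<omega>| = j\<close> mean that
  \<open>\<sigma>\<close> has dimension \<open>j - i - 1\<close>.\<close>

text \<open>The quotients to be compared consist of cosets of quite different objects, so ranks are
  computed in coordinates. Most equalities of ranks are pairs of inequalities: an additive map
  reflecting one subgroup into another suffices, hence a homotopy from one composite to the
  identity, and the comparisons by homotopies need no isomorphism of cohomology groups.

  The facets are thickened because subdivision makes simplices small only for an open cover. A
  singular simplex singles out no member of a cover, but it determines the set of all members
  containing it, and this set grows on passing to a face. That is why the nerve enters through flags
  of index sets and reaches its simplicial form only by barycentric subdivision.

  The Koszul resolution is that of the diagonal: the Koszul complex on the differences of the two
  copies of each variable resolves the polynomial ring over its tensor square, and is then tensored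
  with \<int>[K].\<close>

abbreviation lookup :: "('a \<Rightarrow>\<^sub>0 'b::zero) \<Rightarrow> 'a \<Rightarrow> 'b" where
  "lookup \<equiv> Poly_Mapping.lookup"

abbreviation keys :: "('a \<Rightarrow>\<^sub>0 'b::zero) \<Rightarrow> 'a set" where
  "keys \<equiv> Poly_Mapping.keys"

abbreviation single :: "'a \<Rightarrow> 'b::zero \<Rightarrow> 'a \<Rightarrow>\<^sub>0 'b" where
  "single \<equiv> Poly_Mapping.single"

section \<open>Ranks of subquotients of groups of integer functions\<close>

definition lincomb :: "(('b \<Rightarrow> int) \<Rightarrow> int) \<Rightarrow> ('b \<Rightarrow> int) set \<Rightarrow> 'b \<Rightarrow> int" where
  "lincomb c S = (\<lambda>b. \<Sum>x\<in>S. c x * x b)"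

definition indep_mod :: "('b \<Rightarrow> int) set \<Rightarrow> ('b \<Rightarrow> int) set \<Rightarrow> bool" where
  "indep_mod N S \<longleftrightarrow> finite S \<and> (\<forall>c. lincomb c S \<in> N \<longrightarrow> (\<forall>x\<in>S. c x = 0))"

lemma indep_modD: "indep_mod N S \<Longrightarrow> lincomb c S \<in> N \<Longrightarrow> x \<in> S \<Longrightarrow> c x = 0"
  unfolding indep_mod_def by blast

text \<open>For subgroups \<open>N \<subseteq> Z\<close> this is the rank of the quotient. Avoiding
  cosets lets quotients over different types be compared by maps between functions.\<close>

definition qrank :: "('b \<Rightarrow> int) set \<Rightarrow> ('b \<Rightarrow> int) set \<Rightarrow> enat" where
  "qrank Z N = (SUP S\<in>{S. S \<subseteq> Z \<and> indep_mod N S}. enat (card S))"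

definition fun_subgroup :: "('b \<Rightarrow> int) set \<Rightarrow> bool" where
  "fun_subgroup Z \<longleftrightarrow> (\<lambda>b. 0) \<in> Z \<and> (\<forall>x\<in>Z. \<forall>y\<in>Z. (\<lambda>b. x b - y b) \<in> Z)"

lemma fun_subgroup_zero: "fun_subgroup Z \<Longrightarrow> (\<lambda>b. 0) \<in> Z"
  by (simp add: fun_subgroup_def)

lemma fun_subgroup_diff: "fun_subgroup Z \<Longrightarrow> x \<in> Z \<Longrightarrow> y \<in> Z \<Longrightarrow> (\<lambda>b. x b - y b) \<in> Z"
  by (simp add: fun_subgroup_def)

lemma fun_subgroup_uminus: "fun_subgroup Z \<Longrightarrow> x \<in> Z \<Longrightarrow> (\<lambda>b. - x b) \<in> Z"
  using fun_subgroup_diff[of Z "\<lambda>b. 0" x] fun_subgroup_zero[of Z] by simp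

lemma fun_subgroup_add: "fun_subgroup Z \<Longrightarrow> x \<in> Z \<Longrightarrow> y \<in> Z \<Longrightarrow> (\<lambda>b. x b + y b) \<in> Z"
  using fun_subgroup_diff[of Z x "\<lambda>b. - y b"] fun_subgroup_uminus[of Z y] by simp

lemma fun_subgroup_sum:
  assumes "fun_subgroup Z" "\<And>i. i \<in> I \<Longrightarrow> f i \<in> Z"
  shows "(\<lambda>b. \<Sum>i\<in>I. f i b) \<in> Z"
  using assms(2)
  by (induction I rule: infinite_finite_induct)
    (auto intro: fun_subgroup_add[OF assms(1)] fun_subgroup_zero[OF assms(1)])

lemma fun_subgroup_scale:
  assumes "fun_subgroup Z" "x \<in> Z"
  shows "(\<lambda>b. (k::int) * x b) \<in> Z"
proof -
  have nat: "(\<lambda>b. int n * x b) \<in> Z" for n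
    by (induction n)
      (auto simp: algebra_simps intro: fun_subgroup_add[OF assms(1)]
        fun_subgroup_zero[OF assms(1)] assms(2))
  show ?thesis
    using nat[of "nat k"] fun_subgroup_uminus[OF assms(1) nat[of "nat (- k)"]]
    by (cases "k \<ge> 0") auto
qed

lemma lincomb_closed:
  assumes "fun_subgroup Z" "S \<subseteq> Z"
  shows "lincomb c S \<in> Z"
  unfolding lincomb_def
  using assms by (intro fun_subgroup_sum) (auto intro: fun_subgroup_scale)

lemma qrank_upper: "S \<subseteq> Z \<Longrightarrow> indep_mod N S \<Longrightarrow> enat (card S) \<le> qrank Z N"
  unfolding qrank_def by (rule SUP_upper) simp

lemma qrank_least:
  "(\<And>S. S \<subseteq> Z \<Longrightarrow> indep_mod N S \<Longrightarrow> enat (card S) \<le> r) \<Longrightarrow> qrank Z N \<le> r"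
  unfolding qrank_def by (rule SUP_least) simp

lemma additive_lincomb:
  assumes Z: "fun_subgroup Z"
    and add: "\<And>x y. x \<in> Z \<Longrightarrow> y \<in> Z \<Longrightarrow> \<phi> (\<lambda>b. x b - y b) = (\<lambda>b. \<phi> x b - \<phi> y b)"
    and S: "finite S" "S \<subseteq> Z"
  shows "\<phi> (lincomb c S) = (\<lambda>b. \<Sum>x\<in>S. c x * \<phi> x b)"
proof -
  have zero: "\<phi> (\<lambda>b. 0) = (\<lambda>b. 0)"
    using add[of "\<lambda>b. 0" "\<lambda>b. 0"] fun_subgroup_zero[OF Z] by (auto simp: fun_eq_iff)
  have neg: "\<phi> (\<lambda>b. - x b) = (\<lambda>b. - \<phi> x b)" if "x \<in> Z" for x
    using add[of "\<lambda>b. 0" x] fun_subgroup_zero[OF Z] that zero by simp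
  have plus: "\<phi> (\<lambda>b. x b + y b) = (\<lambda>b. \<phi> x b + \<phi> y b)" if "x \<in> Z" "y \<in> Z" for x y
    using add[of x "\<lambda>b. - y b"] fun_subgroup_uminus[OF Z that(2)] that neg by simp
  have nat: "\<phi> (\<lambda>b. int n * x b) = (\<lambda>b. int n * \<phi> x b)" if x: "x \<in> Z" for n x
  proof (induction n)
    case (Suc n)
    have "\<phi> (\<lambda>b. int n * x b + x b) = (\<lambda>b. int n * \<phi> x b + \<phi> x b)"
      using plus[OF fun_subgroup_scale[OF Z x] x] Suc by simp
    then show ?case
      by (simp add: algebra_simps)
  qed (simp add: zero)
  have scale: "\<phi> (\<lambda>b. k * x b) = (\<lambda>b. k * \<phi> x b)" if x: "x \<in> Z" for k x
  proof (cases "k \<ge> 0")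
    case True
    then show ?thesis
      using nat[OF x, of "nat k"] by simp
  next
    case False
    then show ?thesis
      using nat[OF x, of "nat (- k)"] neg[OF fun_subgroup_scale[OF Z x, of "- k"]] by simp
  qed
  show ?thesis
    using S
  proof (induction S rule: finite_induct)
    case empty
    then show ?case
      by (simp add: lincomb_def zero)
  next
    case (insert y S)
    have "lincomb c (insert y S) = (\<lambda>b. c y * y b + lincomb c S b)"
      using insert by (simp add: lincomb_def)
    then have "\<phi> (lincomb c (insert y S)) = (\<lambda>b. \<phi> (\<lambda>b. c y * y b) b + \<phi> (lincomb c S) b)"
      using plus[of "\<lambda>b. c y * y b" "lincomb c S"] insert
        lincomb_closed[OF Z, of S] fun_subgroup_scale[OF Z, of y]
      by simp
    then show ?case
      using insert scale by simp
  qed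
qed

text \<open>A relation among the images modulo \<open>N'\<close> is the image of a linear
  combination, and \<open>inj\<close> pulls it back to a relation modulo \<open>N\<close>; so
  independent sets have independent images. This is the general tool for comparing ranks.\<close>

lemma qrank_inj_le:
  assumes Z: "fun_subgroup Z" and N': "(\<lambda>b. 0) \<in> N'"
    and add: "\<And>x y. x \<in> Z \<Longrightarrow> y \<in> Z \<Longrightarrow> \<phi> (\<lambda>b. x b - y b) = (\<lambda>b. \<phi> x b - \<phi> y b)"
    and maps: "\<And>x. x \<in> Z \<Longrightarrow> \<phi> x \<in> Z'"
    and inj: "\<And>x. x \<in> Z \<Longrightarrow> \<phi> x \<in> N' \<Longrightarrow> x \<in> N"
  shows "qrank Z N \<le> qrank Z' N'"
proof (rule qrank_least)
  fix S assume S: "S \<subseteq> Z" "indep_mod N S"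
  then have fin: "finite S"
    by (simp add: indep_mod_def)
  have inj_S: "inj_on \<phi> S"
  proof (rule inj_onI, rule ccontr)
    fix x y assume xy: "x \<in> S" "y \<in> S" "\<phi> x = \<phi> y" "x \<noteq> y"
    \<comment> \<open>Two elements of \<open>S\<close> with the same image would differ by an
      element of \<open>N\<close>, a relation with coefficients 1 and -1.\<close>
    let ?c = "\<lambda>z. if z = x then 1 else if z = y then - 1 else (0::int)"
    have "\<phi> (\<lambda>b. x b - y b) = (\<lambda>b. 0)"
      using add[of x y] xy S by (simp add: subset_iff)
    then have "(\<lambda>b. x b - y b) \<in> N"
      using inj fun_subgroup_diff[OF Z] xy S N' by (metis subsetD)
    moreover have "lincomb ?c S = (\<lambda>b. x b - y b)"
    proof
      fix b
      have "lincomb ?c S b = (\<Sum>z\<in>{x, y}. ?c z * z b)"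
        unfolding lincomb_def using fin xy by (intro sum.mono_neutral_right) auto
      then show "lincomb ?c S b = x b - y b"
        using xy by simp
    qed
    ultimately have "?c x = 0"
      using xy(1) by (intro indep_modD[OF S(2), of ?c]) simp_all
    then show False
      by simp
  qed
  have "indep_mod N' (\<phi> ` S)"
    unfolding indep_mod_def
  proof (intro conjI allI impI ballI)
    fix c y assume c: "lincomb c (\<phi> ` S) \<in> N'" and "y \<in> \<phi> ` S"
    then obtain x where x: "x \<in> S" "y = \<phi> x"
      by auto
    have "lincomb c (\<phi> ` S) = \<phi> (lincomb (c \<circ> \<phi>) S)"
      by (subst additive_lincomb[OF Z _ fin S(1), of \<phi>])
        (auto simp: lincomb_def sum.reindex[OF inj_S] intro!: add)
    then have "lincomb (c \<circ> \<phi>) S \<in> N"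
      using c inj lincomb_closed[OF Z S(1)] by auto
    then show "c y = 0"
      using S(2) x by (auto simp: indep_mod_def)
  qed (use fin in simp)
  then have "enat (card (\<phi> ` S)) \<le> qrank Z' N'"
    using maps S by (intro qrank_upper) auto
  then show "enat (card S) \<le> qrank Z' N'"
    by (simp add: card_image inj_S)
qed

lemma qrank_trivial:
  assumes "Z \<subseteq> N" "fun_subgroup N"
  shows "qrank Z N = 0"
proof -
  have "S = {}" if "S \<subseteq> Z" "indep_mod N S" for S
  proof -
    have "lincomb (\<lambda>_. 1) S \<in> N"
      using lincomb_closed[OF assms(2)] assms(1) that(1) by blast
    then have "x \<in> S \<Longrightarrow> (1::int) = 0" for x
      by (rule indep_modD[OF that(2)])
    then show ?thesis
      by auto
  qed
  then have "qrank Z N \<le> 0"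
    by (intro qrank_least) (metis card.empty order_refl zero_enat_def)
  then show ?thesis
    by simp
qed

section \<open>Ranks of quotient groups in coordinates\<close>

lemma finprod_hom_fun:
  assumes "comm_group G"
    and e: "\<And>x y. x \<in> carrier G \<Longrightarrow> y \<in> carrier G \<Longrightarrow> e (x \<otimes>\<^bsub>G\<^esub> y) = (\<lambda>b. e x b + e y b :: int)"
    and S: "finite S" "\<rho> \<in> S \<rightarrow> carrier G"
  shows "e (finprod G (\<lambda>x. \<rho> x [^]\<^bsub>G\<^esub> (c x :: int)) S) = (\<lambda>b. \<Sum>x\<in>S. c x * e (\<rho> x) b)"
proof -
  interpret comm_group G by fact
  have one: "e \<one>\<^bsub>G\<^esub> = (\<lambda>b. 0)"
    using e[of "\<one>\<^bsub>G\<^esub>" "\<one>\<^bsub>G\<^esub>"] by (auto simp: fun_eq_iff)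
  have inv: "e (inv\<^bsub>G\<^esub> x) = (\<lambda>b. - e x b)" if "x \<in> carrier G" for x
  proof -
    have "(\<lambda>b. 0) = (\<lambda>b. e x b + e (inv\<^bsub>G\<^esub> x) b)"
      using e[of x "inv\<^bsub>G\<^esub> x"] that one by simp
    then show ?thesis
      by (auto simp: fun_eq_iff algebra_simps) (metis add.commute add_eq_0_iff)
  qed
  have nat: "e (x [^]\<^bsub>G\<^esub> (n::nat)) = (\<lambda>b. int n * e x b)" if "x \<in> carrier G" for x n
    using that by (induction n) (auto simp: one e algebra_simps)
  have pow: "e (x [^]\<^bsub>G\<^esub> (k::int)) = (\<lambda>b. k * e x b)" if x: "x \<in> carrier G" for x k
  proof (cases k)
    case (nonneg n)
    show ?thesis
      unfolding nonneg int_pow_int by (rule nat[OF x])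
  next
    case (neg n)
    have "e (inv\<^bsub>G\<^esub> (x [^]\<^bsub>G\<^esub> Suc n)) = (\<lambda>b. - (int (Suc n) * e x b))"
      unfolding inv[OF nat_pow_closed[OF x]] nat[OF x] by (rule refl)
    then show ?thesis
      unfolding neg int_pow_neg_int[OF x] by (simp only: minus_mult_left)
  qed
  show ?thesis
    using S
  proof (induction S rule: finite_induct)
    case empty
    then show ?case
      by (simp add: one)
  next
    case (insert y S)
    then have 1: "finprod G (\<lambda>x. \<rho> x [^]\<^bsub>G\<^esub> c x) S \<in> carrier G" and y: "\<rho> y \<in> carrier G"
      by (auto intro!: finprod_closed)
    have "finprod G (\<lambda>x. \<rho> x [^]\<^bsub>G\<^esub> c x) (insert y S)
        = \<rho> y [^]\<^bsub>G\<^esub> c y \<otimes>\<^bsub>G\<^esub> finprod G (\<lambda>x. \<rho> x [^]\<^bsub>G\<^esub> c x) S"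
      using insert by (intro finprod_insert) auto
    moreover have "e (finprod G (\<lambda>x. \<rho> x [^]\<^bsub>G\<^esub> c x) S) = (\<lambda>b. \<Sum>x\<in>S. c x * e (\<rho> x) b)"
      using insert by auto
    ultimately have "e (finprod G (\<lambda>x. \<rho> x [^]\<^bsub>G\<^esub> c x) (insert y S))
        = (\<lambda>b. e (\<rho> y [^]\<^bsub>G\<^esub> c y) b + (\<Sum>x\<in>S. c x * e (\<rho> x) b))"
      using e[OF int_pow_closed[OF y] 1] by metis
    then show ?case
      using insert(1,2) by (simp add: pow[OF y])
  qed
qed

text \<open>Because the coordinate map \<open>e\<close> is injective on \<open>Z\<close>, a product
  of powers lies in \<open>N\<close> exactly when the matching combination of coordinates lies in
  the image of \<open>N\<close>. Each inequality then chooses representatives, of cosets in one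
  direction and of coordinate vectors in the other.\<close>

lemma abelian_rank_quotient:
  assumes G: "comm_group G" and Z: "subgroup Z G" and N: "subgroup N G" "N \<subseteq> Z"
    and e: "\<And>x y. x \<in> Z \<Longrightarrow> y \<in> Z \<Longrightarrow> e (x \<otimes>\<^bsub>G\<^esub> y) = (\<lambda>b. e x b + e y b :: int)"
    and inj: "inj_on e Z"
  shows "abelian_rank (subgroup_generated G Z Mod N) = qrank (e ` Z) (e ` N)"
proof -
  interpret G: comm_group G by fact
  define H where "H = subgroup_generated G Z"
  have carr: "carrier H = Z"
    unfolding H_def using Z by (rule subgroup.carrier_subgroup_generated_subgroup)
  interpret H: comm_group H
    unfolding H_def by (rule G.abelian_subgroup_generated[OF G])
  have mult: "x \<otimes>\<^bsub>H\<^esub> y = x \<otimes>\<^bsub>G\<^esub> y" for x y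
    by (simp add: H_def)
  have NH: "subgroup N H"
    using N carr unfolding H_def by (simp add: G.subgroup_subgroup_generated_iff)
  interpret N: normal N H
    using NH by (rule H.subgroup_imp_normal)
  interpret Q: comm_group "H Mod N"
    by (rule H.abelian_FactGroup[OF NH])
  define q where "q = (\<lambda>x. N #>\<^bsub>H\<^esub> x)"
  have q_hom: "q \<in> hom H (H Mod N)"
    unfolding q_def by (rule N.r_coset_hom_Mod)
  interpret q: group_hom H "H Mod N" q
    using q_hom by unfold_locales
  have q_surj: "carrier (H Mod N) = q ` Z"
    unfolding q_def FactGroup_def RCOSETS_def using carr by auto
  have qZ: "q x \<in> carrier (H Mod N)" if "x \<in> Z" for x
    using that q_surj by simp
  have q_one: "q x = \<one>\<^bsub>H Mod N\<^esub> \<longleftrightarrow> x \<in> N" if "x \<in> Z" for x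
    using that carr NH
    by (auto simp: q_def H.coset_join2 dest: H.rcos_self[of x N] intro: H.coset_join2)
  have eH: "e (x \<otimes>\<^bsub>H\<^esub> y) = (\<lambda>b. e x b + e y b)" if "x \<in> carrier H" "y \<in> carrier H" for x y
    using that e carr by (simp add: mult)
  have e_N: "e x \<in> e ` N \<longleftrightarrow> x \<in> N" if "x \<in> Z" for x
    using inj that N(2) by (auto dest: inj_onD)
  have comb: "q (finprod H (\<lambda>x. \<rho> x [^]\<^bsub>H\<^esub> (c x :: int)) S)
      = finprod (H Mod N) (\<lambda>x. q (\<rho> x) [^]\<^bsub>H Mod N\<^esub> c x) S"
    if "finite S" "\<rho> \<in> S \<rightarrow> Z" for S \<rho> and c :: "'d \<Rightarrow> int"
    using that
  proof (induction S rule: finite_induct)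
    case (insert y S)
    then have 1: "finprod H (\<lambda>x. \<rho> x [^]\<^bsub>H\<^esub> c x) S \<in> carrier H"
      using carr by (intro H.finprod_closed) auto
    have 2: "finprod H (\<lambda>x. \<rho> x [^]\<^bsub>H\<^esub> c x) (insert y S)
      = \<rho> y [^]\<^bsub>H\<^esub> c y \<otimes>\<^bsub>H\<^esub> finprod H (\<lambda>x. \<rho> x [^]\<^bsub>H\<^esub> c x) S"
      using insert carr by (intro H.finprod_insert) auto
    have 3: "finprod (H Mod N) (\<lambda>x. q (\<rho> x) [^]\<^bsub>H Mod N\<^esub> c x) (insert y S)
      = q (\<rho> y) [^]\<^bsub>H Mod N\<^esub> c y \<otimes>\<^bsub>H Mod N\<^esub> finprod (H Mod N) (\<lambda>x. q (\<rho> x) [^]\<^bsub>H Mod N\<^esub> c x) S"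
      using insert by (intro Q.finprod_insert) (auto intro!: Q.int_pow_closed qZ)
    have "q (\<rho> y [^]\<^bsub>H\<^esub> c y) = q (\<rho> y) [^]\<^bsub>H Mod N\<^esub> c y"
      using insert carr by (intro q.hom_int_pow) auto
    then show ?case
      using insert 1 carr by (simp only: 2 3) (subst q.hom_mult, auto)
  qed simp
  have sum_in: "finprod H (\<lambda>x. \<rho> x [^]\<^bsub>H\<^esub> (c x :: int)) S \<in> Z"
    if "\<rho> \<in> S \<rightarrow> Z" for S \<rho> and c :: "'d \<Rightarrow> int"
  proof -
    have "(\<lambda>x. \<rho> x [^]\<^bsub>H\<^esub> (c x :: int)) \<in> S \<rightarrow> carrier H"
      using that carr by (auto intro: H.int_pow_closed)
    then show ?thesis
      using H.finprod_closed carr by blast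
  qed
  have key: "finprod (H Mod N) (\<lambda>x. q (\<rho> x) [^]\<^bsub>H Mod N\<^esub> c x) S = \<one>\<^bsub>H Mod N\<^esub>
      \<longleftrightarrow> (\<lambda>b. \<Sum>x\<in>S. c x * e (\<rho> x) b) \<in> e ` N"
    if "finite S" "\<rho> \<in> S \<rightarrow> Z" for S \<rho> and c :: "'d \<Rightarrow> int"
  proof -
    have "\<rho> \<in> S \<rightarrow> carrier H"
      using that(2) carr by simp
    then have "e (finprod H (\<lambda>x. \<rho> x [^]\<^bsub>H\<^esub> c x) S) = (\<lambda>b. \<Sum>x\<in>S. c x * e (\<rho> x) b)"
      by (intro finprod_hom_fun[where e = e] H.comm_group_axioms that(1)) (use eH in auto)
    then show ?thesis
      using comb[OF that, of c] q_one[OF sum_in[OF that(2), of c]] e_N[OF sum_in[OF that(2), of c]]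
      by metis
  qed
  show ?thesis
    unfolding H_def[symmetric]
  proof (rule antisym)
    show "abelian_rank (H Mod N) \<le> qrank (e ` Z) (e ` N)"
      unfolding abelian_rank_def
    proof (rule SUP_least)
      fix S assume "S \<in> {S. int_independent (H Mod N) S}"
      then have fin: "finite S" and sub: "S \<subseteq> q ` Z"
        and ind: "\<And>c :: _ \<Rightarrow> int. finprod (H Mod N) (\<lambda>x. x [^]\<^bsub>H Mod N\<^esub> c x) S = \<one>\<^bsub>H Mod N\<^esub>
             \<Longrightarrow> \<forall>x\<in>S. c x = 0"
        using q_surj by (auto simp: int_independent_def)
      from sub have "\<forall>C\<in>S. \<exists>x\<in>Z. q x = C"
        by auto
      then obtain \<rho> where \<rho>: "\<And>C. C \<in> S \<Longrightarrow> \<rho> C \<in> Z \<and> q (\<rho> C) = C"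
        by metis
      have inj': "inj_on (e \<circ> \<rho>) S"
        using \<rho> inj by (intro inj_onI) (metis comp_apply inj_onD)
      have "indep_mod (e ` N) ((e \<circ> \<rho>) ` S)"
        unfolding indep_mod_def
      proof (intro conjI allI impI ballI)
        fix c y assume c: "lincomb c ((e \<circ> \<rho>) ` S) \<in> e ` N" and "y \<in> (e \<circ> \<rho>) ` S"
        then obtain C where C: "C \<in> S" "y = e (\<rho> C)"
          by auto
        have "(\<lambda>b. \<Sum>x\<in>S. c (e (\<rho> x)) * e (\<rho> x) b) \<in> e ` N"
          using c unfolding lincomb_def sum.reindex[OF inj'] by simp
        then have "finprod (H Mod N) (\<lambda>x. q (\<rho> x) [^]\<^bsub>H Mod N\<^esub> c (e (\<rho> x))) S = \<one>\<^bsub>H Mod N\<^esub>"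
          using key[OF fin, of \<rho> "\<lambda>x. c (e (\<rho> x))"] \<rho> by auto
        moreover have "finprod (H Mod N) (\<lambda>x. q (\<rho> x) [^]\<^bsub>H Mod N\<^esub> c (e (\<rho> x))) S
            = finprod (H Mod N) (\<lambda>x. x [^]\<^bsub>H Mod N\<^esub> c (e (\<rho> x))) S"
          by (intro Q.finprod_cong') (use \<rho> qZ in \<open>force intro!: Q.int_pow_closed\<close>)+
        ultimately show "c y = 0"
          using ind[of "\<lambda>x. c (e (\<rho> x))"] C by auto
      qed (use fin in simp)
      then have "enat (card ((e \<circ> \<rho>) ` S)) \<le> qrank (e ` Z) (e ` N)"
        using \<rho> by (intro qrank_upper) auto
      then show "enat (card S) \<le> qrank (e ` Z) (e ` N)"
        by (simp only: card_image[OF inj'])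
    qed
  next
    show "qrank (e ` Z) (e ` N) \<le> abelian_rank (H Mod N)"
    proof (rule qrank_least)
      fix S assume S: "S \<subseteq> e ` Z" and ind: "indep_mod (e ` N) S"
      then have fin: "finite S"
        by (simp add: indep_mod_def)
      from S have "\<forall>y\<in>S. \<exists>x\<in>Z. e x = y"
        by auto
      then obtain \<rho> where \<rho>: "\<And>y. y \<in> S \<Longrightarrow> \<rho> y \<in> Z \<and> e (\<rho> y) = y"
        by metis
      then have \<rho>_Z: "\<rho> \<in> S \<rightarrow> Z"
        by auto
      have comb': "(\<lambda>b. \<Sum>x\<in>S. c x * e (\<rho> x) b) = lincomb c S" for c
        using \<rho> by (auto simp: lincomb_def intro!: ext sum.cong)
      have zero: "\<forall>x\<in>S. c x = 0"
        if "finprod (H Mod N) (\<lambda>x. q (\<rho> x) [^]\<^bsub>H Mod N\<^esub> c x) S = \<one>\<^bsub>H Mod N\<^esub>" for c :: "_ \<Rightarrow> int"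
        using that key[OF fin \<rho>_Z, of c] ind by (auto simp: comb' indep_mod_def)
      \<comment> \<open>Independent coordinate vectors cannot share a coset, since the relation with
        coefficients 1 and -1 would then be trivial modulo \<open>N\<close>.\<close>
      have inj': "inj_on (q \<circ> \<rho>) S"
      proof (rule inj_onI, rule ccontr)
        fix x y assume xy: "x \<in> S" "y \<in> S" "(q \<circ> \<rho>) x = (q \<circ> \<rho>) y" "x \<noteq> y"
        let ?c = "\<lambda>z. if z = x then 1 else if z = y then - 1 else (0::int)"
        have qZ': "q (\<rho> z) \<in> carrier (H Mod N)" if "z \<in> S" for z
          using that \<rho> qZ by auto
        have "finprod (H Mod N) (\<lambda>z. q (\<rho> z) [^]\<^bsub>H Mod N\<^esub> ?c z) S
            = finprod (H Mod N) (\<lambda>z. q (\<rho> z) [^]\<^bsub>H Mod N\<^esub> ?c z) {x, y}"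
          using fin xy qZ'
          by (intro Q.finprod_mono_neutral_cong_left[symmetric])
            (auto intro!: Q.int_pow_closed)
        also have "\<dots> = q (\<rho> y) [^]\<^bsub>H Mod N\<^esub> (1::int) \<otimes>\<^bsub>H Mod N\<^esub> q (\<rho> y) [^]\<^bsub>H Mod N\<^esub> (- 1::int)"
          using xy(3,4) qZ'[OF xy(2)] by (simp add: Q.int_pow_closed del: mult_FactGroup one_FactGroup)
        also have "\<dots> = \<one>\<^bsub>H Mod N\<^esub>"
          using Q.int_pow_mult[OF qZ'[OF xy(2)], of 1 "- 1"] by (simp del: mult_FactGroup one_FactGroup)
        finally show False
          using zero[of ?c] xy by auto
      qed
      have "int_independent (H Mod N) ((q \<circ> \<rho>) ` S)"
        unfolding int_independent_def
      proof (intro conjI allI impI ballI)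
        show "(q \<circ> \<rho>) ` S \<subseteq> carrier (H Mod N)"
          using \<rho> qZ by auto
        fix c :: "_ \<Rightarrow> int" and C
        assume c: "finprod (H Mod N) (\<lambda>x. x [^]\<^bsub>H Mod N\<^esub> c x) ((q \<circ> \<rho>) ` S) = \<one>\<^bsub>H Mod N\<^esub>"
          and "C \<in> (q \<circ> \<rho>) ` S"
        then obtain y where y: "y \<in> S" "C = q (\<rho> y)"
          by auto
        have "finprod (H Mod N) (\<lambda>x. x [^]\<^bsub>H Mod N\<^esub> c x) ((q \<circ> \<rho>) ` S)
            = finprod (H Mod N) (\<lambda>x. q (\<rho> x) [^]\<^bsub>H Mod N\<^esub> c (q (\<rho> x))) S"
          using \<rho>
          by (subst Q.finprod_reindex[OF _ inj']) (auto intro!: Q.int_pow_closed qZ)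
        then show "c C = 0"
          using zero[of "\<lambda>x. c (q (\<rho> x))"] c y by auto
      qed (use fin in simp)
      then have "enat (card ((q \<circ> \<rho>) ` S)) \<le> abelian_rank (H Mod N)"
        unfolding abelian_rank_def by (intro SUP_upper) simp
      then show "enat (card S) \<le> abelian_rank (H Mod N)"
        by (simp only: card_image[OF inj'])
    qed
  qed
qed

section \<open>Integral linear dependence and additivity of the rank\<close>

lemma integer_exchange:
  fixes S :: "('b \<Rightarrow> int) set"
  assumes "finite S" "finite T" "T \<subseteq> range (\<lambda>c. lincomb c S)" "card T > card S"
  shows "\<exists>c. lincomb c T = (\<lambda>b. 0) \<and> (\<exists>x\<in>T. c x \<noteq> 0)"
  using assms
proof (induction S arbitrary: T rule: finite_induct)
  case empty
  then have "T = {\<lambda>b. 0}"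
    by (auto simp: lincomb_def card_gt_0_iff subset_singleton_iff)
  then show ?case
    by (intro exI[of _ "\<lambda>_. 1"]) (simp add: lincomb_def)
next
  case (insert s S)
  \<comment> \<open>Steinitz exchange without division: the generator \<open>s\<close> is eliminated
    from \<open>T\<close> by means of a pivot \<open>p\<close> whose coefficient at \<open>s\<close>
    is nonzero.\<close>
  from insert.prems(2) have "\<forall>t\<in>T. \<exists>d. t = lincomb d (insert s S)"
    by auto
  then obtain d where d: "\<And>t. t \<in> T \<Longrightarrow> t = lincomb (d t) (insert s S)"
    by metis
  have split: "t = (\<lambda>b. d t s * s b + lincomb (d t) S b)" if "t \<in> T" for t
    using d[OF that] insert.hyps by (simp add: lincomb_def)
  show ?case
  proof (cases "\<forall>t\<in>T. d t s = 0")
    case True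
    then have "T \<subseteq> range (\<lambda>c. lincomb c S)"
      using split by force
    moreover have "card S < card T"
      using insert by simp
    ultimately show ?thesis
      using insert.IH insert.prems(1) by blast
  next
    case False
    then obtain p where p: "p \<in> T" "d p s \<noteq> 0"
      by auto
    \<comment> \<open>Cross-multiplication with the two coefficients of \<open>s\<close> cancels
      \<open>s\<close>, so \<open>f t\<close> lies in the span of \<open>S\<close>.\<close>
    define f where "f t = (\<lambda>b. d p s * t b - d t s * p b)" for t
    let ?T = "T - {p}"
    show ?thesis
    proof (cases "inj_on f ?T")
      case False
      then obtain t u where tu: "t \<in> ?T" "u \<in> ?T" "t \<noteq> u" "f t = f u"
        by (auto simp: inj_on_def)
      then have ptu: "p \<noteq> t" "p \<noteq> u"
        by auto
      \<comment> \<open>If two eliminated vectors coincide, \<open>f t - f u\<close> is already a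
        relation; the coefficient at \<open>p\<close> is the difference of the two multiples of the
        pivot.\<close>
      let ?c = "\<lambda>x. if x = t then d p s else if x = u then - d p s else if x = p then d u s - d t s else 0"
      have "lincomb ?c T = (\<lambda>b. 0)"
      proof
        fix b
        have "lincomb ?c T b = (\<Sum>x\<in>{t, u, p}. ?c x * x b)"
          unfolding lincomb_def using tu p insert.prems(1) by (intro sum.mono_neutral_right) auto
        also have "\<dots> = f t b - f u b"
          using tu(1-3) ptu by (simp add: f_def algebra_simps)
        also have "\<dots> = 0"
          using tu(4) by simp
        finally show "lincomb ?c T b = 0" .
      qed
      moreover have "?c t \<noteq> 0"
        using p by simp
      ultimately show ?thesis
        using tu by blast
    next
      case True
      have "f ` ?T \<subseteq> range (\<lambda>c. lincomb c S)"
      proof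
        fix y assume "y \<in> f ` ?T"
        then obtain t where t: "t \<in> T" "y = f t"
          by auto
        have "f t = lincomb (\<lambda>x. d p s * d t x - d t s * d p x) S"
        proof
          fix b
          have "f t b = d p s * (d t s * s b + lincomb (d t) S b) - d t s * (d p s * s b + lincomb (d p) S b)"
            unfolding f_def using split[OF t(1)] split[OF p(1)] by metis
          then show "f t b = lincomb (\<lambda>x. d p s * d t x - d t s * d p x) S b"
            by (simp add: lincomb_def algebra_simps sum_subtractf sum_distrib_left)
        qed
        then show "y \<in> range (\<lambda>c. lincomb c S)"
          using t(2) by auto
      qed
      moreover have "card (f ` ?T) > card S"
        using True insert p by (simp add: card_image card_Diff_singleton)
      ultimately obtain c where c: "lincomb c (f ` ?T) = (\<lambda>b. 0)" "\<exists>x\<in>f ` ?T. c x \<noteq> 0"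
        using insert.IH[of "f ` ?T"] insert.prems(1) by auto
      \<comment> \<open>The definition of \<open>f\<close> is substituted into the relation found by
        induction: all multiples of \<open>p\<close> are collected in one coefficient, and the other
        coefficients only gain the nonzero factor \<open>d p s\<close>.\<close>
      let ?c = "\<lambda>x. if x = p then - (\<Sum>t\<in>?T. c (f t) * d t s) else d p s * c (f x)"
      have "lincomb ?c T = (\<lambda>b. 0)"
      proof
        fix b
        have "lincomb ?c T b = ?c p * p b + (\<Sum>x\<in>?T. ?c x * x b)"
          unfolding lincomb_def using p insert.prems(1) by (subst sum.remove[of T p]) auto
        also have "(\<Sum>x\<in>?T. ?c x * x b) = (\<Sum>x\<in>?T. d p s * c (f x) * x b)"
          by (intro sum.cong) auto
        also have "?c p * p b + \<dots> = (\<Sum>x\<in>?T. c (f x) * f x b)"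
          by (simp add: f_def sum_distrib_left sum_distrib_right sum_subtractf sum_negf algebra_simps)
        also have "\<dots> = lincomb c (f ` ?T) b"
          unfolding lincomb_def by (simp add: sum.reindex[OF True])
        finally show "lincomb ?c T b = 0"
          using c by simp
      qed
      moreover obtain t where "t \<in> ?T" "c (f t) \<noteq> 0"
        using c(2) by auto
      ultimately show ?thesis
        using p by (intro exI[of _ ?c]) auto
    qed
  qed
qed

lemma maximal_indep_mod:
  assumes "qrank Z N \<noteq> \<infinity>" "(\<lambda>b. 0) \<in> N"
  obtains S where "S \<subseteq> Z" "indep_mod N S" "qrank Z N = enat (card S)"
proof -
  let ?A = "{S. S \<subseteq> Z \<and> indep_mod N S}"
  have "{} \<in> ?A"
    by (simp add: indep_mod_def)
  then have ne: "(\<lambda>S. enat (card S)) ` ?A \<noteq> {}"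
    by auto
  have fin: "finite ((\<lambda>S. enat (card S)) ` ?A)"
    using assms ne unfolding qrank_def Sup_enat_def by (auto split: if_splits)
  have "qrank Z N \<in> (\<lambda>S. enat (card S)) ` ?A"
    unfolding qrank_def Sup_enat_def using fin ne Max_in[OF fin ne] by auto
  then show ?thesis
    using that by auto
qed

text \<open>By maximality \<open>insert z S\<close> is dependent, and the coefficient of
  \<open>z\<close> in the relation is nonzero because \<open>S\<close> alone is independent. Over
  the integers only a multiple of \<open>z\<close> is reached, which is enough for ranks.\<close>

lemma maximal_indep_mod_multiple:
  assumes Z: "fun_subgroup Z" and S: "S \<subseteq> Z" "indep_mod N S" "qrank Z N = enat (card S)"
    and N: "(\<lambda>b. 0) \<in> N" and z: "z \<in> Z"
  obtains k c where "k \<noteq> 0" "(\<lambda>b. k * z b - lincomb c S b) \<in> N"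
proof (cases "z \<in> S")
  case True
  have "lincomb (\<lambda>x. if x = z then 1 else 0) S = z"
    using S(2) True unfolding lincomb_def indep_mod_def
    by (simp add: if_distrib[of "\<lambda>a. a * _"] cong: if_cong)
  then show ?thesis
    using that[of 1 "\<lambda>x. if x = z then 1 else 0"] N by simp
next
  case False
  have fin: "finite S"
    using S(2) by (simp add: indep_mod_def)
  have "\<not> indep_mod N (insert z S)"
    using qrank_upper[of "insert z S" Z N] S z False fin by auto
  then obtain c x where c: "lincomb c (insert z S) \<in> N" "x \<in> insert z S" "c x \<noteq> 0"
    using fin by (auto simp: indep_mod_def)
  have split: "lincomb c (insert z S) = (\<lambda>b. c z * z b - lincomb (\<lambda>x. - c x) S b)"
    using fin False by (simp add: lincomb_def sum_negf)
  have "c z \<noteq> 0"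
  proof
    assume "c z = 0"
    then have "lincomb c S \<in> N"
      using c(1) fin False by (simp add: lincomb_def)
    then show False
      using indep_modD[OF S(2)] c \<open>c z = 0\<close> by auto
  qed
  then show ?thesis
    using that[of "c z"] c(1) split by metis
qed

definition fun_sum :: "('b \<Rightarrow> int) set \<Rightarrow> ('b \<Rightarrow> int) set \<Rightarrow> ('b \<Rightarrow> int) set" where
  "fun_sum A B = {(\<lambda>b. x b + y b) | x y. x \<in> A \<and> y \<in> B}"

lemma fun_sumI: "x \<in> A \<Longrightarrow> y \<in> B \<Longrightarrow> (\<lambda>b. x b + y b) \<in> fun_sum A B"
  unfolding fun_sum_def by blast

lemma fun_sumE:
  assumes "z \<in> fun_sum A B"
  obtains x y where "x \<in> A" "y \<in> B" "z = (\<lambda>b. x b + y b)"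
  using assms unfolding fun_sum_def by blast

lemma fun_sum_left: "x \<in> A \<Longrightarrow> (\<lambda>b. 0) \<in> B \<Longrightarrow> x \<in> fun_sum A B"
  using fun_sumI[of x A "\<lambda>b. 0" B] by simp

lemma fun_sum_right: "(\<lambda>b. 0) \<in> A \<Longrightarrow> y \<in> B \<Longrightarrow> y \<in> fun_sum A B"
  using fun_sumI[of "\<lambda>b. 0" A y B] by simp

text \<open>For the lower bound, the union of two independent sets is independent as the sum is
  direct. For the upper bound, every element has a nonzero multiple congruent to a combination of
  two maximal independent sets, and \<open>integer_exchange\<close> limits how many such
  combinations are independent. Infinite ranks are treated apart because no independent set attains
  them.\<close>

lemma qrank_direct_sum:
  assumes A: "fun_subgroup A" and B: "fun_subgroup B"
    and NA: "fun_subgroup NA" "NA \<subseteq> A" and NB: "fun_subgroup NB" "NB \<subseteq> B"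
    and disj: "\<And>x y. x \<in> A \<Longrightarrow> y \<in> B \<Longrightarrow> (\<lambda>b. x b + y b) = (\<lambda>b. 0) \<Longrightarrow> x = (\<lambda>b. 0)"
  shows "qrank (fun_sum A B) (fun_sum NA NB)
    = qrank A NA + qrank B NB" (is "qrank ?Z ?N = _")
proof (rule antisym)
  have uniq: "x = x' \<and> y = y'" if "x \<in> A" "y \<in> B" "x' \<in> A" "y' \<in> B"
    "(\<lambda>b. x b + y b) = (\<lambda>b. x' b + y' b)" for x y x' y'
  proof -
    have eq: "x b + y b = x' b + y' b" for b
      by (rule fun_cong[OF that(5)])
    have "(x b - x' b) + (y b - y' b) = 0" for b
      using eq[of b] by linarith
    then have "(\<lambda>b. x b - x' b) = (\<lambda>b. 0)"
      using disj[OF fun_subgroup_diff[OF A that(1,3)] fun_subgroup_diff[OF B that(2,4)]] by simp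
    then have "x b = x' b" for b
      by (metis eq_iff_diff_eq_0)
    then show ?thesis
      using eq by (auto simp: fun_eq_iff)
  qed
  have A_Z: "A \<subseteq> ?Z"
    using fun_sum_left fun_subgroup_zero[OF B] by blast
  have B_Z: "B \<subseteq> ?Z"
    using fun_sum_right fun_subgroup_zero[OF A] by blast
  show "qrank A NA + qrank B NB \<le> qrank ?Z ?N"
  proof -
    have le: "enat (card S + card T) \<le> qrank ?Z ?N"
      if S: "S \<subseteq> A" "indep_mod NA S" and T: "T \<subseteq> B" "indep_mod NB T" for S T
    proof -
      have fin: "finite S" "finite T"
        using S T by (auto simp: indep_mod_def)
      have disjoint: "S \<inter> T = {}"
      proof (rule ccontr)
        assume "S \<inter> T \<noteq> {}"
        then obtain x where x: "x \<in> S" "x \<in> T"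
          by auto
        have "(\<lambda>b. - x b) \<in> B"
          using x T B by (intro fun_subgroup_uminus) auto
        then have "x = (\<lambda>b. 0)"
          using disj[of x "\<lambda>b. - x b"] x S by auto
        then have "lincomb (\<lambda>z. if z = x then 1 else 0) S = (\<lambda>b. 0)"
          using fin x by (simp add: lincomb_def if_distrib[of "\<lambda>a. a * _"] cong: if_cong)
        then have "(if x = x then 1 else 0 :: int) = 0"
          using fun_subgroup_zero[OF NA(1)] x by (intro indep_modD[OF S(2)]) auto
        then show False
          by simp
      qed
      have "indep_mod ?N (S \<union> T)"
        unfolding indep_mod_def
      proof (intro conjI allI impI ballI)
        fix c x assume c: "lincomb c (S \<union> T) \<in> ?N" and x: "x \<in> S \<union> T"
        have split: "lincomb c (S \<union> T) = (\<lambda>b. lincomb c S b + lincomb c T b)"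
          using fin disjoint by (simp add: lincomb_def sum.union_disjoint)
        from c obtain x' y' where "x' \<in> NA" "y' \<in> NB" "lincomb c (S \<union> T) = (\<lambda>b. x' b + y' b)"
          by (rule fun_sumE)
        then have "lincomb c S \<in> NA" "lincomb c T \<in> NB"
          using uniq[of "lincomb c S" "lincomb c T" x' y'] split NA NB
            lincomb_closed[OF A S(1)] lincomb_closed[OF B T(1)] by auto
        then show "c x = 0"
          using indep_modD[OF S(2)] indep_modD[OF T(2)] x by auto
      qed (use fin in auto)
      then have "enat (card (S \<union> T)) \<le> qrank ?Z ?N"
        using S T A_Z B_Z by (intro qrank_upper) auto
      then show ?thesis
        using fin disjoint by (simp add: card_Un_disjoint)
    qed
    have 1: "enat (card S) + qrank B NB \<le> qrank ?Z ?N" if S: "S \<subseteq> A" "indep_mod NA S" for S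
    proof (cases "qrank B NB = \<infinity>")
      case False
      show ?thesis
        by (rule maximal_indep_mod[OF False fun_subgroup_zero[OF NB(1)]]) (use le[OF S] in simp)
    next
      case True
      have "qrank B NB \<le> qrank ?Z ?N"
        using le[of "{}"] by (intro qrank_least) (simp add: indep_mod_def)
      then show ?thesis
        using True by simp
    qed
    show ?thesis
    proof (cases "qrank A NA = \<infinity>")
      case False
      show ?thesis
        by (rule maximal_indep_mod[OF False fun_subgroup_zero[OF NA(1)]]) (use 1 in simp)
    next
      case True
      have "qrank A NA \<le> qrank ?Z ?N"
        using le[of _ "{}"] by (intro qrank_least) (simp add: indep_mod_def)
      then show ?thesis
        using True by simp
    qed
  qed
  show "qrank ?Z ?N \<le> qrank A NA + qrank B NB"
  proof (cases "qrank A NA = \<infinity> \<or> qrank B NB = \<infinity>")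
    case True
    then show ?thesis
      by auto
  next
    case False
    then obtain S T where S: "S \<subseteq> A" "indep_mod NA S" "qrank A NA = enat (card S)"
      and T: "T \<subseteq> B" "indep_mod NB T" "qrank B NB = enat (card T)"
      using maximal_indep_mod fun_subgroup_zero NA(1) NB(1) by metis
    show ?thesis
    proof (rule qrank_least)
      fix W assume W: "W \<subseteq> ?Z" "indep_mod ?N W"
      have fin: "finite S" "finite T" "finite W"
        using S T W by (auto simp: indep_mod_def)
      have "\<exists>k. k \<noteq> 0 \<and> (\<exists>v\<in>range (\<lambda>c. lincomb c (S \<union> T)). (\<lambda>b. k * w b - v b) \<in> ?N)"
        if w: "w \<in> W" for w
      proof -
        obtain x y where xy: "x \<in> A" "y \<in> B" "w = (\<lambda>b. x b + y b)"
          using w W(1) by (blast elim: fun_sumE)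
        obtain k c where kc: "k \<noteq> 0" "(\<lambda>b. k * x b - lincomb c S b) \<in> NA"
          by (rule maximal_indep_mod_multiple[OF A S fun_subgroup_zero[OF NA(1)] xy(1)])
        obtain l d where ld: "l \<noteq> 0" "(\<lambda>b. l * y b - lincomb d T b) \<in> NB"
          by (rule maximal_indep_mod_multiple[OF B T fun_subgroup_zero[OF NB(1)] xy(2)])
        \<comment> \<open>The multipliers found in \<open>A\<close> and \<open>B\<close> differ, so
          \<open>w\<close> is multiplied by both and each combination by the factor of the other
          side. On a common element of \<open>S\<close> and \<open>T\<close> the two coefficients
          add.\<close>
        define v where "v = lincomb (\<lambda>z. (if z \<in> S then l * c z else 0) + (if z \<in> T then k * d z else 0)) (S \<union> T)"
        have v: "v b = l * lincomb c S b + k * lincomb d T b" for b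
        proof -
          have "v b = (\<Sum>z\<in>S \<union> T. if z \<in> S then l * c z * z b else 0) + (\<Sum>z\<in>S \<union> T. if z \<in> T then k * d z * z b else 0)"
            unfolding v_def lincomb_def sum.distrib[symmetric] by (intro sum.cong) (auto simp: algebra_simps)
          also have "(\<Sum>z\<in>S \<union> T. if z \<in> S then l * c z * z b else 0) = (\<Sum>z\<in>S. l * c z * z b)"
            using fin by (intro sum.mono_neutral_cong_right) auto
          also have "(\<Sum>z\<in>S \<union> T. if z \<in> T then k * d z * z b else 0) = (\<Sum>z\<in>T. k * d z * z b)"
            using fin by (intro sum.mono_neutral_cong_right) auto
          finally show ?thesis
            by (simp add: lincomb_def sum_distrib_left mult.assoc)
        qed
        have "(\<lambda>b. (l * k) * w b - v b) = (\<lambda>b. l * (k * x b - lincomb c S b) + k * (l * y b - lincomb d T b))"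
          unfolding v xy(3) by (auto simp: algebra_simps)
        moreover have "(\<lambda>b. l * (k * x b - lincomb c S b)) \<in> NA" "(\<lambda>b. k * (l * y b - lincomb d T b)) \<in> NB"
          using fun_subgroup_scale[OF NA(1) kc(2)] fun_subgroup_scale[OF NB(1) ld(2)] by auto
        ultimately have "(\<lambda>b. (l * k) * w b - v b) \<in> ?N"
          by (simp add: fun_sumI)
        then show ?thesis
          using kc(1) ld(1) unfolding v_def by (intro exI[of _ "l * k"]) auto
      qed
      then have "\<forall>w\<in>W. \<exists>p. fst p \<noteq> 0 \<and> snd p \<in> range (\<lambda>c. lincomb c (S \<union> T)) \<and>
          (\<lambda>b. fst p * w b - snd p b) \<in> ?N"
        by (metis fst_conv snd_conv)
      from bchoice[OF this] obtain p where p: "\<forall>w\<in>W. fst (p w) \<noteq> 0 \<and>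
          snd (p w) \<in> range (\<lambda>c. lincomb c (S \<union> T)) \<and> (\<lambda>b. fst (p w) * w b - snd (p w) b) \<in> ?N"
        by blast
      define k where "k = (\<lambda>w. fst (p w))"
      define v where "v = (\<lambda>w. snd (p w))"
      have kv: "\<And>w. w \<in> W \<Longrightarrow> k w \<noteq> 0"
        "\<And>w. w \<in> W \<Longrightarrow> v w \<in> range (\<lambda>c. lincomb c (S \<union> T))"
        "\<And>w. w \<in> W \<Longrightarrow> (\<lambda>b. k w * w b - v w b) \<in> ?N"
        unfolding k_def v_def by (use p in blast)+
      have N: "fun_subgroup ?N"
        unfolding fun_subgroup_def
      proof (intro conjI ballI)
        show "(\<lambda>b. 0) \<in> ?N"
          using fun_subgroup_zero[OF NA(1)] fun_subgroup_zero[OF NB(1)] by (rule fun_sum_left)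
        fix u u' assume "u \<in> ?N" "u' \<in> ?N"
        then obtain x y x' y' where xy: "x \<in> NA" "y \<in> NB" "x' \<in> NA" "y' \<in> NB"
          "u = (\<lambda>b. x b + y b)" "u' = (\<lambda>b. x' b + y' b)"
          by (auto elim!: fun_sumE)
        have "(\<lambda>b. (x b - x' b) + (y b - y' b)) \<in> ?N"
          by (intro fun_sumI fun_subgroup_diff NA(1) NB(1) xy)
        then show "(\<lambda>b. u b - u' b) \<in> ?N"
          by (simp add: xy(5,6) algebra_simps)
      qed
      \<comment> \<open>A relation among the combinations \<open>v w\<close> becomes, modulo
        \<open>?N\<close>, a relation among the elements \<open>w\<close> whose coefficients carry
        the nonzero factors \<open>k w\<close>.\<close>
      have rel: "\<forall>w\<in>W. a w = 0" if "(\<lambda>b. \<Sum>w\<in>W. a w * v w b) = (\<lambda>b. 0)" for a :: "_ \<Rightarrow> int"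
      proof -
        have "(\<lambda>b. \<Sum>w\<in>W. a w * (k w * w b - v w b)) \<in> ?N"
          by (intro fun_subgroup_sum[OF N] fun_subgroup_scale[OF N] kv(3))
        moreover have "(\<lambda>b. \<Sum>w\<in>W. a w * (k w * w b - v w b)) = lincomb (\<lambda>w. a w * k w) W"
          using that by (simp add: lincomb_def algebra_simps sum_subtractf fun_eq_iff)
        ultimately show ?thesis
          using indep_modD[OF W(2), of "\<lambda>w. a w * k w"] kv(1) by auto
      qed
      have inj: "inj_on v W"
      proof (rule inj_onI, rule ccontr)
        fix x y assume xy: "x \<in> W" "y \<in> W" "v x = v y" "x \<noteq> y"
        let ?a = "\<lambda>z. if z = x then 1 else if z = y then - 1 else (0::int)"
        have "(\<Sum>w\<in>W. ?a w * v w b) = 0" for b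
        proof -
          have "(\<Sum>w\<in>W. ?a w * v w b) = (\<Sum>w\<in>{x, y}. ?a w * v w b)"
            using fin xy by (intro sum.mono_neutral_right) auto
          then show ?thesis
            using xy by simp
        qed
        then have "\<forall>w\<in>W. ?a w = 0"
          by (intro rel) auto
        then have "?a x = 0"
          using xy(1) by blast
        then show False
          by simp
      qed
      have "card W \<le> card (S \<union> T)"
      proof (rule ccontr)
        assume "\<not> card W \<le> card (S \<union> T)"
        then have "\<exists>c. lincomb c (v ` W) = (\<lambda>b. 0) \<and> (\<exists>x\<in>v ` W. c x \<noteq> 0)"
          using fin kv(2) by (intro integer_exchange[of "S \<union> T"]) (auto simp: card_image[OF inj])
        then obtain c where c: "lincomb c (v ` W) = (\<lambda>b. 0)" "\<exists>w\<in>W. c (v w) \<noteq> 0"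
          by auto
        have "(\<lambda>b. \<Sum>w\<in>W. c (v w) * v w b) = (\<lambda>b. 0)"
          using c(1) by (simp add: lincomb_def sum.reindex[OF inj])
        then show False
          using rel[of "\<lambda>w. c (v w)"] c(2) by blast
      qed
      also have "\<dots> \<le> card S + card T"
        by (rule card_Un_le)
      finally show "enat (card W) \<le> qrank A NA + qrank B NB"
        using S T by simp
    qed
  qed
qed

text \<open>Restriction to one fibre of \<open>\<pi>\<close> stays in \<open>Z\<close> and in
  \<open>N\<close>, so both split compatibly, and the fibres are split off one at a time. In the
  application \<open>\<pi>\<close> is the multidegree.\<close>

lemma qrank_fibres:
  fixes Z N :: "('b \<Rightarrow> int) set" and \<pi> :: "'b \<Rightarrow> 'c"
  assumes "finite C"
    and Z: "fun_subgroup Z" and N: "fun_subgroup N" "N \<subseteq> Z"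
    and supp: "\<And>x b. x \<in> Z \<Longrightarrow> x b \<noteq> 0 \<Longrightarrow> \<pi> b \<in> C"
    and Zc: "\<And>x c. x \<in> Z \<Longrightarrow> (\<lambda>b. if \<pi> b = c then x b else 0) \<in> Z"
    and Nc: "\<And>x c. x \<in> N \<Longrightarrow> (\<lambda>b. if \<pi> b = c then x b else 0) \<in> N"
  shows "qrank Z N = (\<Sum>c\<in>C. qrank {x\<in>Z. \<forall>b. x b \<noteq> 0 \<longrightarrow> \<pi> b = c} {x\<in>N. \<forall>b. x b \<noteq> 0 \<longrightarrow> \<pi> b = c})"
  using assms
proof (induction C arbitrary: Z N rule: finite_induct)
  case empty
  then have "x = (\<lambda>b. 0)" if "x \<in> Z" for x
    using that by auto
  then have "Z \<subseteq> N"
    using fun_subgroup_zero[OF empty.prems(2)] by auto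
  then show ?case
    using qrank_trivial[OF _ empty.prems(2)] by simp
next
  case (insert c C)
  define A where "A = {x\<in>Z. \<forall>b. x b \<noteq> 0 \<longrightarrow> \<pi> b = c}"
  define NA where "NA = {x\<in>N. \<forall>b. x b \<noteq> 0 \<longrightarrow> \<pi> b = c}"
  define B where "B = {x\<in>Z. \<forall>b. x b \<noteq> 0 \<longrightarrow> \<pi> b \<noteq> c}"
  define NB where "NB = {x\<in>N. \<forall>b. x b \<noteq> 0 \<longrightarrow> \<pi> b \<noteq> c}"
  have sub: "fun_subgroup {x\<in>Y. \<forall>b. x b \<noteq> 0 \<longrightarrow> P b}" if "fun_subgroup Y" for P and Y :: "('b \<Rightarrow> int) set"
    using that by (auto simp: fun_subgroup_def) metis
  have sum: "Y = fun_sum {x\<in>Y. \<forall>b. x b \<noteq> 0 \<longrightarrow> \<pi> b = c} {x\<in>Y. \<forall>b. x b \<noteq> 0 \<longrightarrow> \<pi> b \<noteq> c}"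
    if Y: "fun_subgroup Y" "\<And>x. x \<in> Y \<Longrightarrow> (\<lambda>b. if \<pi> b = c then x b else 0) \<in> Y" for Y
  proof (intro equalityI subsetI)
    fix x assume x: "x \<in> Y"
    define y where "y = (\<lambda>b. if \<pi> b = c then x b else 0)"
    define z where "z = (\<lambda>b. x b - y b)"
    have y: "y \<in> Y"
      unfolding y_def by (rule Y(2)[OF x])
    have "z \<in> Y"
      unfolding z_def by (intro fun_subgroup_diff Y(1) x y)
    then have "z \<in> {x\<in>Y. \<forall>b. x b \<noteq> 0 \<longrightarrow> \<pi> b \<noteq> c}"
      by (simp add: z_def y_def)
    moreover have "y \<in> {x\<in>Y. \<forall>b. x b \<noteq> 0 \<longrightarrow> \<pi> b = c}"
      using y by (simp add: y_def)
    ultimately have "(\<lambda>b. y b + z b) \<in> fun_sum {x\<in>Y. \<forall>b. x b \<noteq> 0 \<longrightarrow> \<pi> b = c} {x\<in>Y. \<forall>b. x b \<noteq> 0 \<longrightarrow> \<pi> b \<noteq> c}"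
      by (intro fun_sumI)
    moreover have "(\<lambda>b. y b + z b) = x"
      by (simp add: z_def)
    ultimately show "x \<in> fun_sum {x\<in>Y. \<forall>b. x b \<noteq> 0 \<longrightarrow> \<pi> b = c} {x\<in>Y. \<forall>b. x b \<noteq> 0 \<longrightarrow> \<pi> b \<noteq> c}"
      by (simp only:)
  next
    fix z assume "z \<in> fun_sum {x\<in>Y. \<forall>b. x b \<noteq> 0 \<longrightarrow> \<pi> b = c} {x\<in>Y. \<forall>b. x b \<noteq> 0 \<longrightarrow> \<pi> b \<noteq> c}"
    then show "z \<in> Y"
      using fun_subgroup_add[OF Y(1)] by (blast elim: fun_sumE)
  qed
  have sub_B: "fun_subgroup B" "fun_subgroup NB"
    unfolding B_def NB_def by (intro sub[OF insert.prems(1)] sub[OF insert.prems(2)])+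
  have "qrank Z N = qrank A NA + qrank B NB"
  proof -
    have disj: "x = (\<lambda>b. 0)" if "x \<in> A" "y \<in> B" and eq: "(\<lambda>b. x b + y b) = (\<lambda>b. 0)" for x y
    proof -
      have "x b = 0" for b
      proof -
        have "x b = 0 \<or> y b = 0"
          using that(1,2) unfolding A_def B_def by blast
        then show ?thesis
          using fun_cong[OF eq, of b] by linarith
      qed
      then show ?thesis
        by auto
    qed
    have "fun_subgroup A" "fun_subgroup NA"
      unfolding A_def NA_def by (intro sub[OF insert.prems(1)] sub[OF insert.prems(2)])+
    moreover have "NA \<subseteq> A" "NB \<subseteq> B"
      unfolding A_def B_def NA_def NB_def using insert.prems(3) by auto
    ultimately have "qrank (fun_sum A B) (fun_sum NA NB)
      = qrank A NA + qrank B NB"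
      using qrank_direct_sum[of A B NA NB] sub_B disj by blast
    then show ?thesis
      using sum[OF insert.prems(1,5)] sum[OF insert.prems(2,6)]
      unfolding A_def B_def NA_def NB_def by simp
  qed
  moreover have "qrank B NB = (\<Sum>d\<in>C. qrank {x\<in>B. \<forall>b. x b \<noteq> 0 \<longrightarrow> \<pi> b = d} {x\<in>NB. \<forall>b. x b \<noteq> 0 \<longrightarrow> \<pi> b = d})"
  proof (rule insert.IH)
    show "\<pi> b \<in> C" if "x \<in> B" "x b \<noteq> 0" for x b
      using that insert.prems(4)[of x b] by (auto simp: B_def)
    show "(\<lambda>b. if \<pi> b = d then x b else 0) \<in> B" if "x \<in> B" for x d
      using that insert.prems(5)[of x d] by (auto simp: B_def)
    show "(\<lambda>b. if \<pi> b = d then x b else 0) \<in> NB" if "x \<in> NB" for x d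
      using that insert.prems(6)[of x d] by (auto simp: NB_def)
    show "NB \<subseteq> B"
      using insert.prems(3) by (auto simp: B_def NB_def)
  qed (rule sub_B)+
  moreover have "{x\<in>B. \<forall>b. x b \<noteq> 0 \<longrightarrow> \<pi> b = d} = {x\<in>Z. \<forall>b. x b \<noteq> 0 \<longrightarrow> \<pi> b = d}"
    "{x\<in>NB. \<forall>b. x b \<noteq> 0 \<longrightarrow> \<pi> b = d} = {x\<in>N. \<forall>b. x b \<noteq> 0 \<longrightarrow> \<pi> b = d}" if "d \<in> C" for d
    using that insert.hyps by (auto simp: B_def NB_def)
  ultimately show ?case
    using insert.hyps by (simp add: A_def NA_def cong: sum.cong)
qed

section \<open>Chain complexes with bases\<close>

definition smul :: "'r::comm_ring_1 \<Rightarrow> ('d \<Rightarrow>\<^sub>0 'r) \<Rightarrow> 'd \<Rightarrow>\<^sub>0 'r" where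
  "smul r c = Poly_Mapping.map ((*) r) c"

text \<open>The linear extension of a map given on a basis. The coefficient ring is left general
  because integer chains and chains over the polynomial ring share the lemmas.\<close>

definition lin :: "('b \<Rightarrow> 'd \<Rightarrow>\<^sub>0 'r) \<Rightarrow> ('b \<Rightarrow>\<^sub>0 'r::comm_ring_1) \<Rightarrow> 'd \<Rightarrow>\<^sub>0 'r" where
  "lin f c = (\<Sum>b\<in>keys c. smul (lookup c b) (f b))"

abbreviation bas :: "'b \<Rightarrow> 'b \<Rightarrow>\<^sub>0 'r::comm_ring_1" where
  "bas b \<equiv> single b 1"

lemma lookup_smul [simp]: "lookup (smul r c) d = r * lookup c d"
  by (simp add: smul_def map.rep_eq when_def)

lemma lookup_lin_superset:
  assumes "finite A" "keys c \<subseteq> A"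
  shows "lookup (lin f c) d
    = (\<Sum>b\<in>A. lookup c b * lookup (f b) d)"
  unfolding lin_def lookup_sum using assms
  by (intro sum.mono_neutral_cong_left) (auto simp: in_keys_iff)

lemma lookup_lin:
  "lookup (lin f c) d
    = (\<Sum>b\<in>keys c. lookup c b * lookup (f b) d)"
  by (rule lookup_lin_superset) auto

lemma smul_0 [simp]: "smul 0 c = 0" "smul r 0 = 0" and smul_1 [simp]: "smul 1 c = c"
  by (auto intro!: poly_mapping_eqI)

lemma smul_smul: "smul r (smul s c) = smul (r * s) c"
  by (intro poly_mapping_eqI) (simp add: mult.assoc)

lemma smul_add: "smul r (c + d) = smul r c + smul r d"
  by (intro poly_mapping_eqI) (simp add: lookup_add distrib_left)

lemma smul_single [simp]: "smul r (single b s) = single b (r * s)"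
  by (intro poly_mapping_eqI) (simp add: lookup_single when_def)

lemma keys_smul: "keys (smul r c) \<subseteq> keys c"
  by (auto simp: in_keys_iff)

lemma lin_0 [simp]: "lin f 0 = 0"
  by (simp add: lin_def)

lemma lin_add: "lin f (c + d) = lin f c + lin f d"
proof (rule poly_mapping_eqI)
  fix k
  let ?A = "keys c \<union> keys d"
  show "lookup (lin f (c + d)) k = lookup (lin f c + lin f d) k"
    using Poly_Mapping.keys_add[of c d]
    by (simp add: lookup_add lookup_lin_superset[of ?A] distrib_right sum.distrib)
qed

lemma lin_smul: "lin f (smul r c) = smul r (lin f c)"
  by (intro poly_mapping_eqI)
    (simp add: lookup_lin_superset[OF finite_keys keys_smul[of r c]] lookup_lin[of f c] sum_distrib_left mult.assoc)

lemma lin_uminus: "lin f (- c) = - lin f c"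
proof -
  have "- c = smul (- 1) c" for c :: "'e \<Rightarrow>\<^sub>0 'f::comm_ring_1"
    by (intro poly_mapping_eqI) simp
  then show ?thesis
    by (metis lin_smul)
qed

lemma lin_diff: "lin f (c - d) = lin f c - lin f d"
  using lin_add[of f c "- d"] by (simp add: lin_uminus)

lemma lin_sum: "lin f (sum g I) = (\<Sum>i\<in>I. lin f (g i))"
  by (induction I rule: infinite_finite_induct) (auto simp: lin_add)

lemma lin_single [simp]: "lin f (single b r) = smul r (f b)"
  by (simp add: lin_def)

lemma lin_cong: "(\<And>b. b \<in> keys c \<Longrightarrow> f b = g b) \<Longrightarrow> lin f c = lin g c"
  unfolding lin_def by (rule sum.cong) auto

lemma lin_lin: "lin g (lin f c) = lin (\<lambda>b. lin g (f b)) c"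
  by (simp add: lin_def[of f] lin_def[of "\<lambda>b. lin g (f b)"] lin_sum lin_smul)

lemma lin_fun_diff: "lin (\<lambda>b. f b - g b) c = lin f c - lin g c"
  by (intro poly_mapping_eqI) (simp add: lookup_lin lookup_minus right_diff_distrib sum_subtractf)

lemma lin_fun_add: "lin (\<lambda>b. f b + g b) c = lin f c + lin g c"
  by (intro poly_mapping_eqI) (simp add: lookup_lin lookup_add distrib_left sum.distrib)

lemma lin_fun_0 [simp]: "lin (\<lambda>b. 0) c = 0"
  by (simp add: lin_def)

lemma lin_bas [simp]: "lin bas c = c"
  by (intro poly_mapping_eqI) (simp add: lookup_lin lookup_single when_def in_keys_iff if_distrib cong: if_cong)

lemma keys_lin: "keys (lin f c) \<subseteq> (\<Union>b\<in>keys c. keys (f b))"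
proof
  fix d assume "d \<in> keys (lin f c)"
  then have "(\<Sum>b\<in>keys c. lookup c b * lookup (f b) d) \<noteq> 0"
    by (simp add: in_keys_iff lookup_lin)
  then obtain b where "b \<in> keys c" "lookup c b * lookup (f b) d \<noteq> 0"
    by (meson sum.neutral)
  then have "b \<in> keys c" "d \<in> keys (f b)"
    by (auto simp: in_keys_iff)
  then show "d \<in> (\<Union>b\<in>keys c. keys (f b))"
    by blast
qed

lemma keys_lin_subset:
  "(\<And>b. b \<in> keys c \<Longrightarrow> keys (f b) \<subseteq> A) \<Longrightarrow> keys (lin f c) \<subseteq> A"
  using keys_lin[of f c] by blast

lemma keys_diff_subset:
  assumes "keys c \<subseteq> A" "keys d \<subseteq> A"
  shows "keys (c - d) \<subseteq> A"
proof
  fix x assume "x \<in> keys (c - d)"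
  then have "x \<in> keys c \<or> x \<in> keys d"
    by (auto simp: in_keys_iff lookup_minus)
  then show "x \<in> A"
    using assms by blast
qed

lemma frag_cmul_eq_smul: "frag_cmul r c = smul r c"
  by (intro poly_mapping_eqI) simp

lemma frag_extend_eq_lin: "frag_extend f c = lin f c"
  by (simp add: frag_extend_def lin_def frag_cmul_eq_smul)


subsection \<open>Lifting chain maps and homotopies\<close>

text \<open>\<open>\<Phi> n b k\<close> is the set of chains of position \<open>k\<close> allowed
  for a basis element \<open>b\<close> of position \<open>n\<close>. As these are plain sets, the
  lemma covers acyclic carriers, where the support is restricted, as well as graded modules, where
  the degree is.\<close>

lemma chain_map_lift:
  fixes bdC :: "nat \<Rightarrow> 'b \<Rightarrow> 'b \<Rightarrow>\<^sub>0 'r::comm_ring_1" and bdD :: "nat \<Rightarrow> 'd \<Rightarrow> 'd \<Rightarrow>\<^sub>0 'r"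
    and \<Phi> :: "nat \<Rightarrow> 'b \<Rightarrow> nat \<Rightarrow> ('d \<Rightarrow>\<^sub>0 'r) set"
  assumes keys: "\<And>n b. b \<in> BC (Suc n) \<Longrightarrow> keys (bdC (Suc n) b) \<subseteq> BC n"
    and dd: "\<And>n b. b \<in> BC (Suc (Suc n)) \<Longrightarrow> lin (bdC (Suc n)) (bdC (Suc (Suc n)) b) = 0"
    and f0: "\<And>b. b \<in> BC 0 \<Longrightarrow> f0 b \<in> \<Phi> 0 b 0"
    and base: "\<And>b. b \<in> BC (Suc 0) \<Longrightarrow> \<exists>y\<in>\<Phi> (Suc 0) b (Suc 0). lin (bdD (Suc 0)) y = lin f0 (bdC (Suc 0) b)"
    and ext: "\<And>n b y. b \<in> BC (Suc n) \<Longrightarrow> (\<And>b'. b' \<in> BC n \<Longrightarrow> y b' \<in> \<Phi> n b' n) \<Longrightarrow>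
      lin y (bdC (Suc n) b) \<in> \<Phi> (Suc n) b n"
    and acyc: "\<And>n b z. b \<in> BC (Suc (Suc n)) \<Longrightarrow> z \<in> \<Phi> (Suc (Suc n)) b (Suc n) \<Longrightarrow>
      lin (bdD (Suc n)) z = 0 \<Longrightarrow> \<exists>y\<in>\<Phi> (Suc (Suc n)) b (Suc (Suc n)). lin (bdD (Suc (Suc n))) y = z"
  obtains f where "f 0 = f0" "\<And>n b. b \<in> BC n \<Longrightarrow> f n b \<in> \<Phi> n b n"
    "\<And>n b. b \<in> BC (Suc n) \<Longrightarrow> lin (bdD (Suc n)) (f (Suc n) b) = lin (f n) (bdC (Suc n) b)"
proof -
  \<comment> \<open>The last clause says that the next value to be lifted is a cycle. It is part of
    the invariant because it rests on the equation of the preceding step, which the next step no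
    longer sees.\<close>
  let ?P = "\<lambda>n f. (\<forall>b\<in>BC n. f b \<in> \<Phi> n b n) \<and> (n = 0 \<longrightarrow> f = f0) \<and>
    (n > 0 \<longrightarrow> (\<forall>b\<in>BC (Suc n). lin (bdD n) (lin f (bdC (Suc n) b)) = 0))"
  let ?Q = "\<lambda>n f f'. \<forall>b\<in>BC (Suc n). lin (bdD (Suc n)) (f' b) = lin f (bdC (Suc n) b)"
  have "\<exists>f. \<forall>n. ?P n (f n) \<and> ?Q n (f n) (f (Suc n))"
  proof (rule dependent_nat_choice)
    show "\<exists>f. ?P 0 f"
      using f0 by auto
    fix f n assume P: "?P n f"
    have "\<forall>b\<in>BC (Suc n). \<exists>y. y \<in> \<Phi> (Suc n) b (Suc n) \<and> lin (bdD (Suc n)) y = lin f (bdC (Suc n) b)"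
    proof
      fix b assume b: "b \<in> BC (Suc n)"
      show "\<exists>y. y \<in> \<Phi> (Suc n) b (Suc n) \<and> lin (bdD (Suc n)) y = lin f (bdC (Suc n) b)"
      proof (cases n)
        case 0
        then show ?thesis
          using base[of b] P b by auto
      next
        case (Suc k)
        have "lin f (bdC (Suc n) b) \<in> \<Phi> (Suc n) b n"
          using P by (intro ext b) auto
        then show ?thesis
          using acyc[of b k "lin f (bdC (Suc n) b)"] P b Suc by auto
      qed
    qed
    then obtain g where g: "\<And>b. b \<in> BC (Suc n) \<Longrightarrow> g b \<in> \<Phi> (Suc n) b (Suc n)"
      "\<And>b. b \<in> BC (Suc n) \<Longrightarrow> lin (bdD (Suc n)) (g b) = lin f (bdC (Suc n) b)"
      by metis
    have "lin (bdD (Suc n)) (lin g (bdC (Suc (Suc n)) b)) = 0" if b: "b \<in> BC (Suc (Suc n))" for b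
    proof -
      have "lin (bdD (Suc n)) (lin g (bdC (Suc (Suc n)) b))
          = lin (\<lambda>b. lin f (bdC (Suc n) b)) (bdC (Suc (Suc n)) b)"
        unfolding lin_lin using g(2) keys[OF b] by (intro lin_cong) auto
      also have "\<dots> = 0"
        unfolding lin_lin[symmetric] dd[OF b] by simp
      finally show ?thesis .
    qed
    then show "\<exists>g. ?P (Suc n) g \<and> ?Q n f g"
      using g by (intro exI[of _ g]) auto
  qed
  then obtain f where f: "\<And>n. ?P n (f n) \<and> ?Q n (f n) (f (Suc n))"
    by blast
  show thesis
  proof (rule that[of f])
    show "f 0 = f0"
      using f[of 0] by blast
    show "f n b \<in> \<Phi> n b n" if "b \<in> BC n" for n b
      using f[of n] that by blast
    show "lin (bdD (Suc n)) (f (Suc n) b) = lin (f n) (bdC (Suc n) b)" if "b \<in> BC (Suc n)" for n b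
      using f[of n] that by blast
  qed
qed

text \<open>The equations hold only up to sets \<open>N n\<close>. With \<open>N n = {0}\<close> the
  result is a null homotopy of \<open>\<xi>\<close>; with the chains of a subcomplex it deforms
  \<open>\<xi>\<close> into that subcomplex.\<close>

lemma null_homotopy_lift:
  fixes bdC :: "nat \<Rightarrow> 'b \<Rightarrow> 'b \<Rightarrow>\<^sub>0 'r::comm_ring_1" and bdD :: "nat \<Rightarrow> 'd \<Rightarrow> 'd \<Rightarrow>\<^sub>0 'r"
    and \<Phi> :: "nat \<Rightarrow> 'b \<Rightarrow> nat \<Rightarrow> ('d \<Rightarrow>\<^sub>0 'r) set" and N :: "nat \<Rightarrow> ('d \<Rightarrow>\<^sub>0 'r) set"
  assumes keys: "\<And>n b. b \<in> BC (Suc n) \<Longrightarrow> keys (bdC (Suc n) b) \<subseteq> BC n"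
    and dd: "\<And>n b. b \<in> BC (Suc (Suc n)) \<Longrightarrow> lin (bdC (Suc n)) (bdC (Suc (Suc n)) b) = 0"
    and chain: "\<And>n b. b \<in> BC (Suc n) \<Longrightarrow> lin (bdD (Suc n)) (\<xi> (Suc n) b) = lin (\<xi> n) (bdC (Suc n) b)"
    and carr: "\<And>n b. b \<in> BC (Suc n) \<Longrightarrow> \<xi> (Suc n) b \<in> \<Phi> (Suc n) b (Suc n)"
    and base: "\<And>b. b \<in> BC 0 \<Longrightarrow> \<exists>y\<in>\<Phi> 0 b (Suc 0). \<xi> 0 b - lin (bdD (Suc 0)) y \<in> N 0"
    and diff: "\<And>n b x y. b \<in> BC (Suc n) \<Longrightarrow> x \<in> \<Phi> (Suc n) b (Suc n) \<Longrightarrow> y \<in> \<Phi> (Suc n) b (Suc n) \<Longrightarrow>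
      x - y \<in> \<Phi> (Suc n) b (Suc n)"
    and ext: "\<And>n b y. b \<in> BC (Suc n) \<Longrightarrow> (\<And>b'. b' \<in> BC n \<Longrightarrow> y b' \<in> \<Phi> n b' (Suc n)) \<Longrightarrow>
      lin y (bdC (Suc n) b) \<in> \<Phi> (Suc n) b (Suc n)"
    and acyc: "\<And>n b z. b \<in> BC (Suc n) \<Longrightarrow> z \<in> \<Phi> (Suc n) b (Suc n) \<Longrightarrow> lin (bdD (Suc n)) z \<in> N n \<Longrightarrow>
      \<exists>y\<in>\<Phi> (Suc n) b (Suc (Suc n)). z - lin (bdD (Suc (Suc n))) y \<in> N (Suc n)"
    and extN: "\<And>n b y. b \<in> BC (Suc n) \<Longrightarrow> (\<And>b'. b' \<in> BC n \<Longrightarrow> y b' \<in> N n) \<Longrightarrow>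
      lin y (bdC (Suc n) b) \<in> N n"
  obtains h where "\<And>n b. b \<in> BC n \<Longrightarrow> h n b \<in> \<Phi> n b (Suc n)"
    "\<And>b. b \<in> BC 0 \<Longrightarrow> \<xi> 0 b - lin (bdD (Suc 0)) (h 0 b) \<in> N 0"
    "\<And>n b. b \<in> BC (Suc n) \<Longrightarrow>
      \<xi> (Suc n) b - lin (h n) (bdC (Suc n) b) - lin (bdD (Suc (Suc n))) (h (Suc n) b) \<in> N (Suc n)"
proof -
  let ?P = "\<lambda>n h. (\<forall>b\<in>BC n. h b \<in> \<Phi> n b (Suc n)) \<and>
    (n = 0 \<longrightarrow> (\<forall>b\<in>BC 0. \<xi> 0 b - lin (bdD (Suc 0)) (h b) \<in> N 0)) \<and>
    (\<forall>b\<in>BC (Suc n). lin (\<lambda>b'. \<xi> n b' - lin (bdD (Suc n)) (h b')) (bdC (Suc n) b) \<in> N n)"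
  let ?Q = "\<lambda>n h h'. \<forall>b\<in>BC (Suc n).
    \<xi> (Suc n) b - lin h (bdC (Suc n) b) - lin (bdD (Suc (Suc n))) (h' b) \<in> N (Suc n)"
  have "\<exists>h. \<forall>n. ?P n (h n) \<and> ?Q n (h n) (h (Suc n))"
  proof (rule dependent_nat_choice)
    have "\<forall>b\<in>BC 0. \<exists>y. y \<in> \<Phi> 0 b (Suc 0) \<and> \<xi> 0 b - lin (bdD (Suc 0)) y \<in> N 0"
      using base by blast
    from bchoice[OF this] obtain h where h: "\<forall>b\<in>BC 0. h b \<in> \<Phi> 0 b (Suc 0) \<and> \<xi> 0 b - lin (bdD (Suc 0)) (h b) \<in> N 0"
      by blast
    then have "lin (\<lambda>b'. \<xi> 0 b' - lin (bdD (Suc 0)) (h b')) (bdC (Suc 0) b) \<in> N 0" if "b \<in> BC (Suc 0)" for b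
      using that by (intro extN) auto
    then show "\<exists>h. ?P 0 h"
      using h by (intro exI[of _ h] conjI impI ballI) auto
    fix h n assume P: "?P n h"
    have "\<forall>b\<in>BC (Suc n). \<exists>y. y \<in> \<Phi> (Suc n) b (Suc (Suc n)) \<and>
      \<xi> (Suc n) b - lin h (bdC (Suc n) b) - lin (bdD (Suc (Suc n))) y \<in> N (Suc n)"
    proof
      fix b assume b: "b \<in> BC (Suc n)"
      have "lin h (bdC (Suc n) b) \<in> \<Phi> (Suc n) b (Suc n)"
        using P by (intro ext b) auto
      then have z: "\<xi> (Suc n) b - lin h (bdC (Suc n) b) \<in> \<Phi> (Suc n) b (Suc n)"
        by (intro diff b carr)
      have "lin (bdD (Suc n)) (\<xi> (Suc n) b - lin h (bdC (Suc n) b))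
          = lin (\<lambda>b'. \<xi> n b' - lin (bdD (Suc n)) (h b')) (bdC (Suc n) b)"
        by (simp add: lin_diff chain[OF b] lin_lin lin_fun_diff)
      then have "lin (bdD (Suc n)) (\<xi> (Suc n) b - lin h (bdC (Suc n) b)) \<in> N n"
        using P b by simp
      then show "\<exists>y. y \<in> \<Phi> (Suc n) b (Suc (Suc n)) \<and>
          \<xi> (Suc n) b - lin h (bdC (Suc n) b) - lin (bdD (Suc (Suc n))) y \<in> N (Suc n)"
        using acyc[OF b z] by blast
    qed
    from bchoice[OF this] obtain g where g: "\<forall>b\<in>BC (Suc n). g b \<in> \<Phi> (Suc n) b (Suc (Suc n)) \<and>
        \<xi> (Suc n) b - lin h (bdC (Suc n) b) - lin (bdD (Suc (Suc n))) (g b) \<in> N (Suc n)"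
      by blast
    have "lin (\<lambda>b'. \<xi> (Suc n) b' - lin (bdD (Suc (Suc n))) (g b')) (bdC (Suc (Suc n)) b) \<in> N (Suc n)"
      if b: "b \<in> BC (Suc (Suc n))" for b
    proof -
      have "lin (\<lambda>b'. \<xi> (Suc n) b' - lin h (bdC (Suc n) b') - lin (bdD (Suc (Suc n))) (g b'))
          (bdC (Suc (Suc n)) b) \<in> N (Suc n)"
        using g by (intro extN b) auto
      \<comment> \<open>Two successive boundaries vanish, so the correction by \<open>h\<close>
        drops out and the invariant passes to the next position.\<close>
      moreover have "lin (\<lambda>b'. lin h (bdC (Suc n) b')) (bdC (Suc (Suc n)) b) = 0"
        unfolding lin_lin[symmetric] dd[OF b] by simp
      ultimately show ?thesis
        by (simp add: lin_fun_diff)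
    qed
    then show "\<exists>g. ?P (Suc n) g \<and> ?Q n h g"
      using g by (intro exI[of _ g] conjI impI ballI) auto
  qed
  then obtain h where h: "\<And>n. ?P n (h n) \<and> ?Q n (h n) (h (Suc n))"
    by blast
  show thesis
  proof (rule that[of h])
    show "h n b \<in> \<Phi> n b (Suc n)" if "b \<in> BC n" for n b
      using h[of n] that by blast
    show "\<xi> 0 b - lin (bdD (Suc 0)) (h 0 b) \<in> N 0" if "b \<in> BC 0" for b
      using h[of 0] that by blast
    show "\<xi> (Suc n) b - lin (h n) (bdC (Suc n) b) - lin (bdD (Suc (Suc n))) (h (Suc n) b) \<in> N (Suc n)"
      if "b \<in> BC (Suc n)" for n b
      using h[of n] that by blast
  qed
qed


subsection \<open>Cohomology ranks of complexes with bases\<close>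

definition pairing :: "('b \<Rightarrow> int) \<Rightarrow> ('b \<Rightarrow>\<^sub>0 int) \<Rightarrow> int" where
  "pairing u c = (\<Sum>b\<in>keys c. lookup c b * u b)"

text \<open>Cochains are functions on the whole basis type that vanish off \<open>B n\<close>, so
  that each cochain is a single function and \<open>qrank\<close> applies.\<close>

definition cochains :: "(nat \<Rightarrow> 'b set) \<Rightarrow> nat \<Rightarrow> ('b \<Rightarrow> int) set" where
  "cochains B n = {u. \<forall>b. u b \<noteq> 0 \<longrightarrow> b \<in> B n}"

definition cocycles :: "(nat \<Rightarrow> 'b set) \<Rightarrow> (nat \<Rightarrow> 'b \<Rightarrow> 'b \<Rightarrow>\<^sub>0 int) \<Rightarrow> nat \<Rightarrow> ('b \<Rightarrow> int) set" where
  "cocycles B bd n = {u \<in> cochains B n. \<forall>b\<in>B (Suc n). pairing u (bd (Suc n) b) = 0}"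

definition coboundaries :: "(nat \<Rightarrow> 'b set) \<Rightarrow> (nat \<Rightarrow> 'b \<Rightarrow> 'b \<Rightarrow>\<^sub>0 int) \<Rightarrow> nat \<Rightarrow> ('b \<Rightarrow> int) set" where
  "coboundaries B bd n = (case n of 0 \<Rightarrow> {\<lambda>b. 0}
    | Suc m \<Rightarrow> (\<lambda>w b. if b \<in> B n then pairing w (bd n b) else 0) ` cochains B m)"

text \<open>Complexes are augmented and indexed by the number of vertices: position \<open>n\<close> holds the chains of
  dimension \<open>n - 1\<close>.\<close>

definition crank :: "(nat \<Rightarrow> 'b set) \<Rightarrow> (nat \<Rightarrow> 'b \<Rightarrow> 'b \<Rightarrow>\<^sub>0 int) \<Rightarrow> nat \<Rightarrow> enat" where
  "crank B bd n = qrank (cocycles B bd n) (coboundaries B bd n)"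

lemma pairing_superset:
  assumes "finite A" "keys c \<subseteq> A"
  shows "pairing u c = (\<Sum>b\<in>A. lookup c b * u b)"
  unfolding pairing_def using assms
  by (intro sum.mono_neutral_cong_left) (auto simp: in_keys_iff)

lemma pairing_cong: "(\<And>b. b \<in> keys c \<Longrightarrow> u b = v b) \<Longrightarrow> pairing u c = pairing v c"
  unfolding pairing_def by (rule sum.cong) auto

lemma pairing_0 [simp]: "pairing u 0 = 0" "pairing (\<lambda>b. 0) c = 0"
  by (auto simp: pairing_def)

lemma pairing_add: "pairing u (c + d) = pairing u c + pairing u d"
  using Poly_Mapping.keys_add[of c d]
  by (simp add: pairing_superset[of "keys c \<union> keys d"] lookup_add
      distrib_right sum.distrib)

lemma pairing_smul: "pairing u (smul r c) = r * pairing u c"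
  by (simp add: pairing_superset[OF finite_keys keys_smul[of r c]] pairing_def[of u c] sum_distrib_left mult.assoc)

lemma pairing_uminus: "pairing u (- c) = - pairing u c"
  by (simp add: pairing_def sum_negf)

lemma pairing_diff: "pairing u (c - d) = pairing u c - pairing u d"
  using pairing_add[of u c "- d"] by (simp add: pairing_uminus)

lemma pairing_sum: "pairing u (sum g I) = (\<Sum>i\<in>I. pairing u (g i))"
  by (induction I rule: infinite_finite_induct) (auto simp: pairing_add)

lemma pairing_single [simp]: "pairing u (single b r) = r * u b"
  by (simp add: pairing_def)

lemma pairing_lin: "pairing u (lin f c) = pairing (\<lambda>b. pairing u (f b)) c"
  by (simp add: lin_def pairing_sum pairing_smul) (simp add: pairing_def)

lemma pairing_fun_diff: "pairing (\<lambda>b. u b - v b) c = pairing u c - pairing v c"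
  by (simp add: pairing_def right_diff_distrib sum_subtractf)

lemma fun_subgroup_cochains: "fun_subgroup (cochains B n)"
  by (auto simp: fun_subgroup_def cochains_def) metis

lemma fun_subgroup_cocycles: "fun_subgroup (cocycles B bd n)"
  using fun_subgroup_cochains[of B n] by (auto simp: fun_subgroup_def cocycles_def pairing_fun_diff)

lemma coboundaries_0: "coboundaries B bd 0 = {\<lambda>b. 0}"
  by (simp add: coboundaries_def)

lemma coboundaries_Suc: "coboundaries B bd (Suc m)
    = (\<lambda>w b. if b \<in> B (Suc m) then pairing w (bd (Suc m) b) else 0) ` cochains B m"
  by (simp add: coboundaries_def)

lemma fun_subgroup_coboundaries: "fun_subgroup (coboundaries B bd n)"
proof (cases n)
  case 0
  then show ?thesis
    by (auto simp: fun_subgroup_def coboundaries_def)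
next
  case (Suc m)
  show ?thesis
    unfolding fun_subgroup_def Suc coboundaries_Suc
  proof (intro conjI ballI)
    show "(\<lambda>b. 0) \<in> (\<lambda>w b. if b \<in> B (Suc m) then pairing w (bd (Suc m) b) else 0) ` cochains B m"
      using fun_subgroup_zero[OF fun_subgroup_cochains, of B m]
      by (intro image_eqI[of _ _ "\<lambda>b. 0"]) auto
    fix u v
    assume "u \<in> (\<lambda>w b. if b \<in> B (Suc m) then pairing w (bd (Suc m) b) else 0) ` cochains B m"
      "v \<in> (\<lambda>w b. if b \<in> B (Suc m) then pairing w (bd (Suc m) b) else 0) ` cochains B m"
    then obtain u' v' where "u' \<in> cochains B m" "v' \<in> cochains B m"
      "u = (\<lambda>b. if b \<in> B (Suc m) then pairing u' (bd (Suc m) b) else 0)"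
      "v = (\<lambda>b. if b \<in> B (Suc m) then pairing v' (bd (Suc m) b) else 0)"
      by blast
    then show "(\<lambda>b. u b - v b) \<in> (\<lambda>w b. if b \<in> B (Suc m) then pairing w (bd (Suc m) b) else 0) ` cochains B m"
      using fun_subgroup_diff[OF fun_subgroup_cochains, of u' B m v']
      by (intro image_eqI[of _ _ "\<lambda>b. u' b - v' b"]) (auto simp: pairing_fun_diff)
  qed
qed

text \<open>Pulling back along \<open>g\<close> is injective on cohomology: the homotopy from the
  composite of \<open>f\<close> and \<open>g\<close> to the identity turns a primitive of the
  pullback of \<open>u\<close> into a primitive of \<open>u\<close>. One homotopy gives one
  inequality.\<close>

lemma crank_le_of_homotopy_retract:
  assumes f: "\<And>n b. b \<in> BC n \<Longrightarrow> keys (f n b) \<subseteq> BD n"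
    and f_chain: "\<And>n b. b \<in> BC (Suc n) \<Longrightarrow> lin (bdD (Suc n)) (f (Suc n) b) = lin (f n) (bdC (Suc n) b)"
    and g: "\<And>n d. d \<in> BD n \<Longrightarrow> keys (g n d) \<subseteq> BC n"
    and g_chain: "\<And>n d. d \<in> BD (Suc n) \<Longrightarrow> lin (bdC (Suc n)) (g (Suc n) d) = lin (g n) (bdD (Suc n) d)"
    and keysC: "\<And>n b. b \<in> BC (Suc n) \<Longrightarrow> keys (bdC (Suc n) b) \<subseteq> BC n"
    and keysD: "\<And>n b. b \<in> BD (Suc n) \<Longrightarrow> keys (bdD (Suc n) b) \<subseteq> BD n"
    and h: "\<And>n b. b \<in> BC n \<Longrightarrow> keys (h n b) \<subseteq> BC (Suc n)"
    and h_0: "\<And>b. b \<in> BC 0 \<Longrightarrow> lin (g 0) (f 0 b) - bas b = lin (bdC (Suc 0)) (h 0 b)"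
    and h_Suc: "\<And>n b. b \<in> BC (Suc n) \<Longrightarrow> lin (g (Suc n)) (f (Suc n) b) - bas b
      = lin (bdC (Suc (Suc n))) (h (Suc n) b) + lin (h n) (bdC (Suc n) b)"
  shows "crank BC bdC n \<le> crank BD bdD n"
proof -
  let ?\<phi> = "\<lambda>u d. if d \<in> BD n then pairing u (g n d) else 0"
  show ?thesis
    unfolding crank_def
  proof (rule qrank_inj_le[where \<phi> = ?\<phi>])
  show "fun_subgroup (cocycles BC bdC n)"
    by (rule fun_subgroup_cocycles)
  show "(\<lambda>b. 0) \<in> coboundaries BD bdD n"
    by (rule fun_subgroup_zero[OF fun_subgroup_coboundaries])
  show "?\<phi> (\<lambda>b. x b - y b) = (\<lambda>d. ?\<phi> x d - ?\<phi> y d)" for x y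
    by (auto simp: pairing_fun_diff)
  fix u assume u: "u \<in> cocycles BC bdC n"
  have u_bd: "pairing u (lin (bdC (Suc n)) c) = 0" if "keys c \<subseteq> BC (Suc n)" for c
  proof -
    have "pairing u (lin (bdC (Suc n)) c) = pairing (\<lambda>b. 0) c"
      unfolding pairing_lin using that u by (intro pairing_cong) (auto simp: cocycles_def)
    then show ?thesis
      by simp
  qed
  have \<phi>u: "pairing (?\<phi> u) c = pairing u (lin (g n) c)" if "keys c \<subseteq> BD n" for c
    unfolding pairing_lin using that by (intro pairing_cong) auto
  show "?\<phi> u \<in> cocycles BD bdD n"
    using u_bd[OF g] by (auto simp: cocycles_def cochains_def \<phi>u[OF keysD] g_chain[symmetric])
  assume cob: "?\<phi> u \<in> coboundaries BD bdD n"
  have u_fg: "pairing u (lin (g n) (f n b)) = pairing (?\<phi> u) (f n b)" if "b \<in> BC n" for b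
    using \<phi>u[OF f[OF that]] by simp
  show "u \<in> coboundaries BC bdC n"
  proof (cases n)
    case 0
    have "u b = 0" for b
    proof (cases "b \<in> BC n")
      case True
      have "pairing u (lin (g n) (f n b)) = 0"
        using u_fg[OF True] cob by (simp add: coboundaries_def 0)
      moreover have "pairing u (lin (g n) (f n b) - bas b) = 0"
        using h_0[of b] u_bd[OF h[OF True]] True by (simp add: 0)
      ultimately show ?thesis
        by (simp add: pairing_diff)
    next
      case False
      then show ?thesis
        using u by (auto simp: cocycles_def cochains_def)
    qed
    then show ?thesis
      by (auto simp: coboundaries_def 0)
  next
    case (Suc m)
    obtain w where w: "w \<in> cochains BD m"
      "?\<phi> u = (\<lambda>d. if d \<in> BD (Suc m) then pairing w (bdD (Suc m) d) else 0)"
      using cob unfolding Suc coboundaries_Suc by blast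
    \<comment> \<open>When the pullback of \<open>u\<close> along \<open>g\<close> is the coboundary
      of \<open>w\<close>, evaluating the homotopy formula on the cocycle \<open>u\<close> leaves
      this as a primitive of \<open>u\<close>.\<close>
    define v where "v = (\<lambda>b. if b \<in> BC m then pairing w (f m b) - pairing u (h m b) else 0)"
    have u_eq: "u = (\<lambda>b. if b \<in> BC (Suc m) then pairing v (bdC (Suc m) b) else 0)"
    proof
      fix b
      show "u b = (if b \<in> BC (Suc m) then pairing v (bdC (Suc m) b) else 0)"
      proof (cases "b \<in> BC (Suc m)")
        case True
        then have b: "b \<in> BC n"
          by (simp add: Suc)
        have "pairing u (lin (g n) (f n b)) = pairing (\<lambda>d. pairing w (bdD (Suc m) d)) (f n b)"
          unfolding u_fg[OF b] w(2) using f[OF True] by (intro pairing_cong) (auto simp: Suc)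
        also have "\<dots> = pairing w (lin (f m) (bdC (Suc m) b))"
          using f_chain[OF True] by (simp add: Suc pairing_lin[symmetric])
        finally have 1: "pairing u (lin (g n) (f n b)) = pairing w (lin (f m) (bdC (Suc m) b))" .
        have "pairing u (lin (g n) (f n b)) - u b = pairing u (lin (g n) (f n b) - bas b)"
          by (simp add: pairing_diff)
        also have "\<dots> = pairing u (lin (h m) (bdC (Suc m) b))"
          using h_Suc[OF True] u_bd[OF h[OF b]] by (simp add: Suc pairing_add)
        finally have "u b = pairing w (lin (f m) (bdC (Suc m) b)) - pairing u (lin (h m) (bdC (Suc m) b))"
          using 1 by linarith
        also have "\<dots> = pairing (\<lambda>b. pairing w (f m b) - pairing u (h m b)) (bdC (Suc m) b)"
          by (simp add: pairing_lin pairing_fun_diff)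
        also have "\<dots> = pairing v (bdC (Suc m) b)"
          using keysC[OF True] by (intro pairing_cong) (auto simp: v_def)
        finally show ?thesis
          using True by simp
      next
        case False
        then show ?thesis
          using u by (auto simp: cocycles_def cochains_def Suc)
      qed
    qed
    have "v \<in> cochains BC m"
      by (auto simp: v_def cochains_def)
    then show ?thesis
      unfolding Suc coboundaries_Suc by (intro image_eqI[of u _ v] u_eq)
  qed
  qed
qed

text \<open>By \<open>acyc\<close> a chain with boundary in the small complex can be pushed into it.
  Doing so one basis element at a time gives a homotopy \<open>h\<close> vanishing on
  \<open>A\<close>, and the identity minus both composites of \<open>h\<close> with the boundary is
  a retraction \<open>r\<close> onto \<open>A\<close>.\<close>

lemma crank_subcomplex:
  fixes A B :: "nat \<Rightarrow> 'b set" and bd :: "nat \<Rightarrow> 'b \<Rightarrow> 'b \<Rightarrow>\<^sub>0 int"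
  assumes sub: "\<And>n. A n \<subseteq> B n"
    and keysA: "\<And>n b. b \<in> A (Suc n) \<Longrightarrow> keys (bd (Suc n) b) \<subseteq> A n"
    and keysB: "\<And>n b. b \<in> B (Suc n) \<Longrightarrow> keys (bd (Suc n) b) \<subseteq> B n"
    and dd: "\<And>n b. b \<in> B (Suc (Suc n)) \<Longrightarrow> lin (bd (Suc n)) (bd (Suc (Suc n)) b) = 0"
    and base: "A 0 = B 0"
    and acyc: "\<And>n c. keys c \<subseteq> B (Suc n) \<Longrightarrow> keys (lin (bd (Suc n)) c) \<subseteq> A n \<Longrightarrow>
      \<exists>e. keys e \<subseteq> B (Suc (Suc n)) \<and> keys (c - lin (bd (Suc (Suc n))) e) \<subseteq> A (Suc n)"
  shows "crank A bd n = crank B bd n"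
proof -
  \<comment> \<open>For \<open>b\<close> in \<open>A\<close> the carrier is zero in the position of
    the homotopy and all of \<open>A\<close> in the position of \<open>b\<close> itself: this forces
    \<open>h\<close> to vanish on \<open>A\<close>, while the identity still fits.\<close>
  define \<Phi> :: "nat \<Rightarrow> 'b \<Rightarrow> nat \<Rightarrow> ('b \<Rightarrow>\<^sub>0 int) set" where "\<Phi> n b k = (if b \<in> A n
      then (if k = n then {c. keys c \<subseteq> A n} else {0}) else {c. keys c \<subseteq> B k})"
    for n b k
  obtain h :: "nat \<Rightarrow> 'b \<Rightarrow> 'b \<Rightarrow>\<^sub>0 int" where h: "\<And>n b. b \<in> B n \<Longrightarrow> h n b \<in> \<Phi> n b (Suc n)"
    "\<And>b. b \<in> B 0 \<Longrightarrow> bas b - lin (bd (Suc 0)) (h 0 b) \<in> {c. keys c \<subseteq> A 0}"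
    "\<And>n b. b \<in> B (Suc n) \<Longrightarrow> bas b - lin (h n) (bd (Suc n) b) - lin (bd (Suc (Suc n))) (h (Suc n) b)
      \<in> {c. keys c \<subseteq> A (Suc n)}"
  proof (rule null_homotopy_lift[of B bd bd "\<lambda>n b. bas b" \<Phi> "\<lambda>n. {c. keys c \<subseteq> A n}"])
    fix n b
    show "lin (bd (Suc n)) (bas b) = lin bas (bd (Suc n) b)"
      by simp
    show "bas b \<in> \<Phi> (Suc n) b (Suc n)" if "b \<in> B (Suc n)"
      using that by (auto simp: \<Phi>_def)
    show "\<exists>y\<in>\<Phi> 0 b (Suc 0). bas b - lin (bd (Suc 0)) y \<in> {c. keys c \<subseteq> A 0}" if "b \<in> B 0"
      using that base by (intro bexI[of _ 0]) (auto simp: \<Phi>_def)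
    show "x - y \<in> \<Phi> (Suc n) b (Suc n)" if "x \<in> \<Phi> (Suc n) b (Suc n)" "y \<in> \<Phi> (Suc n) b (Suc n)" for x y
      using that by (auto simp: \<Phi>_def split: if_splits dest: subsetD[OF keys_diff_subset])
    show "lin y (bd (Suc n) b) \<in> {c. keys c \<subseteq> A n}"
      if "b \<in> B (Suc n)" "\<And>b'. b' \<in> B n \<Longrightarrow> y b' \<in> {c. keys c \<subseteq> A n}" for y
      using that keysB[OF that(1)] keys_lin_subset[of "bd (Suc n) b" y "A n"] by auto
    show "lin y (bd (Suc n) b) \<in> \<Phi> (Suc n) b (Suc n)"
      if b: "b \<in> B (Suc n)" and y: "\<And>b'. b' \<in> B n \<Longrightarrow> y b' \<in> \<Phi> n b' (Suc n)" for y
    proof (cases "b \<in> A (Suc n)")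
      case True
      have "y b' = 0" if "b' \<in> keys (bd (Suc n) b)" for b'
      proof -
        have "b' \<in> A n"
          using keysA[OF True] that by auto
        then show ?thesis
          using y[of b'] sub[of n] unfolding \<Phi>_def by auto
      qed
      then have "lin y (bd (Suc n) b) = lin (\<lambda>_. 0) (bd (Suc n) b)"
        by (intro lin_cong) auto
      then show ?thesis
        using True by (simp add: \<Phi>_def)
    next
      case False
      have "keys (y b') \<subseteq> B (Suc n)" if "b' \<in> keys (bd (Suc n) b)" for b'
      proof -
        have "b' \<in> B n"
          using keysB[OF b] that by auto
        then show ?thesis
          using y[of b'] unfolding \<Phi>_def by (cases "b' \<in> A n") auto
      qed
      then show ?thesis
        using False by (auto simp: \<Phi>_def intro!: keys_lin_subset)
    qed
    show "\<exists>y\<in>\<Phi> (Suc n) b (Suc (Suc n)). z - lin (bd (Suc (Suc n))) y \<in> {c. keys c \<subseteq> A (Suc n)}"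
      if b: "b \<in> B (Suc n)" and z: "z \<in> \<Phi> (Suc n) b (Suc n)"
        and bz: "lin (bd (Suc n)) z \<in> {c. keys c \<subseteq> A n}" for z
    proof (cases "b \<in> A (Suc n)")
      case True
      then show ?thesis
        using z by (intro bexI[of _ 0]) (auto simp: \<Phi>_def)
    next
      case False
      then show ?thesis
        using acyc[of z n] z bz by (auto simp: \<Phi>_def)
    qed
  qed (use keysB dd in auto)
  have hA: "h n b = 0" if "b \<in> A n" for n b
    using h(1)[of b n] that sub by (auto simp: \<Phi>_def)
  have hB: "keys (h n b) \<subseteq> B (Suc n)" if "b \<in> B n" for n b
    using h(1)[of b n] that by (auto simp: \<Phi>_def split: if_splits)
  define r where "r n b = bas b - (case n of 0 \<Rightarrow> 0 | Suc m \<Rightarrow> lin (h m) (bd n b)) - lin (bd (Suc n)) (h n b)"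
    for n b
  have r_0: "r 0 = (\<lambda>b. bas b - lin (bd (Suc 0)) (h 0 b))"
    and r_Suc: "\<And>m. r (Suc m) = (\<lambda>b. bas b - lin (h m) (bd (Suc m) b) - lin (bd (Suc (Suc m))) (h (Suc m) b))"
    by (auto simp: r_def)
  have r_keys: "keys (r n b) \<subseteq> A n" if "b \<in> B n" for n b
    using h(2)[of b] h(3)[of b] that by (cases n) (auto simp: r_def)
  have r_A: "r n b = bas b" if b: "b \<in> A n" for n b
  proof (cases n)
    case (Suc m)
    have "lin (h m) (bd n b) = lin (\<lambda>_. 0) (bd n b)"
      using keysA[of b m] b hA by (intro lin_cong) (auto simp: Suc)
    then show ?thesis
      using hA[OF b] by (simp add: r_def Suc)
  qed (use hA b in \<open>simp add: r_def\<close>)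
  have r_chain: "lin (bd (Suc n)) (r (Suc n) b) = lin (r n) (bd (Suc n) b)" if b: "b \<in> B (Suc n)" for n b
  proof -
    have 1: "lin (bd (Suc n)) (lin (bd (Suc (Suc n))) (h (Suc n) b)) = 0"
    proof -
      have "lin (bd (Suc n)) (lin (bd (Suc (Suc n))) (h (Suc n) b)) = lin (\<lambda>_. 0) (h (Suc n) b)"
        unfolding lin_lin using dd hB[OF b] by (intro lin_cong) auto
      then show ?thesis
        by simp
    qed
    have 2: "lin (r n) (bd (Suc n) b) = bd (Suc n) b - lin (\<lambda>b. lin (bd (Suc n)) (h n b)) (bd (Suc n) b)"
    proof (cases n)
      case 0
      then show ?thesis
        by (simp add: r_0 lin_fun_diff)
    next
      case (Suc m)
      have "lin (\<lambda>b. lin (h m) (bd n b)) (bd (Suc n) b) = 0"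
        unfolding lin_lin[symmetric] using dd[of b m] b by (simp add: Suc)
      then show ?thesis
        by (simp add: r_Suc lin_fun_diff Suc)
    qed
    show ?thesis
      unfolding 2 by (simp add: r_Suc lin_diff 1) (simp add: lin_lin)
  qed
  show ?thesis
  proof (rule antisym)
    show "crank A bd n \<le> crank B bd n"
      by (rule crank_le_of_homotopy_retract[of A "\<lambda>n. bas" B bd bd r "\<lambda>n b. 0"])
        (use sub r_keys r_chain r_A keysA keysB in auto)
    show "crank B bd n \<le> crank A bd n"
    proof (rule crank_le_of_homotopy_retract[of B r A bd bd "\<lambda>n. bas" "\<lambda>n b. - h n b"])
      have lin_neg: "lin (\<lambda>b. - f b) c = - lin f c" for f :: "'b \<Rightarrow> 'b \<Rightarrow>\<^sub>0 int" and c
        using lin_fun_diff[of "\<lambda>_. 0" f c] by simp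
      show "lin bas (r (Suc n) b) - bas b = lin (bd (Suc (Suc n))) (- h (Suc n) b) + lin (\<lambda>b. - h n b) (bd (Suc n) b)" for n b
        by (simp add: r_def lin_uminus lin_neg)
      show "lin bas (r 0 b) - bas b = lin (bd (Suc 0)) (- h 0 b)" for b
        by (simp add: r_def lin_uminus)
    qed (use sub r_keys r_chain keysA keysB hB in auto)
  qed
qed

section \<open>Acyclic carriers\<close>

definition acyclic_carrier :: "(nat \<Rightarrow> 'd \<Rightarrow> 'd \<Rightarrow>\<^sub>0 int) \<Rightarrow> (nat \<Rightarrow> 'd set) \<Rightarrow> bool" where
  "acyclic_carrier bd A \<longleftrightarrow> (\<forall>n z. keys z \<subseteq> A n \<longrightarrow> (n > 0 \<longrightarrow> lin (bd n) z = 0) \<longrightarrow>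
    (\<exists>y. keys y \<subseteq> A (Suc n) \<and> lin (bd (Suc n)) y = z))"

lemma acyclic_carrierD:
  assumes "acyclic_carrier bd A" "keys z \<subseteq> A n" "n > 0 \<Longrightarrow> lin (bd n) z = 0"
  obtains y where "keys y \<subseteq> A (Suc n)" "lin (bd (Suc n)) y = z"
  using assms unfolding acyclic_carrier_def by blast

text \<open>The method of acyclic carriers for augmented complexes. Acyclicity includes position 0,
  where every multiple of the augmentation generator has to be a boundary; there the map is
  prescribed, and the carriers take over from position 1.\<close>

lemma acyclic_carrier_chain_map:
  assumes keysC: "\<And>n b. b \<in> BC (Suc n) \<Longrightarrow> keys (bdC (Suc n) b) \<subseteq> BC n"
    and ddC: "\<And>n b. b \<in> BC (Suc (Suc n)) \<Longrightarrow> lin (bdC (Suc n)) (bdC (Suc (Suc n)) b) = 0"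
    and d0: "\<And>n b. b \<in> BC (Suc n) \<Longrightarrow> d0 \<in> \<Phi> (Suc n) b 0"
    and acyc: "\<And>n b. b \<in> BC (Suc n) \<Longrightarrow> acyclic_carrier bdD (\<Phi> (Suc n) b)"
    and mono: "\<And>n b b' k. b \<in> BC (Suc (Suc n)) \<Longrightarrow> b' \<in> keys (bdC (Suc (Suc n)) b) \<Longrightarrow>
      \<Phi> (Suc n) b' k \<subseteq> \<Phi> (Suc (Suc n)) b k"
  obtains f where "f 0 = (\<lambda>b. bas d0)" "\<And>n b. b \<in> BC (Suc n) \<Longrightarrow> keys (f (Suc n) b) \<subseteq> \<Phi> (Suc n) b (Suc n)"
    "\<And>n b. b \<in> BC (Suc n) \<Longrightarrow> lin (bdD (Suc n)) (f (Suc n) b) = lin (f n) (bdC (Suc n) b)"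
proof -
  \<comment> \<open>\<open>\<Phi>\<close> is meaningful only for basis elements of positive
    position; those of position 0 are carried by \<open>d0\<close> alone.\<close>
  define \<Phi>' where "\<Phi>' n b k = {c::_ \<Rightarrow>\<^sub>0 int. keys c \<subseteq> (if n = 0 then {d0} else \<Phi> n b k)}" for n b k
  obtain f where f: "f 0 = (\<lambda>b. bas d0)" "\<And>n b. b \<in> BC n \<Longrightarrow> f n b \<in> \<Phi>' n b n"
    "\<And>n b. b \<in> BC (Suc n) \<Longrightarrow> lin (bdD (Suc n)) (f (Suc n) b) = lin (f n) (bdC (Suc n) b)"
  proof (rule chain_map_lift[of BC bdC "\<lambda>b. bas d0" \<Phi>' bdD])
    fix n b
    show "\<exists>y\<in>\<Phi>' (Suc 0) b (Suc 0). lin (bdD (Suc 0)) y = lin (\<lambda>b. bas d0) (bdC (Suc 0) b)" if b: "b \<in> BC (Suc 0)"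
    proof -
      have "keys (lin (\<lambda>b. bas d0) (bdC (Suc 0) b)) \<subseteq> \<Phi> (Suc 0) b 0"
        using d0[OF b] by (intro keys_lin_subset) auto
      then show ?thesis
        using acyc[OF b] by (auto simp: acyclic_carrier_def \<Phi>'_def)
    qed
    show "lin y (bdC (Suc n) b) \<in> \<Phi>' (Suc n) b n"
      if b: "b \<in> BC (Suc n)" and y: "\<And>b'. b' \<in> BC n \<Longrightarrow> y b' \<in> \<Phi>' n b' n" for y
    proof -
      have "keys (y b') \<subseteq> \<Phi> (Suc n) b n" if b': "b' \<in> keys (bdC (Suc n) b)" for b'
      proof (cases n)
        case 0
        then show ?thesis
          using y[of b'] keysC[OF b] b' d0[OF b] by (auto simp: \<Phi>'_def)
      next
        case (Suc m)
        then show ?thesis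
          using y[of b'] keysC[OF b] b' mono[of b m b' n] b unfolding \<Phi>'_def by auto
      qed
      then show ?thesis
        by (auto simp: \<Phi>'_def intro!: keys_lin_subset)
    qed
    show "\<exists>y\<in>\<Phi>' (Suc (Suc n)) b (Suc (Suc n)). lin (bdD (Suc (Suc n))) y = z"
      if "b \<in> BC (Suc (Suc n))" "z \<in> \<Phi>' (Suc (Suc n)) b (Suc n)" "lin (bdD (Suc n)) z = 0" for z
      using acyc[OF that(1)] that(2,3) by (auto simp: acyclic_carrier_def \<Phi>'_def)
  qed (use keysC ddC in \<open>auto simp: \<Phi>'_def\<close>)
  show thesis
  proof (rule that[of f])
    show "keys (f (Suc n) b) \<subseteq> \<Phi> (Suc n) b (Suc n)" if "b \<in> BC (Suc n)" for n b
      using f(2)[OF that] by (simp add: \<Phi>'_def)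
  qed (use f in auto)
qed

text \<open>\<open>\<Phi>\<close> and \<open>\<Psi>\<close> carry chain maps in the two directions,
  and \<open>\<Theta>\<close> carries the homotopy between their composite and the identity: it
  contains \<open>b\<close> itself and, by the last hypothesis, everything the composite can
  reach.\<close>

lemma crank_le_acyclic_carriers:
  assumes keysC: "\<And>n b. b \<in> BC (Suc n) \<Longrightarrow> keys (bdC (Suc n) b) \<subseteq> BC n"
    and ddC: "\<And>n b. b \<in> BC (Suc (Suc n)) \<Longrightarrow> lin (bdC (Suc n)) (bdC (Suc (Suc n)) b) = 0"
    and keysD: "\<And>n b. b \<in> BD (Suc n) \<Longrightarrow> keys (bdD (Suc n) b) \<subseteq> BD n"
    and ddD: "\<And>n b. b \<in> BD (Suc (Suc n)) \<Longrightarrow> lin (bdD (Suc n)) (bdD (Suc (Suc n)) b) = 0"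
    and C0: "BC 0 = {c0}" and D0: "BD 0 = {d0}"
    and \<Phi>: "\<And>n b k. b \<in> BC (Suc n) \<Longrightarrow> \<Phi> (Suc n) b k \<subseteq> BD k"
      "\<And>n b. b \<in> BC (Suc n) \<Longrightarrow> d0 \<in> \<Phi> (Suc n) b 0"
      "\<And>n b. b \<in> BC (Suc n) \<Longrightarrow> acyclic_carrier bdD (\<Phi> (Suc n) b)"
      "\<And>n b b' k. b \<in> BC (Suc (Suc n)) \<Longrightarrow> b' \<in> keys (bdC (Suc (Suc n)) b) \<Longrightarrow>
        \<Phi> (Suc n) b' k \<subseteq> \<Phi> (Suc (Suc n)) b k"
    and \<Psi>: "\<And>n b k. b \<in> BD (Suc n) \<Longrightarrow> \<Psi> (Suc n) b k \<subseteq> BC k"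
      "\<And>n b. b \<in> BD (Suc n) \<Longrightarrow> c0 \<in> \<Psi> (Suc n) b 0"
      "\<And>n b. b \<in> BD (Suc n) \<Longrightarrow> acyclic_carrier bdC (\<Psi> (Suc n) b)"
      "\<And>n b b' k. b \<in> BD (Suc (Suc n)) \<Longrightarrow> b' \<in> keys (bdD (Suc (Suc n)) b) \<Longrightarrow>
        \<Psi> (Suc n) b' k \<subseteq> \<Psi> (Suc (Suc n)) b k"
    and \<Theta>: "\<And>n b k. b \<in> BC (Suc n) \<Longrightarrow> \<Theta> (Suc n) b k \<subseteq> BC k"
      "\<And>n b. b \<in> BC (Suc n) \<Longrightarrow> b \<in> \<Theta> (Suc n) b (Suc n)"
      "\<And>n b. b \<in> BC (Suc n) \<Longrightarrow> acyclic_carrier bdC (\<Theta> (Suc n) b)"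
      "\<And>n b b' k. b \<in> BC (Suc (Suc n)) \<Longrightarrow> b' \<in> keys (bdC (Suc (Suc n)) b) \<Longrightarrow>
        \<Theta> (Suc n) b' k \<subseteq> \<Theta> (Suc (Suc n)) b k"
      "\<And>n b d. b \<in> BC (Suc n) \<Longrightarrow> d \<in> \<Phi> (Suc n) b (Suc n) \<Longrightarrow> \<Psi> (Suc n) d (Suc n) \<subseteq> \<Theta> (Suc n) b (Suc n)"
  shows "crank BC bdC n \<le> crank BD bdD n"
proof -
  obtain f where f: "f 0 = (\<lambda>b. bas d0)" "\<And>n b. b \<in> BC (Suc n) \<Longrightarrow> keys (f (Suc n) b) \<subseteq> \<Phi> (Suc n) b (Suc n)"
    "\<And>n b. b \<in> BC (Suc n) \<Longrightarrow> lin (bdD (Suc n)) (f (Suc n) b) = lin (f n) (bdC (Suc n) b)"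
    by (rule acyclic_carrier_chain_map[of BC bdC d0 \<Phi> bdD]) (use keysC ddC \<Phi> in blast)+
  obtain g where g: "g 0 = (\<lambda>b. bas c0)" "\<And>n b. b \<in> BD (Suc n) \<Longrightarrow> keys (g (Suc n) b) \<subseteq> \<Psi> (Suc n) b (Suc n)"
    "\<And>n b. b \<in> BD (Suc n) \<Longrightarrow> lin (bdC (Suc n)) (g (Suc n) b) = lin (g n) (bdD (Suc n) b)"
    by (rule acyclic_carrier_chain_map[of BD bdD c0 \<Psi> bdC]) (use keysD ddD \<Psi> in blast)+
  have f_keys: "keys (f n b) \<subseteq> BD n" if "b \<in> BC n" for n b
    using that f(1) f(2)[of b] \<Phi>(1)[of b] D0 by (cases n) (auto, blast)
  have g_keys: "keys (g n b) \<subseteq> BC n" if "b \<in> BD n" for n b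
    using that g(1) g(2)[of b] \<Psi>(1)[of b] C0 by (cases n) (auto, blast)
  define \<xi> where "\<xi> n b = lin (g n) (f n b) - bas b" for n b
  \<comment> \<open>In position 0 both maps send generator to generator, so their composite is the
    identity and the homotopy can be zero.\<close>
  define \<Theta>' where "\<Theta>' n b k = (if n = 0 then {0} else {c::_ \<Rightarrow>\<^sub>0 int. keys c \<subseteq> \<Theta> n b k})" for n b k
  obtain h where h: "\<And>n b. b \<in> BC n \<Longrightarrow> h n b \<in> \<Theta>' n b (Suc n)"
    "\<And>b. b \<in> BC 0 \<Longrightarrow> \<xi> 0 b - lin (bdC (Suc 0)) (h 0 b) \<in> {0}"
    "\<And>n b. b \<in> BC (Suc n) \<Longrightarrow> \<xi> (Suc n) b - lin (h n) (bdC (Suc n) b) - lin (bdC (Suc (Suc n))) (h (Suc n) b) \<in> {0}"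
  proof (rule null_homotopy_lift[of BC bdC bdC \<xi> \<Theta>' "\<lambda>n. {0}"])
    fix n b
    show "lin (bdC (Suc n)) (\<xi> (Suc n) b) = lin (\<xi> n) (bdC (Suc n) b)" if b: "b \<in> BC (Suc n)"
    proof -
      have "lin (bdC (Suc n)) (lin (g (Suc n)) (f (Suc n) b)) = lin (g n) (lin (bdD (Suc n)) (f (Suc n) b))"
        unfolding lin_lin using g(3) f_keys[OF b] by (intro lin_cong) auto
      moreover have "\<xi> n = (\<lambda>b. lin (g n) (f n b) - bas b)"
        by (simp add: \<xi>_def fun_eq_iff)
      ultimately show ?thesis
        by (simp add: \<xi>_def lin_diff lin_fun_diff f(3)[OF b] lin_lin)
    qed
    show "\<xi> (Suc n) b \<in> \<Theta>' (Suc n) b (Suc n)" if b: "b \<in> BC (Suc n)"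
    proof -
      have "keys (lin (g (Suc n)) (f (Suc n) b)) \<subseteq> \<Theta> (Suc n) b (Suc n)"
      proof (rule keys_lin_subset)
        fix d assume d: "d \<in> keys (f (Suc n) b)"
        then have "d \<in> BD (Suc n)"
          using f_keys[OF b] by auto
        then show "keys (g (Suc n) d) \<subseteq> \<Theta> (Suc n) b (Suc n)"
          using g(2)[of d n] \<Theta>(5)[OF b, of d] f(2)[OF b] d by blast
      qed
      then show ?thesis
        using \<Theta>(2)[OF b] unfolding \<xi>_def \<Theta>'_def by (simp add: keys_diff_subset)
    qed
    show "\<exists>y\<in>\<Theta>' 0 b (Suc 0). \<xi> 0 b - lin (bdC (Suc 0)) y \<in> {0}" if "b \<in> BC 0"
      using that C0 by (simp add: \<Theta>'_def \<xi>_def f(1) g(1))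
    show "x - y \<in> \<Theta>' (Suc n) b (Suc n)" if "x \<in> \<Theta>' (Suc n) b (Suc n)" "y \<in> \<Theta>' (Suc n) b (Suc n)" for x y
      using that keys_diff_subset[of x _ y] by (auto simp: \<Theta>'_def)
    show "lin y (bdC (Suc n) b) \<in> \<Theta>' (Suc n) b (Suc n)"
      if b: "b \<in> BC (Suc n)" and y: "\<And>b'. b' \<in> BC n \<Longrightarrow> y b' \<in> \<Theta>' n b' (Suc n)" for y
    proof -
      have "keys (y b') \<subseteq> \<Theta> (Suc n) b (Suc n)" if b': "b' \<in> keys (bdC (Suc n) b)" for b'
      proof (cases n)
        case 0
        then show ?thesis
          using y[of b'] keysC[OF b] b' by (auto simp: \<Theta>'_def)
      next
        case (Suc m)
        then show ?thesis
          using y[of b'] keysC[OF b] b' \<Theta>(4)[of b m b' "Suc n"] b unfolding \<Theta>'_def by auto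
      qed
      then show ?thesis
        by (auto simp: \<Theta>'_def intro!: keys_lin_subset)
    qed
    show "\<exists>y\<in>\<Theta>' (Suc n) b (Suc (Suc n)). z - lin (bdC (Suc (Suc n))) y \<in> {0}"
      if "b \<in> BC (Suc n)" "z \<in> \<Theta>' (Suc n) b (Suc n)" "lin (bdC (Suc n)) z \<in> {0}" for z
    proof -
      have acy: "acyclic_carrier bdC (\<Theta> (Suc n) b)"
        by (rule \<Theta>(3)[OF that(1)])
      have "keys z \<subseteq> \<Theta> (Suc n) b (Suc n)" "lin (bdC (Suc n)) z = 0"
        using that(2,3) by (auto simp: \<Theta>'_def)
      then obtain y where "keys y \<subseteq> \<Theta> (Suc n) b (Suc (Suc n))" "lin (bdC (Suc (Suc n))) y = z"
        using acyclic_carrierD[OF acy] by blast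
      then show ?thesis
        by (intro bexI[of _ y]) (auto simp: \<Theta>'_def)
    qed
    show "lin y (bdC (Suc n) b) \<in> {0}" if "b \<in> BC (Suc n)" "\<And>b'. b' \<in> BC n \<Longrightarrow> y b' \<in> {0}" for y
    proof -
      have "lin y (bdC (Suc n) b) = lin (\<lambda>_. 0) (bdC (Suc n) b)"
        using keysC[OF that(1)] that(2) by (intro lin_cong) auto
      then show ?thesis
        by simp
    qed
  qed (use keysC ddC in auto)
  show ?thesis
  proof (rule crank_le_of_homotopy_retract[of BC f BD bdD bdC g h])
    show "keys (h n b) \<subseteq> BC (Suc n)" if "b \<in> BC n" for n b
    proof (cases n)
      case (Suc m)
      then show ?thesis
        using h(1)[OF that] \<Theta>(1)[of b m "Suc n"] that unfolding \<Theta>'_def by auto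
    qed (use h(1)[OF that] in \<open>simp add: \<Theta>'_def\<close>)
    show "lin (g 0) (f 0 b) - bas b = lin (bdC (Suc 0)) (h 0 b)" if "b \<in> BC 0" for b
      using h(2)[OF that] by (simp add: \<xi>_def)
    show "lin (g (Suc n)) (f (Suc n) b) - bas b = lin (bdC (Suc (Suc n))) (h (Suc n) b) + lin (h n) (bdC (Suc n) b)"
      if "b \<in> BC (Suc n)" for n b
      using h(3)[OF that] by (simp add: \<xi>_def algebra_simps)
  qed (use f_keys g_keys f(3) g(3) keysC keysD in auto)
qed

section \<open>The augmented singular complex\<close>

type_synonym 'a sing = "(nat \<Rightarrow> real) \<Rightarrow> 'a"

text \<open>With the formal simplex of dimension -1 in position 0, the augmentation is just the
  first differential and reduced cohomology needs no separate treatment.\<close>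

fun sbas :: "'a topology \<Rightarrow> nat \<Rightarrow> 'a sing set" where
  "sbas T 0 = {\<lambda>x. undefined}"
| "sbas T (Suc n) = singular_simplex_set n T"

fun sbd :: "nat \<Rightarrow> 'a sing \<Rightarrow> 'a chain" where
  "sbd 0 s = 0"
| "sbd (Suc 0) s = frag_of (\<lambda>x. undefined)"
| "sbd (Suc (Suc n)) s = chain_boundary (Suc n) (frag_of s)"

lemma lin_sbd: "lin (sbd (Suc (Suc n))) c = chain_boundary (Suc n) c"
proof -
  have "lin (sbd (Suc (Suc n))) c = frag_extend (\<lambda>s. chain_boundary (Suc n) (frag_of s)) c"
    unfolding frag_extend_eq_lin by (rule lin_cong) simp
  also have "\<dots> = chain_boundary (Suc n) c"
    unfolding chain_boundary_of by (simp add: chain_boundary_def)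
  finally show ?thesis .
qed

lemma singular_chain_iff_keys: "singular_chain n T c \<longleftrightarrow> keys c \<subseteq> sbas T (Suc n)"
  by (simp add: singular_chain_def)

lemma keys_sbd:
  assumes "s \<in> sbas T (Suc n)"
  shows "keys (sbd (Suc n) s) \<subseteq> sbas T n"
proof (cases n)
  case (Suc m)
  then have "singular_chain (Suc m) T (frag_of s)"
    using assms by (simp add: singular_chain_of)
  then show ?thesis
    using singular_chain_boundary_alt[of m T "frag_of s"] by (simp add: Suc singular_chain_iff_keys)
qed simp

lemma sbd_sbd:
  assumes s: "s \<in> sbas T (Suc (Suc n))"
  shows "lin (sbd (Suc n)) (sbd (Suc (Suc n)) s) = 0"
proof (cases n)
  case 0
  have "sbd (Suc (Suc 0)) s = frag_of (singular_face (Suc 0) 0 s) - frag_of (singular_face (Suc 0) (Suc 0) s)"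
    by (simp add: chain_boundary_of)
  then show ?thesis
    by (simp add: 0 lin_diff del: sbd.simps(3))
next
  case (Suc m)
  have "singular_chain (Suc (Suc m)) T (frag_of s)"
    using s by (simp add: singular_chain_of Suc)
  then show ?thesis
    using chain_boundary_boundary_alt by (simp add: Suc lin_sbd)
qed

lemma sbas_mono: "A \<subseteq> B \<Longrightarrow> sbas (top_of_set A) n \<subseteq> sbas (top_of_set B) n"
  by (cases n) (auto intro: singular_simplex_mono)

lemma sbas_subset_iff:
  "A \<subseteq> B \<Longrightarrow> s \<in> sbas (top_of_set A) (Suc n) \<longleftrightarrow>
    s \<in> sbas (top_of_set B) (Suc n) \<and> s ` standard_simplex n \<subseteq> A"
  by (auto simp: singular_simplex_subtopology)

section \<open>Straight-line homotopies and convex sets\<close>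

lemma homotopic_with_straight:
  fixes r :: "'a::real_normed_vector \<Rightarrow> 'a"
  assumes r: "continuous_on Y r" and Y: "\<And>y. y \<in> Y \<Longrightarrow> closed_segment y (r y) \<subseteq> Y"
    and S: "\<And>x. x \<in> S \<Longrightarrow> closed_segment x (r x) \<subseteq> S"
  shows "homotopic_with (\<lambda>h. h \<in> S \<rightarrow> S) (top_of_set Y) (top_of_set Y) id r"
proof -
  let ?h = "\<lambda>y. (1 - fst y) *\<^sub>R snd y + fst y *\<^sub>R r (snd y)"
  have seg: "(1 - t) *\<^sub>R y + t *\<^sub>R r y \<in> closed_segment y (r y)" if "t \<in> {0..1}" for t y
    using that by (auto simp: closed_segment_def)
  have "continuous_on ({0..1} \<times> Y) ?h"
    by (intro continuous_intros continuous_on_compose2[OF r]) auto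
  moreover have "?h ` ({0..1} \<times> Y) \<subseteq> Y"
    using seg Y by fastforce
  ultimately have "continuous_map (prod_topology (top_of_set {0..1}) (top_of_set Y)) (top_of_set Y) ?h"
    by (simp add: image_subset_iff_funcset)
  moreover have "\<forall>t\<in>{0..1}. (\<lambda>x. ?h (t, x)) \<in> S \<rightarrow> S"
    using seg S by fastforce
  ultimately show ?thesis
    unfolding homotopic_with_def by (intro exI[of _ ?h]) auto
qed

text \<open>The straight-line homotopy to a point makes a cycle homologous to its image under the
  constant map, so it remains to bound that image. In dimension 0 it vanishes since the coefficients
  add up to zero; in higher dimensions cycles of a point are boundaries; and the augmentation
  generator is the boundary of a vertex.\<close>

lemma acyclic_carrier_convex:
  fixes A :: "'a::real_normed_vector set"
  assumes A: "convex A" "A \<noteq> {}"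
  shows "acyclic_carrier sbd (sbas (top_of_set A))"
  unfolding acyclic_carrier_def
proof (intro allI impI)
  fix n and z :: "'a chain"
  assume z: "keys z \<subseteq> sbas (top_of_set A) n" and bz: "0 < n \<longrightarrow> lin (sbd n) z = 0"
  obtain a where a: "a \<in> A"
    using A by auto
  let ?T = "top_of_set A"
  have cont: "continuous_map ?T (top_of_set {a}) (\<lambda>_. a)" "continuous_map (top_of_set {a}) ?T id"
    using a by auto
  have boundary: "\<exists>y. singular_chain (Suc p) ?T y \<and> chain_boundary (Suc p) y = c - chain_map p (\<lambda>_. a) c"
    if "singular_chain p ?T c" "chain_boundary p c = 0" for p c
  proof -
    have "homotopic_with (\<lambda>h. h \<in> {} \<rightarrow> {}) ?T ?T id (\<lambda>_. a)"
      by (rule homotopic_with_straight) (use a A(1) in \<open>simp_all add: closed_segment_subset\<close>)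
    moreover have "singular_relcycle p ?T {} c"
      using that by (simp add: singular_cycle)
    ultimately have "homologous_rel p ?T {} (chain_map p id c) (chain_map p (\<lambda>_. a) c)"
      by (rule homotopic_imp_homologous_rel_chain_maps)
    then show ?thesis
      using chain_map_ident[OF that(1)] by (simp add: homologous_rel_def singular_boundary)
  qed
  consider "n = 0" | "n = 1" | p where "n = Suc (Suc p)"
    by (metis One_nat_def not0_implies_Suc)
  then show "\<exists>y. keys y \<subseteq> sbas ?T (Suc n) \<and> lin (sbd (Suc n)) y = z"
  proof cases
    case 1
    let ?s = "restrict (\<lambda>_. a) (standard_simplex 0)"
    have "singular_simplex 0 ?T ?s"
      using a by (auto simp: singular_simplex_def continuous_map_in_subtopology)
    moreover have "z = single (\<lambda>x. undefined) (lookup z (\<lambda>x. undefined))"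
      using z 1 by (intro poly_mapping_eqI) (auto simp: lookup_single when_def in_keys_iff subset_iff)
    ultimately show ?thesis
      using 1 by (intro exI[of _ "single ?s (lookup z (\<lambda>x. undefined))"]) auto
  next
    case 2
    let ?s = "restrict (\<lambda>_. a) (standard_simplex 0)"
    have ch: "singular_chain 0 ?T z"
      using z 2 by (simp add: singular_chain_def)
    \<comment> \<open>The augmentation of \<open>z\<close> is the sum of its coefficients, which is
      also the only coefficient of its image under the constant map.\<close>
    have aug: "lin (\<lambda>_. frag_of (\<lambda>x. undefined)) z = (0 :: 'a chain)"
      using bz 2 lin_cong[of z "sbd (Suc 0)" "\<lambda>_. frag_of (\<lambda>x. undefined)"] by simp
    have "chain_map 0 (\<lambda>_. a) z = lin (\<lambda>_. frag_of ?s) z"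
      unfolding chain_map_def frag_extend_eq_lin by (rule lin_cong) (simp add: simplex_map_def restrict_def)
    also have "\<dots> = lin (\<lambda>_. frag_of ?s) (lin (\<lambda>_. frag_of (\<lambda>x. undefined)) z :: 'a chain)"
      unfolding lin_lin by simp
    finally have "chain_map 0 (\<lambda>_. a) z = 0"
      by (simp add: aug)
    then show ?thesis
      using boundary[OF ch] by (auto simp: 2 lin_sbd singular_chain_def chain_boundary_def)
  next
    case 3
    have ch: "singular_chain (Suc p) ?T z"
      using z 3 by (simp add: singular_chain_def)
    have cyc: "chain_boundary (Suc p) z = 0"
      using bz 3 by (simp add: lin_sbd)
    have "singular_relcycle (Suc p) (top_of_set {a}) {} (chain_map (Suc p) (\<lambda>_. a) z)"
      using ch cyc cont(1) by (intro singular_relcycle_chain_map[of _ ?T]) (auto simp: singular_cycle)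
    then have "singular_relboundary (Suc p) (top_of_set {a}) {} (chain_map (Suc p) (\<lambda>_. a) z)"
      by (subst singular_boundary_eq_cycle_singleton[of _ a]) auto
    then obtain d where d: "singular_chain (Suc (Suc p)) (top_of_set {a}) d"
      "chain_boundary (Suc (Suc p)) d = chain_map (Suc p) (\<lambda>_. a) z"
      by (auto simp: singular_boundary)
    have d': "singular_chain (Suc (Suc p)) ?T d"
      using singular_chain_mono[of _ euclidean "{a}" d A] d(1) a by simp
    obtain y where y: "singular_chain (Suc (Suc p)) ?T y"
      "chain_boundary (Suc (Suc p)) y = z - chain_map (Suc p) (\<lambda>_. a) z"
      using boundary[OF ch cyc] by auto
    have "chain_boundary (Suc (Suc p)) (y + d) = z"
      by (simp add: chain_boundary_add y d)
    moreover have "singular_chain (Suc (Suc p)) ?T (y + d)"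
      using y d' by (intro singular_chain_add)
    ultimately show ?thesis
      by (intro exI[of _ "y + d"]) (simp add: 3 lin_sbd singular_chain_def)
  qed
qed

text \<open>The map \<open>r\<close> may move points of \<open>S\<close>, but the segments from them
  stay in \<open>S\<close>. So the homotopy is one of pairs, and a relative cycle is homologous
  modulo \<open>S\<close> to its image under \<open>r\<close>, a chain of \<open>S\<close>.\<close>

lemma crank_deformation_retract:
  fixes r :: "'a::real_normed_vector \<Rightarrow> 'a"
  assumes SY: "S \<subseteq> Y" and r: "continuous_on Y r" "r ` Y \<subseteq> S"
    and Y: "\<And>y. y \<in> Y \<Longrightarrow> closed_segment y (r y) \<subseteq> Y"
    and S: "\<And>x. x \<in> S \<Longrightarrow> closed_segment x (r x) \<subseteq> S"
  shows "crank (sbas (top_of_set S)) sbd n = crank (sbas (top_of_set Y)) sbd n"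
proof (rule crank_subcomplex)
  fix n and c :: "'a chain"
  assume c: "keys c \<subseteq> sbas (top_of_set Y) (Suc n)"
    and bc: "keys (lin (sbd (Suc n)) c) \<subseteq> sbas (top_of_set S) n"
  have ch: "singular_chain n (top_of_set Y) c"
    using c by (simp add: singular_chain_def)
  have S': "subtopology (top_of_set Y) S = top_of_set S"
    using SY by (simp add: subtopology_subtopology inf_absorb2)
  have "singular_chain (n - 1) (top_of_set S) (chain_boundary n c)"
    using bc by (cases n) (auto simp: lin_sbd singular_chain_def chain_boundary_def)
  then have "singular_relcycle n (top_of_set Y) S c"
    using ch by (simp add: singular_relcycle S')
  with homotopic_with_straight[OF r(1) Y S]
  have "homologous_rel n (top_of_set Y) S (chain_map n id c) (chain_map n r c)"
    by (rule homotopic_imp_homologous_rel_chain_maps)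
  then obtain d e where d: "singular_chain (Suc n) (top_of_set Y) d"
    and e: "singular_chain n (top_of_set S) e"
    and eq: "chain_boundary (Suc n) d + e = c - chain_map n r c"
    using chain_map_ident[OF ch] by (auto simp: homologous_rel_def singular_relboundary S')
  have "singular_chain n (top_of_set S) (chain_map n r c)"
    using r by (intro singular_chain_chain_map[OF ch]) (auto simp: image_subset_iff_funcset)
  then have "singular_chain n (top_of_set S) (e + chain_map n r c)"
    using e by (intro singular_chain_add)
  moreover have "e + chain_map n r c = c - lin (sbd (Suc (Suc n))) d"
    using eq by (simp add: lin_sbd algebra_simps)
  ultimately show "\<exists>d. keys d \<subseteq> sbas (top_of_set Y) (Suc (Suc n)) \<and>
      keys (c - lin (sbd (Suc (Suc n))) d) \<subseteq> sbas (top_of_set S) (Suc n)"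
    using d by (intro exI[of _ d]) (simp add: singular_chain_def)
qed (fact sbas_mono[OF SY] | erule keys_sbd | erule sbd_sbd | simp)+

section \<open>Small simplices\<close>

fun smallbas :: "('i \<Rightarrow> 'a set) \<Rightarrow> 'i set \<Rightarrow> nat \<Rightarrow> 'a::topological_space sing set" where
  "smallbas U I 0 = {\<lambda>x. undefined}"
| "smallbas U I (Suc n) = (\<Union>i\<in>I. sbas (top_of_set (U i)) (Suc n))"

lemma smallbas_subset: "smallbas U I n \<subseteq> sbas (top_of_set (\<Union>i\<in>I. U i)) n"
proof (cases n)
  case (Suc m)
  have "sbas (top_of_set (U i)) (Suc m) \<subseteq> sbas (top_of_set (\<Union>i\<in>I. U i)) (Suc m)" if "i \<in> I" for i
    using that by (intro sbas_mono) auto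
  then show ?thesis
    unfolding Suc smallbas.simps by blast
qed simp

lemma keys_sbd_smallbas:
  assumes "s \<in> smallbas U I (Suc n)"
  shows "keys (sbd (Suc n) s) \<subseteq> smallbas U I n"
proof (cases n)
  case (Suc m)
  obtain i where "i \<in> I" "s \<in> sbas (top_of_set (U i)) (Suc n)"
    using assms by auto
  then show ?thesis
    using keys_sbd[of s "top_of_set (U i)" n] by (auto simp: Suc simp del: sbd.simps)
qed simp

text \<open>An iterated subdivision of a chain is small, and the homotopy from it to the identity
  keeps small chains small. Hence a chain with small boundary differs from a small one by a
  boundary.\<close>

lemma crank_small_simplices:
  fixes U :: "'i \<Rightarrow> 'a::topological_space set"
  assumes U: "\<And>i. i \<in> I \<Longrightarrow> open (U i)"
  shows "crank (smallbas U I) sbd n = crank (sbas (top_of_set (\<Union>i\<in>I. U i))) sbd n"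
proof (rule crank_subcomplex)
  let ?Y = "top_of_set (\<Union>i\<in>I. U i)"
  fix n and c :: "'a chain"
  assume c: "keys c \<subseteq> sbas ?Y (Suc n)"
    and bc: "keys (lin (sbd (Suc n)) c) \<subseteq> smallbas U I n"
  have ch: "singular_chain n ?Y c"
    using c by (simp add: singular_chain_def)
  obtain N where N: "\<And>m f. \<lbrakk>N \<le> m; f \<in> keys ((singular_subdivision n ^^ m) c)\<rbrakk>
      \<Longrightarrow> \<exists>V\<in>U ` I. f \<in> standard_simplex n \<rightarrow> V"
  proof (rule sufficient_iterated_singular_subdivision_exists[of "U ` I" ?Y n c])
    show "openin ?Y V" if "V \<in> U ` I" for V
      using that U by (auto intro!: open_subset)
  qed (use ch in auto)
  \<comment> \<open>The homotopy is one family for all spaces: applied inside a single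
    \<open>U i\<close> it does not leave it.\<close>
  obtain h where h: "\<And>p. h p 0 = (0 :: 'a chain)"
    "\<And>p c1 c2. h p (c1-c2) = h p c1 - h p c2"
    "\<And>p S c. singular_chain p S c \<Longrightarrow> singular_chain (Suc p) S (h p c)"
    "\<And>p S c. singular_chain p S c
      \<Longrightarrow> chain_boundary (Suc p) (h p c) + h (p - Suc 0) (chain_boundary p c)
        = (singular_subdivision p ^^ N) c - c"
    by (blast intro: chain_homotopic_iterated_singular_subdivision[where n = N])
  have sub_chain: "singular_chain n ?Y ((singular_subdivision n ^^ m) c)" for m
    by (induction m) (auto simp: ch singular_chain_singular_subdivision)
  have sub_small: "keys ((singular_subdivision n ^^ N) c) \<subseteq> smallbas U I (Suc n)"
  proof
    fix f assume f: "f \<in> keys ((singular_subdivision n ^^ N) c)"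
    then obtain i where i: "i \<in> I" "f \<in> standard_simplex n \<rightarrow> U i"
      using N[OF order_refl f] by auto
    have "singular_simplex n ?Y f"
      using sub_chain[of N] f by (auto simp: singular_chain_def)
    then have "f \<in> sbas (top_of_set (U i)) (Suc n)"
      using i by (subst sbas_subset_iff[of "U i" "\<Union>i\<in>I. U i"]) auto
    then show "f \<in> smallbas U I (Suc n)"
      using i by auto
  qed
  have h_small: "keys (h p d) \<subseteq> smallbas U I (Suc (Suc p))"
    if "keys d \<subseteq> smallbas U I (Suc p)" for p d
    using that
  proof (induction d rule: frag_induction)
    case (one s)
    then obtain i where i: "i \<in> I" "singular_simplex p (top_of_set (U i)) s"
      by auto
    then have "singular_chain (Suc p) (top_of_set (U i)) (h p (frag_of s))"
      by (intro h(3)) (simp add: singular_chain_of)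
    then show ?case
      using i by (auto simp: singular_chain_def)
  next
    case (diff a b)
    then show ?case
      by (simp only: h(2) keys_diff_subset)
  qed (simp add: h(1))
  have hbc: "keys (h (n - Suc 0) (chain_boundary n c)) \<subseteq> smallbas U I (Suc n)"
  proof (cases n)
    case 0
    then show ?thesis
      by (simp add: chain_boundary_def h(1))
  next
    case (Suc m)
    then show ?thesis
      using h_small[of "chain_boundary n c" m] bc by (simp add: lin_sbd)
  qed
  \<comment> \<open>The homotopy formula rearranged, which explains the sign of
    \<open>h n c\<close>; both terms on the right are small.\<close>
  have "c - lin (sbd (Suc (Suc n))) (- h n c)
      = (singular_subdivision n ^^ N) c - h (n - Suc 0) (chain_boundary n c)"
    using h(4)[OF ch] by (simp add: lin_sbd chain_boundary_minus algebra_simps)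
  then have "keys (c - lin (sbd (Suc (Suc n))) (- h n c)) \<subseteq> smallbas U I (Suc n)"
    using sub_small hbc by (simp only: keys_diff_subset)
  moreover have "keys (- h n c) \<subseteq> sbas ?Y (Suc (Suc n))"
    using h(3)[OF ch] by (simp add: singular_chain_def)
  ultimately show "\<exists>e. keys e \<subseteq> sbas ?Y (Suc (Suc n)) \<and>
      keys (c - lin (sbd (Suc (Suc n))) e) \<subseteq> smallbas U I (Suc n)"
    by blast
qed (rule smallbas_subset | erule keys_sbd_smallbas | erule keys_sbd | erule sbd_sbd | simp)+

section \<open>Simplicial complexes and the nerve theorem\<close>

lemma lin_fun_smul: "lin (\<lambda>b. smul r (f b)) c = smul r (lin f c)"
  by (intro poly_mapping_eqI) (simp add: lookup_lin sum_distrib_left mult.left_commute)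

lemma smul_sum: "smul r (sum f A) = (\<Sum>a\<in>A. smul r (f a))"
  by (intro poly_mapping_eqI) (simp add: lookup_sum sum_distrib_left)

text \<open>\<open>\<gamma>\<close> is a contracting homotopy, usually the cone over a vertex. As
  the boundary vanishes in position 0, the cone identity makes every chain there a boundary.\<close>

lemma acyclic_carrier_cone:
  fixes \<gamma> :: "'d \<Rightarrow> 'd \<Rightarrow>\<^sub>0 int"
  assumes bd0: "\<And>b. b \<in> A 0 \<Longrightarrow> bd 0 b = 0"
    and keys: "\<And>n b. b \<in> A n \<Longrightarrow> keys (\<gamma> b) \<subseteq> A (Suc n)"
    and cone: "\<And>n b. b \<in> A n \<Longrightarrow> lin (bd (Suc n)) (\<gamma> b) + lin \<gamma> (bd n b) = bas b"
  shows "acyclic_carrier bd A"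
  unfolding acyclic_carrier_def
proof (intro allI impI)
  fix n z assume z: "keys z \<subseteq> A n" and bz: "0 < n \<longrightarrow> lin (bd n) z = 0"
  have bz': "lin (bd n) z = 0"
  proof (cases n)
    case 0
    have "lin (bd n) z = lin (\<lambda>_. 0) z"
      using z bd0 by (intro lin_cong) (auto simp: 0)
    then show ?thesis
      by simp
  qed (use bz in simp)
  have "lin (bd (Suc n)) (lin \<gamma> z) + lin \<gamma> (lin (bd n) z)
      = lin (\<lambda>b. lin (bd (Suc n)) (\<gamma> b) + lin \<gamma> (bd n b)) z"
    by (simp add: lin_lin lin_fun_add)
  also have "\<dots> = lin bas z"
    using z cone by (intro lin_cong) auto
  finally have "lin (bd (Suc n)) (lin \<gamma> z) = z"
    by (simp add: bz')
  moreover have "keys (lin \<gamma> z) \<subseteq> A (Suc n)"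
    using z keys by (intro keys_lin_subset) auto
  ultimately show "\<exists>y. keys y \<subseteq> A (Suc n) \<and> lin (bd (Suc n)) y = z"
    by blast
qed


subsection \<open>Chains of a partially ordered set\<close>

text \<open>The alternating sum of the lists with one entry deleted: the head is deleted with sign
  plus, and each deletion in the tail is one position later, hence the minus.\<close>

primrec lbd :: "'v list \<Rightarrow> 'v list \<Rightarrow>\<^sub>0 int" where
  "lbd [] = 0"
| "lbd (x # xs) = bas xs - lin (\<lambda>ys. bas (x # ys)) (lbd xs)"

text \<open>The inclusions need not be strict, so a list may repeat a set. Admitting these
  degenerate simplices allows a cone to be formed without asking whether its apex already
  occurs.\<close>

definition chainbas :: "'a set set \<Rightarrow> nat \<Rightarrow> 'a set list set" where
  "chainbas V n = {xs. length xs = n \<and> set xs \<subseteq> V \<and> sorted_wrt (\<subseteq>) xs}"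

lemma keys_lbd:
  "ys \<in> keys (lbd xs) \<Longrightarrow>
    length xs = Suc (length ys) \<and> set ys \<subseteq> set xs \<and> (sorted_wrt P xs \<longrightarrow> sorted_wrt P ys)"
proof (induction xs arbitrary: ys)
  case (Cons x xs)
  have "keys (lbd (x # xs)) \<subseteq> {xs} \<union> (#) x ` keys (lbd xs)"
    unfolding lbd.simps
    by (intro keys_diff_subset keys_lin_subset) (auto simp: le_supI1)
  then consider "ys = xs" | zs where "ys = x # zs" "zs \<in> keys (lbd xs)"
    using Cons.prems by auto
  then show ?case
    using Cons.IH by cases auto
qed simp

lemma keys_lbd_chainbas: "xs \<in> chainbas V (Suc n) \<Longrightarrow> keys (lbd xs) \<subseteq> chainbas V n"
  unfolding chainbas_def using keys_lbd[where P = "(\<subseteq>)"] by fastforce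

lemma lin_lbd_Cons: "lin lbd (lin (\<lambda>ys. bas (x # ys)) c) = c - lin (\<lambda>ys. bas (x # ys)) (lin lbd c)"
  by (simp add: lin_lin lin_fun_diff)

lemma lbd_lbd: "lin lbd (lbd xs) = 0"
  by (induction xs) (simp_all add: lin_diff lin_lbd_Cons)

lemma lbd_append: "lbd (xs @ [b]) = lin (\<lambda>ys. bas (ys @ [b])) (lbd xs) + single xs ((- 1) ^ length xs)"
proof (induction xs)
  case (Cons x xs)
  have "lbd ((x # xs) @ [b]) = bas (xs @ [b]) - lin (\<lambda>ys. bas (x # ys))
      (lin (\<lambda>ys. bas (ys @ [b])) (lbd xs) + single xs ((- 1) ^ length xs))"
    using Cons by simp
  also have "\<dots> = lin (\<lambda>ys. bas (ys @ [b])) (lbd (x # xs)) + single (x # xs) ((- 1) ^ length (x # xs))"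
    by (simp add: lin_add lin_diff lin_lin single_uminus)
  finally show ?case .
qed (simp add: single_one)

lemma acyclic_carrier_chains_above:
  assumes "a \<in> V" "\<And>v. v \<in> V \<Longrightarrow> a \<subseteq> v"
  shows "acyclic_carrier (\<lambda>n. lbd) (chainbas V)"
proof (rule acyclic_carrier_cone[where \<gamma> = "\<lambda>xs. bas (a # xs)"])
  show "keys (bas (a # b) :: _ \<Rightarrow>\<^sub>0 int) \<subseteq> chainbas V (Suc n)" if "b \<in> chainbas V n" for n b
    using that assms by (auto simp: chainbas_def)
qed (auto simp: chainbas_def)

text \<open>Over a greatest element the cone is taken at the end of the list; its sign is the one
  with which \<open>lbd\<close> deletes a last entry.\<close>

lemma acyclic_carrier_chains_below:
  assumes "a \<in> V" "\<And>v. v \<in> V \<Longrightarrow> v \<subseteq> a"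
  shows "acyclic_carrier (\<lambda>n. lbd) (chainbas V)"
proof (rule acyclic_carrier_cone[where \<gamma> = "\<lambda>xs. single (xs @ [a]) ((- 1) ^ length xs)"])
  fix n b assume b: "b \<in> chainbas V n"
  show "keys (single (b @ [a]) ((- 1) ^ length b) :: _ \<Rightarrow>\<^sub>0 int) \<subseteq> chainbas V (Suc n)"
    using b assms by (auto simp: chainbas_def sorted_wrt_append)
  have "lin (\<lambda>xs. single (xs @ [a]) ((- 1) ^ length xs)) (lbd b)
      = lin (\<lambda>xs. smul (- ((- 1) ^ length b)) (bas (xs @ [a]))) (lbd b)"
    using keys_lbd[of _ b] by (intro lin_cong) auto
  also have "\<dots> = smul (- ((- 1) ^ length b)) (lin (\<lambda>xs. bas (xs @ [a])) (lbd b))"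
    by (rule lin_fun_smul)
  finally have "lin (\<lambda>xs. single (xs @ [a]) ((- 1) ^ length xs)) (lbd b)
      = smul (- ((- 1) ^ length b)) (lin (\<lambda>xs. bas (xs @ [a])) (lbd b))" .
  then show "lin lbd (single (b @ [a]) ((- 1) ^ length b))
      + lin (\<lambda>xs. single (xs @ [a]) ((- 1) ^ length xs)) (lbd b) = bas b"
    by (simp add: lbd_append smul_add)
      (intro poly_mapping_eqI, simp add: lookup_add lookup_single power_mult_distrib[symmetric])
qed (auto simp: chainbas_def)


subsection \<open>Oriented simplices\<close>

text \<open>The same sign enters the simplicial boundary and the Koszul differential, so that the
  two can be matched in a squarefree multidegree.\<close>

definition ssgn :: "'i::linorder \<Rightarrow> 'i set \<Rightarrow> 'r::comm_ring_1" where
  "ssgn k I = (- 1) ^ card {i\<in>I. i < k}"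

definition setbd :: "'i::linorder set \<Rightarrow> 'i set \<Rightarrow>\<^sub>0 'r::comm_ring_1" where
  "setbd I = (\<Sum>k\<in>I. single (I - {k}) (ssgn k I))"

definition setbas :: "'i set set \<Rightarrow> nat \<Rightarrow> 'i set set" where
  "setbas K n = {I\<in>K. finite I \<and> card I = n}"

lemma ssgn_square [simp]: "ssgn k I * ssgn k I = 1"
  by (simp add: ssgn_def flip: power_add mult_2)

lemma ssgn_remove_greater: "k < l \<Longrightarrow> ssgn k (I - {l}) = ssgn k I"
  unfolding ssgn_def by (rule arg_cong[of _ _ "\<lambda>A. (- 1) ^ card A"]) auto

lemma ssgn_remove_less:
  assumes "finite I" "k \<in> I" "k < l"
  shows "ssgn l (I - {k}) = - ssgn l I"
proof -
  have "{i\<in>I. i < l} = insert k {i\<in>I - {k}. i < l}"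
    using assms by auto
  then have "card {i\<in>I. i < l} = Suc (card {i\<in>I - {k}. i < l})"
    using assms(1) by simp
  then show ?thesis
    by (simp add: ssgn_def)
qed

text \<open>Removing the smaller of two elements shifts the position of the larger by one, while
  removing the larger leaves the smaller in place.\<close>

lemma ssgn_swap:
  assumes "finite I" "k \<in> I" "l \<in> I" "k \<noteq> l"
  shows "ssgn k I * ssgn l (I - {k}) = - (ssgn l I * ssgn k (I - {l}) :: 'r::comm_ring_1)"
proof (cases "k < l")
  case True
  then have "ssgn k (I - {l}) = (ssgn k I :: 'r)" "ssgn l (I - {k}) = (- ssgn l I :: 'r)"
    using assms by (auto intro: ssgn_remove_greater ssgn_remove_less)
  then show ?thesis
    by simp
next
  case False
  then have "l < k"
    using assms(4) by simp
  then have "ssgn l (I - {k}) = (ssgn l I :: 'r)" "ssgn k (I - {l}) = (- ssgn k I :: 'r)"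
    using assms by (auto intro: ssgn_remove_greater ssgn_remove_less)
  then show ?thesis
    by simp
qed

text \<open>The pairs are split by their order. Adding the sum to its transpose would only show that
  twice the sum vanishes, and the target is an arbitrary abelian group.\<close>

lemma sum_pairs_antisym:
  fixes g :: "'i::linorder \<Rightarrow> 'i \<Rightarrow> 'a::ab_group_add"
  assumes "finite I" "\<And>k l. k \<in> I \<Longrightarrow> l \<in> I \<Longrightarrow> k \<noteq> l \<Longrightarrow> g k l = - g l k"
  shows "(\<Sum>k\<in>I. \<Sum>l\<in>I - {k}. g k l) = 0"
proof -
  have "(\<Sum>k\<in>I. \<Sum>l\<in>I - {k}. g k l) = (\<Sum>k\<in>I. (\<Sum>l\<in>{l\<in>I. l < k}. g k l) + (\<Sum>l\<in>{l\<in>I. k < l}. g k l))"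
  proof (rule sum.cong)
    fix k
    have eq: "I - {k} = {l\<in>I. l < k} \<union> {l\<in>I. k < l}"
      by auto
    show "(\<Sum>l\<in>I - {k}. g k l) = (\<Sum>l\<in>{l\<in>I. l < k}. g k l) + (\<Sum>l\<in>{l\<in>I. k < l}. g k l)"
    proof -
      have disj: "{l\<in>I. l < k} \<inter> {l\<in>I. k < l} = {}"
        by (auto dest: less_asym)
      have fin: "finite {l\<in>I. l < k}" "finite {l\<in>I. k < l}"
        using assms(1) by auto
      show ?thesis
        unfolding eq by (rule sum.union_disjoint[OF fin disj])
    qed
  qed simp
  also have "\<dots> = (\<Sum>k\<in>I. \<Sum>l\<in>{l\<in>I. l < k}. g k l) + (\<Sum>k\<in>I. \<Sum>l\<in>{l\<in>I. k < l}. g k l)"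
    by (rule sum.distrib)
  also have "(\<Sum>k\<in>I. \<Sum>l\<in>{l\<in>I. k < l}. g k l) = (\<Sum>l\<in>I. \<Sum>k\<in>{k\<in>I. k < l}. g k l)"
    using assms(1) by (rule sum.swap_restrict[OF _ assms(1)])
  also have "\<dots> = - (\<Sum>l\<in>I. \<Sum>k\<in>{k\<in>I. k < l}. g l k)"
    unfolding sum_negf[symmetric] using assms(2) by (intro sum.cong) auto
  finally show ?thesis
    by simp
qed

lemma keys_sum_subset:
  "(\<And>i. i \<in> I \<Longrightarrow> keys (f i) \<subseteq> A) \<Longrightarrow> keys (sum f I :: 'b \<Rightarrow>\<^sub>0 'r::comm_ring_1) \<subseteq> A"
proof (induction I rule: infinite_finite_induct)
  case (insert x F)
  then show ?case
    using Poly_Mapping.keys_add[of "f x" "sum f F"] by auto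
qed auto

lemma setbd_setbd:
  assumes "finite I"
  shows "lin setbd (setbd I) = (0 :: 'i::linorder set \<Rightarrow>\<^sub>0 'r::comm_ring_1)"
proof -
  let ?g = "\<lambda>k l. single (I - {k} - {l}) (ssgn k I * ssgn l (I - {k}) :: 'r)"
  have "lin setbd (setbd I) = (\<Sum>k\<in>I. smul (ssgn k I :: 'r) (setbd (I - {k})))"
    by (simp add: setbd_def[of I] lin_sum)
  also have "\<dots> = (\<Sum>k\<in>I. \<Sum>l\<in>I - {k}. ?g k l)"
    by (simp add: setbd_def smul_sum)
  also have "\<dots> = 0"
  proof (rule sum_pairs_antisym[OF assms])
    fix k l assume kl: "k \<in> I" "l \<in> I" "k \<noteq> l"
    have "I - {k} - {l} = I - {l} - {k}"
      by auto
    then show "?g k l = - ?g l k"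
      using ssgn_swap[OF assms kl, where ?'r = 'r] by (simp flip: single_uminus)
  qed
  finally show ?thesis .
qed

lemma setbd_insert_less:
  assumes "finite I" "a \<notin> I" "\<And>i. i \<in> I \<Longrightarrow> a < i"
  shows "setbd (insert a I) = bas I - (\<Sum>k\<in>I. single (insert a (I - {k})) (ssgn k I :: 'r::comm_ring_1))"
proof -
  have "setbd (insert a I) = single (insert a I - {a}) (ssgn a (insert a I) :: 'r)
      + (\<Sum>k\<in>I. single (insert a I - {k}) (ssgn k (insert a I)))"
    unfolding setbd_def using assms by simp
  also have "insert a I - {a} = I"
    using assms by auto
  also have "ssgn a (insert a I) = (1 :: 'r)"
  proof -
    have "{i \<in> insert a I. i < a} = {}"
      using assms(3) by (auto dest: less_asym)
    then show ?thesis
      by (simp only: ssgn_def card.empty power_0)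
  qed
  also have "(\<Sum>k\<in>I. single (insert a I - {k}) (ssgn k (insert a I) :: 'r))
      = (\<Sum>k\<in>I. - single (insert a (I - {k})) (ssgn k I))"
  proof (rule sum.cong)
    fix k assume k: "k \<in> I"
    have "ssgn k (insert a I - {a}) = (- ssgn k (insert a I) :: 'r)"
      using assms k by (intro ssgn_remove_less) auto
    moreover have "insert a I - {a} = I"
      using assms by auto
    ultimately have "ssgn k (insert a I) = (- ssgn k I :: 'r)"
      by simp
    moreover have "insert a I - {k} = insert a (I - {k})"
      using assms k by auto
    ultimately show "single (insert a I - {k}) (ssgn k (insert a I) :: 'r)
        = - single (insert a (I - {k})) (ssgn k I)"
      by (simp add: single_uminus)
  qed simp
  finally show ?thesis
    by (simp add: sum_negf)
qed

lemma keys_setbd: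
  assumes "I \<in> setbas K (Suc n)" "\<And>J. J \<subseteq> I \<Longrightarrow> J \<in> K"
  shows "keys (setbd I :: 'i::linorder set \<Rightarrow>\<^sub>0 'r::comm_ring_1) \<subseteq> setbas K n"
  unfolding setbd_def using assms
  by (intro keys_sum_subset) (auto simp: setbas_def card_Diff_singleton)

lemma acyclic_carrier_full_simplex:
  fixes I :: "'i::linorder set"
  assumes "finite I" "I \<noteq> {}"
  shows "acyclic_carrier (\<lambda>n. setbd) (setbas (Pow I))"
proof (rule acyclic_carrier_cone[where \<gamma> = "\<lambda>J. if Min I \<in> J then 0 else bas (insert (Min I) J)"])
  let ?a = "Min I"
  have a: "?a \<in> I" "\<And>i. i \<in> I \<Longrightarrow> ?a \<le> i"
    using assms by auto
  fix n J assume J: "J \<in> setbas (Pow I) n"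
  then have fin: "finite J" and sub: "J \<subseteq> I"
    by (auto simp: setbas_def)
  show "keys (if ?a \<in> J then 0 else bas (insert ?a J) :: _ \<Rightarrow>\<^sub>0 int) \<subseteq> setbas (Pow I) (Suc n)"
    using J a by (auto simp: setbas_def)
  let ?cone = "\<lambda>J. if ?a \<in> J then 0 else bas (insert ?a J) :: _ \<Rightarrow>\<^sub>0 int"
  have lin_cone: "lin ?cone (setbd J) = (\<Sum>k\<in>J. smul (ssgn k J :: int) (?cone (J - {k})))" for J :: "'i set"
    by (simp add: setbd_def lin_sum)
  show "lin setbd (?cone J) + lin ?cone (setbd J) = bas J"
  proof (cases "?a \<in> J")
    case False
    then have less: "?a < i" if "i \<in> J" for i
      using a(2)[of i] that sub by (cases "i = ?a") auto
    have "lin ?cone (setbd J) = (\<Sum>k\<in>J. single (insert ?a (J - {k})) (ssgn k J :: int))"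
      unfolding lin_cone using False by (intro sum.cong) auto
    then show ?thesis
      using False setbd_insert_less[OF fin False less, where ?'r = int] by simp
  next
    case True
    have "{i\<in>J. i < ?a} = {}"
      using a(2) sub by (auto simp: not_less[symmetric])
    then have sgn: "ssgn ?a J = (1 :: int)"
      by (simp only: ssgn_def card.empty power_0)
    have "lin ?cone (setbd J) = (\<Sum>k\<in>{?a}. smul (ssgn k J) (?cone (J - {k})))"
      unfolding lin_cone using True fin by (intro sum.mono_neutral_right) auto
    also have "\<dots> = bas J"
      using True sgn by (simp add: insert_absorb)
    finally show ?thesis
      using True by simp
  qed
qed (auto simp: setbas_def setbd_def)


subsection \<open>Barycentric subdivision\<close>

lemma sorted_chain_hd: "xs \<in> chainbas V n \<Longrightarrow> v \<in> set xs \<Longrightarrow> hd xs \<subseteq> v"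
  by (cases xs) (auto simp: chainbas_def)

lemma sorted_chain_last: "xs \<in> chainbas V n \<Longrightarrow> v \<in> set xs \<Longrightarrow> v \<subseteq> last xs"
  by (cases xs rule: rev_cases) (auto simp: chainbas_def sorted_wrt_append)

lemma chainbas_hd_last_in:
  "xs \<in> chainbas V (Suc n) \<Longrightarrow> hd xs \<in> V" "xs \<in> chainbas V (Suc n) \<Longrightarrow> last xs \<in> V"
  by (cases xs; force simp: chainbas_def)+

lemma chainbas_mono: "V \<subseteq> W \<Longrightarrow> chainbas V n \<subseteq> chainbas W n"
  by (auto simp: chainbas_def)

lemma chainbas_face_hd_last:
  assumes "xs \<in> chainbas V (Suc (Suc n))" "ys \<in> keys (lbd xs)"
  shows "hd xs \<subseteq> hd ys" "last ys \<subseteq> last xs"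
proof -
  have "set ys \<subseteq> set xs" "length ys = Suc n"
    using keys_lbd[OF assms(2)] assms(1) by (auto simp: chainbas_def)
  then have "hd ys \<in> set xs" "last ys \<in> set xs"
    by (cases ys; force)+
  then show "hd xs \<subseteq> hd ys" "last ys \<subseteq> last xs"
    using sorted_chain_hd[OF assms(1)] sorted_chain_last[OF assms(1)] by auto
qed

text \<open>A flag is carried by the faces of its largest member, a simplex by the flags of its
  nonempty faces. A face of a flag has a smaller or equal largest member, so the carriers are
  monotone, and each composite stays inside one simplex or its flags, which gives
  \<open>?\<Theta>\<close> and \<open>?\<Theta>'\<close>.\<close>

lemma crank_barycentric_subdivision:
  fixes K :: "'i::linorder set set"
  assumes K: "\<And>I J. I \<in> K \<Longrightarrow> J \<subseteq> I \<Longrightarrow> J \<in> K" and fin: "\<And>I. I \<in> K \<Longrightarrow> finite I" and empty: "{} \<in> K"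
  shows "crank (chainbas (K - {{}})) (\<lambda>n. lbd) n = crank (setbas K) (\<lambda>n. setbd) n"
proof -
  let ?V = "K - {{}}"
  let ?\<Phi> = "\<lambda>n xs. setbas (Pow (last xs))"
  let ?\<Psi> = "\<lambda>n I. chainbas (Pow I - {{}})"
  let ?\<Theta> = "\<lambda>n xs. chainbas (Pow (last xs) - {{}})"
  let ?\<Theta>' = "\<lambda>n I. setbas (Pow I)"
  have C0: "chainbas ?V 0 = {[]}" and D0: "setbas K 0 = {{}}"
    using empty by (auto simp: chainbas_def setbas_def)
  have last_K: "last xs \<in> K" "last xs \<noteq> {}" "finite (last xs)" if "xs \<in> chainbas ?V (Suc n)" for xs n
    using chainbas_hd_last_in(2)[OF that] fin by auto
  have K_simps: "I \<in> K" "I \<noteq> {}" "finite I" if "I \<in> setbas K (Suc n)" for I n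
    using that by (auto simp: setbas_def)
  have keysC: "keys (lbd b) \<subseteq> chainbas ?V n" if "b \<in> chainbas ?V (Suc n)" for n b
    by (rule keys_lbd_chainbas[OF that])
  have keysD: "keys (setbd b :: _ \<Rightarrow>\<^sub>0 int) \<subseteq> setbas K n" if "b \<in> setbas K (Suc n)" for n b
    by (rule keys_setbd[OF that]) (use K K_simps(1)[OF that] in auto)
  have ddD: "lin setbd (setbd b) = (0 :: _ \<Rightarrow>\<^sub>0 int)" if "b \<in> setbas K (Suc (Suc n))" for n b
    by (rule setbd_setbd[OF K_simps(3)[OF that]])
  have \<Phi>1: "?\<Phi> n b k \<subseteq> setbas K k" if "b \<in> chainbas ?V (Suc n)" for n b k
    using last_K[OF that] K by (auto simp: setbas_def)
  have \<Phi>4: "?\<Phi> n b' k \<subseteq> ?\<Phi> n b k"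
    if "b \<in> chainbas ?V (Suc (Suc n))" "b' \<in> keys (lbd b)" for n b b' k
    using chainbas_face_hd_last(2)[OF that] by (auto simp: setbas_def)
  have \<Psi>1: "?\<Psi> n b k \<subseteq> chainbas ?V k" if "b \<in> setbas K (Suc n)" for n b k
    using K_simps[OF that] K by (intro chainbas_mono) auto
  have \<Psi>3: "acyclic_carrier (\<lambda>n. lbd) (chainbas (Pow I - {{}}))" if "I \<noteq> {}" for I :: "'i set"
    by (rule acyclic_carrier_chains_below[of I]) (use that in auto)
  have setface: "b' \<subseteq> b" if "b' \<in> keys (setbd b :: _ \<Rightarrow>\<^sub>0 int)" for b b' :: "'i set"
  proof -
    have "keys (setbd b :: _ \<Rightarrow>\<^sub>0 int) \<subseteq> Pow b"
      unfolding setbd_def by (rule keys_sum_subset) auto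
    then show ?thesis
      using that by blast
  qed
  have \<Psi>4: "?\<Psi> n b' k \<subseteq> ?\<Psi> n b k" if "b' \<in> keys (setbd b :: _ \<Rightarrow>\<^sub>0 int)" for n :: nat and b b' :: "'i set" and k
    using setface[OF that] by (intro chainbas_mono) auto
  have \<Theta>4: "?\<Theta> n b' k \<subseteq> ?\<Theta> n b k"
    if "b \<in> chainbas ?V (Suc (Suc n))" "b' \<in> keys (lbd b)" for n b b' k
    using chainbas_face_hd_last(2)[OF that] by (intro chainbas_mono) auto
  have \<Theta>2: "b \<in> ?\<Theta> n b (Suc n)" if "b \<in> chainbas ?V (Suc n)" for n b
    using sorted_chain_last[OF that] that by (auto simp: chainbas_def)
  have \<Theta>5: "?\<Psi> n d (Suc n) \<subseteq> ?\<Theta> n b (Suc n)" if "d \<in> ?\<Phi> n b (Suc n)" for n b d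
    using that by (intro chainbas_mono) (auto simp: setbas_def)
  have \<Theta>'5: "?\<Phi> n d (Suc n) \<subseteq> ?\<Theta>' n b (Suc n)" if "d \<in> ?\<Psi> n b (Suc n)" for n b d
    using chainbas_hd_last_in(2)[OF that] by (auto simp: setbas_def)
  have \<Phi>3: "acyclic_carrier (\<lambda>n. setbd) (?\<Phi> n b)" if "b \<in> chainbas ?V (Suc n)" for n b
    using last_K[OF that] by (intro acyclic_carrier_full_simplex)
  have \<Psi>3': "acyclic_carrier (\<lambda>n. lbd) (?\<Psi> n b)" if "b \<in> setbas K (Suc n)" for n b
    using K_simps[OF that] by (intro \<Psi>3)
  have \<Theta>3: "acyclic_carrier (\<lambda>n. lbd) (?\<Theta> n b)" if "b \<in> chainbas ?V (Suc n)" for n b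
    using last_K[OF that] by (intro \<Psi>3)
  have \<Theta>'3: "acyclic_carrier (\<lambda>n. setbd) (?\<Theta>' n b)" if "b \<in> setbas K (Suc n)" for n b
    using K_simps[OF that] by (intro acyclic_carrier_full_simplex)
  have \<Theta>1: "?\<Theta> n b k \<subseteq> chainbas ?V k" if "b \<in> chainbas ?V (Suc n)" for n b k
    using last_K[OF that] K by (intro chainbas_mono) auto
  have \<Theta>'1: "?\<Theta>' n b k \<subseteq> setbas K k" if "b \<in> setbas K (Suc n)" for n b k
    using K_simps(1)[OF that] K by (auto simp: setbas_def)
  have \<Theta>'2: "b \<in> ?\<Theta>' n b (Suc n)" if "b \<in> setbas K (Suc n)" for n b
    using that by (auto simp: setbas_def)
  have \<Theta>'4: "?\<Theta>' n b' k \<subseteq> ?\<Theta>' n b k" if "b' \<in> keys (setbd b :: _ \<Rightarrow>\<^sub>0 int)" for n :: nat and b b' :: "'i set" and k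
    using setface[OF that] by (auto simp: setbas_def)
  have nil: "[] \<in> chainbas W 0" for W :: "'i set set"
    by (simp add: chainbas_def)
  have emp: "{} \<in> setbas (Pow J) 0" for J :: "'i set"
    by (simp add: setbas_def)
  show ?thesis
  proof (rule antisym)
    show "crank (chainbas ?V) (\<lambda>n. lbd) n \<le> crank (setbas K) (\<lambda>n. setbd) n"
      by (rule crank_le_acyclic_carriers[where \<Phi> = ?\<Phi> and \<Psi> = ?\<Psi> and \<Theta> = ?\<Theta>, OF keysC lbd_lbd keysD ddD C0 D0
            \<Phi>1 emp \<Phi>3 \<Phi>4 \<Psi>1 nil \<Psi>3' \<Psi>4 \<Theta>1 \<Theta>2 \<Theta>3 \<Theta>4 \<Theta>5])
    show "crank (setbas K) (\<lambda>n. setbd) n \<le> crank (chainbas ?V) (\<lambda>n. lbd) n"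
      by (rule crank_le_acyclic_carriers[where \<Phi> = ?\<Psi> and \<Psi> = ?\<Phi> and \<Theta> = ?\<Theta>', OF keysD ddD keysC lbd_lbd D0 C0
            \<Psi>1 nil \<Psi>3' \<Psi>4 \<Phi>1 emp \<Phi>3 \<Phi>4 \<Theta>'1 \<Theta>'2 \<Theta>'3 \<Theta>'4 \<Theta>'5])
  qed
qed


subsection \<open>The nerve of a convex open cover\<close>

text \<open>The label of a singular simplex is the set of all cover members containing it. The
  simplex is carried by the flags of sets above its label, a cone with the label as apex, and this
  cone shrinks for a face since its label grows. A flag is carried by the singular simplices in the
  intersection over its smallest member, which is convex and nonempty.\<close>

lemma crank_small_simplices_eq_nerve_chains:
  fixes U :: "'i \<Rightarrow> 'a::real_normed_vector set"
  assumes conv: "\<And>i. i \<in> I \<Longrightarrow> convex (U i)"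
  defines "V \<equiv> {J. J \<subseteq> I \<and> J \<noteq> {} \<and> (\<Inter>i\<in>J. U i) \<noteq> {}}"
  shows "crank (smallbas U I) sbd n = crank (chainbas V) (\<lambda>n. lbd) n"
proof -
  let ?U = "\<lambda>J. top_of_set (\<Inter>i\<in>J. U i)"
  define label where "label n s = {i\<in>I. s \<in> sbas (top_of_set (U i)) n}" for n s
  let ?\<Phi> = "\<lambda>n s. chainbas {J\<in>V. label n s \<subseteq> J}"
  let ?\<Psi> = "\<lambda>n xs. sbas (?U (hd xs))"
  let ?\<Theta> = "\<lambda>n s. sbas (?U (label n s))"
  let ?\<Theta>' = "\<lambda>n xs. chainbas {J\<in>V. hd xs \<subseteq> J}"
  have C0: "smallbas U I 0 = {\<lambda>x. undefined}" and D0: "chainbas V 0 = {[]}"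
    by (auto simp: chainbas_def)
  have sbas_Inter: "s \<in> sbas (?U J) (Suc n) \<longleftrightarrow> (\<forall>i\<in>J. s \<in> sbas (top_of_set (U i)) (Suc n))"
    if "J \<noteq> {}" for J s n
    using that by (auto simp: singular_simplex_subtopology)
  have label_V: "label (Suc n) s \<in> V" if s: "s \<in> smallbas U I (Suc n)" for n s
  proof -
    have ne: "label (Suc n) s \<noteq> {}"
      using s by (auto simp: label_def)
    have "s \<in> sbas (?U (label (Suc n) s)) (Suc n)"
      unfolding sbas_Inter[OF ne] by (simp add: label_def)
    then have "s ` standard_simplex n \<subseteq> (\<Inter>i\<in>label (Suc n) s. U i)"
      by (simp add: singular_simplex_subtopology)
    then have "(\<Inter>i\<in>label (Suc n) s. U i) \<noteq> {}"
      using nonempty_standard_simplex[of n] by blast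
    then show ?thesis
      using ne by (auto simp: V_def label_def)
  qed
  have label_face: "label (Suc (Suc n)) s \<subseteq> label (Suc n) t" if "t \<in> keys (sbd (Suc (Suc n)) s)" for n s t
    using keys_sbd[of s _ "Suc n"] that unfolding label_def by blast
  have sub_small: "sbas (?U J) k \<subseteq> smallbas U I k" if "J \<in> V" for J k
  proof (cases k)
    case (Suc l)
    then show ?thesis
      using that sbas_Inter[of J _ l] unfolding Suc smallbas.simps V_def by blast
  qed simp
  have acyc: "acyclic_carrier sbd (sbas (?U J))" if "J \<in> V" for J
    using that conv by (intro acyclic_carrier_convex convex_INT) (auto simp: V_def)
  have acyc': "acyclic_carrier (\<lambda>n. lbd) (chainbas {J\<in>V. L \<subseteq> J})" if "L \<in> V" for L
    by (rule acyclic_carrier_chains_above[of L]) (use that in auto)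
  have keysC: "keys (sbd (Suc n) b) \<subseteq> smallbas U I n" if "b \<in> smallbas U I (Suc n)" for n b
    by (rule keys_sbd_smallbas[OF that])
  have ddC: "lin (sbd (Suc n)) (sbd (Suc (Suc n)) b) = 0" if "b \<in> smallbas U I (Suc (Suc n))" for n b
    using smallbas_subset that by (intro sbd_sbd) blast
  have keysD: "keys (lbd b) \<subseteq> chainbas V n" if "b \<in> chainbas V (Suc n)" for n b
    by (rule keys_lbd_chainbas[OF that])
  have \<Phi>1: "?\<Phi> n b k \<subseteq> chainbas V k" for n b k
    by (intro chainbas_mono) auto
  have \<Phi>3: "acyclic_carrier (\<lambda>n. lbd) (?\<Phi> (Suc n) b)" if "b \<in> smallbas U I (Suc n)" for n b
    by (rule acyc'[OF label_V[OF that]])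
  have \<Phi>4: "?\<Phi> (Suc n) b' k \<subseteq> ?\<Phi> (Suc (Suc n)) b k"
    if "b' \<in> keys (sbd (Suc (Suc n)) b)" for n b b' k
    using label_face[OF that] by (intro chainbas_mono) auto
  have \<Psi>1: "?\<Psi> n b k \<subseteq> smallbas U I k" if "b \<in> chainbas V (Suc n)" for n b k
    by (rule sub_small[OF chainbas_hd_last_in(1)[OF that]])
  have \<Psi>3: "acyclic_carrier sbd (?\<Psi> n b)" if "b \<in> chainbas V (Suc n)" for n b
    by (rule acyc[OF chainbas_hd_last_in(1)[OF that]])
  have \<Psi>4: "?\<Psi> n b' k \<subseteq> ?\<Psi> n b k"
    if "b \<in> chainbas V (Suc (Suc n))" "b' \<in> keys (lbd b)" for n b b' k
    using chainbas_face_hd_last(1)[OF that] by (intro sbas_mono) auto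
  have label_Inter: "J \<subseteq> label (Suc n) s" if "s \<in> sbas (?U J) (Suc n)" "J \<in> V" for J s n
    using that sbas_Inter[of J s n] unfolding label_def V_def by blast
  have \<Theta>2: "b \<in> ?\<Theta> (Suc n) b (Suc n)" if "b \<in> smallbas U I (Suc n)" for n b
    using label_V[OF that] sbas_Inter[of "label (Suc n) b" b n] unfolding label_def V_def by blast
  have \<Theta>4: "?\<Theta> (Suc n) b' k \<subseteq> ?\<Theta> (Suc (Suc n)) b k"
    if "b' \<in> keys (sbd (Suc (Suc n)) b)" for n b b' k
    using label_face[OF that] by (intro sbas_mono) auto
  have \<Theta>5: "?\<Psi> (Suc n) d (Suc n) \<subseteq> ?\<Theta> (Suc n) b (Suc n)" if "d \<in> ?\<Phi> (Suc n) b (Suc n)" for n b d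
    using chainbas_hd_last_in(1)[OF that] by (intro sbas_mono) auto
  have \<Theta>'2: "b \<in> ?\<Theta>' n b (Suc n)" if "b \<in> chainbas V (Suc n)" for n b
    using sorted_chain_hd[OF that] that by (auto simp: chainbas_def)
  have \<Theta>'3: "acyclic_carrier (\<lambda>n. lbd) (?\<Theta>' n b)" if "b \<in> chainbas V (Suc n)" for n b
    by (rule acyc'[OF chainbas_hd_last_in(1)[OF that]])
  have \<Theta>'4: "?\<Theta>' n b' k \<subseteq> ?\<Theta>' n b k"
    if "b \<in> chainbas V (Suc (Suc n))" "b' \<in> keys (lbd b)" for n b b' k
    using chainbas_face_hd_last(1)[OF that] by (intro chainbas_mono) auto
  have \<Theta>'5: "?\<Phi> (Suc n) d (Suc n) \<subseteq> ?\<Theta>' (Suc n) b (Suc n)"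
    if "b \<in> chainbas V (Suc n)" "d \<in> ?\<Psi> (Suc n) b (Suc n)" for n b d
    using label_Inter[OF that(2) chainbas_hd_last_in(1)[OF that(1)]] by (intro chainbas_mono) auto
  have nil: "[] \<in> chainbas W 0" for W :: "'i set set"
    by (simp add: chainbas_def)
  have und: "(\<lambda>x. undefined) \<in> sbas T 0" for T :: "'a topology"
    by simp
  have \<Theta>1: "?\<Theta> (Suc n) b k \<subseteq> smallbas U I k" if "b \<in> smallbas U I (Suc n)" for n b k
    by (rule sub_small[OF label_V[OF that]])
  have \<Theta>3: "acyclic_carrier sbd (?\<Theta> (Suc n) b)" if "b \<in> smallbas U I (Suc n)" for n b
    by (rule acyc[OF label_V[OF that]])
  have \<Theta>'1: "?\<Theta>' n b k \<subseteq> chainbas V k" for n b k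
    by (intro chainbas_mono) auto
  show ?thesis
  proof (rule antisym)
    show "crank (smallbas U I) sbd n \<le> crank (chainbas V) (\<lambda>n. lbd) n"
      by (rule crank_le_acyclic_carriers[where \<Phi> = ?\<Phi> and \<Psi> = ?\<Psi> and \<Theta> = ?\<Theta>, OF keysC ddC keysD lbd_lbd C0 D0
            \<Phi>1 nil \<Phi>3 \<Phi>4 \<Psi>1 und \<Psi>3 \<Psi>4 \<Theta>1 \<Theta>2 \<Theta>3 \<Theta>4 \<Theta>5])
    show "crank (chainbas V) (\<lambda>n. lbd) n \<le> crank (smallbas U I) sbd n"
      by (rule crank_le_acyclic_carriers[where \<Phi> = ?\<Psi> and \<Psi> = ?\<Phi> and \<Theta> = ?\<Theta>', OF keysD lbd_lbd keysC ddC D0 C0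
            \<Psi>1 und \<Psi>3 \<Psi>4 \<Phi>1 nil \<Phi>3 \<Phi>4 \<Theta>'1 \<Theta>'2 \<Theta>'3 \<Theta>'4 \<Theta>'5])
  qed
qed

lemma crank_nerve:
  fixes U :: "'i::linorder \<Rightarrow> 'a::real_normed_vector set"
  assumes "finite I" "\<And>i. i \<in> I \<Longrightarrow> convex (U i)" "\<And>i. i \<in> I \<Longrightarrow> open (U i)"
  defines "K \<equiv> insert {} {J. J \<subseteq> I \<and> J \<noteq> {} \<and> (\<Inter>i\<in>J. U i) \<noteq> {}}"
  shows "crank (sbas (top_of_set (\<Union>i\<in>I. U i))) sbd n = crank (setbas K) (\<lambda>n. setbd) n"
proof -
  have "crank (sbas (top_of_set (\<Union>i\<in>I. U i))) sbd n = crank (smallbas U I) sbd n"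
    using assms(3) by (rule crank_small_simplices[symmetric])
  also have "\<dots> = crank (chainbas {J. J \<subseteq> I \<and> J \<noteq> {} \<and> (\<Inter>i\<in>J. U i) \<noteq> {}}) (\<lambda>n. lbd) n"
    using assms(2) by (rule crank_small_simplices_eq_nerve_chains)
  also have "{J. J \<subseteq> I \<and> J \<noteq> {} \<and> (\<Inter>i\<in>J. U i) \<noteq> {}} = K - {{}}"
    by (auto simp: K_def)
  also have "crank (chainbas (K - {{}})) (\<lambda>n. lbd) n = crank (setbas K) (\<lambda>n. setbd) n"
  proof (rule crank_barycentric_subdivision)
    show "finite J" if "J \<in> K" for J
      using that assms(1) by (auto simp: K_def intro: finite_subset)
    show "J \<in> K" if "L \<in> K" "J \<subseteq> L" for L J
    proof (cases "J = {}")
      case False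
      then have "L \<subseteq> I" "(\<Inter>i\<in>L. U i) \<noteq> {}"
        using that by (auto simp: K_def)
      moreover have "(\<Inter>i\<in>L. U i) \<subseteq> (\<Inter>i\<in>J. U i)"
        using that(2) by (rule INF_superset_mono) simp
      ultimately show ?thesis
        using False that(2) unfolding K_def by blast
    qed (simp add: K_def)
  qed (simp add: K_def)
  finally show ?thesis .
qed

subsection \<open>The nerve of a cover by compact convex sets\<close>

text \<open>If a point were within \<open>\<epsilon>\<close> of every member, a nearest point of one
  member would be within \<open>2 * \<epsilon>\<close> of all; but on that compact member the sum of
  the distances has a positive minimum.\<close>

lemma compact_empty_Inter_gap:
  fixes F :: "'i \<Rightarrow> 'a::euclidean_space set"
  assumes J: "finite J" "J \<noteq> {}" and F: "\<And>i. i \<in> J \<Longrightarrow> compact (F i)" "\<And>i. i \<in> J \<Longrightarrow> F i \<noteq> {}"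
    and empty: "(\<Inter>i\<in>J. F i) = {}"
  obtains \<epsilon> where "\<epsilon> > 0" "\<And>y. \<exists>i\<in>J. infdist y (F i) > \<epsilon>"
proof -
  obtain i0 where i0: "i0 \<in> J"
    using J by auto
  let ?f = "\<lambda>x. \<Sum>i\<in>J. infdist x (F i)"
  have "continuous_on (F i0) ?f"
    by (intro continuous_intros)
  then obtain x0 where x0: "x0 \<in> F i0" "\<And>x. x \<in> F i0 \<Longrightarrow> ?f x0 \<le> ?f x"
    using continuous_attains_inf[OF F(1)[OF i0] F(2)[OF i0]] by blast
  have "?f x0 \<noteq> 0"
  proof
    assume "?f x0 = 0"
    then have "infdist x0 (F i) = 0" if "i \<in> J" for i
      using that J(1) by (simp add: sum_nonneg_eq_0_iff infdist_nonneg)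
    then have "x0 \<in> F i" if "i \<in> J" for i
      using that F by (simp add: in_closed_iff_infdist_zero compact_imp_closed)
    then show False
      using empty by auto
  qed
  then have pos: "?f x0 > 0"
    by (simp add: sum_nonneg infdist_nonneg less_le)
  \<comment> \<open>Chosen so that \<open>card J\<close> distances of at most
    \<open>2 * \<epsilon>\<close> add up to less than the minimum; the added 1 makes the inequality
    strict.\<close>
  define \<epsilon> where "\<epsilon> = ?f x0 / (2 * real (card J) + 1)"
  have eps: "\<epsilon> > 0" "2 * \<epsilon> * real (card J) < ?f x0"
    using pos by (auto simp: \<epsilon>_def field_simps)
  show ?thesis
  proof (rule that[OF eps(1)], rule ccontr)
    fix y assume "\<not> (\<exists>i\<in>J. infdist y (F i) > \<epsilon>)"
    then have y: "infdist y (F i) \<le> \<epsilon>" if "i \<in> J" for i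
      using that by force
    obtain x where x: "x \<in> F i0" "infdist y (F i0) = dist y x"
      using infdist_attains_inf[of "F i0" y] F i0 compact_imp_closed by blast
    have "?f x \<le> (\<Sum>i\<in>J. 2 * \<epsilon>)"
    proof (rule sum_mono)
      fix i assume i: "i \<in> J"
      have "infdist x (F i) \<le> infdist y (F i) + dist x y"
        by (rule infdist_triangle)
      then show "infdist x (F i) \<le> 2 * \<epsilon>"
        using y[OF i] y[OF i0] x(2) by (simp add: dist_commute)
    qed
    then show False
      using x0(2)[OF x(1)] eps(2) by (simp add: algebra_simps)
  qed
qed

text \<open>The open neighbourhoods \<open>U i\<close> are convex and have the same nerve as the
  members. The map \<open>r\<close> sends \<open>y\<close> into every member at distance at most
  \<open>\<epsilon>\<close> from it, so the segment from \<open>y\<close> to \<open>r y\<close>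
  stays in each convex set \<open>U i\<close> or \<open>F i\<close> that contains
  \<open>y\<close>.\<close>

lemma crank_compact_convex_cover:
  fixes F :: "'i::linorder \<Rightarrow> 'a::euclidean_space set"
  assumes I: "finite I" and F: "\<And>i. i \<in> I \<Longrightarrow> compact (F i)" "\<And>i. i \<in> I \<Longrightarrow> convex (F i)" "\<And>i. i \<in> I \<Longrightarrow> F i \<noteq> {}"
  shows "crank (sbas (top_of_set (\<Union>i\<in>I. F i))) sbd n
    = crank (setbas (insert {} {J. J \<subseteq> I \<and> J \<noteq> {} \<and> (\<Inter>i\<in>J. F i) \<noteq> {}})) (\<lambda>n. setbd) n"
proof -
  define W where "W = {J. J \<subseteq> I \<and> J \<noteq> {} \<and> (\<Inter>i\<in>J. F i) = {}}"
  have finW: "finite W"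
    by (rule finite_subset[of _ "Pow I"]) (auto simp: W_def I)
  have "\<forall>J\<in>W. \<exists>\<epsilon>>0. \<forall>y. \<exists>i\<in>J. infdist y (F i) > \<epsilon>"
  proof
    fix J assume J: "J \<in> W"
    then have "finite J" "J \<noteq> {}" "(\<Inter>i\<in>J. F i) = {}" "\<And>i. i \<in> J \<Longrightarrow> i \<in> I"
      using I by (auto simp: W_def intro: finite_subset)
    then obtain \<epsilon> where "\<epsilon> > 0" "\<And>y. \<exists>i\<in>J. infdist y (F i) > \<epsilon>"
      using compact_empty_Inter_gap[of J F thesis] F by blast
    then show "\<exists>\<epsilon>>0. \<forall>y. \<exists>i\<in>J. infdist y (F i) > \<epsilon>"
      by blast
  qed
  then obtain e where e: "\<And>J. J \<in> W \<Longrightarrow> e J > 0" "\<And>J y. J \<in> W \<Longrightarrow> \<exists>i\<in>J. infdist y (F i) > e J"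
    by metis
  \<comment> \<open>At most every gap of an empty intersection; the 1 covers the case that there is
    none.\<close>
  define \<epsilon> where "\<epsilon> = Min (insert 1 (e ` W))"
  have eps_pos: "\<epsilon> > 0"
    using e(1) finW by (simp add: \<epsilon>_def)
  have eps: "\<exists>i\<in>J. infdist y (F i) > \<epsilon>" if "J \<in> W" for J y
  proof -
    have "\<epsilon> \<le> e J"
      using that finW by (simp add: \<epsilon>_def)
    then show ?thesis
      using e(2)[OF that, of y] by force
  qed
  define U where "U i = {y. infdist y (F i) < \<epsilon>}" for i
  define V where "V = {J. J \<subseteq> I \<and> J \<noteq> {} \<and> (\<Inter>i\<in>J. F i) \<noteq> {}}"
  have finV: "finite V"
    by (rule finite_subset[of _ "Pow I"]) (auto simp: V_def I)
  define near where "near y = {i\<in>I. infdist y (F i) \<le> \<epsilon>}" for y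
  have FU: "F i \<subseteq> U i" for i
    using eps_pos by (auto simp: U_def infdist_zero)
  have openU: "open (U i)" for i
    unfolding U_def by (intro open_Collect_less continuous_intros)
  have convU: "convex (U i)" if i: "i \<in> I" for i
  proof -
    \<comment> \<open>The neighbourhood is the Minkowski sum with an open ball, whence its
      convexity; nearest points exist since the member is compact.\<close>
    have "U i = (\<Union>x\<in>F i. \<Union>b\<in>ball 0 \<epsilon>. {x + b})"
    proof (intro equalityI subsetI)
      fix y assume "y \<in> U i"
      moreover obtain x where "x \<in> F i" "infdist y (F i) = dist y x"
        using infdist_attains_inf[of "F i" y] F[OF i] compact_imp_closed by blast
      ultimately show "y \<in> (\<Union>x\<in>F i. \<Union>b\<in>ball 0 \<epsilon>. {x + b})"
        by (intro UN_I[of x] UN_I[of "y - x"]) (auto simp: U_def dist_norm norm_minus_commute)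
    next
      fix y assume "y \<in> (\<Union>x\<in>F i. \<Union>b\<in>ball 0 \<epsilon>. {x + b})"
      then obtain x b where "x \<in> F i" "norm b < \<epsilon>" "y = x + b"
        by auto
      then show "y \<in> U i"
        using infdist_le[of x "F i" y] by (simp add: U_def dist_norm)
    qed
    then show ?thesis
      using convex_sums[OF F(2)[OF i] convex_ball[of 0 \<epsilon>]] by simp
  qed
  have nearV: "near y \<in> V" if "near y \<noteq> {}" for y
  proof (rule ccontr)
    assume "near y \<notin> V"
    then have "near y \<in> W"
      using that by (auto simp: V_def W_def near_def)
    then show False
      using eps[of "near y" y] by (auto simp: near_def)
  qed
  have same_nerve: "(\<Inter>i\<in>J. U i) \<noteq> {} \<longleftrightarrow> (\<Inter>i\<in>J. F i) \<noteq> {}" if J: "J \<subseteq> I" "J \<noteq> {}" for J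
  proof
    assume "(\<Inter>i\<in>J. U i) \<noteq> {}"
    then obtain y where y: "\<And>i. i \<in> J \<Longrightarrow> infdist y (F i) < \<epsilon>"
      by (auto simp: U_def)
    show "(\<Inter>i\<in>J. F i) \<noteq> {}"
    proof
      assume "(\<Inter>i\<in>J. F i) = {}"
      then have "J \<in> W"
        using J by (simp add: W_def)
      then show False
        using eps[of J y] y by force
    qed
  next
    assume "(\<Inter>i\<in>J. F i) \<noteq> {}"
    then show "(\<Inter>i\<in>J. U i) \<noteq> {}"
      using FU by blast
  qed
  define p where "p J = (SOME x. x \<in> (\<Inter>i\<in>J. F i))" for J
  have p: "p J \<in> F i" if J: "J \<in> V" and i: "i \<in> J" for J i
  proof -
    obtain x where "x \<in> (\<Inter>i\<in>J. F i)"
      using J unfolding V_def by blast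
    then have "p J \<in> (\<Inter>i\<in>J. F i)"
      unfolding p_def by (rule someI)
    then show ?thesis
      using i by auto
  qed
  \<comment> \<open>The weight of \<open>J\<close> vanishes as soon as some member outside
    \<open>J\<close> is within \<open>\<epsilon>\<close> of \<open>y\<close>. So only sets
    \<open>J\<close> containing \<open>near y\<close> count, and their points \<open>p J\<close> lie
    in all members near \<open>y\<close>. When \<open>near y\<close> is nonempty it belongs to
    \<open>V\<close> and has positive weight itself, so the total is positive.\<close>
  define wt where "wt J y = (\<Prod>i\<in>I - J. max 0 (infdist y (F i) - \<epsilon>))" for J y
  define tot where "tot y = (\<Sum>J\<in>V. wt J y)" for y
  define r where "r y = (\<Sum>J\<in>V. (wt J y / tot y) *\<^sub>R p J)" for y
  have wt_nonneg: "wt J y \<ge> 0" for J y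
    unfolding wt_def by (intro prod_nonneg) auto
  have wt_near: "near y \<subseteq> J" if "wt J y \<noteq> 0" for J y
  proof (rule subsetI, rule ccontr)
    fix i assume i: "i \<in> near y" "i \<notin> J"
    then have "max 0 (infdist y (F i) - \<epsilon>) = 0" "i \<in> I - J"
      by (auto simp: near_def)
    then have "wt J y = 0"
      unfolding wt_def using I by (intro prod_zero) auto
    then show False
      using that by simp
  qed
  have tot_pos: "tot y > 0" if "near y \<noteq> {}" for y
  proof -
    have "wt (near y) y > 0"
      unfolding wt_def by (intro prod_pos) (auto simp: near_def)
    also have "wt (near y) y \<le> tot y"
      unfolding tot_def using nearV[OF that] finV wt_nonneg by (intro member_le_sum) auto
    finally show ?thesis .
  qed
  have r_in: "r y \<in> F i" if i: "i \<in> near y" for y i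
  proof -
    have ne: "near y \<noteq> {}"
      using i by auto
    let ?V = "{J\<in>V. wt J y \<noteq> 0}"
    have "r y = (\<Sum>J\<in>?V. (wt J y / tot y) *\<^sub>R p J)"
      unfolding r_def using finV by (intro sum.mono_neutral_right) auto
    moreover have "(\<Sum>J\<in>?V. wt J y / tot y) = 1"
    proof -
      have "(\<Sum>J\<in>?V. wt J y / tot y) = (\<Sum>J\<in>V. wt J y / tot y)"
        using finV by (intro sum.mono_neutral_left) auto
      also have "\<dots> = tot y / tot y"
        by (simp only: sum_divide_distrib[symmetric] tot_def[symmetric])
      finally show ?thesis
        using tot_pos[OF ne] by simp
    qed
    moreover have "p J \<in> F i" if "J \<in> ?V" for J
      using that wt_near[of J y] i by (intro p) auto
    ultimately show ?thesis
      using finV wt_nonneg tot_pos[OF ne] F(2)[of i] i convex_sum[of ?V "F i" "\<lambda>J. wt J y / tot y" p]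
      by (simp add: near_def less_imp_le)
  qed
  have near_U: "i \<in> near y" if "i \<in> I" "y \<in> U i" for i y
    using that by (simp add: near_def U_def)
  have "crank (sbas (top_of_set (\<Union>i\<in>I. F i))) sbd n = crank (sbas (top_of_set (\<Union>i\<in>I. U i))) sbd n"
  proof (rule crank_deformation_retract[where r = r])
    show "(\<Union>i\<in>I. F i) \<subseteq> (\<Union>i\<in>I. U i)"
      using FU by blast
    show "continuous_on (\<Union>i\<in>I. U i) r"
    proof -
      have "near y \<noteq> {}" if "y \<in> (\<Union>i\<in>I. U i)" for y
        using that near_U by blast
      then have "tot y \<noteq> 0" if "y \<in> (\<Union>i\<in>I. U i)" for y
        using that tot_pos by (metis less_irrefl)
      moreover have cont: "continuous_on A (wt J)" for A J
        unfolding wt_def by (intro continuous_intros)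
      moreover have "continuous_on A tot" for A
        unfolding tot_def by (intro continuous_intros cont)
      ultimately show ?thesis
        unfolding r_def by (intro continuous_intros) auto
    qed
    show "r ` (\<Union>i\<in>I. U i) \<subseteq> (\<Union>i\<in>I. F i)"
      using r_in near_U by blast
    show "closed_segment y (r y) \<subseteq> (\<Union>i\<in>I. U i)" if y: "y \<in> (\<Union>i\<in>I. U i)" for y
    proof -
      obtain i where i: "i \<in> I" "y \<in> U i"
        using y by auto
      then have "r y \<in> U i"
        using r_in[OF near_U[OF i]] FU by blast
      then have "closed_segment y (r y) \<subseteq> U i"
        using i convU by (intro closed_segment_subset)
      then show ?thesis
        using i by blast
    qed
    show "closed_segment y (r y) \<subseteq> (\<Union>i\<in>I. F i)" if y: "y \<in> (\<Union>i\<in>I. F i)" for y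
    proof -
      obtain i where i: "i \<in> I" "y \<in> F i"
        using y by auto
      then have "r y \<in> F i"
        using r_in[OF near_U[of i y]] FU by blast
      then have "closed_segment y (r y) \<subseteq> F i"
        using i F(2) by (intro closed_segment_subset)
      then show ?thesis
        using i by blast
    qed
  qed
  also have "\<dots> = crank (setbas (insert {} {J. J \<subseteq> I \<and> J \<noteq> {} \<and> (\<Inter>i\<in>J. U i) \<noteq> {}})) (\<lambda>n. setbd) n"
    using I convU openU by (rule crank_nerve)
  also have "{J. J \<subseteq> I \<and> J \<noteq> {} \<and> (\<Inter>i\<in>J. U i) \<noteq> {}} = {J. J \<subseteq> I \<and> J \<noteq> {} \<and> (\<Inter>i\<in>J. F i) \<noteq> {}}"
    by (simp add: same_nerve cong: conj_cong)
  finally show ?thesis .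
qed


section \<open>Ranks of reduced singular cohomology groups\<close>

lemma keys_add_subset:
  assumes "keys c \<subseteq> A" "keys d \<subseteq> A"
  shows "keys (c + d) \<subseteq> A"
  using assms Poly_Mapping.keys_add[of c d] by blast

lemma hom_free_Abelian_group_add:
  "f \<in> hom (free_Abelian_group B) integer_group \<Longrightarrow> keys c \<subseteq> B \<Longrightarrow> keys d \<subseteq> B \<Longrightarrow>
    f (c + d) = f c + f d"
  using hom_mult[of f "free_Abelian_group B" integer_group c d] by simp

lemma hom_free_Abelian_group_pairing:
  assumes f: "f \<in> hom (free_Abelian_group B) integer_group" and c: "keys c \<subseteq> B"
  shows "f c = pairing (\<lambda>s. f (frag_of s)) c"
proof -
  have zero: "f 0 = 0"
    using hom_free_Abelian_group_add[OF f, of 0 0] by simp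
  have diff: "f (a - b) = f a - f b" if "keys a \<subseteq> B" "keys b \<subseteq> B" for a b
    using hom_free_Abelian_group_add[OF f, of "a - b" b] keys_diff_subset[of a B b] that by simp
  from c have "keys c \<subseteq> B \<and> f c = pairing (\<lambda>s. f (frag_of s)) c"
  proof (induction c rule: frag_induction)
    case (diff a b)
    then show ?case
      using \<open>\<And>a b. _ \<Longrightarrow> _ \<Longrightarrow> f (a - b) = f a - f b\<close> keys_diff_subset[of a B b] by (simp add: pairing_diff)
  qed (auto simp: zero)
  then show ?thesis
    by simp
qed

lemma comm_group_hom_group:
  assumes "group A"
  shows "comm_group (hom_group A integer_group)"
proof -
  interpret A: group A
    by fact
  have hom: "f x \<otimes>\<^bsub>A\<^esub> y = f x \<otimes>\<^bsub>A\<^esub> y" for f x y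
    by simp
  show ?thesis
  proof (rule comm_groupI)
    fix f assume f: "f \<in> carrier (hom_group A integer_group)"
    show "\<exists>g\<in>carrier (hom_group A integer_group). g \<otimes>\<^bsub>hom_group A integer_group\<^esub> f = \<one>\<^bsub>hom_group A integer_group\<^esub>"
      using f by (intro bexI[of _ "\<lambda>x\<in>carrier A. - f x"]) (auto simp: hom_group_def hom_def)
  qed (auto simp: hom_group_def hom_def extensional_def fun_eq_iff)
qed

lemma aug_boundary_lin: "aug_boundary (int n) c = lin (sbd (Suc n)) c"
proof (cases n)
  case 0
  then show ?thesis
    by (simp add: aug_boundary_def frag_extend_eq_lin) (rule lin_cong, simp)
next
  case (Suc m)
  show ?thesis
    unfolding Suc lin_sbd by (simp add: aug_boundary_def del: of_nat_Suc)
qed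

lemma aug_boundary_neg: "n < 0 \<Longrightarrow> aug_boundary n c = 0"
  by (simp add: aug_boundary_def)

lemma aug_simplex_set_sbas: "aug_simplex_set (int n - 1) T = sbas T n"
  by (cases n) (auto simp: aug_simplex_set_def)

lemma aug_boundary_add: "aug_boundary n (c + d) = aug_boundary n c + aug_boundary n d"
  by (cases n) (simp_all add: aug_boundary_lin lin_add aug_boundary_neg)

lemma keys_aug_boundary:
  assumes "keys c \<subseteq> aug_simplex_set n T"
  shows "keys (aug_boundary n c) \<subseteq> aug_simplex_set (n - 1) T"
proof (cases n)
  case (nonneg k)
  have "keys c \<subseteq> sbas T (Suc k)"
    using assms aug_simplex_set_sbas[of "Suc k" T] by (simp add: nonneg)
  then show ?thesis
    unfolding nonneg aug_boundary_lin aug_simplex_set_sbas using keys_sbd by (intro keys_lin_subset) blast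
qed (simp add: aug_boundary_neg)

lemma aug_boundary_boundary:
  assumes "keys c \<subseteq> aug_simplex_set (n + 1) T"
  shows "aug_boundary n (aug_boundary (n + 1) c) = 0"
proof (cases n)
  case (nonneg k)
  have "keys c \<subseteq> sbas T (Suc (Suc k))"
    using assms aug_simplex_set_sbas[of "Suc (Suc k)" T] by (simp add: nonneg add.commute)
  then have "lin (sbd (Suc k)) (lin (sbd (Suc (Suc k))) c) = lin (\<lambda>_. 0) c"
    unfolding lin_lin using sbd_sbd by (intro lin_cong) blast
  then show ?thesis
    using aug_boundary_lin[of "Suc k" c] by (simp add: nonneg aug_boundary_lin add.commute)
qed (simp add: aug_boundary_neg)

lemma coboundary_in_carrier:
  assumes f: "f \<in> carrier (aug_cochain_group n T)"
  shows "coboundary n T f \<in> carrier (aug_cochain_group (n + 1) T)"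
proof -
  have hom: "f \<in> hom (free_Abelian_group (aug_simplex_set n T)) integer_group"
    using f by (simp add: aug_cochain_group_def hom_group_def aug_chain_group_def)
  have keys: "keys (aug_boundary (n + 1) c) \<subseteq> aug_simplex_set n T"
    if "keys c \<subseteq> aug_simplex_set (n + 1) T" for c
    using keys_aug_boundary[OF that] by simp
  have "f (aug_boundary (n + 1) (c + d)) = f (aug_boundary (n + 1) c) + f (aug_boundary (n + 1) d)"
    if "keys c \<subseteq> aug_simplex_set (n + 1) T" "keys d \<subseteq> aug_simplex_set (n + 1) T" for c d
    unfolding aug_boundary_add by (rule hom_free_Abelian_group_add[OF hom keys[OF that(1)] keys[OF that(2)]])
  moreover have "keys (c + d) \<subseteq> aug_simplex_set (n + 1) T"
    if "keys c \<subseteq> aug_simplex_set (n + 1) T" "keys d \<subseteq> aug_simplex_set (n + 1) T" for c d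
    using that Poly_Mapping.keys_add[of c d] by blast
  ultimately show ?thesis
    by (auto simp: aug_cochain_group_def hom_group_def coboundary_def aug_chain_group_def hom_def keys_add_subset)
qed

text \<open>A homomorphism on a free abelian group is determined by its values on generators, so
  restriction to generators is an injective coordinate map to which
  \<open>abelian_rank_quotient\<close> applies.\<close>

lemma abelian_rank_reduced_cohomology_aux:
  fixes T :: "'a topology" and n :: int
  defines "e \<equiv> \<lambda>f s. if s \<in> aug_simplex_set n T then f (frag_of s) else 0"
  shows "abelian_rank (reduced_cohomology_group n T) = qrank
      (e ` kernel (aug_cochain_group n T) (aug_cochain_group (n + 1) T) (coboundary n T))
      (e ` coboundary (n - 1) T ` carrier (aug_cochain_group (n - 1) T))"
proof -
  let ?G = "aug_cochain_group n T" and ?G' = "aug_cochain_group (n + 1) T"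
  have grp: "comm_group (aug_cochain_group k T)" for k
    unfolding aug_cochain_group_def aug_chain_group_def by (rule comm_group_hom_group) simp
  have hom: "group_hom (aug_cochain_group k T) (aug_cochain_group (k + 1) T) (coboundary k T)" for k
  proof -
    interpret comm_group "aug_cochain_group k T" by (rule grp)
    interpret G': comm_group "aug_cochain_group (k + 1) T" by (rule grp)
    show ?thesis
    proof (unfold_locales, unfold hom_def, intro CollectI conjI ballI)
      show "coboundary k T \<in> carrier (aug_cochain_group k T) \<rightarrow> carrier (aug_cochain_group (k + 1) T)"
        using coboundary_in_carrier by blast
      fix f g
      show "coboundary k T (f \<otimes>\<^bsub>aug_cochain_group k T\<^esub> g)
          = coboundary k T f \<otimes>\<^bsub>aug_cochain_group (k + 1) T\<^esub> coboundary k T g"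
        using keys_aug_boundary[where n = "k + 1" and T = T]
        by (auto simp: coboundary_def aug_cochain_group_def hom_group_def aug_chain_group_def fun_eq_iff)
    qed
  qed
  interpret \<delta>: group_hom ?G ?G' "coboundary n T"
    by (rule hom)
  interpret \<delta>': group_hom "aug_cochain_group (n - 1) T" ?G "coboundary (n - 1) T"
    using hom[of "n - 1"] by simp
  have Z: "subgroup (kernel ?G ?G' (coboundary n T)) ?G"
    by (rule \<delta>.subgroup_kernel)
  have N: "subgroup (coboundary (n - 1) T ` carrier (aug_cochain_group (n - 1) T)) ?G"
    by (rule \<delta>'.img_is_subgroup)
  have dd: "coboundary n T (coboundary (n - 1) T f) = \<one>\<^bsub>?G'\<^esub>" if f: "f \<in> carrier (aug_cochain_group (n - 1) T)" for f
  proof -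
    have "f 0 = 0"
      using f hom_free_Abelian_group_add[of f "aug_simplex_set (n - 1) T" 0 0]
      by (simp add: aug_cochain_group_def hom_group_def aug_chain_group_def)
    moreover have "aug_boundary n (aug_boundary (n + 1) c) = 0" "keys (aug_boundary (n + 1) c) \<subseteq> aug_simplex_set n T"
      if "keys c \<subseteq> aug_simplex_set (n + 1) T" for c
      using aug_boundary_boundary[OF that] keys_aug_boundary[OF that] by auto
    ultimately show ?thesis
      by (auto simp: coboundary_def aug_cochain_group_def hom_group_def aug_chain_group_def fun_eq_iff)
  qed
  have NZ: "coboundary (n - 1) T ` carrier (aug_cochain_group (n - 1) T) \<subseteq> kernel ?G ?G' (coboundary n T)"
    using dd \<delta>'.hom_closed by (auto simp: kernel_def)
  show ?thesis
    unfolding reduced_cohomology_group_def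
  proof (rule abelian_rank_quotient[OF grp Z N NZ])
    show "e (f \<otimes>\<^bsub>?G\<^esub> g) = (\<lambda>b. e f b + e g b)" for f g
      by (auto simp: e_def aug_cochain_group_def hom_group_def aug_chain_group_def)
    show "inj_on e (kernel ?G ?G' (coboundary n T))"
    proof (rule inj_onI)
      fix f g assume f: "f \<in> kernel ?G ?G' (coboundary n T)" and g: "g \<in> kernel ?G ?G' (coboundary n T)" and eq: "e f = e g"
      have hom: "h \<in> hom (free_Abelian_group (aug_simplex_set n T)) integer_group"
        "h \<in> extensional (carrier (aug_chain_group n T))" if "h \<in> kernel ?G ?G' (coboundary n T)" for h
        using that by (auto simp: kernel_def aug_cochain_group_def hom_group_def aug_chain_group_def)
      show "f = g"
      proof (rule extensionalityI[OF hom(2)[OF f] hom(2)[OF g]])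
        fix c assume "c \<in> carrier (aug_chain_group n T)"
        then have c: "keys c \<subseteq> aug_simplex_set n T"
          by (simp add: aug_chain_group_def)
        have "f (frag_of s) = g (frag_of s)" if "s \<in> keys c" for s
          using fun_cong[OF eq, of s] c that by (auto simp: e_def split: if_splits)
        then show "f c = g c"
          unfolding hom_free_Abelian_group_pairing[OF hom(1)[OF f] c] hom_free_Abelian_group_pairing[OF hom(1)[OF g] c]
          by (rule pairing_cong)
      qed
    qed
  qed
qed

text \<open>Below degree -1 there are no simplices, so all coordinates vanish. This covers the terms
  with \<open>j < i\<close>.\<close>

lemma abelian_rank_reduced_cohomology_neg:
  fixes T :: "'a topology"
  assumes "n < - 1"
  shows "abelian_rank (reduced_cohomology_group n T) = 0"
proof -
  have 1: "aug_simplex_set n T = {}"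
    using assms by (simp add: aug_simplex_set_def)
  have "fun_subgroup {\<lambda>s. 0 :: int}"
    by (simp add: fun_subgroup_def)
  have ne: "carrier (aug_cochain_group (n - 1) T) \<noteq> {}"
    using comm_group_hom_group[of "aug_chain_group (n - 1) T"]
    unfolding aug_cochain_group_def aug_chain_group_def
    by (metis comm_group_def comm_monoid_def empty_iff group_free_Abelian_group monoid.one_closed)
  have "qrank ((\<lambda>f (s :: 'a sing). 0) ` A) ((\<lambda>f s. 0 :: int) ` B) = 0" if "B \<noteq> {}" for A B :: "('a chain \<Rightarrow> int) set"
    using that by (intro qrank_trivial) (auto simp: fun_subgroup_def image_constant_conv)
  then show ?thesis
    unfolding abelian_rank_reduced_cohomology_aux 1 using ne by simp
qed

text \<open>Restriction \<open>e\<close> to generators and linear extension \<open>ext\<close> match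
  homomorphisms with cochains, and the coboundary with composition with \<open>sbd\<close>. The
  shift by one is that between dimension and number of vertices.\<close>

lemma abelian_rank_reduced_cohomology:
  "abelian_rank (reduced_cohomology_group (int n - 1) T) = crank (sbas T) sbd n"
proof -
  define e where "e = (\<lambda>f :: 'a chain \<Rightarrow> int. \<lambda>s. if s \<in> sbas T n then f (frag_of s) else 0)"
  define ext where "ext m u = (\<lambda>c\<in>carrier (free_Abelian_group (sbas T m)). pairing u c)" for m and u :: "'a sing \<Rightarrow> int"
  have coch: "carrier (aug_cochain_group (int m - 1) T)
      = hom (free_Abelian_group (sbas T m)) integer_group \<inter> extensional (carrier (free_Abelian_group (sbas T m)))" for m
    by (simp add: aug_cochain_group_def hom_group_def aug_chain_group_def aug_simplex_set_sbas)
  have one: "\<one>\<^bsub>aug_cochain_group (int m - 1) T\<^esub> = (\<lambda>c\<in>carrier (free_Abelian_group (sbas T m)). 0)" for m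
    by (simp add: aug_cochain_group_def hom_group_def aug_chain_group_def aug_simplex_set_sbas)
  have ext_coch: "ext m u \<in> carrier (aug_cochain_group (int m - 1) T)" for m u
    by (simp add: coch ext_def hom_def pairing_add keys_add_subset)
  have cob: "coboundary (int m - 1) T f = (\<lambda>c\<in>carrier (free_Abelian_group (sbas T (Suc m))). f (lin (sbd (Suc m)) c))" for m f
    using aug_simplex_set_sbas[of "Suc m" T] by (simp add: coboundary_def aug_chain_group_def aug_boundary_lin)
  have f_pairing: "f c = pairing (\<lambda>s. f (frag_of s)) c"
    if "f \<in> carrier (aug_cochain_group (int m - 1) T)" "keys c \<subseteq> sbas T m" for m f c
    using that coch by (intro hom_free_Abelian_group_pairing) auto
  have e_pairing: "pairing (e f) c = pairing (\<lambda>s. f (frag_of s)) c" if "keys c \<subseteq> sbas T n" for f c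
    using that by (intro pairing_cong) (auto simp: e_def)
  have e_ext: "e (ext n u) = u" if "u \<in> cochains (sbas T) n" for u
    using that by (auto simp: e_def ext_def cochains_def fun_eq_iff)
  have bd_keys: "keys (sbd (Suc m) b) \<subseteq> sbas T m" if "b \<in> sbas T (Suc m)" for m b
    by (rule keys_sbd[OF that])
  have "e ` kernel (aug_cochain_group (int n - 1) T) (aug_cochain_group (int n - 1 + 1) T) (coboundary (int n - 1) T)
      = cocycles (sbas T) sbd n"
  proof (intro equalityI subsetI)
    fix u assume "u \<in> e ` kernel (aug_cochain_group (int n - 1) T) (aug_cochain_group (int n - 1 + 1) T) (coboundary (int n - 1) T)"
    then obtain f where f: "f \<in> carrier (aug_cochain_group (int n - 1) T)"
      "coboundary (int n - 1) T f = \<one>\<^bsub>aug_cochain_group (int n - 1 + 1) T\<^esub>" "u = e f"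
      by (auto simp: kernel_def)
    have "f (lin (sbd (Suc n)) (frag_of b)) = 0" if "b \<in> sbas T (Suc n)" for b
      using fun_cong[OF f(2), of "frag_of b"] one[of "Suc n"] that by (simp add: cob)
    then have "pairing u (sbd (Suc n) b) = 0" if "b \<in> sbas T (Suc n)" for b
      using f_pairing[OF f(1) bd_keys[OF that]] e_pairing[OF bd_keys[OF that]] that f(3) by simp
    then show "u \<in> cocycles (sbas T) sbd n"
      by (auto simp: cocycles_def cochains_def f(3) e_def)
  next
    fix u assume u: "u \<in> cocycles (sbas T) sbd n"
    then have uc: "u \<in> cochains (sbas T) n"
      by (simp add: cocycles_def)
    have "ext n u (lin (sbd (Suc n)) c) = 0" if c: "keys c \<subseteq> sbas T (Suc n)" for c
    proof -
      have "keys (lin (sbd (Suc n)) c) \<subseteq> sbas T n"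
        using c bd_keys by (intro keys_lin_subset) blast
      then have "ext n u (lin (sbd (Suc n)) c) = pairing (\<lambda>b. pairing u (sbd (Suc n) b)) c"
        by (simp add: ext_def pairing_lin)
      also have "\<dots> = pairing (\<lambda>_. 0) c"
        using c u by (intro pairing_cong) (auto simp: cocycles_def)
      finally show ?thesis
        by simp
    qed
    then have "coboundary (int n - 1) T (ext n u) = \<one>\<^bsub>aug_cochain_group (int n - 1 + 1) T\<^esub>"
      using one[of "Suc n"] by (auto simp: cob fun_eq_iff)
    then have "ext n u \<in> kernel (aug_cochain_group (int n - 1) T) (aug_cochain_group (int n - 1 + 1) T) (coboundary (int n - 1) T)"
      using ext_coch by (simp add: kernel_def)
    then show "u \<in> e ` kernel (aug_cochain_group (int n - 1) T) (aug_cochain_group (int n - 1 + 1) T) (coboundary (int n - 1) T)"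
      by (intro image_eqI[of u e "ext n u"]) (simp_all add: e_ext[OF uc])
  qed
  moreover have "e ` coboundary (int n - 1 - 1) T ` carrier (aug_cochain_group (int n - 1 - 1) T) = coboundaries (sbas T) sbd n"
  proof (cases n)
    \<comment> \<open>There are no simplices of dimension -2, so no nonzero coboundary reaches
      degree -1, in agreement with \<open>coboundaries\<close> in position 0.\<close>
    case 0
    have "e (coboundary (- 2) T f) = (\<lambda>s. 0)" if f: "f \<in> carrier (aug_cochain_group (- 2) T)" for f
    proof -
      have "f 0 = 0"
        using f hom_free_Abelian_group_add[of f "aug_simplex_set (- 2) T" 0 0]
        by (simp add: aug_cochain_group_def hom_group_def aug_chain_group_def)
      then show ?thesis
        using aug_simplex_set_sbas[of 0 T]
        by (auto simp: e_def coboundary_def aug_boundary_neg aug_chain_group_def 0 fun_eq_iff)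
    qed
    moreover have "carrier (aug_cochain_group (- 2) T) \<noteq> {}"
      using comm_group_hom_group[of "aug_chain_group (- 2) T"]
      unfolding aug_cochain_group_def aug_chain_group_def
      by (metis comm_group_def comm_monoid_def empty_iff group_free_Abelian_group monoid.one_closed)
    ultimately show ?thesis
      by (auto simp: 0 coboundaries_0 image_image image_iff)
  next
    case (Suc m)
    have e_cob: "e (coboundary (int m - 1) T f) = (\<lambda>b. if b \<in> sbas T (Suc m)
        then pairing (\<lambda>s. if s \<in> sbas T m then f (frag_of s) else 0) (sbd (Suc m) b) else 0)"
      if f: "f \<in> carrier (aug_cochain_group (int m - 1) T)" for f
    proof
      fix b
      show "e (coboundary (int m - 1) T f) b = (if b \<in> sbas T (Suc m)
          then pairing (\<lambda>s. if s \<in> sbas T m then f (frag_of s) else 0) (sbd (Suc m) b) else 0)"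
      proof (cases "b \<in> sbas T (Suc m)")
        case True
        have "f (sbd (Suc m) b) = pairing (\<lambda>s. if s \<in> sbas T m then f (frag_of s) else 0) (sbd (Suc m) b)"
          unfolding f_pairing[OF f bd_keys[OF True]] using bd_keys[OF True] by (intro pairing_cong) auto
        then show ?thesis
          using True by (simp add: e_def Suc cob del: sbas.simps)
      qed (simp add: e_def Suc del: sbas.simps)
    qed
    show ?thesis
    proof (intro equalityI subsetI)
      fix u assume "u \<in> e ` coboundary (int n - 1 - 1) T ` carrier (aug_cochain_group (int n - 1 - 1) T)"
      then obtain f where f: "f \<in> carrier (aug_cochain_group (int m - 1) T)" "u = e (coboundary (int m - 1) T f)"
        by (auto simp: Suc)
      show "u \<in> coboundaries (sbas T) sbd n"
        unfolding f(2) e_cob[OF f(1)] Suc coboundaries_Suc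
        by (rule imageI) (simp add: cochains_def)
    next
      fix u assume "u \<in> coboundaries (sbas T) sbd n"
      then obtain w where w: "w \<in> cochains (sbas T) m"
        "u = (\<lambda>b. if b \<in> sbas T (Suc m) then pairing w (sbd (Suc m) b) else 0)"
        unfolding Suc coboundaries_Suc by blast
      have "(\<lambda>s. if s \<in> sbas T m then ext m w (frag_of s) else 0) = w"
        using w(1) by (auto simp: ext_def cochains_def fun_eq_iff)
      then have "u = e (coboundary (int m - 1) T (ext m w))"
        unfolding w(2) e_cob[OF ext_coch] by (simp only:)
      then show "u \<in> e ` coboundary (int n - 1 - 1) T ` carrier (aug_cochain_group (int n - 1 - 1) T)"
        using ext_coch[of m w] by (auto simp: Suc)
    qed
  qed
  ultimately show ?thesis
    unfolding abelian_rank_reduced_cohomology_aux crank_def aug_simplex_set_sbas e_def by simp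
qed

section \<open>Graded free resolutions with bases\<close>

subsection \<open>Homogeneous chains\<close>

definition mdeg :: "(nat \<Rightarrow>\<^sub>0 nat) \<Rightarrow> nat" where
  "mdeg t = (\<Sum>k\<in>keys t. lookup t k)"

lemma mdeg_superset: "finite A \<Longrightarrow> keys t \<subseteq> A \<Longrightarrow> mdeg t = (\<Sum>k\<in>A. lookup t k)"
  unfolding mdeg_def by (intro sum.mono_neutral_left) (auto simp: in_keys_iff)

lemma keys_add_nat: "keys (s + t) = keys s \<union> keys (t :: 'a \<Rightarrow>\<^sub>0 nat)"
  by (auto simp: in_keys_iff lookup_add)

lemma mdeg_add: "mdeg (s + t) = mdeg s + mdeg t"
  by (simp add: mdeg_superset[of "keys s \<union> keys t"] keys_add_nat lookup_add sum.distrib)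

lemma mdeg_0 [simp]: "mdeg 0 = 0" and mdeg_single [simp]: "mdeg (single k n) = n"
  by (simp_all add: mdeg_def)

lemma mdeg_eq_0_iff: "mdeg t = 0 \<longleftrightarrow> t = 0"
  by (auto simp: mdeg_def in_keys_iff intro!: poly_mapping_eqI)

text \<open>An element of \<open>\<int>[K]\<close> is represented by its normal form, the polynomial fixed by \<open>red K\<close>.\<close>

definition red :: "nat set set \<Rightarrow> int_mpoly \<Rightarrow> int_mpoly" where
  "red K p = Abs_poly_mapping (\<lambda>t. if keys t \<in> K then lookup p t else 0)"

lemma lookup_red [simp]:
  "lookup (red K p) t = (if keys t \<in> K then lookup p t else 0)"
proof -
  have "finite {t. (if keys t \<in> K then lookup p t else 0) \<noteq> 0}"
    by (rule finite_subset[OF _ finite_keys[of p]]) (auto simp: in_keys_iff)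
  then show ?thesis
    by (simp add: red_def)
qed

lemma red_add: "red K (p + q) = red K p + red K q"
  by (intro poly_mapping_eqI) (simp add: lookup_add)

lemma red_0 [simp]: "red K 0 = 0"
  by (intro poly_mapping_eqI) simp

lemma red_uminus: "red K (- p) = - red K p"
  by (intro poly_mapping_eqI) simp

lemma red_diff: "red K (p - q) = red K p - red K q"
  by (intro poly_mapping_eqI) (simp add: lookup_minus)

lemma red_sum: "red K (sum f A) = (\<Sum>a\<in>A. red K (f a))"
  by (induction A rule: infinite_finite_induct) (simp_all add: red_add)

lemma red_red [simp]: "red K (red K p) = red K p"
  by (intro poly_mapping_eqI) simp

definition down_closed :: "nat set set \<Rightarrow> bool" where
  "down_closed K \<longleftrightarrow> (\<forall>I\<in>K. \<forall>J\<subseteq>I. J \<in> K)"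

lemma lookup_mult_nonzero:
  fixes p q :: int_mpoly
  assumes "lookup (p * q) a \<noteq> 0"
  obtains s t where "lookup p s \<noteq> 0" "lookup q t \<noteq> 0" "a = s + t"
proof -
  have "a \<in> keys (p * q)"
    using assms by (simp add: in_keys_iff)
  then obtain s t where "a = s + t" "s \<in> keys p" "t \<in> keys q"
    using keys_mult[of p q] by blast
  then show ?thesis
    by (intro that[of s t]) (simp_all add: in_keys_iff)
qed

text \<open>A multiple of a monomial has a larger support, and a set containing a non-face is a
  non-face because \<open>K\<close> is closed downwards.\<close>

lemma red_mult_zero:
  assumes K: "down_closed K" and p: "red K p = 0"
  shows "red K (r * p) = 0"
proof (rule poly_mapping_eqI)
  fix t
  have "lookup (r * p) t = 0" if t: "keys t \<in> K"
  proof (rule ccontr)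
    assume "lookup (r * p) t \<noteq> 0"
    then obtain u v where uv: "lookup p v \<noteq> 0" "t = u + v"
      by (rule lookup_mult_nonzero)
    have "keys v \<in> K"
      using K t uv(2) by (auto simp: down_closed_def keys_add_nat)
    then show False
      using uv(1) lookup_red[of K p v] p by simp
  qed
  then show "lookup (red K (r * p)) t = lookup 0 t"
    by simp
qed

lemma red_mult_red:
  assumes "down_closed K"
  shows "red K (r * red K p) = red K (r * p)"
proof -
  have "red K (r * (p - red K p)) = 0"
    by (rule red_mult_zero[OF assms]) (simp add: red_diff)
  then show ?thesis
    by (simp add: right_diff_distrib red_diff)
qed

definition hom_chains :: "nat \<Rightarrow> 'b set \<Rightarrow> ('b \<Rightarrow> nat) \<Rightarrow> nat \<Rightarrow> ('b \<Rightarrow>\<^sub>0 int_mpoly) set" where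
  "hom_chains m B \<delta> k = {c. \<forall>b a. lookup (lookup c b) a \<noteq> 0 \<longrightarrow>
     b \<in> B \<and> keys a \<subseteq> {1..m} \<and> \<delta> b + 2 * mdeg a = k}"

definition nf_grading :: "nat set set \<Rightarrow> nat \<Rightarrow> int_mpoly set" where
  "nf_grading K k = {p. \<forall>a. lookup p a \<noteq> 0 \<longrightarrow> keys a \<in> K \<and> 2 * mdeg a = k}"

text \<open>The module homomorphism to \<int>[K] with prescribed values on the basis, computed on
  normal forms: reducing each product takes the place of calculating with residue classes.\<close>

definition aug_of :: "nat set set \<Rightarrow> ('b \<Rightarrow> int_mpoly) \<Rightarrow> ('b \<Rightarrow>\<^sub>0 int_mpoly) \<Rightarrow> int_mpoly" where
  "aug_of K ag c = (\<Sum>b\<in>keys c. red K (lookup c b * ag b))"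

lemma hom_chains_diff: "x \<in> hom_chains m B \<delta> k \<Longrightarrow> y \<in> hom_chains m B \<delta> k \<Longrightarrow> x - y \<in> hom_chains m B \<delta> k"
  unfolding hom_chains_def
proof (intro CollectI allI impI)
  fix b a
  assume x: "x \<in> {c. \<forall>b a. lookup (lookup c b) a \<noteq> 0 \<longrightarrow>
      b \<in> B \<and> keys a \<subseteq> {1..m} \<and> \<delta> b + 2 * mdeg a = k}"
    and y: "y \<in> {c. \<forall>b a. lookup (lookup c b) a \<noteq> 0 \<longrightarrow>
      b \<in> B \<and> keys a \<subseteq> {1..m} \<and> \<delta> b + 2 * mdeg a = k}"
    and "lookup (lookup (x - y) b) a \<noteq> 0"
  then have "lookup (lookup x b) a \<noteq> 0 \<or> lookup (lookup y b) a \<noteq> 0"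
    by (auto simp: lookup_minus)
  then show "b \<in> B \<and> keys a \<subseteq> {1..m} \<and> \<delta> b + 2 * mdeg a = k"
    using x y by blast
qed

lemma keys_hom_chains:
  assumes "c \<in> hom_chains m B \<delta> k"
  shows "keys c \<subseteq> B"
proof
  fix b assume "b \<in> keys c"
  then have "lookup c b \<noteq> 0"
    by (simp add: in_keys_iff)
  then obtain a where "lookup (lookup c b) a \<noteq> 0"
    by (metis poly_mapping_eqI lookup_zero)
  then show "b \<in> B"
    using assms by (auto simp: hom_chains_def)
qed

lemma bas_hom_chains: "b \<in> B \<Longrightarrow> bas b \<in> hom_chains m B \<delta> (\<delta> b)"
  by (auto simp: hom_chains_def lookup_single when_def lookup_one split: if_splits)

lemma lookup_lin_nonzero:
  fixes f :: "'b \<Rightarrow> 'd \<Rightarrow>\<^sub>0 int_mpoly"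
  assumes "lookup (lookup (lin f c) d) a \<noteq> 0"
  obtains b s t where "lookup (lookup c b) s \<noteq> 0"
    "lookup (lookup (f b) d) t \<noteq> 0" "a = s + t"
proof -
  have "(\<Sum>b\<in>keys c. lookup (lookup c b * lookup (f b) d) a) \<noteq> 0"
    using assms by (simp add: lookup_lin lookup_sum)
  then obtain b where "lookup (lookup c b * lookup (f b) d) a \<noteq> 0"
    by (meson sum.neutral)
  then show ?thesis
    using that by (rule lookup_mult_nonzero)
qed

lemma lin_hom_chains:
  assumes c: "c \<in> hom_chains m B \<delta> k" and f: "\<And>b. b \<in> B \<Longrightarrow> f b \<in> hom_chains m B' \<delta>' (\<delta> b)"
  shows "lin f c \<in> hom_chains m B' \<delta>' k"
  unfolding hom_chains_def
proof (intro CollectI allI impI)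
  fix d a assume "lookup (lookup (lin f c) d) a \<noteq> 0"
  then obtain b s t where bst: "lookup (lookup c b) s \<noteq> 0"
    "lookup (lookup (f b) d) t \<noteq> 0" "a = s + t"
    by (rule lookup_lin_nonzero)
  then have 1: "b \<in> B" "keys s \<subseteq> {1..m}" "\<delta> b + 2 * mdeg s = k"
    using c by (auto simp: hom_chains_def)
  then have "d \<in> B'" "keys t \<subseteq> {1..m}" "\<delta>' d + 2 * mdeg t = \<delta> b"
    using f[OF 1(1)] bst(2) by (auto simp: hom_chains_def)
  then show "d \<in> B' \<and> keys a \<subseteq> {1..m} \<and> \<delta>' d + 2 * mdeg a = k"
    using 1 bst(3) by (auto simp: keys_add_nat mdeg_add)
qed

lemma aug_of_superset:
  assumes "finite A" "keys c \<subseteq> A"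
  shows "aug_of K ag c = (\<Sum>b\<in>A. red K (lookup c b * ag b))"
  unfolding aug_of_def using assms by (intro sum.mono_neutral_left) (auto simp: in_keys_iff)

lemma aug_of_0 [simp]: "aug_of K ag 0 = 0"
  by (simp add: aug_of_def)

lemma aug_of_add: "aug_of K ag (c + d) = aug_of K ag c + aug_of K ag d"
  using Poly_Mapping.keys_add[of c d]
  by (simp add: aug_of_superset[of "keys c \<union> keys d"] lookup_add
      distrib_right red_add sum.distrib)

lemma aug_of_smul:
  assumes "down_closed K"
  shows "aug_of K ag (smul r c) = red K (r * aug_of K ag c)"
proof -
  have "aug_of K ag (smul r c) = (\<Sum>b\<in>keys c. red K (r * (lookup c b * ag b)))"
    by (subst aug_of_superset[OF finite_keys keys_smul[of r c]]) (simp add: mult.assoc)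
  also have "\<dots> = (\<Sum>b\<in>keys c. red K (r * red K (lookup c b * ag b)))"
    by (simp add: red_mult_red[OF assms])
  also have "\<dots> = red K (r * aug_of K ag c)"
    by (simp add: aug_of_def sum_distrib_left red_sum)
  finally show ?thesis .
qed

lemma aug_of_sum: "aug_of K ag (sum f A) = (\<Sum>a\<in>A. aug_of K ag (f a))"
  by (induction A rule: infinite_finite_induct) (simp_all add: aug_of_add)

lemma aug_of_uminus: "aug_of K ag (- c) = - aug_of K ag c"
  by (simp add: aug_of_def red_uminus sum_negf)

lemma aug_of_diff: "aug_of K ag (c - d) = aug_of K ag c - aug_of K ag d"
  using aug_of_add[of K ag c "- d"] by (simp add: aug_of_uminus)

lemma aug_of_bas [simp]: "aug_of K ag (bas b) = red K (ag b)"
  by (simp add: aug_of_def)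

lemma aug_of_lin:
  assumes "down_closed K"
  shows "aug_of K ag (lin f c) = aug_of K (\<lambda>b. aug_of K ag (f b)) c"
  unfolding lin_def aug_of_sum aug_of_smul[OF assms] by (simp add: aug_of_def[of K _ c])

lemma aug_of_cong: "(\<And>b. b \<in> keys c \<Longrightarrow> ag b = ag' b) \<Longrightarrow> aug_of K ag c = aug_of K ag' c"
  unfolding aug_of_def by (intro sum.cong) auto

lemma nf_grading_red: "p \<in> nf_grading K k \<Longrightarrow> red K p = p"
  by (intro poly_mapping_eqI) (auto simp: nf_grading_def)


subsection \<open>Comparison of resolutions\<close>

text \<open>Exactness is demanded degree by degree on homogeneous chains. This is what comparison
  maps use, as basis elements are homogeneous, and it suits the Koszul complex, whose exactness is
  proved by an induction bounded by the degree. The basis type is free, so that both the chosen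
  resolution and the Koszul resolution are instances.\<close>

definition based_resolution :: "nat \<Rightarrow> nat set set \<Rightarrow> (nat \<Rightarrow> 'b set) \<Rightarrow> (nat \<Rightarrow> 'b \<Rightarrow> nat) \<Rightarrow>
    (nat \<Rightarrow> 'b \<Rightarrow> 'b \<Rightarrow>\<^sub>0 int_mpoly) \<Rightarrow> ('b \<Rightarrow> int_mpoly) \<Rightarrow> bool" where
  "based_resolution m K B \<delta> d ag \<longleftrightarrow>
    (\<forall>n. \<forall>b\<in>B (Suc n). d (Suc n) b \<in> hom_chains m (B n) (\<delta> n) (\<delta> (Suc n) b)) \<and>
    (\<forall>n. \<forall>b\<in>B (Suc (Suc n)). lin (d (Suc n)) (d (Suc (Suc n)) b) = 0) \<and>
    (\<forall>n k. \<forall>z\<in>hom_chains m (B (Suc n)) (\<delta> (Suc n)) k. lin (d (Suc n)) z = 0 \<longrightarrow>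
      (\<exists>y\<in>hom_chains m (B (Suc (Suc n))) (\<delta> (Suc (Suc n))) k. lin (d (Suc (Suc n))) y = z)) \<and>
    (\<forall>b\<in>B 0. ag b \<in> nf_grading K (\<delta> 0 b)) \<and>
    (\<forall>b\<in>B (Suc 0). aug_of K ag (d (Suc 0) b) = 0) \<and>
    (\<forall>k. \<forall>x\<in>nf_grading K k. \<exists>c\<in>hom_chains m (B 0) (\<delta> 0) k. aug_of K ag c = x) \<and>
    (\<forall>k. \<forall>c\<in>hom_chains m (B 0) (\<delta> 0) k. aug_of K ag c = 0 \<longrightarrow>
      (\<exists>y\<in>hom_chains m (B (Suc 0)) (\<delta> (Suc 0)) k. lin (d (Suc 0)) y = c))"

lemma based_resolutionD:
  assumes "based_resolution m K B \<delta> d ag"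
  shows "\<And>n b. b \<in> B (Suc n) \<Longrightarrow> d (Suc n) b \<in> hom_chains m (B n) (\<delta> n) (\<delta> (Suc n) b)"
    "\<And>n b. b \<in> B (Suc (Suc n)) \<Longrightarrow> lin (d (Suc n)) (d (Suc (Suc n)) b) = 0"
    "\<And>n k z. z \<in> hom_chains m (B (Suc n)) (\<delta> (Suc n)) k \<Longrightarrow> lin (d (Suc n)) z = 0 \<Longrightarrow>
      \<exists>y\<in>hom_chains m (B (Suc (Suc n))) (\<delta> (Suc (Suc n))) k. lin (d (Suc (Suc n))) y = z"
    "\<And>b. b \<in> B 0 \<Longrightarrow> ag b \<in> nf_grading K (\<delta> 0 b)"
    "\<And>b. b \<in> B (Suc 0) \<Longrightarrow> aug_of K ag (d (Suc 0) b) = 0"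
    "\<And>k x. x \<in> nf_grading K k \<Longrightarrow> \<exists>c\<in>hom_chains m (B 0) (\<delta> 0) k. aug_of K ag c = x"
    "\<And>k c. c \<in> hom_chains m (B 0) (\<delta> 0) k \<Longrightarrow> aug_of K ag c = 0 \<Longrightarrow>
      \<exists>y\<in>hom_chains m (B (Suc 0)) (\<delta> (Suc 0)) k. lin (d (Suc 0)) y = c"
  using assms unfolding based_resolution_def by simp_all

text \<open>The usual lifting from free modules; taking the homogeneous chains in the degree of
  \<open>b\<close> as carrier keeps the comparison map graded.\<close>

lemma based_resolution_chain_map:
  assumes K: "down_closed K" and F: "based_resolution m K B \<delta> d ag" and G: "based_resolution m K B' \<delta>' d' ag'"
  obtains f where "\<And>n b. b \<in> B n \<Longrightarrow> f n b \<in> hom_chains m (B' n) (\<delta>' n) (\<delta> n b)"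
    "\<And>n b. b \<in> B (Suc n) \<Longrightarrow> lin (d' (Suc n)) (f (Suc n) b) = lin (f n) (d (Suc n) b)"
    "\<And>b. b \<in> B 0 \<Longrightarrow> aug_of K ag' (f 0 b) = ag b"
proof -
  note F = based_resolutionD[OF F] and G = based_resolutionD[OF G]
  have "\<forall>b\<in>B 0. \<exists>c. c \<in> hom_chains m (B' 0) (\<delta>' 0) (\<delta> 0 b) \<and> aug_of K ag' c = ag b"
    using F(4) G(6) by blast
  from bchoice[OF this] obtain f0 where f0: "\<And>b. b \<in> B 0 \<Longrightarrow> f0 b \<in> hom_chains m (B' 0) (\<delta>' 0) (\<delta> 0 b)"
    "\<And>b. b \<in> B 0 \<Longrightarrow> aug_of K ag' (f0 b) = ag b"
    by blast
  obtain f where f: "f 0 = f0" "\<And>n b. b \<in> B n \<Longrightarrow> f n b \<in> hom_chains m (B' n) (\<delta>' n) (\<delta> n b)"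
    "\<And>n b. b \<in> B (Suc n) \<Longrightarrow> lin (d' (Suc n)) (f (Suc n) b) = lin (f n) (d (Suc n) b)"
  proof (rule chain_map_lift[of B d f0 "\<lambda>n b k. hom_chains m (B' k) (\<delta>' k) (\<delta> n b)" d'])
    fix n b
    show "keys (d (Suc n) b) \<subseteq> B n" if "b \<in> B (Suc n)"
      by (rule keys_hom_chains[OF F(1)[OF that]])
    show "\<exists>y\<in>hom_chains m (B' (Suc 0)) (\<delta>' (Suc 0)) (\<delta> (Suc 0) b). lin (d' (Suc 0)) y = lin f0 (d (Suc 0) b)"
      if b: "b \<in> B (Suc 0)"
    proof (rule G(7))
      show "lin f0 (d (Suc 0) b) \<in> hom_chains m (B' 0) (\<delta>' 0) (\<delta> (Suc 0) b)"
        by (rule lin_hom_chains[OF F(1)[OF b] f0(1)])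
      have "aug_of K ag' (lin f0 (d (Suc 0) b)) = aug_of K ag (d (Suc 0) b)"
        unfolding aug_of_lin[OF K] using f0(2) keys_hom_chains[OF F(1)[OF b]] by (intro aug_of_cong) auto
      then show "aug_of K ag' (lin f0 (d (Suc 0) b)) = 0"
        using F(5)[OF b] by simp
    qed
    show "lin y (d (Suc n) b) \<in> hom_chains m (B' n) (\<delta>' n) (\<delta> (Suc n) b)"
      if "b \<in> B (Suc n)" "\<And>b'. b' \<in> B n \<Longrightarrow> y b' \<in> hom_chains m (B' n) (\<delta>' n) (\<delta> n b')" for y
      by (rule lin_hom_chains[OF F(1)[OF that(1)] that(2)])
  qed (use F(2) f0(1) G(3) in auto)
  show thesis
    using f f0(2) by (intro that[of f]) auto
qed

lemma based_resolution_null_homotopy: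
  assumes K: "down_closed K" and F: "based_resolution m K B \<delta> d ag" and G: "based_resolution m K B' \<delta>' d' ag'"
    and g: "\<And>n b. b \<in> B n \<Longrightarrow> g n b \<in> hom_chains m (B' n) (\<delta>' n) (\<delta> n b)"
    "\<And>n b. b \<in> B (Suc n) \<Longrightarrow> lin (d' (Suc n)) (g (Suc n) b) = lin (g n) (d (Suc n) b)"
    "\<And>b. b \<in> B 0 \<Longrightarrow> aug_of K ag' (g 0 b) = 0"
  obtains h where "\<And>n b. b \<in> B n \<Longrightarrow> h n b \<in> hom_chains m (B' (Suc n)) (\<delta>' (Suc n)) (\<delta> n b)"
    "\<And>b. b \<in> B 0 \<Longrightarrow> g 0 b = lin (d' (Suc 0)) (h 0 b)"
    "\<And>n b. b \<in> B (Suc n) \<Longrightarrow> g (Suc n) b = lin (h n) (d (Suc n) b) + lin (d' (Suc (Suc n))) (h (Suc n) b)"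
proof -
  note F = based_resolutionD[OF F] and G = based_resolutionD[OF G]
  obtain h where h: "\<And>n b. b \<in> B n \<Longrightarrow> h n b \<in> hom_chains m (B' (Suc n)) (\<delta>' (Suc n)) (\<delta> n b)"
    "\<And>b. b \<in> B 0 \<Longrightarrow> g 0 b - lin (d' (Suc 0)) (h 0 b) \<in> {0}"
    "\<And>n b. b \<in> B (Suc n) \<Longrightarrow> g (Suc n) b - lin (h n) (d (Suc n) b) - lin (d' (Suc (Suc n))) (h (Suc n) b) \<in> {0}"
  proof (rule null_homotopy_lift[of B d d' g "\<lambda>n b k. hom_chains m (B' k) (\<delta>' k) (\<delta> n b)" "\<lambda>n. {0}"])
    fix n b
    show "keys (d (Suc n) b) \<subseteq> B n" if "b \<in> B (Suc n)"
      by (rule keys_hom_chains[OF F(1)[OF that]])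
    show "\<exists>y\<in>hom_chains m (B' (Suc 0)) (\<delta>' (Suc 0)) (\<delta> 0 b). g 0 b - lin (d' (Suc 0)) y \<in> {0}" if "b \<in> B 0"
      using G(7)[OF g(1)[OF that] g(3)[OF that]] by force
    show "lin y (d (Suc n) b) \<in> hom_chains m (B' (Suc n)) (\<delta>' (Suc n)) (\<delta> (Suc n) b)"
      if "b \<in> B (Suc n)" "\<And>b'. b' \<in> B n \<Longrightarrow> y b' \<in> hom_chains m (B' (Suc n)) (\<delta>' (Suc n)) (\<delta> n b')" for y
      by (rule lin_hom_chains[OF F(1)[OF that(1)] that(2)])
    show "\<exists>y\<in>hom_chains m (B' (Suc (Suc n))) (\<delta>' (Suc (Suc n))) (\<delta> (Suc n) b). z - lin (d' (Suc (Suc n))) y \<in> {0}"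
      if "z \<in> hom_chains m (B' (Suc n)) (\<delta>' (Suc n)) (\<delta> (Suc n) b)" "lin (d' (Suc n)) z \<in> {0}" for z
      using G(3)[OF that(1)] that(2) by auto
    show "lin y (d (Suc n) b) \<in> {0}" if b: "b \<in> B (Suc n)" and y: "\<And>b'. b' \<in> B n \<Longrightarrow> y b' \<in> {0}" for y
    proof -
      have "lin y (d (Suc n) b) = lin (\<lambda>_. 0) (d (Suc n) b)"
        using y keys_hom_chains[OF F(1)[OF b]] by (intro lin_cong) auto
      then show ?thesis
        by simp
    qed
  qed (use F(2) g hom_chains_diff in auto)
  show thesis
  proof (rule that[of h])
    show "g 0 b = lin (d' (Suc 0)) (h 0 b)" if "b \<in> B 0" for b
      using h(2)[OF that] by simp
    show "g (Suc n) b = lin (h n) (d (Suc n) b) + lin (d' (Suc (Suc n))) (h (Suc n) b)" if "b \<in> B (Suc n)" for n b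
      using h(3)[OF that] by (simp add: algebra_simps)
  qed (rule h(1))
qed


subsection \<open>Reduction modulo the augmentation ideal\<close>

lemma augmentation_0 [simp]: "augmentation 0 = 0" and augmentation_1 [simp]: "augmentation 1 = 1"
  by (simp_all add: augmentation_def)

lemma augmentation_add: "augmentation (p + q) = augmentation p + augmentation q"
  by (simp add: augmentation_def lookup_add)

lemma add_eq_0_nat_poly: "s + t = (0 :: 'a \<Rightarrow>\<^sub>0 nat) \<longleftrightarrow> s = 0 \<and> t = 0"
  by (auto simp: poly_mapping_eq_iff fun_eq_iff lookup_add)

lemma zero_eq_add_nat_poly: "(0 :: 'a \<Rightarrow>\<^sub>0 nat) = s + t \<longleftrightarrow> s = 0 \<and> t = 0"
  by (metis add_eq_0_nat_poly)

text \<open>Exponents are natural numbers, so a product has a constant term only through the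
  constant terms of its factors.\<close>

lemma augmentation_mult: "augmentation (p * q) = augmentation p * augmentation q"
proof -
  have "augmentation (p * q) = (\<Sum>s. lookup p s * (\<Sum>t. lookup q t when 0 = s + t))"
    by (simp add: augmentation_def lookup_mult)
  also have "\<dots> = (\<Sum>s. lookup p s * (\<Sum>t. (lookup q t when t = 0) when s = 0))"
    by (intro Sum_any.cong arg_cong2[where f = "(*)"] refl)
      (auto simp: when_def zero_eq_add_nat_poly)
  also have "\<dots> = (\<Sum>s. (lookup p s * lookup q 0) when s = 0)"
    by (intro Sum_any.cong) (auto simp: when_def)
  also have "\<dots> = augmentation p * augmentation q"
    by (simp add: augmentation_def)
  finally show ?thesis .
qed

lemma augmentation_sum: "augmentation (sum f A) = (\<Sum>a\<in>A. augmentation (f a))"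
  by (induction A rule: infinite_finite_induct) (simp_all add: augmentation_add)

text \<open>Tensoring with \<int> in coordinates: each coefficient is replaced by its constant
  term.\<close>

definition mod_aug :: "('b \<Rightarrow>\<^sub>0 int_mpoly) \<Rightarrow> 'b \<Rightarrow>\<^sub>0 int" where
  "mod_aug c = Poly_Mapping.map augmentation c"

lemma lookup_mod_aug [simp]: "lookup (mod_aug c) b = augmentation (lookup c b)"
  by (simp add: mod_aug_def map.rep_eq when_def)

lemma mod_aug_0 [simp]: "mod_aug 0 = 0"
  by (intro poly_mapping_eqI) simp

lemma mod_aug_add: "mod_aug (c + d) = mod_aug c + mod_aug d"
  by (intro poly_mapping_eqI) (simp add: lookup_add augmentation_add)

lemma mod_aug_bas [simp]: "mod_aug (bas b) = bas b"
  by (intro poly_mapping_eqI) (simp add: lookup_single when_def)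

lemma keys_mod_aug: "keys (mod_aug c) \<subseteq> keys c"
  by (auto simp: in_keys_iff)

lemma mod_aug_lin: "mod_aug (lin f c) = lin (\<lambda>b. mod_aug (f b)) (mod_aug c)"
  by (intro poly_mapping_eqI)
    (simp add: lookup_lin_superset[OF finite_keys keys_mod_aug] lookup_lin[of f] augmentation_sum augmentation_mult)

text \<open>Only constant coefficients survive, and a constant adds nothing to the degree, so just
  the basis elements of degree exactly \<open>k\<close> remain.\<close>

lemma keys_mod_aug_hom_chains:
  assumes "c \<in> hom_chains m B \<delta> k"
  shows "keys (mod_aug c) \<subseteq> {b\<in>B. \<delta> b = k}"
proof
  fix b assume "b \<in> keys (mod_aug c)"
  then have "lookup (lookup c b) 0 \<noteq> 0"
    by (simp add: in_keys_iff augmentation_def)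
  then have "b \<in> B \<and> keys (0 :: nat \<Rightarrow>\<^sub>0 nat) \<subseteq> {1..m} \<and> \<delta> b + 2 * mdeg 0 = k"
    using assms unfolding hom_chains_def by blast
  then show "b \<in> {b\<in>B. \<delta> b = k}"
    by simp
qed

section \<open>Homology ranks of a resolution tensored with the integers\<close>

definition cycle_chains where
  "cycle_chains B \<delta> d i k = {c :: 'b \<Rightarrow>\<^sub>0 int. keys c \<subseteq> {b\<in>B i. \<delta> i b = k} \<and>
     (i > 0 \<longrightarrow> lin (\<lambda>b. mod_aug (d i b)) c = 0)}"

definition boundary_chains where
  "boundary_chains B \<delta> d i k = lin (\<lambda>b. mod_aug (d (Suc i) b)) `
     {c :: 'b \<Rightarrow>\<^sub>0 int. keys c \<subseteq> {b\<in>B (Suc i). \<delta> (Suc i) b = k}}"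

definition hrank :: "(nat \<Rightarrow> 'b set) \<Rightarrow> (nat \<Rightarrow> 'b \<Rightarrow> nat) \<Rightarrow> (nat \<Rightarrow> 'b \<Rightarrow> 'b \<Rightarrow>\<^sub>0 int_mpoly) \<Rightarrow> nat \<Rightarrow> nat \<Rightarrow> enat" where
  "hrank B \<delta> d i k = qrank (lookup ` cycle_chains B \<delta> d i k) (lookup ` boundary_chains B \<delta> d i k)"

lemma fun_subgroup_lookup_image:
  assumes "0 \<in> C" "\<And>x y. x \<in> C \<Longrightarrow> y \<in> C \<Longrightarrow> x - y \<in> C"
  shows "fun_subgroup (lookup ` C :: ('b \<Rightarrow> int) set)"
  unfolding fun_subgroup_def
proof (intro conjI ballI)
  show "(\<lambda>b. 0) \<in> lookup ` C"
    using assms(1) by (intro image_eqI[of _ _ 0]) (auto simp: fun_eq_iff)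
  fix u v assume "u \<in> lookup ` C" "v \<in> lookup ` C"
  then obtain x y where "x \<in> C" "y \<in> C" "u = lookup x" "v = lookup y"
    by auto
  then show "(\<lambda>b. u b - v b) \<in> lookup ` C"
    using assms(2) by (intro image_eqI[of _ _ "x - y"]) (auto simp: fun_eq_iff lookup_minus)
qed

lemma fun_subgroup_cycle_chains: "fun_subgroup (lookup ` cycle_chains B \<delta> d i k)"
  by (rule fun_subgroup_lookup_image) (use keys_diff_subset in \<open>auto simp: cycle_chains_def lin_diff\<close>)

lemma fun_subgroup_boundary_chains: "fun_subgroup (lookup ` boundary_chains B \<delta> d i k)"
proof (rule fun_subgroup_lookup_image)
  show "0 \<in> boundary_chains B \<delta> d i k"
    by (auto simp: boundary_chains_def intro!: image_eqI[of _ _ 0])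
  fix x y assume "x \<in> boundary_chains B \<delta> d i k" "y \<in> boundary_chains B \<delta> d i k"
  then obtain x' y' where "keys x' \<subseteq> {b\<in>B (Suc i). \<delta> (Suc i) b = k}"
    "keys y' \<subseteq> {b\<in>B (Suc i). \<delta> (Suc i) b = k}"
    "x = lin (\<lambda>b. mod_aug (d (Suc i) b)) x'" "y = lin (\<lambda>b. mod_aug (d (Suc i) b)) y'"
    unfolding boundary_chains_def by blast
  then show "x - y \<in> boundary_chains B \<delta> d i k"
    unfolding boundary_chains_def by (intro image_eqI[of _ _ "x' - y'"]) (simp_all add: lin_diff keys_diff_subset)
qed

text \<open>The comparison maps and the homotopy from their composite to the identity preserve the
  degree, hence survive reduction, and pushing cycles forward along \<open>f\<close> reflects
  boundaries. Applied in both directions this makes the rank independent of the resolution.\<close>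

lemma hrank_le:
  assumes K: "down_closed K" and F: "based_resolution m K B \<delta> d ag" and G: "based_resolution m K B' \<delta>' d' ag'"
  shows "hrank B \<delta> d i k \<le> hrank B' \<delta>' d' i k"
proof -
  note F' = based_resolutionD[OF F] and G' = based_resolutionD[OF G]
  obtain f where f: "\<And>n b. b \<in> B n \<Longrightarrow> f n b \<in> hom_chains m (B' n) (\<delta>' n) (\<delta> n b)"
    "\<And>n b. b \<in> B (Suc n) \<Longrightarrow> lin (d' (Suc n)) (f (Suc n) b) = lin (f n) (d (Suc n) b)"
    "\<And>b. b \<in> B 0 \<Longrightarrow> aug_of K ag' (f 0 b) = ag b"
    by (rule based_resolution_chain_map[OF K F G]) blast
  obtain g where g: "\<And>n b. b \<in> B' n \<Longrightarrow> g n b \<in> hom_chains m (B n) (\<delta> n) (\<delta>' n b)"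
    "\<And>n b. b \<in> B' (Suc n) \<Longrightarrow> lin (d (Suc n)) (g (Suc n) b) = lin (g n) (d' (Suc n) b)"
    "\<And>b. b \<in> B' 0 \<Longrightarrow> aug_of K ag (g 0 b) = ag' b"
    by (rule based_resolution_chain_map[OF K G F]) blast
  define \<xi> where "\<xi> n b = lin (g n) (f n b) - bas b" for n b
  have \<xi>_fun: "\<xi> n = (\<lambda>b. lin (g n) (f n b) - bas b)" for n
    by (simp add: \<xi>_def fun_eq_iff)
  obtain h where h: "\<And>n b. b \<in> B n \<Longrightarrow> h n b \<in> hom_chains m (B (Suc n)) (\<delta> (Suc n)) (\<delta> n b)"
    "\<And>b. b \<in> B 0 \<Longrightarrow> \<xi> 0 b = lin (d (Suc 0)) (h 0 b)"
    "\<And>n b. b \<in> B (Suc n) \<Longrightarrow> \<xi> (Suc n) b = lin (h n) (d (Suc n) b) + lin (d (Suc (Suc n))) (h (Suc n) b)"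
  proof (rule based_resolution_null_homotopy[OF K F F, of \<xi>])
    fix n b
    show "\<xi> n b \<in> hom_chains m (B n) (\<delta> n) (\<delta> n b)" if "b \<in> B n"
      unfolding \<xi>_def by (intro hom_chains_diff lin_hom_chains[OF f(1)[OF that] g(1)] bas_hom_chains that)
    show "lin (d (Suc n)) (\<xi> (Suc n) b) = lin (\<xi> n) (d (Suc n) b)" if b: "b \<in> B (Suc n)"
    proof -
      have "lin (d (Suc n)) (lin (g (Suc n)) (f (Suc n) b)) = lin (g n) (lin (d' (Suc n)) (f (Suc n) b))"
        unfolding lin_lin using g(2) keys_hom_chains[OF f(1)[OF b]] by (intro lin_cong) auto
      then show ?thesis
        unfolding \<xi>_fun by (simp add: lin_diff lin_fun_diff f(2)[OF b] lin_lin)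
    qed
    show "aug_of K ag (\<xi> 0 b) = 0" if b: "b \<in> B 0"
    proof -
      have "aug_of K ag (lin (g 0) (f 0 b)) = aug_of K ag' (f 0 b)"
        unfolding aug_of_lin[OF K] using g(3) keys_hom_chains[OF f(1)[OF b]] by (intro aug_of_cong) auto
      then show ?thesis
        using f(3)[OF b] nf_grading_red[OF F'(4)[OF b]] by (simp add: \<xi>_def aug_of_diff)
    qed
  qed blast
  define f' where "f' = (\<lambda>n b. mod_aug (f n b))"
  define g' where "g' = (\<lambda>n b. mod_aug (g n b))"
  define h' where "h' = (\<lambda>n b. mod_aug (h n b))"
  define e where "e = (\<lambda>n b. mod_aug (d n b))"
  define e' where "e' = (\<lambda>n b. mod_aug (d' n b))"
  have lin_mod: "lin (\<lambda>b. mod_aug (p b)) (lin (\<lambda>b. mod_aug (q b)) c) = lin (\<lambda>b. mod_aug (lin p (q b))) c"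
    for p :: "'d \<Rightarrow> 'f \<Rightarrow>\<^sub>0 int_mpoly" and q :: "'e \<Rightarrow> 'd \<Rightarrow>\<^sub>0 int_mpoly" and c
    by (simp add: lin_lin mod_aug_lin)
  have f_deg: "keys (lin (f' n) c) \<subseteq> {b\<in>B' n. \<delta>' n b = k}"
    if "keys c \<subseteq> {b\<in>B n. \<delta> n b = k}" for n c
    unfolding f'_def using that keys_mod_aug_hom_chains[OF f(1)] by (intro keys_lin_subset) blast
  have g_deg: "keys (lin (g' n) c) \<subseteq> {b\<in>B n. \<delta> n b = k}"
    if "keys c \<subseteq> {b\<in>B' n. \<delta>' n b = k}" for n c
    unfolding g'_def using that keys_mod_aug_hom_chains[OF g(1)] by (intro keys_lin_subset) blast
  have h_deg: "keys (lin (h' n) c) \<subseteq> {b\<in>B (Suc n). \<delta> (Suc n) b = k}"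
    if "keys c \<subseteq> {b\<in>B n. \<delta> n b = k}" for n c
    unfolding h'_def using that keys_mod_aug_hom_chains[OF h(1)] by (intro keys_lin_subset) blast
  have f_chain: "lin (e' (Suc n)) (lin (f' (Suc n)) c) = lin (f' n) (lin (e (Suc n)) c)"
    if "keys c \<subseteq> B (Suc n)" for n c
    unfolding e_def e'_def f'_def lin_mod using that f(2) by (intro lin_cong) auto
  have g_chain: "lin (e (Suc n)) (lin (g' (Suc n)) c) = lin (g' n) (lin (e' (Suc n)) c)"
    if "keys c \<subseteq> B' (Suc n)" for n c
    unfolding e_def e'_def g'_def lin_mod using that g(2) by (intro lin_cong) auto
  have lookup_inj: "lookup x = lookup y \<longleftrightarrow> x = y" for x y :: "'z \<Rightarrow>\<^sub>0 int"
    by (rule lookup_inject)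
  show ?thesis
    unfolding hrank_def
  proof (rule qrank_inj_le[where \<phi> = "\<lambda>u. lookup (lin (f' i) (Abs_poly_mapping u))"])
    show "fun_subgroup (lookup ` cycle_chains B \<delta> d i k)"
      by (rule fun_subgroup_cycle_chains)
    show "(\<lambda>b. 0) \<in> lookup ` boundary_chains B' \<delta>' d' i k"
      by (rule fun_subgroup_zero[OF fun_subgroup_boundary_chains])
    have abs: "Abs_poly_mapping (lookup c) = c" for c :: "'a \<Rightarrow>\<^sub>0 int"
      by (rule lookup_inverse)
    fix u assume "u \<in> lookup ` cycle_chains B \<delta> d i k"
    then obtain c where c: "c \<in> cycle_chains B \<delta> d i k" "u = lookup c"
      by auto
    {
      fix v assume "v \<in> lookup ` cycle_chains B \<delta> d i k"
      then obtain c' where c': "v = lookup c'"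
        by auto
      have eq: "(\<lambda>b. u b - v b) = lookup (c - c')"
        by (simp add: c c' fun_eq_iff lookup_minus)
      show "lookup (lin (f' i) (Abs_poly_mapping (\<lambda>b. u b - v b)))
          = (\<lambda>b. lookup (lin (f' i) (Abs_poly_mapping u)) b - lookup (lin (f' i) (Abs_poly_mapping v)) b)"
        unfolding eq by (simp add: c c' abs lin_diff lookup_minus fun_eq_iff)
    }
    have ck: "keys c \<subseteq> {b\<in>B i. \<delta> i b = k}" "keys c \<subseteq> B i"
      using c(1) by (auto simp: cycle_chains_def)
    have cyc: "lin (e (Suc j)) c = 0" if "i = Suc j" for j
      using c(1) that by (auto simp: cycle_chains_def e_def)
    have "lin (e' (Suc j)) (lin (f' (Suc j)) c) = 0" if "i = Suc j" for j
      using f_chain[of c j] ck cyc[OF that] that by simp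
    then have "lin (f' i) c \<in> cycle_chains B' \<delta>' d' i k"
      using f_deg[OF ck(1)] by (cases i) (auto simp: cycle_chains_def e'_def)
    then show "lookup (lin (f' i) (Abs_poly_mapping u)) \<in> lookup ` cycle_chains B' \<delta>' d' i k"
      by (simp add: c abs)
    assume "lookup (lin (f' i) (Abs_poly_mapping u)) \<in> lookup ` boundary_chains B' \<delta>' d' i k"
    then obtain y where y: "keys y \<subseteq> {b\<in>B' (Suc i). \<delta>' (Suc i) b = k}"
      "lin (f' i) c = lin (e' (Suc i)) y"
      by (auto simp: c abs lookup_inj boundary_chains_def e'_def)
    have "lin (\<lambda>b. mod_aug (\<xi> i b)) c = lin (e (Suc i)) (lin (h' i) c)"
    proof (cases i)
      case 0
      then show ?thesis
        unfolding e_def h'_def lin_mod using ck(2) h(2) by (intro lin_cong) auto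
    next
      case (Suc j)
      have "lin (\<lambda>b. mod_aug (\<xi> i b)) c = lin (\<lambda>b. mod_aug (lin (h j) (d i b)) + mod_aug (lin (d (Suc i)) (h i b))) c"
        using ck(2) h(3) by (intro lin_cong) (auto simp: Suc mod_aug_add)
      also have "\<dots> = lin (h' j) (lin (e i) c) + lin (e (Suc i)) (lin (h' i) c)"
        by (simp add: lin_fun_add e_def h'_def lin_mod)
      finally show ?thesis
        using cyc[OF Suc] by (simp add: Suc)
    qed
    moreover have "lin (\<lambda>b. mod_aug (\<xi> i b)) c = lin (g' i) (lin (f' i) c) - c"
    proof -
      have "mod_aug (\<xi> i b) = mod_aug (lin (g i) (f i b)) - bas b" for b
        by (intro poly_mapping_eqI) (simp add: \<xi>_def lookup_minus augmentation_def lookup_single when_def lookup_one)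
      then show ?thesis
        by (simp add: lin_fun_diff g'_def f'_def lin_mod)
    qed
    \<comment> \<open>Since \<open>f\<close> sends \<open>c\<close> to a boundary, applying
      \<open>g\<close> and subtracting the homotopy term exhibits \<open>c\<close> as a
      boundary.\<close>
    ultimately have "c = lin (g' i) (lin (e' (Suc i)) y) - lin (e (Suc i)) (lin (h' i) c)"
      using y(2) by (simp add: algebra_simps)
    also have "lin (g' i) (lin (e' (Suc i)) y) = lin (e (Suc i)) (lin (g' (Suc i)) y)"
      by (rule g_chain[symmetric]) (use y(1) in auto)
    finally have "c = lin (e (Suc i)) (lin (g' (Suc i)) y - lin (h' i) c)"
      by (simp add: lin_diff)
    moreover have "keys (lin (g' (Suc i)) y - lin (h' i) c) \<subseteq> {b\<in>B (Suc i). \<delta> (Suc i) b = k}"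
      by (intro keys_diff_subset g_deg[OF y(1)] h_deg[OF ck(1)])
    ultimately have "c \<in> boundary_chains B \<delta> d i k"
      unfolding boundary_chains_def e_def by blast
    then show "u \<in> lookup ` boundary_chains B \<delta> d i k"
      by (simp add: c)
  qed
qed

section \<open>The Koszul resolution of a Stanley--Reisner ring\<close>

type_synonym kbasis = "nat set \<times> (nat \<Rightarrow>\<^sub>0 nat)"

text \<open>Over the integers, chains with polynomial coefficients have a basis of pairs of a basis
  element and a monomial. In these terms a contraction can be written down that is not linear over
  the polynomial ring.\<close>

definition flat :: "('b \<Rightarrow>\<^sub>0 int_mpoly) \<Rightarrow> 'b \<times> (nat \<Rightarrow>\<^sub>0 nat) \<Rightarrow>\<^sub>0 int" where
  "flat c = (\<Sum>b\<in>keys c. \<Sum>a\<in>keys (lookup c b).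
     single (b, a) (lookup (lookup c b) a))"

definition unflat :: "('b \<times> (nat \<Rightarrow>\<^sub>0 nat) \<Rightarrow>\<^sub>0 int) \<Rightarrow> 'b \<Rightarrow>\<^sub>0 int_mpoly" where
  "unflat z = (\<Sum>x\<in>keys z. single (fst x) (single (snd x) (lookup z x)))"

lemma lookup_flat: "lookup (flat c) (b, a) = lookup (lookup c b) a"
proof -
  have "lookup (flat c) (b, a) = (\<Sum>b'\<in>keys c. if b' = b
      then (\<Sum>a'\<in>keys (lookup c b'). if a' = a then lookup (lookup c b') a' else 0) else 0)"
    unfolding flat_def lookup_sum by (intro sum.cong refl) (auto simp: lookup_single when_def intro!: sum.neutral sum.cong)
  also have "\<dots> = lookup (lookup c b) a"
    by (simp add: in_keys_iff)
  finally show ?thesis .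
qed

lemma lookup_unflat: "lookup (lookup (unflat z) b) a = lookup z (b, a)"
proof -
  have "lookup (lookup (unflat z) b) a
      = (\<Sum>x\<in>keys z. if x = (b, a) then lookup z x else 0)"
    unfolding unflat_def lookup_sum by (intro sum.cong refl) (auto simp: lookup_single when_def prod_eq_iff)
  also have "\<dots> = lookup z (b, a)"
    by (simp add: in_keys_iff)
  finally show ?thesis .
qed

lemma mpoly_chain_eqI:
  fixes c d :: "'b \<Rightarrow>\<^sub>0 int_mpoly"
  assumes "\<And>b a. lookup (lookup c b) a = lookup (lookup d b) a"
  shows "c = d"
  using assms by (intro poly_mapping_eqI)

lemma unflat_flat [simp]: "unflat (flat c) = c"
  by (rule mpoly_chain_eqI) (simp add: lookup_unflat lookup_flat)

lemma unflat_eq_0_iff: "unflat z = 0 \<longleftrightarrow> z = 0"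
proof
  assume "unflat z = 0"
  then have "lookup z (b, a) = 0" for b a
    by (simp flip: lookup_unflat)
  then show "z = 0"
    by (intro poly_mapping_eqI) (metis lookup_zero surj_pair)
qed (simp add: unflat_def)

lemma unflat_0 [simp]: "unflat 0 = 0"
  by (simp add: unflat_eq_0_iff)

lemma unflat_add: "unflat (x + y) = unflat x + unflat y"
  by (rule mpoly_chain_eqI) (simp add: lookup_unflat lookup_add)

lemma unflat_diff: "unflat (x - y) = unflat x - unflat y"
  by (rule mpoly_chain_eqI) (simp add: lookup_unflat lookup_minus)

lemma unflat_sum: "unflat (sum f A) = (\<Sum>a\<in>A. unflat (f a))"
  by (induction A rule: infinite_finite_induct) (simp_all add: unflat_add)

lemma unflat_single [simp]: "unflat (single (b, a) n) = single b (single a n)"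
  by (simp add: unflat_def)

text \<open>An integral map that is compatible with multiplication by monomials is the flattened
  form of a map linear over the polynomial ring.\<close>

lemma unflat_lin:
  assumes "\<And>b a. unflat (Fd (b, a)) = smul (single a 1) (d b)"
  shows "unflat (lin Fd z) = lin d (unflat z)"
proof -
  have "lin d (unflat z) = (\<Sum>x\<in>keys z. smul (single (snd x) (lookup z x)) (d (fst x)))"
    by (simp add: unflat_def lin_sum)
  also have "\<dots> = (\<Sum>x\<in>keys z. unflat (smul (lookup z x) (Fd x)))"
  proof (rule sum.cong)
    fix x
    have "unflat (smul n y) = smul (single 0 n) (unflat y)" for n and y :: "'b \<times> (nat \<Rightarrow>\<^sub>0 nat) \<Rightarrow>\<^sub>0 int"
      by (rule mpoly_chain_eqI) (simp add: lookup_unflat flip: mult_map_scale_conv_mult, simp add: map.rep_eq when_def lookup_unflat)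
    moreover have "unflat (Fd x) = smul (single (snd x) 1) (d (fst x))"
      using assms[of "fst x" "snd x"] by simp
    ultimately show "smul (single (snd x) (lookup z x)) (d (fst x)) = unflat (smul (lookup z x) (Fd x))"
      by (simp add: smul_smul mult_single)
  qed simp
  also have "\<dots> = unflat (lin Fd z)"
    by (simp add: lin_def unflat_sum)
  finally show ?thesis
    by simp
qed

lemma unflat_hom_chains:
  "unflat z \<in> hom_chains m B \<delta> k \<longleftrightarrow>
    keys z \<subseteq> {(b, a). b \<in> B \<and> keys a \<subseteq> {1..m} \<and> \<delta> b + 2 * mdeg a = k}"
proof -
  have "unflat z \<in> hom_chains m B \<delta> k \<longleftrightarrow> (\<forall>b a. (b, a) \<in> keys z \<longrightarrow> b \<in> B \<and> keys a \<subseteq> {1..m} \<and> \<delta> b + 2 * mdeg a = k)"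
    unfolding hom_chains_def mem_Collect_eq lookup_unflat in_keys_iff by (rule refl)
  then show ?thesis
    by (simp only: subset_iff mem_Collect_eq split_paired_All prod.case)
qed

definition ev :: "nat \<Rightarrow> nat \<Rightarrow>\<^sub>0 nat" where
  "ev k = single k 1"

lemma lookup_ev: "lookup (ev k) i = (if i = k then 1 else 0)"
  by (simp add: ev_def lookup_single when_def)

lemma keys_ev [simp]: "keys (ev k) = {k}"
  by (simp add: ev_def)

lemma mdeg_ev [simp]: "mdeg (ev k) = 1"
  by (simp add: ev_def mdeg_def)


text \<open>The pair \<open>(I, t)\<close> stands for \<open>u\<^sub>I \<otimes> v\<^sup>t\<close>, and the differential comes from
  \<open>u\<^sub>k \<mapsto> v\<^sub>k \<otimes> 1 - 1 \<otimes> v\<^sub>k\<close>.\<close>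

definition kos_bas :: "nat \<Rightarrow> nat set set \<Rightarrow> nat \<Rightarrow> kbasis set" where
  "kos_bas m K i = {(I, t). I \<subseteq> {1..m} \<and> card I = i \<and> keys t \<in> K}"

definition kos_deg :: "kbasis \<Rightarrow> nat" where
  "kos_deg b = 2 * (card (fst b) + mdeg (snd b))"

definition kos_d :: "nat set set \<Rightarrow> kbasis \<Rightarrow> kbasis \<Rightarrow>\<^sub>0 int_mpoly" where
  "kos_d K b = (\<Sum>k\<in>fst b. single (fst b - {k}, snd b) (single (ev k) (ssgn k (fst b)))
     - (if keys (snd b + ev k) \<in> K
        then single (fst b - {k}, snd b + ev k) (single 0 (ssgn k (fst b))) else 0))"

definition kos_aug :: "kbasis \<Rightarrow> int_mpoly" where
  "kos_aug b = (if fst b = {} then single (snd b) 1 else 0)"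

text \<open>The differential in the \<open>\<int>\<close>-basis of triples \<open>((I, t), a)\<close>, standing for
  \<open>v\<^sup>a \<otimes> u\<^sub>I \<otimes> v\<^sup>t\<close>, split into the part multiplying the ring of coefficients and the part
  multiplying the Stanley--Reisner ring.\<close>

definition kos_d0 :: "kbasis \<times> (nat \<Rightarrow>\<^sub>0 nat) \<Rightarrow> kbasis \<times> (nat \<Rightarrow>\<^sub>0 nat) \<Rightarrow>\<^sub>0 int" where
  "kos_d0 = (\<lambda>((I, t), a). \<Sum>k\<in>I. single ((I - {k}, t), a + ev k) (ssgn k I))"

definition kos_d1 :: "nat set set \<Rightarrow> kbasis \<times> (nat \<Rightarrow>\<^sub>0 nat) \<Rightarrow> kbasis \<times> (nat \<Rightarrow>\<^sub>0 nat) \<Rightarrow>\<^sub>0 int" where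
  "kos_d1 K = (\<lambda>((I, t), a). \<Sum>k\<in>I. if keys (t + ev k) \<in> K
     then single ((I - {k}, t + ev k), a) (ssgn k I) else 0)"

definition kos_df :: "nat set set \<Rightarrow> kbasis \<times> (nat \<Rightarrow>\<^sub>0 nat) \<Rightarrow> kbasis \<times> (nat \<Rightarrow>\<^sub>0 nat) \<Rightarrow>\<^sub>0 int" where
  "kos_df K x = kos_d0 x - kos_d1 K x"

text \<open>A contraction for the coefficient part alone: the smallest index occurring in
  \<open>I\<close> or in the monomial \<open>a\<close> is moved from \<open>a\<close> into
  \<open>I\<close>, unless it is in \<open>I\<close> already. The monomial \<open>t\<close> of
  \<int>[K] is left alone.\<close>

definition kos_h :: "kbasis \<times> (nat \<Rightarrow>\<^sub>0 nat) \<Rightarrow> kbasis \<times> (nat \<Rightarrow>\<^sub>0 nat) \<Rightarrow>\<^sub>0 int" where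
  "kos_h = (\<lambda>((I, t), a). let S = I \<union> keys a in
     if S = {} \<or> Min S \<in> I then 0 else bas ((insert (Min S) I, t), a - ev (Min S)))"

lemma unflat_kos_df: "unflat (kos_df K (b, a)) = smul (single a 1) (kos_d K b)"
proof -
  have if_unflat: "unflat (if P then x else 0) = (if P then unflat x else 0)" for P and x :: "kbasis \<times> (nat \<Rightarrow>\<^sub>0 nat) \<Rightarrow>\<^sub>0 int"
    by simp
  have if_smul: "smul r (if P then x else 0) = (if P then smul r x else 0)" for P and r :: int_mpoly and x :: "kbasis \<Rightarrow>\<^sub>0 int_mpoly"
    by simp
  have smul_diff: "smul r (x - y) = smul r x - smul r y" for r :: int_mpoly and x y :: "kbasis \<Rightarrow>\<^sub>0 int_mpoly"
    by (intro poly_mapping_eqI) (simp add: lookup_minus right_diff_distrib)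
  show ?thesis
  proof (cases b)
    case (Pair I t)
    show ?thesis
      unfolding Pair kos_df_def kos_d0_def kos_d1_def kos_d_def prod.case fst_conv snd_conv
      by (simp add: unflat_diff unflat_sum if_unflat smul_sum smul_diff if_smul mult_single sum_subtractf cong: if_cong)
  qed
qed

text \<open>The differential is a signed sum of commuting operators, one for each index; as the
  signs anticommute, the double sum is antisymmetric.\<close>

lemma kos_df_kos_df:
  assumes K: "down_closed K" and I: "finite I"
  shows "lin (kos_df K) (kos_df K ((I, t), a)) = 0"
proof -
  let ?T = "\<lambda>J t a. \<lambda>k. bas ((J, t), a + ev k) - (if keys (t + ev k) \<in> K then bas ((J, t + ev k), a) else 0) :: _ \<Rightarrow>\<^sub>0 int"
  have df: "kos_df K ((J, t), a) = (\<Sum>k\<in>J. smul (ssgn k J) (?T (J - {k}) t a k))" for J t a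
    unfolding kos_df_def kos_d0_def kos_d1_def prod.case sum_subtractf[symmetric]
    by (intro sum.cong refl poly_mapping_eqI) (auto simp: lookup_minus lookup_single when_def)
  \<comment> \<open>Two successive operators without their signs. They commute because
    \<open>K\<close> is closed downwards: if \<open>t\<close> times both variables is nonzero in
    \<int>[K], so is either intermediate product.\<close>
  define Q where "Q k l = lin (\<lambda>((J, t), a). ?T (J - {l}) t a l) (?T (I - {k}) t a k)" for k l
  have Q_sym: "Q k l = Q l k" for k l
  proof -
    have Q: "Q k l = bas ((I - {k} - {l}, t), a + ev k + ev l)
        - (if keys (t + ev l) \<in> K then bas ((I - {k} - {l}, t + ev l), a + ev k) else 0)
        - (if keys (t + ev k) \<in> K then bas ((I - {k} - {l}, t + ev k), a + ev l) else 0)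
        + (if keys (t + ev k + ev l) \<in> K then bas ((I - {k} - {l}, t + ev k + ev l), a) else 0)" for k l
    proof -
      have "keys (t + ev k) \<in> K" if "keys (t + ev k + ev l) \<in> K"
      proof -
        have "keys (t + ev k) \<subseteq> keys (t + ev k + ev l)"
          by (auto simp: keys_add_nat)
        then show ?thesis
          using K that unfolding down_closed_def by blast
      qed
      then show ?thesis
        by (auto simp: Q_def lin_diff)
    qed
    have "I - {k} - {l} = I - {l} - {k}"
      by auto
    then show ?thesis
      unfolding Q[of k l] Q[of l k] by (simp add: add_ac)
  qed
  have "lin (kos_df K) (kos_df K ((I, t), a))
      = (\<Sum>k\<in>I. smul (ssgn k I) (lin (kos_df K) (?T (I - {k}) t a k)))"
    unfolding df[of I] by (simp only: lin_sum lin_smul)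
  also have "\<dots> = (\<Sum>k\<in>I. \<Sum>l\<in>I - {k}. smul (ssgn k I * ssgn l (I - {k})) (Q k l))"
  proof (rule sum.cong)
    fix k
    have "lin (kos_df K) (?T (I - {k}) t a k)
        = (\<Sum>l\<in>I - {k}. smul (ssgn l (I - {k})) (Q k l))"
    proof -
      have "lin (kos_df K) (?T (I - {k}) t a k)
          = lin (\<lambda>((J, t), a). \<Sum>l\<in>I - {k}. smul (ssgn l (I - {k})) (?T (J - {l}) t a l)) (?T (I - {k}) t a k)"
      proof (rule lin_cong)
        fix x assume "x \<in> keys (?T (I - {k}) t a k)"
        then have "fst (fst x) = I - {k}"
          by (auto simp: in_keys_iff lookup_minus lookup_single when_def split: if_splits)
        then show "kos_df K x = (\<lambda>((J, t), a). \<Sum>l\<in>I - {k}. smul (ssgn l (I - {k})) (?T (J - {l}) t a l)) x"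
          using df by (cases x; cases "fst x") auto
      qed
      also have "\<dots> = (\<Sum>l\<in>I - {k}. smul (ssgn l (I - {k})) (Q k l))"
      proof -
        have "lin (\<lambda>x. \<Sum>l\<in>A. smul (s l) (f l x)) c = (\<Sum>l\<in>A. smul (s l) (lin (f l) c))"
          for A and s :: "nat \<Rightarrow> int" and f :: "nat \<Rightarrow> kbasis \<times> (nat \<Rightarrow>\<^sub>0 nat) \<Rightarrow> kbasis \<times> (nat \<Rightarrow>\<^sub>0 nat) \<Rightarrow>\<^sub>0 int" and c
          by (induction A rule: infinite_finite_induct) (simp_all add: lin_fun_add lin_fun_smul)
        then show ?thesis
          unfolding Q_def by (simp add: case_prod_unfold)
      qed
      finally show ?thesis .
    qed
    then show "smul (ssgn k I) (lin (kos_df K) (?T (I - {k}) t a k))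
        = (\<Sum>l\<in>I - {k}. smul (ssgn k I * ssgn l (I - {k})) (Q k l))"
      by (simp only: smul_sum smul_smul)
  qed simp
  also have "\<dots> = 0"
  proof (rule sum_pairs_antisym[OF I])
    fix k l assume kl: "k \<in> I" "l \<in> I" "k \<noteq> l"
    have "smul (- n) c = - smul n c" for n :: int and c :: "kbasis \<times> (nat \<Rightarrow>\<^sub>0 nat) \<Rightarrow>\<^sub>0 int"
      by (intro poly_mapping_eqI) simp
    then show "smul (ssgn k I * ssgn l (I - {k})) (Q k l) = - smul (ssgn l I * ssgn k (I - {l})) (Q l k)"
      unfolding ssgn_swap[OF I kl] Q_sym[of k l] by simp
  qed
  finally show ?thesis .
qed

section \<open>A contraction of the coefficient part\<close>

lemma minus_ev_add: "k \<in> keys a \<Longrightarrow> a - ev k + ev l = a + ev l - ev k"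
  by (intro poly_mapping_eqI) (auto simp: lookup_add lookup_minus lookup_ev in_keys_iff)

lemma minus_ev_self: "k \<in> keys a \<Longrightarrow> a - ev k + ev k = a"
  by (intro poly_mapping_eqI) (auto simp: lookup_add lookup_minus lookup_ev in_keys_iff)

lemma ssgn_Min:
  assumes "\<And>i. i \<in> I \<Longrightarrow> k \<le> i"
  shows "ssgn k I = 1"
proof -
  have "{i\<in>I. i < k} = {}"
    using assms by (auto simp: not_less[symmetric])
  then show ?thesis
    by (simp only: ssgn_def card.empty power_0)
qed

text \<open>\<open>kos_d0\<close> moves indices from \<open>I\<close> to the monomial without
  changing their union, so the same smallest index \<open>k\<close> is used throughout. If
  \<open>k\<close> lies in \<open>I\<close>, only the term moving \<open>k\<close> out and back
  survives; otherwise the differential of the new element returns the old one with sign 1, and the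
  remaining terms cancel in pairs.\<close>

lemma kos_h_homotopy:
  assumes I: "finite I" and ne: "I \<noteq> {} \<or> a \<noteq> 0"
  shows "lin kos_d0 (kos_h ((I, t), a)) + lin kos_h (kos_d0 ((I, t), a)) = bas ((I, t), a)"
proof -
  define S where "S = I \<union> keys a"
  define k where "k = Min S"
  have "S \<noteq> {}" "finite S"
    using I ne by (auto simp: S_def)
  then have kS: "k \<in> S" and k_le: "\<And>i. i \<in> S \<Longrightarrow> k \<le> i"
    by (auto simp: k_def)
  have S_shift: "(I - {l}) \<union> keys (a + ev l) = S" if "l \<in> I" for l
    using that by (auto simp: S_def keys_add_nat)
  have h_shift: "kos_h ((I - {l}, t), a + ev l) = (if k \<in> I - {l} then 0 else bas ((insert k (I - {l}), t), a + ev l - ev k))"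
    if "l \<in> I" for l
    unfolding kos_h_def prod.case Let_def S_shift[OF that] using \<open>S \<noteq> {}\<close> by (simp add: k_def)
  have h: "kos_h ((I, t), a) = (if k \<in> I then 0 else bas ((insert k I, t), a - ev k))"
    unfolding kos_h_def using \<open>S \<noteq> {}\<close> by (simp add: Let_def k_def S_def)
  have lin_h: "lin kos_h (kos_d0 ((I, t), a)) = (\<Sum>l\<in>I. smul (ssgn l I) (if k \<in> I - {l} then 0 else bas ((insert k (I - {l}), t), a + ev l - ev k)))"
    unfolding kos_d0_def prod.case lin_sum by (intro sum.cong refl) (simp only: lin_single h_shift)
  show ?thesis
  proof (cases "k \<in> I")
    case True
    have "ssgn k I = (1 :: int)"
      using k_le by (intro ssgn_Min) (auto simp: S_def)
    have "lin kos_h (kos_d0 ((I, t), a)) = (\<Sum>l\<in>{k}. smul (ssgn l I) (if k \<in> I - {l} then 0 else bas ((insert k (I - {l}), t), a + ev l - ev k)))"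
      unfolding lin_h using True I by (intro sum.mono_neutral_right) auto
    also have "\<dots> = bas ((I, t), a)"
      using True \<open>ssgn k I = 1\<close> by (simp add: insert_absorb)
    finally show ?thesis
      using True h by simp
  next
    case False
    then have ka: "k \<in> keys a"
      using kS by (simp add: S_def)
    have "ssgn k (insert k I) = (1 :: int)"
      using k_le by (intro ssgn_Min) (auto simp: S_def)
    have sgn: "ssgn l (insert k I) = (- ssgn l I :: int)" if "l \<in> I" for l
    proof -
      have "k < l"
        using k_le[of l] that False by (cases "k = l") (auto simp: S_def)
      then have "ssgn l (insert k I - {k}) = (- ssgn l (insert k I) :: int)"
        using I by (intro ssgn_remove_less) auto
      moreover have "insert k I - {k} = I"
        using False by auto
      ultimately show ?thesis
        by simp
    qed
    have "lin kos_d0 (kos_h ((I, t), a)) = (\<Sum>l\<in>insert k I. single ((insert k I - {l}, t), a - ev k + ev l) (ssgn l (insert k I)))"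
      using False h by (simp add: kos_d0_def)
    also have "\<dots> = bas ((I, t), a) + (\<Sum>l\<in>I. single ((insert k I - {l}, t), a - ev k + ev l) (ssgn l (insert k I)))"
      using False I \<open>ssgn k (insert k I) = 1\<close> minus_ev_self[OF ka] by simp
    also have "(\<Sum>l\<in>I. single ((insert k I - {l}, t), a - ev k + ev l) (ssgn l (insert k I) :: int))
        = (\<Sum>l\<in>I. - smul (ssgn l I) (if k \<in> I - {l} then 0 else bas ((insert k (I - {l}), t), a + ev l - ev k)))"
    proof (rule sum.cong)
      fix l assume l: "l \<in> I"
      have "insert k I - {l} = insert k (I - {l})"
        using l False by auto
      then show "single ((insert k I - {l}, t), a - ev k + ev l) (ssgn l (insert k I))
          = - smul (ssgn l I :: int) (if k \<in> I - {l} then 0 else bas ((insert k (I - {l}), t), a + ev l - ev k))"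
        using False by (simp add: sgn[OF l] minus_ev_add[OF ka] flip: single_uminus)
    qed simp
    finally show ?thesis
      by (simp add: lin_h sum_negf)
  qed
qed

lemma kos_h_zero: "kos_h (({}, t), 0) = 0"
  by (simp add: kos_h_def)

section \<open>Exactness of the Koszul complex\<close>

definition kflat :: "nat \<Rightarrow> nat set set \<Rightarrow> nat \<Rightarrow> nat \<Rightarrow> (kbasis \<times> (nat \<Rightarrow>\<^sub>0 nat)) set" where
  "kflat m K i k = {(b, a). b \<in> kos_bas m K i \<and> keys a \<subseteq> {1..m} \<and> kos_deg b + 2 * mdeg a = k}"

lemma mdeg_minus_ev: "k \<in> keys a \<Longrightarrow> Suc (mdeg (a - ev k)) = mdeg a"
  using mdeg_add[of "a - ev k" "ev k"] by (simp add: minus_ev_self)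

lemma keys_kos_h:
  assumes "x \<in> kflat m K i k"
  shows "keys (kos_h x) \<subseteq> {y\<in>kflat m K (Suc i) k. Suc (mdeg (snd y)) = mdeg (snd x)}"
proof -
  obtain I t a where x: "x = ((I, t), a)"
    by (metis surj_pair)
  let ?S = "I \<union> keys a" and ?k = "Min (I \<union> keys a)"
  have x': "I \<subseteq> {1..m}" "card I = i" "keys t \<in> K" "keys a \<subseteq> {1..m}"
    "2 * (i + mdeg t) + 2 * mdeg a = k"
    using assms by (auto simp: x kflat_def kos_bas_def kos_deg_def)
  have fin: "finite I"
    using x'(1) finite_subset by blast
  show ?thesis
  proof (cases "?S = {} \<or> ?k \<in> I")
    case True
    then show ?thesis
      by (auto simp: x kos_h_def Let_def)
  next
    case False
    then have "?k \<in> ?S"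
      using fin by (intro Min_in) auto
    then have ka: "?k \<in> keys a"
      using False by auto
    have sub: "keys (a - ev ?k) \<subseteq> keys a"
      by (auto simp: in_keys_iff lookup_minus)
    have "((insert ?k I, t), a - ev ?k) \<in> kflat m K (Suc i) k"
      using x' False fin ka sub mdeg_minus_ev[OF ka] by (auto simp: kflat_def kos_bas_def kos_deg_def)
    then show ?thesis
      using False mdeg_minus_ev[OF ka] by (simp add: x kos_h_def Let_def)
  qed
qed

lemma keys_kos_d1:
  assumes "x \<in> kflat m K (Suc i) k"
  shows "keys (kos_d1 K x) \<subseteq> {y\<in>kflat m K i k. mdeg (snd y) = mdeg (snd x)}"
proof -
  obtain I t a where x: "x = ((I, t), a)"
    by (metis surj_pair)
  have x': "I \<subseteq> {1..m}" "card I = Suc i" "keys t \<in> K" "keys a \<subseteq> {1..m}"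
    "2 * (Suc i + mdeg t) + 2 * mdeg a = k"
    using assms by (auto simp: x kflat_def kos_bas_def kos_deg_def)
  have fin: "finite I"
    using x'(1) finite_subset by blast
  show ?thesis
    unfolding x kos_d1_def prod.case using x' fin
    by (intro keys_sum_subset) (auto simp: kflat_def kos_bas_def kos_deg_def mdeg_add)
qed

lemma keys_kos_d0:
  assumes "x \<in> kflat m K (Suc i) k"
  shows "keys (kos_d0 x) \<subseteq> kflat m K i k"
proof -
  obtain I t a where x: "x = ((I, t), a)"
    by (metis surj_pair)
  have x': "I \<subseteq> {1..m}" "card I = Suc i" "keys t \<in> K" "keys a \<subseteq> {1..m}"
    "2 * (Suc i + mdeg t) + 2 * mdeg a = k"
    using assms by (auto simp: x kflat_def kos_bas_def kos_deg_def)
  have fin: "finite I"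
    using x'(1) finite_subset by blast
  show ?thesis
    unfolding x kos_d0_def prod.case using x' fin
    by (intro keys_sum_subset) (auto simp: kflat_def kos_bas_def kos_deg_def mdeg_add keys_add_nat)
qed

lemma keys_kos_df: "x \<in> kflat m K (Suc i) k \<Longrightarrow> keys (kos_df K x) \<subseteq> kflat m K i k"
  unfolding kos_df_def using keys_kos_d0[of x m K i k] keys_kos_d1[of x m K i k] by (intro keys_diff_subset) auto

lemma kflat_finite: "((I, t), a) \<in> kflat m K i k \<Longrightarrow> finite I"
  by (auto simp: kflat_def kos_bas_def intro: finite_subset)

lemma kos_df_lin_kos_df:
  assumes "down_closed K" "keys z \<subseteq> kflat m K i k"
  shows "lin (kos_df K) (lin (kos_df K) z) = 0"
proof -
  have "lin (kos_df K) (lin (kos_df K) z) = lin (\<lambda>_. 0) z"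
    unfolding lin_lin
  proof (rule lin_cong)
    fix x assume x: "x \<in> keys z"
    obtain I t a where xe: "x = ((I, t), a)"
      by (metis surj_pair)
    have "((I, t), a) \<in> kflat m K i k"
      using x xe assms(2) by auto
    then show "lin (kos_df K) (kos_df K x) = 0"
      unfolding xe by (intro kos_df_kos_df assms(1) kflat_finite)
  qed
  then show ?thesis
    by simp
qed

text \<open>As \<open>kos_h\<close> lowers the degree in the coefficients by one and contracts \<open>kos_d0\<close>, subtracting the
  boundary of \<open>kos_h z\<close> from \<open>z\<close> lowers that degree.\<close>

lemma kos_exact_Suc:
  assumes K: "down_closed K"
  shows "keys z \<subseteq> {x\<in>kflat m K (Suc i) k. mdeg (snd x) < p} \<Longrightarrow> lin (kos_df K) z = 0 \<Longrightarrow>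
    \<exists>y. keys y \<subseteq> kflat m K (Suc (Suc i)) k \<and> lin (kos_df K) y = z"
proof (induction p arbitrary: z)
  case 0
  then have "z = 0"
    by simp
  then show ?case
    by (intro exI[of _ 0]) simp
next
  case (Suc p)
  define w where "w = lin kos_h z"
  have zk: "keys z \<subseteq> kflat m K (Suc i) k"
    using Suc.prems(1) by auto
  have w_keys: "keys w \<subseteq> {y\<in>kflat m K (Suc (Suc i)) k. mdeg (snd y) < p}"
    unfolding w_def
  proof (rule keys_lin_subset)
    fix x assume "x \<in> keys z"
    then have "x \<in> kflat m K (Suc i) k" "mdeg (snd x) < Suc p"
      using Suc.prems(1) by auto
    then show "keys (kos_h x) \<subseteq> {y\<in>kflat m K (Suc (Suc i)) k. mdeg (snd y) < p}"
      using keys_kos_h[of x m K "Suc i" k] by auto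
  qed
  have "lin kos_d0 w + lin kos_h (lin kos_d0 z) = lin (\<lambda>x. lin kos_d0 (kos_h x) + lin kos_h (kos_d0 x)) z"
    by (simp add: w_def lin_lin lin_fun_add)
  also have "\<dots> = lin bas z"
  proof (rule lin_cong)
    fix x assume "x \<in> keys z"
    then obtain I t a where x: "x = ((I, t), a)" "((I, t), a) \<in> kflat m K (Suc i) k"
      using zk by (metis subsetD surj_pair)
    have "I \<noteq> {}"
      using x(2) by (auto simp: kflat_def kos_bas_def)
    then show "lin kos_d0 (kos_h x) + lin kos_h (kos_d0 x) = bas x"
      unfolding x(1) using kos_h_homotopy[OF kflat_finite[OF x(2)]] by blast
  qed
  finally have 1: "lin kos_d0 w = z - lin kos_h (lin kos_d0 z)"
    by (simp add: algebra_simps)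
  have df: "lin (kos_df K) c = lin kos_d0 c - lin (kos_d1 K) c" for c
    by (simp add: kos_df_def[abs_def] lin_fun_diff)
  \<comment> \<open>On a cycle the two parts of the differential agree, and \<open>kos_d1\<close>
    does not change the degree in the coefficients; this is what makes the remainder
    \<open>z'\<close> smaller.\<close>
  have 2: "lin kos_d0 z = lin (kos_d1 K) z"
    using Suc.prems(2) by (simp add: df)
  define z' where "z' = z - lin (kos_df K) w"
  have z'_eq: "z' = lin kos_h (lin (kos_d1 K) z) + lin (kos_d1 K) w"
    by (simp add: z'_def df 1 2)
  have d1z: "keys (lin (kos_d1 K) z) \<subseteq> {x\<in>kflat m K i k. mdeg (snd x) < Suc p}"
  proof (rule keys_lin_subset)
    fix x assume "x \<in> keys z"
    then show "keys (kos_d1 K x) \<subseteq> {x\<in>kflat m K i k. mdeg (snd x) < Suc p}"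
      using Suc.prems(1) keys_kos_d1[of x m K i k] by fastforce
  qed
  have "keys (lin kos_h (lin (kos_d1 K) z)) \<subseteq> {x\<in>kflat m K (Suc i) k. mdeg (snd x) < p}"
  proof (rule keys_lin_subset)
    fix x assume "x \<in> keys (lin (kos_d1 K) z)"
    then show "keys (kos_h x) \<subseteq> {x\<in>kflat m K (Suc i) k. mdeg (snd x) < p}"
      using d1z keys_kos_h[of x m K i k] by fastforce
  qed
  moreover have "keys (lin (kos_d1 K) w) \<subseteq> {x\<in>kflat m K (Suc i) k. mdeg (snd x) < p}"
  proof (rule keys_lin_subset)
    fix x assume "x \<in> keys w"
    then show "keys (kos_d1 K x) \<subseteq> {x\<in>kflat m K (Suc i) k. mdeg (snd x) < p}"
      using w_keys keys_kos_d1[of x m K "Suc i" k] by fastforce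
  qed
  ultimately have "keys z' \<subseteq> {x\<in>kflat m K (Suc i) k. mdeg (snd x) < p}"
    unfolding z'_eq by (rule keys_add_subset)
  moreover have "lin (kos_df K) z' = 0"
  proof -
    have "keys w \<subseteq> kflat m K (Suc (Suc i)) k"
      using w_keys by auto
    then show ?thesis
      using Suc.prems(2) kos_df_lin_kos_df[OF K] by (simp add: z'_def lin_diff)
  qed
  ultimately obtain y where y: "keys y \<subseteq> kflat m K (Suc (Suc i)) k" "lin (kos_df K) y = z'"
    using Suc.IH by blast
  have "keys (y + w) \<subseteq> kflat m K (Suc (Suc i)) k"
    using y(1) w_keys by (intro keys_add_subset) auto
  moreover have "lin (kos_df K) (y + w) = z"
    by (simp add: lin_add y(2) z'_def)
  ultimately show ?case
    by blast
qed

text \<open>In position 0 the contraction fails exactly on constant coefficients. So a chain is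
  moved to one with constant coefficients, and what is left there is seen by the
  augmentation.\<close>

lemma kos_exact_0:
  assumes K: "down_closed K"
  shows "keys z \<subseteq> {x\<in>kflat m K 0 k. mdeg (snd x) < Suc p} \<Longrightarrow>
    \<exists>y. keys y \<subseteq> kflat m K (Suc 0) k \<and> keys (z - lin (kos_df K) y) \<subseteq> {x\<in>kflat m K 0 k. mdeg (snd x) = 0}"
proof (induction p arbitrary: z)
  case 0
  then show ?case
    by (intro exI[of _ 0]) auto
next
  case (Suc p)
  define w where "w = lin kos_h z"
  \<comment> \<open>The projection to constant coefficients, the defect of the homotopy identity in
    position 0.\<close>
  define \<pi> where "\<pi> x = (if snd x = 0 then bas x else 0 :: kbasis \<times> (nat \<Rightarrow>\<^sub>0 nat) \<Rightarrow>\<^sub>0 int)" for x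
  have w_keys: "keys w \<subseteq> {y\<in>kflat m K (Suc 0) k. mdeg (snd y) < Suc p}"
    unfolding w_def
  proof (rule keys_lin_subset)
    fix x assume "x \<in> keys z"
    then have "x \<in> kflat m K 0 k" "mdeg (snd x) < Suc (Suc p)"
      using Suc.prems(1) by auto
    then show "keys (kos_h x) \<subseteq> {y\<in>kflat m K (Suc 0) k. mdeg (snd y) < Suc p}"
      using keys_kos_h[of x m K 0 k] by auto
  qed
  have "lin kos_d0 w + lin \<pi> z = lin (\<lambda>x. lin kos_d0 (kos_h x) + \<pi> x) z"
    by (simp add: w_def lin_lin lin_fun_add)
  also have "\<dots> = lin bas z"
  proof (rule lin_cong)
    fix x assume "x \<in> keys z"
    then obtain I t a where x: "x = ((I, t), a)" "((I, t), a) \<in> kflat m K 0 k"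
      using Suc.prems(1) by (metis (no_types, lifting) mem_Collect_eq subsetD surj_pair)
    have I: "I = {}"
      using x(2) kflat_finite[OF x(2)] by (auto simp: kflat_def kos_bas_def)
    show "lin kos_d0 (kos_h x) + \<pi> x = bas x"
    proof (cases "a = 0")
      case True
      then show ?thesis
        by (simp add: x(1) I kos_h_zero \<pi>_def)
    next
      case False
      then show ?thesis
        using kos_h_homotopy[of "{}" a t] by (simp add: x(1) I \<pi>_def kos_d0_def)
    qed
  qed
  finally have 1: "lin kos_d0 w = z - lin \<pi> z"
    by (simp add: algebra_simps)
  have df: "lin (kos_df K) c = lin kos_d0 c - lin (kos_d1 K) c" for c
    by (simp add: kos_df_def[abs_def] lin_fun_diff)
  have eq: "z - lin (kos_df K) w = lin \<pi> z + lin (kos_d1 K) w"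
    by (simp add: df 1)
  have "keys (lin \<pi> z) \<subseteq> {x\<in>kflat m K 0 k. mdeg (snd x) < Suc p}"
  proof (rule keys_lin_subset)
    fix x assume "x \<in> keys z"
    then show "keys (\<pi> x) \<subseteq> {x\<in>kflat m K 0 k. mdeg (snd x) < Suc p}"
      using Suc.prems(1) by (auto simp: \<pi>_def)
  qed
  moreover have "keys (lin (kos_d1 K) w) \<subseteq> {x\<in>kflat m K 0 k. mdeg (snd x) < Suc p}"
  proof (rule keys_lin_subset)
    fix x assume "x \<in> keys w"
    then show "keys (kos_d1 K x) \<subseteq> {x\<in>kflat m K 0 k. mdeg (snd x) < Suc p}"
      using w_keys keys_kos_d1[of x m K 0 k] by fastforce
  qed
  ultimately have "keys (z - lin (kos_df K) w) \<subseteq> {x\<in>kflat m K 0 k. mdeg (snd x) < Suc p}"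
    unfolding eq by (rule keys_add_subset)
  from Suc.IH[OF this] obtain y where y: "keys y \<subseteq> kflat m K (Suc 0) k"
    "keys (z - lin (kos_df K) w - lin (kos_df K) y) \<subseteq> {x\<in>kflat m K 0 k. mdeg (snd x) = 0}"
    by blast
  have "keys (w + y) \<subseteq> kflat m K (Suc 0) k"
    using y(1) w_keys by (intro keys_add_subset) auto
  then show ?case
    using y(2) by (intro exI[of _ "w + y"]) (simp add: lin_add diff_diff_add)
qed

text \<open>On constant coefficients the augmentation only renames the basis, hence is injective
  there; this gives exactness at the end of the complex.\<close>

lemma kos_aug_flat:
  assumes z: "keys z \<subseteq> {x\<in>kflat m K 0 k. mdeg (snd x) = 0}" and t: "keys t \<in> K"
  shows "lookup (aug_of K kos_aug (unflat z)) t = lookup z (({}, t), 0)"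
proof -
  have key: "x = (({}, snd (fst x)), 0)" "keys (snd (fst x)) \<in> K" if "x \<in> keys z" for x
  proof -
    obtain I s a where x: "x = ((I, s), a)"
      by (metis surj_pair)
    have "((I, s), a) \<in> kflat m K 0 k" "mdeg a = 0"
      using z that x by auto
    moreover from this have "finite I"
      by (auto dest: kflat_finite)
    ultimately show "x = (({}, snd (fst x)), 0)" "keys (snd (fst x)) \<in> K"
      by (auto simp: x kflat_def kos_bas_def mdeg_eq_0_iff)
  qed
  have "aug_of K kos_aug (unflat z) = (\<Sum>x\<in>keys z. aug_of K kos_aug (single (fst x) (single (snd x) (lookup z x))))"
    unfolding unflat_def by (rule aug_of_sum)
  also have "\<dots> = (\<Sum>x\<in>keys z. single (snd (fst x)) (lookup z x))"
  proof (rule sum.cong)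
    fix x assume x: "x \<in> keys z"
    obtain s where xs: "x = (({}, s), 0)"
      using key(1)[OF x] by blast
    moreover from this x have "single 0 (lookup z (({}, s), 0)) \<noteq> (0 :: int_mpoly)"
      by (metis in_keys_iff lookup_single_eq lookup_zero)
    ultimately have "aug_of K kos_aug (single (fst x) (single (snd x) (lookup z x)))
        = red K (single (snd (fst x)) (lookup z x))"
      by (simp add: aug_of_def kos_aug_def mult_single)
    also have "\<dots> = single (snd (fst x)) (lookup z x)"
      using key(2)[OF x] by (intro poly_mapping_eqI) (auto simp: lookup_single when_def)
    finally show "aug_of K kos_aug (single (fst x) (single (snd x) (lookup z x)))
        = single (snd (fst x)) (lookup z x)" .
  qed simp
  finally have "lookup (aug_of K kos_aug (unflat z)) t
      = (\<Sum>x\<in>keys z. if x = (({}, t), 0) then lookup z x else 0)"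
  proof (simp only: lookup_sum, intro sum.cong refl)
    fix x assume x: "x \<in> keys z"
    obtain s where "x = (({}, s), 0)"
      using key(1)[OF x] by blast
    then have "snd (fst x) = t \<longleftrightarrow> x = (({}, t), 0)"
      by simp
    then show "lookup (single (snd (fst x)) (lookup z x)) t
        = (if x = (({}, t), 0) then lookup z x else 0)"
      by (simp add: lookup_single when_def)
  qed
  then show ?thesis
    by (simp add: in_keys_iff)
qed

text \<open>Both terms of the differential augment to the same monomial. If that monomial is zero in
  \<int>[K], the second term is absent and the first reduces to zero.\<close>

lemma kos_aug_kos_d:
  assumes "b \<in> kos_bas m K (Suc 0)"
  shows "aug_of K kos_aug (kos_d K b) = 0"
proof -
  obtain k t where bk: "b = ({k}, t)" "keys t \<in> K"
    using assms by (auto simp: kos_bas_def card_1_singleton_iff)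
  have sgn: "ssgn k {k} = (1 :: int)"
    by (rule ssgn_Min) auto
  have single_aug: "aug_of K kos_aug (single ({}, s) (single a 1)) = red K (single (a + s) 1)" for s a
    by (simp add: aug_of_def kos_aug_def mult_single)
  have 0: "red K (single (t + ev k) 1) = 0" if "keys (t + ev k) \<notin> K"
    using that by (intro poly_mapping_eqI) (auto simp: lookup_single when_def)
  have aug0: "aug_of K kos_aug 0 = 0"
    by (simp add: aug_of_def)
  have d: "kos_d K b = single ({}, t) (single (ev k) 1)
     - (if keys (t + ev k) \<in> K then single ({}, t + ev k) (single 0 1) else 0)"
    unfolding bk(1) kos_d_def fst_conv snd_conv by (simp add: sgn)
  show ?thesis
  proof (cases "keys (t + ev k) \<in> K")
    case True
    then have d': "kos_d K b = single ({}, t) (single (ev k) 1) - single ({}, t + ev k) (single 0 1)"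
      unfolding d by (simp only: if_True)
    show ?thesis
      unfolding d' aug_of_diff single_aug by (simp only: add.commute[of "ev k"] add_0 diff_self)
  next
    case False
    then have d': "kos_d K b = single ({}, t) (single (ev k) 1)"
      unfolding d by (simp only: if_False diff_zero)
    show ?thesis
      unfolding d' single_aug add.commute[of "ev k"] by (rule 0[OF False])
  qed
qed

theorem kos_based_resolution:
  assumes K: "down_closed K" and Km: "\<And>I. I \<in> K \<Longrightarrow> I \<subseteq> {1..m}"
  shows "based_resolution m K (kos_bas m K) (\<lambda>n. kos_deg) (\<lambda>n. kos_d K) kos_aug"
proof -
  have hom: "unflat z \<in> hom_chains m (kos_bas m K i) kos_deg k \<longleftrightarrow> keys z \<subseteq> kflat m K i k" for z i k
    unfolding unflat_hom_chains kflat_def by simp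
  have d_unflat: "kos_d K b = unflat (kos_df K (b, 0))" for b
    by (simp add: unflat_kos_df)
  have lin_unflat: "lin (kos_d K) (unflat z) = unflat (lin (kos_df K) z)" for z
    by (rule unflat_lin[OF unflat_kos_df, symmetric])
  have bflat: "(b, 0) \<in> kflat m K n (kos_deg b)" if "b \<in> kos_bas m K n" for b n
    using that by (simp add: kflat_def)
  \<comment> \<open>The internal degree bounds the degree in the coefficients, which starts the
    inductions of the exactness proofs.\<close>
  have bounded: "\<exists>p. keys z \<subseteq> {x\<in>kflat m K i k. mdeg (snd x) < Suc p}" if "keys z \<subseteq> kflat m K i k" for z i k
    using that by (intro exI[of _ k]) (auto simp: kflat_def)
  show ?thesis
    unfolding based_resolution_def
  proof (intro conjI allI ballI impI)
    fix n b assume b: "b \<in> kos_bas m K (Suc n)"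
    show "kos_d K b \<in> hom_chains m (kos_bas m K n) kos_deg (kos_deg b)"
      unfolding d_unflat hom by (rule keys_kos_df[OF bflat[OF b]])
  next
    fix n b assume b: "b \<in> kos_bas m K (Suc (Suc n))"
    obtain I t where "b = (I, t)"
      by (cases b)
    then show "lin (kos_d K) (kos_d K b) = 0"
      unfolding d_unflat lin_unflat using kos_df_kos_df[OF K, of I t 0] kflat_finite bflat[OF b] by auto
  next
    fix n k c assume c: "c \<in> hom_chains m (kos_bas m K (Suc n)) kos_deg k" and dc: "lin (kos_d K) c = 0"
    define z where "z = flat c"
    have cz: "c = unflat z"
      by (simp add: z_def)
    obtain p where "keys z \<subseteq> {x\<in>kflat m K (Suc n) k. mdeg (snd x) < Suc p}"
      using bounded c unfolding cz hom by blast
    moreover have "lin (kos_df K) z = 0"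
      using dc unfolding cz lin_unflat unflat_eq_0_iff .
    ultimately have "\<exists>y. keys y \<subseteq> kflat m K (Suc (Suc n)) k \<and> lin (kos_df K) y = z"
      by (rule kos_exact_Suc[OF K])
    then obtain y where y: "keys y \<subseteq> kflat m K (Suc (Suc n)) k" "lin (kos_df K) y = z"
      by auto
    then show "\<exists>y\<in>hom_chains m (kos_bas m K (Suc (Suc n))) kos_deg k. lin (kos_d K) y = c"
      by (intro bexI[of _ "unflat y"]) (simp_all add: lin_unflat cz hom)
  next
    fix b assume "b \<in> kos_bas m K 0"
    then show "kos_aug b \<in> nf_grading K (kos_deg b)"
      by (auto simp: kos_bas_def kos_aug_def nf_grading_def kos_deg_def lookup_single when_def split: if_splits)
  next
    fix b assume b: "b \<in> kos_bas m K (Suc 0)"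
    then show "aug_of K kos_aug (kos_d K b) = 0"
      by (rule kos_aug_kos_d)
  next
    fix k x assume x: "x \<in> nf_grading K k"
    define z where "z = lin (\<lambda>t. bas (({} :: nat set, t), 0 :: nat \<Rightarrow>\<^sub>0 nat)) (x :: (nat \<Rightarrow>\<^sub>0 nat) \<Rightarrow>\<^sub>0 int)"
    have zk: "keys z \<subseteq> {x\<in>kflat m K 0 k. mdeg (snd x) = 0}"
      unfolding z_def using x
      by (intro keys_lin_subset) (auto simp: kflat_def kos_bas_def kos_deg_def nf_grading_def in_keys_iff)
    have lookup_z: "lookup z (({}, t), 0) = lookup x t" for t
      by (simp add: z_def lookup_lin lookup_single when_def in_keys_iff if_distrib cong: if_cong)
    have "aug_of K kos_aug (unflat z) = x"
    proof (rule poly_mapping_eqI)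
      fix t
      have "red K (aug_of K kos_aug (unflat z)) = aug_of K kos_aug (unflat z)"
        by (simp add: aug_of_def red_sum)
      then have "lookup (aug_of K kos_aug (unflat z)) t = 0" if "keys t \<notin> K"
        using that by (metis lookup_red)
      then show "lookup (aug_of K kos_aug (unflat z)) t = lookup x t"
        using kos_aug_flat[OF zk, of t] x lookup_z[of t] by (cases "keys t \<in> K") (auto simp: nf_grading_def)
    qed
    then show "\<exists>c\<in>hom_chains m (kos_bas m K 0) kos_deg k. aug_of K kos_aug c = x"
      using zk by (intro bexI[of _ "unflat z"]) (auto simp: hom)
  next
    fix k c assume c: "c \<in> hom_chains m (kos_bas m K 0) kos_deg k" and ac: "aug_of K kos_aug c = 0"
    define z where "z = flat c"
    have cz: "c = unflat z"
      by (simp add: z_def)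
    obtain p where "keys z \<subseteq> {x\<in>kflat m K 0 k. mdeg (snd x) < Suc p}"
      using bounded c unfolding cz hom by blast
    then have "\<exists>y. keys y \<subseteq> kflat m K (Suc 0) k \<and> keys (z - lin (kos_df K) y) \<subseteq> {x\<in>kflat m K 0 k. mdeg (snd x) = 0}"
      by (rule kos_exact_0[OF K])
    then obtain y where y: "keys y \<subseteq> kflat m K (Suc 0) k"
      "keys (z - lin (kos_df K) y) \<subseteq> {x\<in>kflat m K 0 k. mdeg (snd x) = 0}"
      by auto
    have aug_d: "aug_of K kos_aug (lin (kos_d K) (unflat y)) = 0"
    proof -
      have "aug_of K kos_aug (lin (kos_d K) (unflat y)) = aug_of K (\<lambda>b. 0) (unflat y)"
        unfolding aug_of_lin[OF K]
      proof (rule aug_of_cong)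
        fix b assume "b \<in> keys (unflat y)"
        then have b: "b \<in> kos_bas m K (Suc 0)"
          using y(1) keys_hom_chains unfolding hom[symmetric] by blast
        then show "aug_of K kos_aug (kos_d K b) = 0"
          by (rule kos_aug_kos_d)
      qed
      then show ?thesis
        by (simp add: aug_of_def)
    qed
    \<comment> \<open>What is left has constant coefficients and augmentation zero, so all its
      coefficients are zero.\<close>
    have "z - lin (kos_df K) y = 0"
    proof (rule poly_mapping_eqI, rule ccontr)
      fix x assume "lookup (z - lin (kos_df K) y) x \<noteq> lookup 0 x"
      then have x: "x \<in> keys (z - lin (kos_df K) y)"
        by (simp add: in_keys_iff)
      obtain I t a where xe: "x = ((I, t), a)"
        by (metis surj_pair)
      have xk: "((I, t), a) \<in> kflat m K 0 k" "a = 0"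
        using x y(2) by (auto simp: xe mdeg_eq_0_iff)
      then have xe': "x = (({}, t), 0)" "keys t \<in> K"
        using kflat_finite[OF xk(1)] by (auto simp: xe kflat_def kos_bas_def)
      have "lookup (z - lin (kos_df K) y) x = lookup (aug_of K kos_aug (unflat (z - lin (kos_df K) y))) t"
        unfolding xe'(1) by (rule kos_aug_flat[OF y(2) xe'(2), symmetric])
      also have "aug_of K kos_aug (unflat (z - lin (kos_df K) y)) = 0"
        using ac aug_d by (simp add: unflat_diff aug_of_diff cz lin_unflat)
      finally show False
        using x by (simp add: in_keys_iff)
    qed
    then show "\<exists>y\<in>hom_chains m (kos_bas m K (Suc 0)) kos_deg k. lin (kos_d K) y = c"
      using y(1) by (intro bexI[of _ "unflat y"]) (simp_all add: lin_unflat cz hom)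
  qed
qed

section \<open>Homology of the Koszul resolution\<close>

text \<open>Both \<open>\<phi>\<close> and its inverse on the image reflect the subgroups, so
  \<open>qrank_inj_le\<close> applies twice.\<close>

lemma qrank_image:
  assumes Z: "fun_subgroup Z" and N: "fun_subgroup N" "N \<subseteq> Z"
    and add: "\<And>x y. x \<in> Z \<Longrightarrow> y \<in> Z \<Longrightarrow> \<phi> (\<lambda>b. x b - y b) = (\<lambda>b. \<phi> x b - \<phi> y b)"
    and inj: "inj_on \<phi> Z"
  shows "qrank (\<phi> ` Z) (\<phi> ` N) = qrank Z N"
proof (rule antisym)
  have \<phi>0: "\<phi> (\<lambda>b. 0) = (\<lambda>b. 0)"
    using add[of "\<lambda>b. 0" "\<lambda>b. 0"] fun_subgroup_zero[OF Z] by (auto simp: fun_eq_iff)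
  have sub: "fun_subgroup (\<phi> ` Y)" if Y: "fun_subgroup Y" "Y \<subseteq> Z" for Y
    unfolding fun_subgroup_def
  proof (intro conjI ballI)
    show "(\<lambda>b. 0) \<in> \<phi> ` Y"
      using \<phi>0 fun_subgroup_zero[OF Y(1)] by (metis image_eqI)
    fix x y assume "x \<in> \<phi> ` Y" "y \<in> \<phi> ` Y"
    then obtain x' y' where xy: "x' \<in> Y" "y' \<in> Y" "x = \<phi> x'" "y = \<phi> y'"
      by auto
    then have "(\<lambda>b. x b - y b) = \<phi> (\<lambda>b. x' b - y' b)"
      using add[of x' y'] Y(2) by (simp add: subsetD)
    then show "(\<lambda>b. x b - y b) \<in> \<phi> ` Y"
      using fun_subgroup_diff[OF Y(1) xy(1,2)] by simp
  qed
  show "qrank Z N \<le> qrank (\<phi> ` Z) (\<phi> ` N)"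
  proof (rule qrank_inj_le[OF Z _ add])
    show "(\<lambda>b. 0) \<in> \<phi> ` N"
      by (rule fun_subgroup_zero[OF sub[OF N]])
    show "x \<in> N" if "x \<in> Z" "\<phi> x \<in> \<phi> ` N" for x
      using inj that N(2) by (auto dest: inj_onD)
  qed auto
  define \<psi> where "\<psi> = inv_into Z \<phi>"
  have \<psi>: "\<psi> (\<phi> x) = x" if "x \<in> Z" for x
    using inj that by (simp add: \<psi>_def)
  show "qrank (\<phi> ` Z) (\<phi> ` N) \<le> qrank Z N"
  proof (rule qrank_inj_le[where \<phi> = \<psi>])
    show "fun_subgroup (\<phi> ` Z)"
      by (rule sub[OF Z order_refl])
    show "(\<lambda>b. 0) \<in> N"
      by (rule fun_subgroup_zero[OF N(1)])
    show "\<psi> (\<lambda>b. x b - y b) = (\<lambda>b. \<psi> x b - \<psi> y b)" if "x \<in> \<phi> ` Z" "y \<in> \<phi> ` Z" for x y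
    proof -
      obtain x' y' where xy: "x' \<in> Z" "y' \<in> Z" "x = \<phi> x'" "y = \<phi> y'"
        using \<open>x \<in> \<phi> ` Z\<close> \<open>y \<in> \<phi> ` Z\<close> by (elim imageE)
      then have "\<psi> (\<lambda>b. x b - y b) = \<psi> (\<phi> (\<lambda>b. x' b - y' b))"
        using add by simp
      also have "\<dots> = (\<lambda>b. x' b - y' b)"
        by (rule \<psi>[OF fun_subgroup_diff[OF Z xy(1,2)]])
      finally show ?thesis
        using xy \<psi> by simp
    qed
    show "\<psi> x \<in> Z" if "x \<in> \<phi> ` Z" for x
      using that \<psi> by auto
    show "x \<in> \<phi> ` N" if "x \<in> \<phi> ` Z" "\<psi> x \<in> N" for x
      using that \<psi> by auto
  qed
qed

definition restr :: "('b \<Rightarrow> bool) \<Rightarrow> ('b \<Rightarrow>\<^sub>0 'r::comm_ring_1) \<Rightarrow> 'b \<Rightarrow>\<^sub>0 'r" where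
  "restr P c = lin (\<lambda>b. if P b then bas b else 0) c"

lemma lookup_restr: "lookup (restr P c) b = (if P b then lookup c b else 0)"
proof -
  have "lookup (restr P c) b = (\<Sum>b'\<in>keys c. if b' = b then if P b then lookup c b else 0 else 0)"
    unfolding restr_def lookup_lin by (intro sum.cong) (auto simp: lookup_single when_def)
  then show ?thesis
    by (simp add: in_keys_iff)
qed

lemma restr_id: "(\<And>b. b \<in> keys c \<Longrightarrow> P b) \<Longrightarrow> restr P c = c"
  by (intro poly_mapping_eqI) (auto simp: lookup_restr in_keys_iff)

lemma restr_none: "(\<And>b. b \<in> keys c \<Longrightarrow> \<not> P b) \<Longrightarrow> restr P c = 0"
  by (intro poly_mapping_eqI) (auto simp: lookup_restr in_keys_iff)

lemma lin_restr:
  assumes "\<And>b b'. b \<in> keys z \<Longrightarrow> b' \<in> keys (D b) \<Longrightarrow> P b' \<longleftrightarrow> Q b"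
  shows "lin D (restr Q z) = restr P (lin D z)"
proof -
  have "lin D (restr Q z) = lin (\<lambda>b. lin D (if Q b then bas b else 0)) z"
    by (simp add: restr_def lin_lin)
  also have "\<dots> = lin (\<lambda>b. restr P (D b)) z"
  proof (rule lin_cong)
    fix b assume "b \<in> keys z"
    then show "lin D (if Q b then bas b else 0) = restr P (D b)"
      using assms[of b] restr_id[of "D b" P] restr_none[of "D b" P] by (cases "Q b") auto
  qed
  also have "\<dots> = restr P (lin D z)"
    by (simp add: restr_def lin_lin)
  finally show ?thesis .
qed

lemma keys_restr: "keys (restr P c) = {b\<in>keys c. P b}"
  by (rule Set.set_eqI) (simp add: in_keys_iff lookup_restr)

text \<open>The reduced differential preserves \<open>\<pi>\<close>, so restriction to a fibre
  commutes with it and the complex splits.\<close>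

lemma hrank_fibres:
  fixes \<pi> :: "'b \<Rightarrow> 'c"
  assumes C: "finite C" "\<And>b. b \<in> B i \<Longrightarrow> \<delta> i b = k \<Longrightarrow> \<pi> b \<in> C"
    and \<pi>: "\<And>n b b'. b \<in> B (Suc n) \<Longrightarrow> b' \<in> keys (mod_aug (d (Suc n) b)) \<Longrightarrow> \<pi> b' = \<pi> b"
    and sub: "boundary_chains B \<delta> d i k \<subseteq> cycle_chains B \<delta> d i k"
  shows "hrank B \<delta> d i k = (\<Sum>c\<in>C. hrank (\<lambda>n. {b\<in>B n. \<pi> b = c}) \<delta> d i k)"
proof -
  let ?Z = "lookup ` cycle_chains B \<delta> d i k" and ?N = "lookup ` boundary_chains B \<delta> d i k"
  let ?D = "\<lambda>n b. mod_aug (d n b)"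
  have restr_cyc: "restr (\<lambda>b. \<pi> b = c) z \<in> cycle_chains B \<delta> d i k" if z: "z \<in> cycle_chains B \<delta> d i k" for z c
  proof -
    have "lin (?D i) (restr (\<lambda>b. \<pi> b = c) z) = 0" if "i > 0"
    proof -
      obtain n where n: "i = Suc n"
        using \<open>i > 0\<close> by (cases i) auto
      have "lin (?D i) (restr (\<lambda>b. \<pi> b = c) z) = restr (\<lambda>b. \<pi> b = c) (lin (?D i) z)"
      proof (rule lin_restr)
        fix b b' assume "b \<in> keys z" "b' \<in> keys (?D i b)"
        then have "\<pi> b' = \<pi> b"
          using z \<pi>[of b n b'] unfolding n cycle_chains_def by blast
        then show "\<pi> b' = c \<longleftrightarrow> \<pi> b = c"
          by simp
      qed
      also have "\<dots> = 0"
        using z that by (simp add: cycle_chains_def restr_def)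
      finally show ?thesis .
    qed
    then show ?thesis
      using z by (auto simp: cycle_chains_def keys_restr)
  qed
  have lin_restr_D: "lin (?D (Suc i)) (restr (\<lambda>b. \<pi> b = c) z) = restr (\<lambda>b. \<pi> b = c) (lin (?D (Suc i)) z)"
    if z: "keys z \<subseteq> {b\<in>B (Suc i). \<delta> (Suc i) b = k}" for z c
  proof (rule lin_restr)
    fix b b' assume "b \<in> keys z" "b' \<in> keys (?D (Suc i) b)"
    then have "\<pi> b' = \<pi> b"
      using z \<pi>[of b i b'] by blast
    then show "\<pi> b' = c \<longleftrightarrow> \<pi> b = c"
      by simp
  qed
  have lookup_restr': "(\<lambda>b. if \<pi> b = c then lookup z b else 0) = lookup (restr (\<lambda>b. \<pi> b = c) z)"
    for c and z :: "'b \<Rightarrow>\<^sub>0 int"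
    by (simp add: fun_eq_iff lookup_restr)
  have lin_restr_D': "(\<lambda>b. if \<pi> b = c then lookup (lin (?D (Suc i)) z) b else 0)
      = lookup (lin (?D (Suc i)) (restr (\<lambda>b. \<pi> b = c) z))"
    if z: "keys z \<subseteq> {b\<in>B (Suc i). \<delta> (Suc i) b = k}" for z c
    unfolding lookup_restr' lin_restr_D[OF z] ..
  have "hrank B \<delta> d i k = (\<Sum>c\<in>C. qrank {x\<in>?Z. \<forall>b. x b \<noteq> 0 \<longrightarrow> \<pi> b = c} {x\<in>?N. \<forall>b. x b \<noteq> 0 \<longrightarrow> \<pi> b = c})"
    unfolding hrank_def
  proof (rule qrank_fibres[OF C(1) fun_subgroup_cycle_chains fun_subgroup_boundary_chains])
    show "?N \<subseteq> ?Z"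
      using sub by blast
    show "\<pi> b \<in> C" if "x \<in> ?Z" "x b \<noteq> 0" for x b
      using that by (auto simp: cycle_chains_def in_keys_iff intro!: C(2))
    show "(\<lambda>b. if \<pi> b = c then x b else 0) \<in> ?Z" if "x \<in> ?Z" for x c
      using that restr_cyc by (auto simp: lookup_restr')
    show "(\<lambda>b. if \<pi> b = c then x b else 0) \<in> ?N" if "x \<in> ?N" for x c
    proof -
      obtain z where z: "keys z \<subseteq> {b\<in>B (Suc i). \<delta> (Suc i) b = k}" "x = lookup (lin (?D (Suc i)) z)"
        using \<open>x \<in> ?N\<close> by (auto simp: boundary_chains_def)
      then have "(\<lambda>b. if \<pi> b = c then x b else 0) = lookup (lin (?D (Suc i)) (restr (\<lambda>b. \<pi> b = c) z))"
        using lin_restr_D'[OF z(1), of c] by (simp only:)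
      moreover have "keys (restr (\<lambda>b. \<pi> b = c) z) \<subseteq> {b\<in>B (Suc i). \<delta> (Suc i) b = k}"
        using z(1) by (auto simp: keys_restr)
      ultimately show ?thesis
        by (auto simp: boundary_chains_def)
    qed
  qed
  also have "\<dots> = (\<Sum>c\<in>C. hrank (\<lambda>n. {b\<in>B n. \<pi> b = c}) \<delta> d i k)"
  proof (rule sum.cong)
    fix c
    let ?B = "\<lambda>n. {b\<in>B n. \<pi> b = c}"
    have "cycle_chains ?B \<delta> d i k = {z\<in>cycle_chains B \<delta> d i k. \<forall>b. lookup z b \<noteq> 0 \<longrightarrow> \<pi> b = c}"
      unfolding cycle_chains_def by (rule Set.set_eqI) (simp only: mem_Collect_eq subset_iff in_keys_iff; blast)
    then have "{x\<in>?Z. \<forall>b. x b \<noteq> 0 \<longrightarrow> \<pi> b = c} = lookup ` cycle_chains ?B \<delta> d i k"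
      by auto
    moreover have "{x\<in>?N. \<forall>b. x b \<noteq> 0 \<longrightarrow> \<pi> b = c} = lookup ` boundary_chains ?B \<delta> d i k"
    proof (intro equalityI subsetI)
      fix x assume x: "x \<in> {x\<in>?N. \<forall>b. x b \<noteq> 0 \<longrightarrow> \<pi> b = c}"
      then obtain z where z: "keys z \<subseteq> {b\<in>B (Suc i). \<delta> (Suc i) b = k}" "x = lookup (lin (?D (Suc i)) z)"
        by (auto simp: boundary_chains_def)
      have "x = (\<lambda>b. if \<pi> b = c then x b else 0)"
      proof
        fix b
        show "x b = (if \<pi> b = c then x b else 0)"
          using x by (cases "x b = 0") auto
      qed
      also have "\<dots> = lookup (lin (?D (Suc i)) (restr (\<lambda>b. \<pi> b = c) z))"
        unfolding z(2) by (rule lin_restr_D'[OF z(1)])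
      finally have "x = lookup (lin (?D (Suc i)) (restr (\<lambda>b. \<pi> b = c) z))" .
      moreover have "keys (restr (\<lambda>b. \<pi> b = c) z) \<subseteq> {b\<in>?B (Suc i). \<delta> (Suc i) b = k}"
        using z(1) by (auto simp: keys_restr)
      ultimately show "x \<in> lookup ` boundary_chains ?B \<delta> d i k"
        unfolding boundary_chains_def image_image by (rule image_eqI[OF _ CollectI])
    next
      fix x assume "x \<in> lookup ` boundary_chains ?B \<delta> d i k"
      then obtain z where z: "keys z \<subseteq> {b\<in>?B (Suc i). \<delta> (Suc i) b = k}" "x = lookup (lin (?D (Suc i)) z)"
        by (auto simp: boundary_chains_def)
      have z': "keys z \<subseteq> {b\<in>B (Suc i). \<delta> (Suc i) b = k}" "restr (\<lambda>b. \<pi> b = c) z = z"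
        using z(1) by (auto intro!: restr_id)
      then have "x = (\<lambda>b. if \<pi> b = c then x b else 0)"
        using lin_restr_D'[OF z'(1), of c] by (simp only: z(2) z'(2))
      then have "x b = 0" if "\<pi> b \<noteq> c" for b
        using that by (metis (full_types))
      then show "x \<in> {x\<in>?N. \<forall>b. x b \<noteq> 0 \<longrightarrow> \<pi> b = c}"
        using z'(1) z(2) by (auto simp: boundary_chains_def)
    qed
    ultimately show "qrank {x\<in>?Z. \<forall>b. x b \<noteq> 0 \<longrightarrow> \<pi> b = c} {x\<in>?N. \<forall>b. x b \<noteq> 0 \<longrightarrow> \<pi> b = c} = hrank ?B \<delta> d i k"
      by (simp add: hrank_def)
  qed simp
  finally show ?thesis .
qed

lemma based_resolution_boundaries_subset:
  assumes "based_resolution m K B \<delta> d ag"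
  shows "boundary_chains B \<delta> d i k \<subseteq> cycle_chains B \<delta> d i k"
proof
  note F = based_resolutionD[OF assms]
  fix x assume "x \<in> boundary_chains B \<delta> d i k"
  then obtain c where c: "keys c \<subseteq> {b\<in>B (Suc i). \<delta> (Suc i) b = k}" "x = lin (\<lambda>b. mod_aug (d (Suc i) b)) c"
    by (auto simp: boundary_chains_def)
  have "keys x \<subseteq> {b\<in>B i. \<delta> i b = k}"
    unfolding c(2)
  proof (rule keys_lin_subset)
    fix b assume "b \<in> keys c"
    then show "keys (mod_aug (d (Suc i) b)) \<subseteq> {b\<in>B i. \<delta> i b = k}"
      using c(1) keys_mod_aug_hom_chains[OF F(1)[of b i]] by auto
  qed
  moreover have "lin (\<lambda>b. mod_aug (d i b)) x = 0" if "i > 0"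
  proof -
    obtain n where n: "i = Suc n"
      using \<open>i > 0\<close> by (cases i) auto
    have "lin (\<lambda>b. mod_aug (d i b)) x = lin (\<lambda>b. mod_aug (lin (d (Suc n)) (d (Suc (Suc n)) b))) c"
      by (simp add: c(2) lin_lin n mod_aug_lin)
    also have "\<dots> = lin (\<lambda>_. 0) c"
    proof (rule lin_cong)
      fix b assume "b \<in> keys c"
      then have "b \<in> B (Suc (Suc n))"
        using c(1) n by auto
      then show "mod_aug (lin (d (Suc n)) (d (Suc (Suc n)) b)) = 0"
        by (simp add: F(2))
    qed
    finally show ?thesis
      by simp
  qed
  ultimately show "x \<in> cycle_chains B \<delta> d i k"
    by (simp add: cycle_chains_def)
qed

section \<open>Splitting the reduced Koszul complex by multidegree\<close>

definition ind :: "nat set \<Rightarrow> nat \<Rightarrow>\<^sub>0 nat" where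
  "ind I = (\<Sum>k\<in>I. ev k)"

lemma lookup_ind: "finite I \<Longrightarrow> lookup (ind I) k = (if k \<in> I then 1 else 0)"
  by (simp add: ind_def lookup_sum lookup_ev)

lemma keys_ind: "finite I \<Longrightarrow> keys (ind I) = I"
  by (rule Set.set_eqI) (simp add: in_keys_iff lookup_ind)

lemma mdeg_ind: "finite I \<Longrightarrow> mdeg (ind I) = card I"
  by (simp add: mdeg_def keys_ind lookup_ind)

lemma ind_insert: "finite I \<Longrightarrow> k \<notin> I \<Longrightarrow> ind (insert k I) = ind I + ev k"
  by (simp add: ind_def add.commute)

lemma ind_remove: "finite I \<Longrightarrow> k \<in> I \<Longrightarrow> ind (I - {k}) + ev k = ind I"
  using ind_insert[of "I - {k}" k] by (simp add: insert_absorb)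

text \<open>What remains of the differential when the coefficient variables become zero, up to a
  global sign, which changes neither cycles nor boundaries.\<close>

definition kos_e :: "nat set set \<Rightarrow> kbasis \<Rightarrow> kbasis \<Rightarrow>\<^sub>0 int" where
  "kos_e K = (\<lambda>(I, t). \<Sum>k\<in>I. if keys (t + ev k) \<in> K then single (I - {k}, t + ev k) (ssgn k I) else 0)"

lemma mod_aug_kos_d: "mod_aug (kos_d K b) = - kos_e K b"
proof -
  have mod_aug_diff: "mod_aug (x - y) = mod_aug x - mod_aug y" for x y :: "kbasis \<Rightarrow>\<^sub>0 int_mpoly"
    by (intro poly_mapping_eqI) (simp add: lookup_minus augmentation_def)
  have mod_aug_sum: "mod_aug (sum f A) = (\<Sum>a\<in>A. mod_aug (f a))" for f :: "nat \<Rightarrow> kbasis \<Rightarrow>\<^sub>0 int_mpoly" and A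
    by (induction A rule: infinite_finite_induct) (simp_all add: mod_aug_add)
  have mod_aug_single: "mod_aug (single b p) = single b (augmentation p)" for b :: kbasis and p
    by (intro poly_mapping_eqI) (simp add: lookup_single when_def)
  have ev0: "augmentation (single (ev k) n) = 0" for k n
    by (simp add: augmentation_def lookup_single when_def) (metis keys_ev keys_zero insert_not_empty)
  have aug0: "augmentation (single 0 n) = n" for n
    by (simp add: augmentation_def)
  have mod_aug_if: "mod_aug (if P then x else 0) = (if P then mod_aug x else 0)" for P and x :: "kbasis \<Rightarrow>\<^sub>0 int_mpoly"
    by simp
  show ?thesis
    unfolding kos_d_def kos_e_def case_prod_unfold
    by (simp add: mod_aug_sum mod_aug_diff mod_aug_single ev0 aug0 mod_aug_if sum_subtractf sum_negf cong: if_cong)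
qed

lemma lin_mod_aug_kos_d: "lin (\<lambda>b. mod_aug (kos_d K b)) c = - lin (kos_e K) c"
proof -
  have "lin (\<lambda>b. 0 - kos_e K b) c = lin (\<lambda>b. 0) c - lin (kos_e K) c"
    by (rule lin_fun_diff)
  then show ?thesis
    by (simp add: mod_aug_kos_d)
qed

lemma cycle_chains_kos: "cycle_chains B (\<lambda>n. kos_deg) (\<lambda>n. kos_d K) i k
    = {c. keys c \<subseteq> {b\<in>B i. kos_deg b = k} \<and> (i > 0 \<longrightarrow> lin (kos_e K) c = 0)}"
  by (simp add: cycle_chains_def lin_mod_aug_kos_d)

lemma boundary_chains_kos: "boundary_chains B (\<lambda>n. kos_deg) (\<lambda>n. kos_d K) i k
    = lin (kos_e K) ` {c. keys c \<subseteq> {b\<in>B (Suc i). kos_deg b = k}}"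
proof -
  let ?C = "{c :: kbasis \<Rightarrow>\<^sub>0 int. keys c \<subseteq> {b\<in>B (Suc i). kos_deg b = k}}"
  have "(\<lambda>c. - lin (kos_e K) c) ` ?C = lin (kos_e K) ` uminus ` ?C"
    unfolding image_image lin_uminus ..
  also have "uminus ` ?C = ?C"
  proof (intro equalityI subsetI)
    fix c assume "c \<in> ?C"
    then show "c \<in> uminus ` ?C"
      by (intro image_eqI[of _ _ "- c"]) auto
  qed auto
  finally show ?thesis
    unfolding boundary_chains_def lin_mod_aug_kos_d .
qed

text \<open>The exterior generator of index \<open>k\<close> is given the multidegree of the
  variable it is sent to, so that the differential preserves multidegrees.\<close>

definition kos_mdeg :: "kbasis \<Rightarrow> nat \<Rightarrow>\<^sub>0 nat" where
  "kos_mdeg b = ind (fst b) + snd b"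

lemma kos_mdeg_kos_e:
  assumes "finite (fst b)" "b' \<in> keys (kos_e K b)"
  shows "kos_mdeg b' = kos_mdeg b"
proof -
  have "keys (kos_e K b) \<subseteq> {b'. kos_mdeg b' = kos_mdeg b}"
    unfolding kos_e_def case_prod_unfold
  proof (rule keys_sum_subset)
    fix k assume k: "k \<in> fst b"
    have "ind (fst b - {k}) + (snd b + ev k) = ind (fst b) + snd b"
      by (simp flip: ind_remove[OF assms(1) k] add: add_ac)
    then show "keys (if keys (snd b + ev k) \<in> K
        then single (fst b - {k}, snd b + ev k) (ssgn k (fst b)) else 0 :: _ \<Rightarrow>\<^sub>0 int) \<subseteq> {b'. kos_mdeg b' = kos_mdeg b}"
      by (auto simp: kos_mdeg_def)
  qed
  then show ?thesis
    using assms(2) by auto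
qed

lemma mdeg_kos_mdeg: "finite (fst b) \<Longrightarrow> 2 * mdeg (kos_mdeg b) = kos_deg b"
  by (simp add: kos_mdeg_def kos_deg_def mdeg_add mdeg_ind)

text \<open>Exponents of a monomial of degree \<open>j\<close> are at most \<open>j\<close>, so it
  is a function between finite sets. The finiteness is what allows the rank to be summed over
  multidegrees.\<close>

lemma finite_monomials: "finite {c :: nat \<Rightarrow>\<^sub>0 nat. keys c \<subseteq> {1..m} \<and> mdeg c = j}"
proof -
  let ?C = "{c :: nat \<Rightarrow>\<^sub>0 nat. keys c \<subseteq> {1..m} \<and> mdeg c = j}"
  let ?f = "\<lambda>c :: nat \<Rightarrow>\<^sub>0 nat. restrict (lookup c) {1..m}"
  have "?f ` ?C \<subseteq> {1..m} \<rightarrow>\<^sub>E {..j}"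
  proof clarify
    fix c :: "nat \<Rightarrow>\<^sub>0 nat" assume c: "keys c \<subseteq> {1..m}" "j = mdeg c"
    have "lookup c k \<le> mdeg c" if "k \<in> {1..m}" for k
      unfolding mdeg_superset[OF finite_atLeastAtMost c(1)] using that by (intro member_le_sum) auto
    then show "?f c \<in> {1..m} \<rightarrow>\<^sub>E {..mdeg c}"
      by (auto simp: PiE_iff)
  qed
  then have "finite (?f ` ?C)"
    by (rule finite_subset) (intro finite_PiE; simp)
  moreover have "inj_on ?f ?C"
  proof (rule inj_onI)
    fix c c' assume c: "c \<in> ?C" "c' \<in> ?C" and eq: "?f c = ?f c'"
    show "c = c'"
    proof (rule poly_mapping_eqI)
      fix k
      show "lookup c k = lookup c' k"
      proof (cases "k \<in> {1..m}")
        case True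
        then show ?thesis
          using fun_cong[OF eq, of k] by simp
      next
        case False
        then have "k \<notin> keys c" "k \<notin> keys c'"
          using c by auto
        then show ?thesis
          by (simp add: in_keys_iff)
      qed
    qed
  qed
  ultimately show ?thesis
    by (rule finite_imageD)
qed

lemma hrank_kos_multidegree:
  assumes K: "down_closed K" "\<And>I. I \<in> K \<Longrightarrow> I \<subseteq> {1..m}"
  shows "hrank (kos_bas m K) (\<lambda>n. kos_deg) (\<lambda>n. kos_d K) i (2 * j)
    = (\<Sum>c\<in>{c. keys c \<subseteq> {1..m} \<and> mdeg c = j}.
        hrank (\<lambda>n. {b\<in>kos_bas m K n. kos_mdeg b = c}) (\<lambda>n. kos_deg) (\<lambda>n. kos_d K) i (2 * j))"
proof (rule hrank_fibres[OF finite_monomials])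
  have fin: "finite (fst b)" if "b \<in> kos_bas m K n" for b n
    using that finite_subset[of "fst b" "{1..m}"] by (auto simp: kos_bas_def)
  show "kos_mdeg b \<in> {c. keys c \<subseteq> {1..m} \<and> mdeg c = j}" if b: "b \<in> kos_bas m K i" "kos_deg b = 2 * j" for b
  proof -
    have "keys (kos_mdeg b) \<subseteq> {1..m}"
    proof -
      have "fst b \<subseteq> {1..m}" "keys (snd b) \<in> K"
        using b(1) by (auto simp: kos_bas_def)
      then show ?thesis
        unfolding kos_mdeg_def keys_add_nat keys_ind[OF fin[OF b(1)]] using K(2) by blast
    qed
    then show ?thesis
      using mdeg_kos_mdeg[OF fin[OF b(1)]] b(2) by simp
  qed
  show "kos_mdeg b' = kos_mdeg b" if "b \<in> kos_bas m K (Suc n)" "b' \<in> keys (mod_aug (kos_d K b))" for n b b'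
    using that by (intro kos_mdeg_kos_e[of _ _ K] fin) (simp_all add: mod_aug_kos_d)
  show "boundary_chains (kos_bas m K) (\<lambda>n. kos_deg) (\<lambda>n. kos_d K) i (2 * j)
      \<subseteq> cycle_chains (kos_bas m K) (\<lambda>n. kos_deg) (\<lambda>n. kos_d K) i (2 * j)"
    by (rule based_resolution_boundaries_subset[OF kos_based_resolution[OF K]])
qed

text \<open>In a multidegree with an exponent at least two, exchanging \<open>v\<^sub>l\<close> for \<open>u\<^sub>l\<close> is a contraction: it
  does not change the support of the monomial in the Stanley--Reisner ring.\<close>

definition kos_contract :: "nat \<Rightarrow> kbasis \<Rightarrow> kbasis \<Rightarrow>\<^sub>0 int" where
  "kos_contract l = (\<lambda>(I, t). if l \<in> I then 0 else single (insert l I, t - ev l) (ssgn l (insert l I)))"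

text \<open>By the exponent condition \<open>l\<close> stays in the support of the monomial even
  after one factor has been moved into \<open>I\<close>. So all face conditions are the same before
  and after, and the terms for indices other than \<open>l\<close> vanish or cancel.\<close>

lemma kos_contract_homotopy:
  assumes I: "finite I" and t: "keys t \<in> K" and l: "2 \<le> lookup (kos_mdeg (I, t)) l"
  shows "lin (kos_e K) (kos_contract l (I, t)) + lin (kos_contract l) (kos_e K (I, t)) = bas (I, t)"
proof -
  have cl: "lookup t l + (if l \<in> I then 1 else 0) \<ge> 2"
    using l by (simp add: kos_mdeg_def lookup_add lookup_ind[OF I] add.commute)
  have if_smul: "smul r (if P then x else 0) = (if P then smul r x else 0)" for P and r :: int and x :: "kbasis \<Rightarrow>\<^sub>0 int"
    by simp
  have if_lin: "lin f (if P then x else 0) = (if P then lin f x else 0)" for P and x :: "kbasis \<Rightarrow>\<^sub>0 int" and f :: "kbasis \<Rightarrow> kbasis \<Rightarrow>\<^sub>0 int"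
    by simp
  have lin_e: "lin (kos_contract l) (kos_e K (I, t)) = (\<Sum>k\<in>I. if keys (t + ev k) \<in> K
      then smul (ssgn k I) (kos_contract l (I - {k}, t + ev k)) else 0)"
    unfolding kos_e_def prod.case lin_sum if_lin lin_single ..
  have lt: "l \<in> keys t"
    using cl by (auto simp: in_keys_iff split: if_splits)
  then have keys_l: "keys (t + ev l) = keys t"
    by (auto simp: keys_add_nat)
  show ?thesis
  proof (cases "l \<in> I")
    case True
    have "lin (kos_contract l) (kos_e K (I, t)) = (\<Sum>k\<in>{l}. if keys (t + ev k) \<in> K
      then smul (ssgn k I) (kos_contract l (I - {k}, t + ev k)) else 0)"
      unfolding lin_e using I True by (intro sum.mono_neutral_right) (auto simp: kos_contract_def)
    also have "\<dots> = bas (I, t)"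
      using True t keys_l by (simp add: kos_contract_def insert_absorb)
    finally show ?thesis
      using True by (simp add: kos_contract_def)
  next
    case False
    let ?A = "insert l I"
    have t2: "t - ev l + ev l = t"
      by (rule minus_ev_self[OF lt])
    have "keys (t - ev l) = keys t"
      using cl False by (auto simp: in_keys_iff lookup_minus lookup_ev)
    then have keys_k: "keys (t - ev l + ev k) = keys (t + ev k)" for k
      by (simp add: keys_add_nat)
    have "lin (kos_e K) (kos_contract l (I, t)) = (\<Sum>k\<in>?A. if keys (t + ev k) \<in> K
        then single (?A - {k}, t - ev l + ev k) (ssgn l ?A * ssgn k ?A) else 0)"
      using False by (simp add: kos_contract_def kos_e_def smul_sum if_smul keys_k cong: if_cong)
    also have "\<dots> = bas (I, t) + (\<Sum>k\<in>I. if keys (t + ev k) \<in> K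
        then single (?A - {k}, t - ev l + ev k) (ssgn l ?A * ssgn k ?A) else 0)"
      using False I t keys_l t2 by simp
    also have "(\<Sum>k\<in>I. if keys (t + ev k) \<in> K
        then single (?A - {k}, t - ev l + ev k) (ssgn l ?A * ssgn k ?A) else 0)
        = (\<Sum>k\<in>I. - (if keys (t + ev k) \<in> K
      then smul (ssgn k I) (kos_contract l (I - {k}, t + ev k)) else 0 :: _ \<Rightarrow>\<^sub>0 int))"
    proof (rule sum.cong)
      fix k assume k: "k \<in> I"
      then have "k \<noteq> l"
        using False by auto
      have eq: "?A - {k} = insert l (I - {k})" "?A - {l} = I"
        using False k by auto
      \<comment> \<open>The signs for removing \<open>k\<close> and \<open>l\<close> in the two
        orders are opposite; multiplying by signs of square one isolates the product that is
        needed.\<close>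
      have "ssgn k ?A * ssgn l (?A - {k}) = - (ssgn l ?A * ssgn k (?A - {l}) :: int)"
        using I k \<open>k \<noteq> l\<close> by (intro ssgn_swap) auto
      then have "ssgn k ?A * ssgn l (?A - {k}) * (ssgn l ?A * ssgn l (?A - {k}))
          = - (ssgn l ?A * ssgn k (?A - {l})) * (ssgn l ?A * ssgn l (?A - {k}) :: int)"
        by (simp only:)
      moreover have "ssgn k ?A * ssgn l (?A - {k}) * (ssgn l ?A * ssgn l (?A - {k}))
          = ssgn l (?A - {k}) * ssgn l (?A - {k}) * (ssgn l ?A * ssgn k ?A :: int)"
        by (simp only: ac_simps)
      moreover have "- (ssgn l ?A * ssgn k (?A - {l})) * (ssgn l ?A * ssgn l (?A - {k}))
          = - (ssgn l ?A * ssgn l ?A * (ssgn k (?A - {l}) * ssgn l (?A - {k})) :: int)"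
        by (simp only: ac_simps mult_minus_left mult_minus_right)
      ultimately have "ssgn l ?A * ssgn k ?A = - (ssgn k (?A - {l}) * ssgn l (?A - {k}) :: int)"
        by (simp only: ssgn_square mult_1_left)
      then have "ssgn l ?A * ssgn k ?A = - (ssgn k I * ssgn l (insert l (I - {k})) :: int)"
        by (simp add: eq)
      then show "(if keys (t + ev k) \<in> K
        then single (?A - {k}, t - ev l + ev k) (ssgn l ?A * ssgn k ?A) else 0)
        = - (if keys (t + ev k) \<in> K
      then smul (ssgn k I) (kos_contract l (I - {k}, t + ev k)) else 0 :: _ \<Rightarrow>\<^sub>0 int)"
        using False by (simp add: kos_contract_def eq minus_ev_add[OF lt] single_uminus)
    qed simp
    finally show ?thesis
      unfolding lin_e sum_negf by simp
  qed
qed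

text \<open>The contraction preserves the multidegree and the internal degree, so within this
  multidegree every cycle is a boundary.\<close>

lemma hrank_kos_nonsquarefree:
  assumes K: "\<And>I. I \<in> K \<Longrightarrow> I \<subseteq> {1..m}" and l: "2 \<le> lookup c l"
  shows "hrank (\<lambda>n. {b\<in>kos_bas m K n. kos_mdeg b = c}) (\<lambda>n. kos_deg) (\<lambda>n. kos_d K) i k = 0"
proof -
  let ?B = "\<lambda>n. {b\<in>kos_bas m K n. kos_mdeg b = c}"
  have bas: "\<exists>I t. b = (I, t) \<and> finite I \<and> I \<subseteq> {1..m} \<and> card I = n \<and> keys t \<in> K \<and> kos_mdeg (I, t) = c"
    if "b \<in> ?B n" for b n
    using that finite_subset[of "fst b" "{1..m}"] by (auto simp: kos_bas_def)
  have contract: "keys (kos_contract l b) \<subseteq> {b\<in>?B (Suc i). kos_deg b = k}" if b: "b \<in> ?B i" "kos_deg b = k" for b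
  proof -
    obtain I t where I: "b = (I, t)" "finite I" "I \<subseteq> {1..m}" "card I = i" "keys t \<in> K" "kos_mdeg (I, t) = c"
      using bas[OF b(1)] by blast
    show ?thesis
    proof (cases "l \<in> I")
      case True
      then show ?thesis
        by (simp add: I(1) kos_contract_def)
    next
      case False
      have tl: "2 \<le> lookup t l"
        using l False unfolding I(6)[symmetric] by (simp add: kos_mdeg_def lookup_add lookup_ind[OF I(2)])
      then have lt: "l \<in> keys t"
        by (simp add: in_keys_iff)
      have keys: "keys (t - ev l) = keys t"
        using tl by (auto simp: in_keys_iff lookup_minus lookup_ev)
      have lm: "l \<in> {1..m}"
        using lt K[OF I(5)] by blast
      have c: "kos_mdeg (insert l I, t - ev l) = c"
        unfolding I(6)[symmetric] kos_mdeg_def fst_conv snd_conv ind_insert[OF I(2) False]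
        using minus_ev_self[OF lt] by (metis add.assoc add.commute)
      then have "kos_deg (insert l I, t - ev l) = kos_deg (I, t)"
        using mdeg_kos_mdeg[of "(insert l I, t - ev l)"] mdeg_kos_mdeg[of "(I, t)"] I(2,6) by simp
      moreover have "(insert l I, t - ev l) \<in> kos_bas m K (Suc i)"
        using I lm False keys by (simp add: kos_bas_def)
      ultimately show ?thesis
        using c b(2) False by (simp add: I(1) kos_contract_def)
    qed
  qed
  have "lookup ` cycle_chains ?B (\<lambda>n. kos_deg) (\<lambda>n. kos_d K) i k
      \<subseteq> lookup ` boundary_chains ?B (\<lambda>n. kos_deg) (\<lambda>n. kos_d K) i k"
  proof (rule image_mono, rule subsetI)
    fix z assume z: "z \<in> cycle_chains ?B (\<lambda>n. kos_deg) (\<lambda>n. kos_d K) i k"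
    then have zB: "b \<in> ?B i \<and> kos_deg b = k" if "b \<in> keys z" for b
      using that by (auto simp: cycle_chains_kos)
    have ez: "lin (kos_e K) z = 0"
    proof (cases "i = 0")
      case True
      have "lin (kos_e K) z = lin (\<lambda>_. 0) z"
      proof (rule lin_cong)
        fix b assume b: "b \<in> keys z"
        obtain I t where "b = (I, t)" "finite I" "card I = i"
          using bas zB[OF b] by blast
        then show "kos_e K b = 0"
          using True by (simp add: kos_e_def)
      qed
      then show ?thesis
        by simp
    next
      case False
      then show ?thesis
        using z by (simp add: cycle_chains_kos)
    qed
    have "z = lin bas z"
      by simp
    also have "\<dots> = lin (\<lambda>b. lin (kos_e K) (kos_contract l b) + lin (kos_contract l) (kos_e K b)) z"
    proof (rule lin_cong)
      fix b assume b: "b \<in> keys z"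
      obtain I t where I: "b = (I, t)" "finite I" "keys t \<in> K" "kos_mdeg (I, t) = c"
        using bas zB[OF b] by blast
      then show "bas b = lin (kos_e K) (kos_contract l b) + lin (kos_contract l) (kos_e K b)"
        unfolding I(1) using l by (intro kos_contract_homotopy[symmetric]) simp_all
    qed
    also have "\<dots> = lin (kos_e K) (lin (kos_contract l) z)"
      by (simp add: lin_fun_add ez flip: lin_lin)
    finally have "z = lin (kos_e K) (lin (kos_contract l) z)" .
    moreover have "keys (lin (kos_contract l) z) \<subseteq> {b\<in>?B (Suc i). kos_deg b = k}"
      using contract zB by (intro keys_lin_subset) blast
    ultimately show "z \<in> boundary_chains ?B (\<lambda>n. kos_deg) (\<lambda>n. kos_d K) i k"
      unfolding boundary_chains_kos by (rule image_eqI[OF _ CollectI])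
  qed
  then show ?thesis
    unfolding hrank_def by (rule qrank_trivial[OF _ fun_subgroup_boundary_chains])
qed

section \<open>Squarefree multidegrees and full subcomplexes\<close>

lemma kos_e_kos_e:
  assumes K: "down_closed K" "\<And>I. I \<in> K \<Longrightarrow> I \<subseteq> {1..m}" and b: "b \<in> kos_bas m K (Suc (Suc n))"
  shows "lin (kos_e K) (kos_e K b) = 0"
proof -
  have "mod_aug (lin (kos_d K) (kos_d K b)) = 0"
    using based_resolutionD(2)[OF kos_based_resolution[OF K], of b n] b by simp
  then have "lin (\<lambda>b. mod_aug (kos_d K b)) (mod_aug (kos_d K b)) = 0"
    by (simp only: mod_aug_lin)
  then show ?thesis
    unfolding lin_mod_aug_kos_d by (simp add: mod_aug_kos_d lin_uminus)
qed

lemma keys_kos_e: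
  assumes b: "b \<in> kos_bas m K (Suc n)" "kos_mdeg b = c"
  shows "keys (kos_e K b) \<subseteq> {b\<in>kos_bas m K n. kos_mdeg b = c}"
proof -
  have 1: "fst b \<subseteq> {1..m}" "card (fst b) = Suc n"
    using b(1) by (auto simp: kos_bas_def)
  have fb: "finite (fst b)"
    using 1(1) finite_subset by blast
  have "keys (kos_e K b) \<subseteq> kos_bas m K n"
    unfolding kos_e_def case_prod_unfold
  proof (rule keys_sum_subset)
    fix k assume "k \<in> fst b"
    then show "keys (if keys (snd b + ev k) \<in> K
        then single (fst b - {k}, snd b + ev k) (ssgn k (fst b)) else 0 :: _ \<Rightarrow>\<^sub>0 int) \<subseteq> kos_bas m K n"
      using 1 fb by (auto simp: kos_bas_def)
  qed
  then show ?thesis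
    using kos_mdeg_kos_e[OF fb, of _ K] b(2) by auto
qed

text \<open>In the squarefree multidegree of \<open>\<omega>\<close>, the Koszul complex is the cochain complex of the full
  subcomplex on \<open>\<omega>\<close>, the simplex \<open>\<sigma>\<close> corresponding to \<open>u\<^bsub>\<omega> - \<sigma>\<^esub> \<otimes> v\<^sup>\<sigma>\<close> up to the sign \<open>sq_sgn\<close>.\<close>

definition sq_elt :: "nat set \<Rightarrow> nat set \<Rightarrow> kbasis" where
  "sq_elt \<omega> \<sigma> = (\<omega> - \<sigma>, ind \<sigma>)"

definition sq_sgn :: "nat set \<Rightarrow> nat set \<Rightarrow> int" where
  "sq_sgn \<omega> \<sigma> = (\<Prod>k\<in>\<sigma>. ssgn k \<omega>)"

lemma sq_sgn_square [simp]: "sq_sgn \<omega> \<sigma> * sq_sgn \<omega> \<sigma> = 1"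
  by (simp add: sq_sgn_def flip: prod.distrib)

text \<open>The elements of \<open>\<omega>\<close> below \<open>k\<close> lie either in
  \<open>\<sigma>\<close> or in the complement of \<open>\<sigma> - {k}\<close>, so the sign of
  \<open>k\<close> in \<open>\<omega>\<close> is the product of its signs in these two sets. The
  product over \<open>\<sigma>\<close> in \<open>sq_sgn\<close> is made to absorb exactly this
  discrepancy.\<close>

lemma sq_sgn_remove:
  assumes "finite \<omega>" "\<sigma> \<subseteq> \<omega>" "k \<in> \<sigma>"
  shows "sq_sgn \<omega> \<sigma> * ssgn k (\<omega> - (\<sigma> - {k})) = ssgn k \<sigma> * sq_sgn \<omega> (\<sigma> - {k})"
proof -
  have fin: "finite \<sigma>"
    using assms by (auto intro: finite_subset)
  have 1: "sq_sgn \<omega> \<sigma> = ssgn k \<omega> * sq_sgn \<omega> (\<sigma> - {k})"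
    unfolding sq_sgn_def using fin assms(3) by (rule prod.remove)
  have "{i\<in>\<omega>. i < k} = {i\<in>\<sigma>. i < k} \<union> {i\<in>\<omega> - (\<sigma> - {k}). i < k}"
    using assms by auto
  then have "card {i\<in>\<omega>. i < k} = card {i\<in>\<sigma>. i < k} + card {i\<in>\<omega> - (\<sigma> - {k}). i < k}"
    using assms(1) fin by (simp only:) (intro card_Un_disjoint; auto)
  then have 2: "ssgn k \<omega> = (ssgn k \<sigma> * ssgn k (\<omega> - (\<sigma> - {k})) :: int)"
    by (simp add: ssgn_def power_add)
  have "sq_sgn \<omega> \<sigma> * ssgn k (\<omega> - (\<sigma> - {k}))
      = ssgn k \<sigma> * sq_sgn \<omega> (\<sigma> - {k}) * (ssgn k (\<omega> - (\<sigma> - {k})) * ssgn k (\<omega> - (\<sigma> - {k})))"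
    unfolding 1 2 by (simp only: ac_simps)
  then show ?thesis
    by simp
qed

lemma inj_on_sq_elt: "finite \<omega> \<Longrightarrow> inj_on (sq_elt \<omega>) (Pow \<omega>)"
  by (rule inj_onI) (auto simp: sq_elt_def)

text \<open>Koszul chains are read as cochains: a coefficient becomes, up to sign, a value on a
  simplex. Taking an index out of the exterior part adds a vertex to \<open>\<sigma>\<close>, which
  is why the Koszul differential becomes a coboundary.\<close>

definition sq_fun :: "nat set \<Rightarrow> (kbasis \<Rightarrow> int) \<Rightarrow> nat set \<Rightarrow> int" where
  "sq_fun \<omega> x = (\<lambda>\<sigma>. if \<sigma> \<subseteq> \<omega> then sq_sgn \<omega> \<sigma> * x (sq_elt \<omega> \<sigma>) else 0)"

lemma pairing_setbd: "pairing u (setbd \<sigma>) = (\<Sum>k\<in>\<sigma>. ssgn k \<sigma> * u (\<sigma> - {k}))"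
  by (simp add: setbd_def pairing_sum)

lemma lookup_kos_e_sq_elt:
  assumes \<omega>: "finite \<omega>" and \<tau>: "\<tau> \<subseteq> \<omega>" and \<sigma>: "\<sigma> \<subseteq> \<omega>" "\<sigma> \<in> K"
  shows "lookup (kos_e K (sq_elt \<omega> \<tau>)) (sq_elt \<omega> \<sigma>) = (\<Sum>k\<in>\<sigma>. if \<tau> = \<sigma> - {k} then ssgn k (\<omega> - \<tau>) else 0)"
proof -
  have "lookup (kos_e K (sq_elt \<omega> \<tau>)) (sq_elt \<omega> \<sigma>)
      = (\<Sum>k\<in>\<omega> - \<tau>. if k \<in> \<sigma> \<and> \<tau> = \<sigma> - {k} then ssgn k (\<omega> - \<tau>) else 0)"
    unfolding sq_elt_def[of \<omega> \<tau>] kos_e_def prod.case lookup_sum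
  proof (rule sum.cong)
    fix k assume k: "k \<in> \<omega> - \<tau>"
    have fin: "finite \<tau>"
      using \<tau> \<omega> by (rule finite_subset)
    have "ind \<tau> + ev k = ind (insert k \<tau>)"
      using k fin by (simp add: ind_insert)
    moreover have "\<omega> - \<tau> - {k} = \<omega> - insert k \<tau>"
      by auto
    ultimately have eq: "(\<omega> - \<tau> - {k}, ind \<tau> + ev k) = sq_elt \<omega> (insert k \<tau>)" "keys (ind \<tau> + ev k) = insert k \<tau>"
      using fin by (simp_all add: sq_elt_def keys_ind)
    have "sq_elt \<omega> (insert k \<tau>) = sq_elt \<omega> \<sigma> \<longleftrightarrow> insert k \<tau> = \<sigma>"
      using inj_on_eq_iff[OF inj_on_sq_elt[OF \<omega>], of "insert k \<tau>" \<sigma>] k \<tau> \<sigma> by auto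
    moreover have "insert k \<tau> = \<sigma> \<longleftrightarrow> k \<in> \<sigma> \<and> \<tau> = \<sigma> - {k}"
      using k by auto
    ultimately show "lookup (if keys (ind \<tau> + ev k) \<in> K
        then single (\<omega> - \<tau> - {k}, ind \<tau> + ev k) (ssgn k (\<omega> - \<tau>)) else 0) (sq_elt \<omega> \<sigma>)
        = (if k \<in> \<sigma> \<and> \<tau> = \<sigma> - {k} then ssgn k (\<omega> - \<tau>) else 0 :: int)"
      unfolding eq using \<sigma>(2) by (auto simp: lookup_single when_def)
  qed simp
  also have "\<dots> = (\<Sum>k\<in>\<sigma>. if \<tau> = \<sigma> - {k} then ssgn k (\<omega> - \<tau>) else 0)"
    using \<omega> \<sigma>(1) finite_subset[OF \<sigma>(1) \<omega>] by (intro sum.mono_neutral_cong) auto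
  finally show ?thesis .
qed

text \<open>The basis elements whose differential meets \<open>\<sigma>\<close> are those of the
  faces \<open>\<sigma> - {k}\<close>, and \<open>sq_sgn_remove\<close> turns the Koszul sign of
  each into its simplicial sign.\<close>

lemma sq_fun_kos_e:
  assumes \<omega>: "finite \<omega>" and \<sigma>: "\<sigma> \<subseteq> \<omega>" "\<sigma> \<in> K" and z: "keys z \<subseteq> sq_elt \<omega> ` Pow \<omega>"
  shows "sq_fun \<omega> (lookup (lin (kos_e K) z)) \<sigma> = pairing (sq_fun \<omega> (lookup z)) (setbd \<sigma>)"
proof -
  have fin: "finite \<sigma>"
    using \<sigma>(1) \<omega> by (rule finite_subset)
  have "lookup (lin (kos_e K) z) (sq_elt \<omega> \<sigma>)
      = (\<Sum>b\<in>sq_elt \<omega> ` Pow \<omega>. lookup z b * lookup (kos_e K b) (sq_elt \<omega> \<sigma>))"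
    using \<omega> by (intro lookup_lin_superset z) auto
  also have "\<dots> = (\<Sum>\<tau>\<in>Pow \<omega>. lookup z (sq_elt \<omega> \<tau>) * (\<Sum>k\<in>\<sigma>. if \<tau> = \<sigma> - {k} then ssgn k (\<omega> - \<tau>) else 0))"
    unfolding sum.reindex[OF inj_on_sq_elt[OF \<omega>]] o_def using lookup_kos_e_sq_elt[OF \<omega> _ \<sigma>] by (intro sum.cong) auto
  also have "\<dots> = (\<Sum>\<tau>\<in>Pow \<omega>. \<Sum>k\<in>\<sigma>. if \<tau> = \<sigma> - {k} then lookup z (sq_elt \<omega> (\<sigma> - {k})) * ssgn k (\<omega> - (\<sigma> - {k})) else 0)"
    unfolding sum_distrib_left by (intro sum.cong) auto
  also have "\<dots> = (\<Sum>k\<in>\<sigma>. \<Sum>\<tau>\<in>Pow \<omega>. if \<tau> = \<sigma> - {k} then lookup z (sq_elt \<omega> (\<sigma> - {k})) * ssgn k (\<omega> - (\<sigma> - {k})) else 0)"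
    by (rule sum.swap)
  also have "\<dots> = (\<Sum>k\<in>\<sigma>. lookup z (sq_elt \<omega> (\<sigma> - {k})) * ssgn k (\<omega> - (\<sigma> - {k})))"
    using \<omega> \<sigma>(1) by (intro sum.cong refl) (auto simp: sum.delta)
  finally have "sq_fun \<omega> (lookup (lin (kos_e K) z)) \<sigma>
      = (\<Sum>k\<in>\<sigma>. sq_sgn \<omega> \<sigma> * ssgn k (\<omega> - (\<sigma> - {k})) * lookup z (sq_elt \<omega> (\<sigma> - {k})))"
    using \<sigma>(1) by (simp add: sq_fun_def sum_distrib_left ac_simps)
  also have "\<dots> = (\<Sum>k\<in>\<sigma>. ssgn k \<sigma> * sq_fun \<omega> (lookup z) (\<sigma> - {k}))"
  proof (rule sum.cong)
    fix k assume k: "k \<in> \<sigma>"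
    have "\<sigma> - {k} \<subseteq> \<omega>"
      using \<sigma>(1) by auto
    then show "sq_sgn \<omega> \<sigma> * ssgn k (\<omega> - (\<sigma> - {k})) * lookup z (sq_elt \<omega> (\<sigma> - {k}))
        = ssgn k \<sigma> * sq_fun \<omega> (lookup z) (\<sigma> - {k})"
      unfolding sq_sgn_remove[OF \<omega> \<sigma>(1) k] by (simp add: sq_fun_def)
  qed simp
  finally show ?thesis
    by (simp add: pairing_setbd)
qed

text \<open>The exponents of the exterior part and of the monomial add up to one at each index of
  \<open>\<omega>\<close> and to zero elsewhere. So the two parts are complementary in
  \<open>\<omega>\<close>, and the support of the monomial determines the element.\<close>

lemma kos_bas_squarefree:
  assumes \<omega>: "\<omega> \<subseteq> {1..m}" "card \<omega> = j"
  shows "{b\<in>kos_bas m K n. kos_mdeg b = ind \<omega>} = sq_elt \<omega> ` {\<sigma>\<in>K. \<sigma> \<subseteq> \<omega> \<and> card \<sigma> + n = j}"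
proof -
  have fin: "finite \<omega>"
    using \<omega>(1) finite_subset by blast
  show ?thesis
  proof (intro equalityI subsetI)
    fix b assume b: "b \<in> {b\<in>kos_bas m K n. kos_mdeg b = ind \<omega>}"
    obtain I t where bI: "b = (I, t)"
      by (cases b)
    have I: "I \<subseteq> {1..m}" "card I = n" "keys t \<in> K" "ind I + t = ind \<omega>"
      using b by (auto simp: bI kos_bas_def kos_mdeg_def)
    have finI: "finite I"
      using I(1) finite_subset by blast
    have l: "(if k \<in> I then 1 else 0) + lookup t k = (if k \<in> \<omega> then 1 else 0)" for k
      using arg_cong[OF I(4), of "\<lambda>x. lookup x k"] by (simp only: lookup_add lookup_ind[OF finI] lookup_ind[OF fin])
    have sub: "keys t \<subseteq> \<omega>"
    proof
      fix k assume "k \<in> keys t"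
      then show "k \<in> \<omega>"
        using l[of k] by (cases "k \<in> \<omega>") (auto simp: in_keys_iff)
    qed
    have t: "t = ind (keys t)"
    proof (rule poly_mapping_eqI)
      fix k
      show "lookup t k = lookup (ind (keys t)) k"
        unfolding lookup_ind[OF finite_keys] in_keys_iff using l[of k] by (cases "k \<in> \<omega>"; cases "k \<in> I") auto
    qed
    have I': "I = \<omega> - keys t"
    proof (rule Set.set_eqI)
      fix k
      show "k \<in> I \<longleftrightarrow> k \<in> \<omega> - keys t"
        unfolding Diff_iff in_keys_iff using l[of k] by (cases "k \<in> \<omega>"; cases "k \<in> I") auto
    qed
    have "card (keys t) + n = j"
      using card_Diff_subset[OF finite_keys sub] card_mono[OF fin sub] I(2) \<omega>(2) by (simp flip: I')
    then show "b \<in> sq_elt \<omega> ` {\<sigma>\<in>K. \<sigma> \<subseteq> \<omega> \<and> card \<sigma> + n = j}"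
      using I(3) sub t I' by (intro image_eqI[of _ _ "keys t"]) (auto simp: bI sq_elt_def)
  next
    fix b assume "b \<in> sq_elt \<omega> ` {\<sigma>\<in>K. \<sigma> \<subseteq> \<omega> \<and> card \<sigma> + n = j}"
    then obtain \<sigma> where \<sigma>: "b = sq_elt \<omega> \<sigma>" "\<sigma> \<in> K" "\<sigma> \<subseteq> \<omega>" "card \<sigma> + n = j"
      by auto
    have fs: "finite \<sigma>"
      using \<sigma>(3) fin by (rule finite_subset)
    have "ind (\<omega> - \<sigma>) + ind \<sigma> = ind \<omega>"
      using \<sigma>(3) fs fin by (intro poly_mapping_eqI) (auto simp: lookup_add lookup_ind)
    moreover have "card (\<omega> - \<sigma>) = n"
      using card_Diff_subset[OF fs \<sigma>(3)] \<sigma>(4) \<omega>(2) by simp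
    ultimately show "b \<in> {b\<in>kos_bas m K n. kos_mdeg b = ind \<omega>}"
      using \<sigma> \<omega>(1) fs by (auto simp: sq_elt_def kos_bas_def kos_mdeg_def keys_ind)
  qed
qed

text \<open>The exterior part takes \<open>i\<close> of the \<open>j\<close> indices, so
  \<open>\<sigma>\<close> has \<open>j - i\<close> vertices, which is its position in the augmented
  complex.\<close>

lemma hrank_kos_squarefree:
  assumes K: "down_closed K" "\<And>I. I \<in> K \<Longrightarrow> I \<subseteq> {1..m}" and \<omega>: "\<omega> \<subseteq> {1..m}" "card \<omega> = j"
  shows "hrank (\<lambda>n. {b\<in>kos_bas m K n. kos_mdeg b = ind \<omega>}) (\<lambda>n. kos_deg) (\<lambda>n. kos_d K) i (2 * j)
    = (if i \<le> j then crank (setbas {\<sigma>\<in>K. \<sigma> \<subseteq> \<omega>}) (\<lambda>n. setbd) (j - i) else 0)"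
proof -
  let ?B = "\<lambda>n. {b\<in>kos_bas m K n. kos_mdeg b = ind \<omega>}"
  have fin: "finite \<omega>"
    using \<omega>(1) finite_subset by blast
  define S where "S n = {\<sigma>\<in>K. \<sigma> \<subseteq> \<omega> \<and> card \<sigma> + n = j}" for n
  have B: "{b\<in>?B n. kos_deg b = 2 * j} = sq_elt \<omega> ` S n" for n
  proof -
    have "kos_deg b = 2 * j" if b: "b \<in> ?B n" for b
    proof -
      have "finite (fst b)"
        using b finite_subset[of "fst b" "{1..m}"] by (auto simp: kos_bas_def)
      then show ?thesis
        using b mdeg_kos_mdeg[of b] mdeg_ind[OF fin] \<omega>(2) by auto
    qed
    then show ?thesis
      using kos_bas_squarefree[OF \<omega>, of K n] by (auto simp: S_def)
  qed
  let ?Z = "{z. keys z \<subseteq> sq_elt \<omega> ` S i \<and> (i > 0 \<longrightarrow> lin (kos_e K) z = 0)}"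
  let ?N = "lin (kos_e K) ` {z. keys z \<subseteq> sq_elt \<omega> ` S (Suc i)}"
  have Z: "cycle_chains ?B (\<lambda>n. kos_deg) (\<lambda>n. kos_d K) i (2 * j) = ?Z"
    unfolding cycle_chains_kos B ..
  have N: "boundary_chains ?B (\<lambda>n. kos_deg) (\<lambda>n. kos_d K) i (2 * j) = ?N"
    unfolding boundary_chains_kos B ..
  have S_Pow: "sq_elt \<omega> ` S n \<subseteq> sq_elt \<omega> ` Pow \<omega>" for n
    by (auto simp: S_def)
  show ?thesis
  proof (cases "i \<le> j")
    case False
    then have "S i = {}"
      by (auto simp: S_def)
    then have "lookup ` ?Z \<subseteq> {\<lambda>b. 0}"
      by auto
    moreover have "{\<lambda>b. 0} \<subseteq> lookup ` boundary_chains ?B (\<lambda>n. kos_deg) (\<lambda>n. kos_d K) i (2 * j)"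
      using fun_subgroup_zero[OF fun_subgroup_boundary_chains] by (simp only: insert_subset empty_subsetI simp_thms)
    ultimately have "lookup ` ?Z \<subseteq> lookup ` boundary_chains ?B (\<lambda>n. kos_deg) (\<lambda>n. kos_d K) i (2 * j)"
      by (rule subset_trans)
    then have "hrank ?B (\<lambda>n. kos_deg) (\<lambda>n. kos_d K) i (2 * j) = 0"
      unfolding hrank_def Z by (rule qrank_trivial[OF _ fun_subgroup_boundary_chains])
    then show ?thesis
      using False by simp
  next
    case True
    let ?K = "{\<sigma>\<in>K. \<sigma> \<subseteq> \<omega>}" and ?n = "j - i"
    have S_setbas: "S i = setbas ?K ?n"
      using True fin by (auto simp: S_def setbas_def intro: finite_subset)
    have fS: "finite (S n)" for n
      by (rule finite_subset[of _ "Pow \<omega>"]) (use fin in \<open>auto simp: S_def\<close>)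
    have keys_bd: "keys (lin (kos_e K) z) \<subseteq> sq_elt \<omega> ` S n" if z: "keys z \<subseteq> sq_elt \<omega> ` S (Suc n)" for z n
    proof (rule keys_lin_subset)
      fix b assume "b \<in> keys z"
      then have "b \<in> ?B (Suc n)"
        using z unfolding kos_bas_squarefree[OF \<omega>, of K "Suc n"] S_def by blast
      then show "keys (kos_e K b) \<subseteq> sq_elt \<omega> ` S n"
        using keys_kos_e[of b m K n "ind \<omega>"] unfolding kos_bas_squarefree[OF \<omega>, of K n] S_def by blast
    qed
    have sq_inj: "lookup z = lookup z'"
      if "keys z \<subseteq> sq_elt \<omega> ` Pow \<omega>" "keys z' \<subseteq> sq_elt \<omega> ` Pow \<omega>"
        "\<And>\<sigma>. \<sigma> \<subseteq> \<omega> \<Longrightarrow> sq_fun \<omega> (lookup z) \<sigma> = sq_fun \<omega> (lookup z') \<sigma>" for z z'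
    proof
      fix b
      show "lookup z b = lookup z' b"
      proof (cases "b \<in> sq_elt \<omega> ` Pow \<omega>")
        case True
        then obtain \<sigma> where \<sigma>: "b = sq_elt \<omega> \<sigma>" "\<sigma> \<subseteq> \<omega>"
          by auto
        have "sq_sgn \<omega> \<sigma> * lookup z b = sq_sgn \<omega> \<sigma> * lookup z' b"
          using that(3)[OF \<sigma>(2)] \<sigma> by (simp add: sq_fun_def)
        moreover have "sq_sgn \<omega> \<sigma> \<noteq> 0"
          using sq_sgn_square[of \<omega> \<sigma>] by (metis mult_zero_left zero_neq_one)
        ultimately show ?thesis
          by simp
      next
        case False
        then have "b \<notin> keys z" "b \<notin> keys z'"
          using that(1,2) by auto
        then show ?thesis
          by (simp add: in_keys_iff)
      qed
    qed
    \<comment> \<open>The inverse of \<open>sq_fun\<close>; as \<open>sq_sgn\<close> has square one,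
      the same sign serves in both directions.\<close>
    define \<psi> where "\<psi> n u = (\<Sum>\<sigma>\<in>S n. single (sq_elt \<omega> \<sigma>) (sq_sgn \<omega> \<sigma> * u \<sigma>))" for n and u :: "nat set \<Rightarrow> int"
    have keys_\<psi>: "keys (\<psi> n u) \<subseteq> sq_elt \<omega> ` S n" for n u
      unfolding \<psi>_def by (intro keys_sum_subset) auto
    have \<psi>: "sq_fun \<omega> (lookup (\<psi> n u)) = u" if u: "\<And>\<sigma>. u \<sigma> \<noteq> 0 \<Longrightarrow> \<sigma> \<in> S n" for n u
    proof
      fix \<sigma>
      show "sq_fun \<omega> (lookup (\<psi> n u)) \<sigma> = u \<sigma>"
      proof (cases "\<sigma> \<subseteq> \<omega>")
        case True
        have "lookup (\<psi> n u) (sq_elt \<omega> \<sigma>) = (\<Sum>\<tau>\<in>S n. if \<tau> = \<sigma> then sq_sgn \<omega> \<sigma> * u \<sigma> else 0)"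
          unfolding \<psi>_def lookup_sum
        proof (rule sum.cong)
          fix \<tau> assume "\<tau> \<in> S n"
          then have "sq_elt \<omega> \<tau> = sq_elt \<omega> \<sigma> \<longleftrightarrow> \<tau> = \<sigma>"
            using True inj_on_eq_iff[OF inj_on_sq_elt[OF fin]] by (auto simp: S_def)
          then show "lookup (single (sq_elt \<omega> \<tau>) (sq_sgn \<omega> \<tau> * u \<tau>)) (sq_elt \<omega> \<sigma>)
              = (if \<tau> = \<sigma> then sq_sgn \<omega> \<sigma> * u \<sigma> else 0)"
            by (auto simp: lookup_single when_def)
        qed simp
        also have "\<dots> = sq_sgn \<omega> \<sigma> * u \<sigma>"
          using u[of \<sigma>] fS by (auto simp: sum.delta)
        finally show ?thesis
          using True by (simp add: sq_fun_def flip: mult.assoc)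
      next
        case False
        then show ?thesis
          using u[of \<sigma>] by (auto simp: sq_fun_def S_def)
      qed
    qed
    have sq_supp: "\<sigma> \<in> S n" if "sq_fun \<omega> (lookup z) \<sigma> \<noteq> 0" and zS: "keys z \<subseteq> sq_elt \<omega> ` S n" for z n \<sigma>
    proof -
      have "\<sigma> \<subseteq> \<omega>" "sq_elt \<omega> \<sigma> \<in> keys z"
        using that(1) by (auto simp: sq_fun_def in_keys_iff split: if_splits)
      then obtain \<tau> where \<tau>: "\<tau> \<in> S n" "sq_elt \<omega> \<sigma> = sq_elt \<omega> \<tau>"
        using zS by auto
      then have "\<sigma> = \<tau>"
        using inj_onD[OF inj_on_sq_elt[OF fin] \<tau>(2)] \<open>\<sigma> \<subseteq> \<omega>\<close> by (auto simp: S_def)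
      then show ?thesis
        using \<tau>(1) by simp
    qed
    have "hrank ?B (\<lambda>n. kos_deg) (\<lambda>n. kos_d K) i (2 * j)
        = qrank (sq_fun \<omega> ` lookup ` ?Z) (sq_fun \<omega> ` lookup ` ?N)"
      unfolding hrank_def Z[symmetric] N[symmetric]
    proof (rule qrank_image[OF fun_subgroup_cycle_chains fun_subgroup_boundary_chains, symmetric])
      show "lookup ` boundary_chains ?B (\<lambda>n. kos_deg) (\<lambda>n. kos_d K) i (2 * j)
          \<subseteq> lookup ` cycle_chains ?B (\<lambda>n. kos_deg) (\<lambda>n. kos_d K) i (2 * j)"
        unfolding Z N
      proof (rule image_mono, rule subsetI)
        fix y assume "y \<in> ?N"
        then obtain z where z: "keys z \<subseteq> sq_elt \<omega> ` S (Suc i)" "y = lin (kos_e K) z"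
          by auto
        have "lin (kos_e K) y = 0" if "i > 0"
        proof -
          obtain n where n: "i = Suc n"
            using \<open>i > 0\<close> by (cases i) auto
          have "lin (kos_e K) y = lin (\<lambda>_. 0) z"
            unfolding z(2) lin_lin
          proof (rule lin_cong)
            fix b assume "b \<in> keys z"
            then have "b \<in> ?B (Suc i)"
              using z(1) unfolding kos_bas_squarefree[OF \<omega>, of K "Suc i"] S_def by blast
            then show "lin (kos_e K) (kos_e K b) = 0"
              unfolding n by (intro kos_e_kos_e[OF K]) auto
          qed
          then show ?thesis
            by simp
        qed
        then show "y \<in> ?Z"
          using keys_bd[OF z(1)] z(2) by blast
      qed
      show "sq_fun \<omega> (\<lambda>b. x b - y b) = (\<lambda>b. sq_fun \<omega> x b - sq_fun \<omega> y b)" for x y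
        by (auto simp: sq_fun_def fun_eq_iff right_diff_distrib)
      show "inj_on (sq_fun \<omega>) (lookup ` cycle_chains ?B (\<lambda>n. kos_deg) (\<lambda>n. kos_d K) i (2 * j))"
        unfolding Z
      proof (rule inj_onI)
        fix x y assume "x \<in> lookup ` ?Z" "y \<in> lookup ` ?Z" "sq_fun \<omega> x = sq_fun \<omega> y"
        then obtain z z' where z: "x = lookup z" "keys z \<subseteq> sq_elt \<omega> ` Pow \<omega>"
            "y = lookup z'" "keys z' \<subseteq> sq_elt \<omega> ` Pow \<omega>"
            "sq_fun \<omega> (lookup z) = sq_fun \<omega> (lookup z')"
          using S_Pow[of i] by auto
        show "x = y"
          unfolding z(1,3) by (rule sq_inj[OF z(2,4)]) (simp only: z(5))
      qed
    qed
    also have "sq_fun \<omega> ` lookup ` ?Z = cocycles (setbas ?K) (\<lambda>n. setbd) ?n"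
    proof (intro equalityI subsetI)
      fix u assume "u \<in> sq_fun \<omega> ` lookup ` ?Z"
      then obtain z where z: "u = sq_fun \<omega> (lookup z)" "keys z \<subseteq> sq_elt \<omega> ` S i" "i > 0 \<Longrightarrow> lin (kos_e K) z = 0"
        by auto
      have "pairing u (setbd \<sigma>) = 0" if \<sigma>: "\<sigma> \<in> setbas ?K (Suc ?n)" for \<sigma>
      proof -
        have \<sigma>': "\<sigma> \<subseteq> \<omega>" "\<sigma> \<in> K" "card \<sigma> = Suc ?n"
          using \<sigma> by (auto simp: setbas_def)
        \<comment> \<open>A simplex with one more vertex fits into \<open>\<omega>\<close>, so the
          exterior part is nonempty and the cycle condition is not void.\<close>
        then have "i > 0"
          using card_mono[OF fin \<sigma>'(1)] \<omega>(2) by simp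
        then have "lin (kos_e K) z = 0"
          by (rule z(3))
        moreover have "sq_fun \<omega> (lookup (lin (kos_e K) z)) \<sigma> = pairing u (setbd \<sigma>)"
          unfolding z(1) using z(2) S_Pow[of i] by (intro sq_fun_kos_e[OF fin \<sigma>'(1,2)]) auto
        moreover have "sq_fun \<omega> (lookup 0) \<sigma> = 0"
          by (simp add: sq_fun_def)
        ultimately show ?thesis
          by (simp only:)
      qed
      then show "u \<in> cocycles (setbas ?K) (\<lambda>n. setbd) ?n"
        using z(1,2) sq_supp unfolding cocycles_def cochains_def S_setbas[symmetric] by blast
    next
      fix u assume u: "u \<in> cocycles (setbas ?K) (\<lambda>n. setbd) ?n"
      then have u': "\<And>\<sigma>. u \<sigma> \<noteq> 0 \<Longrightarrow> \<sigma> \<in> S i" "\<And>\<sigma>. \<sigma> \<in> setbas ?K (Suc ?n) \<Longrightarrow> pairing u (setbd \<sigma>) = 0"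
        unfolding S_setbas cocycles_def cochains_def by blast+
      have "lin (kos_e K) (\<psi> i u) = 0" if "i > 0"
      proof -
        obtain n where n: "i = Suc n"
          using \<open>i > 0\<close> by (cases i) auto
        have k1: "keys (\<psi> i u) \<subseteq> sq_elt \<omega> ` S (Suc n)"
          using keys_\<psi>[of i u] n by simp
        have "lookup (lin (kos_e K) (\<psi> i u)) = lookup 0"
        proof (rule sq_inj)
          show "keys (lin (kos_e K) (\<psi> i u)) \<subseteq> sq_elt \<omega> ` Pow \<omega>"
            using keys_bd[OF k1] S_Pow by blast
          fix \<sigma> assume \<sigma>: "\<sigma> \<subseteq> \<omega>"
          have "sq_fun \<omega> (lookup (lin (kos_e K) (\<psi> i u))) \<sigma> = 0"
          proof (rule ccontr)
            assume ne: "sq_fun \<omega> (lookup (lin (kos_e K) (\<psi> i u))) \<sigma> \<noteq> 0"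
            then have \<sigma>S: "\<sigma> \<in> S n"
              using sq_supp keys_bd[OF k1] by blast
            then have "\<sigma> \<in> setbas ?K (Suc ?n)"
              using True n fin by (auto simp: S_def setbas_def intro: finite_subset)
            moreover have "\<sigma> \<in> K"
              using \<sigma>S by (simp add: S_def)
            ultimately show False
              using ne sq_fun_kos_e[OF fin \<sigma>, of K "\<psi> i u"] u'(2)[of \<sigma>] \<psi>[of u i] u'(1) keys_\<psi>[of i u] S_Pow[of i] by auto
          qed
          then show "sq_fun \<omega> (lookup (lin (kos_e K) (\<psi> i u))) \<sigma> = sq_fun \<omega> (lookup 0) \<sigma>"
            by (simp add: sq_fun_def)
        qed simp
        then show ?thesis
          by (intro poly_mapping_eqI) (simp only:)
      qed
      then have "\<psi> i u \<in> ?Z"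
        using keys_\<psi> by blast
      then show "u \<in> sq_fun \<omega> ` lookup ` ?Z"
        using \<psi>[OF u'(1), symmetric] by (intro image_eqI imageI) auto
    qed
    also have "sq_fun \<omega> ` lookup ` ?N = coboundaries (setbas ?K) (\<lambda>n. setbd) ?n"
    proof (cases ?n)
      \<comment> \<open>Here \<open>i = j\<close>: the exterior part already exhausts
        \<open>\<omega>\<close> and cannot be longer, so the only boundary is zero.\<close>
      case 0
      then have "S (Suc i) = {}"
        using True by (auto simp: S_def)
      then have "?N = {0}"
        by auto
      then show ?thesis
        unfolding 0 coboundaries_0 by (simp add: sq_fun_def fun_eq_iff)
    next
      case (Suc n)
      have S_Suc: "S (Suc i) = setbas ?K n"
        using Suc fin by (auto simp: S_def setbas_def intro: finite_subset)
      have d: "sq_fun \<omega> (lookup (lin (kos_e K) z))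
          = (\<lambda>\<sigma>. if \<sigma> \<in> setbas ?K (Suc n) then pairing (sq_fun \<omega> (lookup z)) (setbd \<sigma>) else 0)"
        if z: "keys z \<subseteq> sq_elt \<omega> ` S (Suc i)" for z
      proof
        fix \<sigma>
        show "sq_fun \<omega> (lookup (lin (kos_e K) z)) \<sigma>
            = (if \<sigma> \<in> setbas ?K (Suc n) then pairing (sq_fun \<omega> (lookup z)) (setbd \<sigma>) else 0)"
        proof (cases "\<sigma> \<in> S i")
          case True
          then have "\<sigma> \<subseteq> \<omega>" "\<sigma> \<in> K" "\<sigma> \<in> setbas ?K (Suc n)"
            using S_setbas Suc by (auto simp: S_def)
          then show ?thesis
            using sq_fun_kos_e[OF fin, of \<sigma> K z] z S_Pow[of "Suc i"] by auto
        next
          case False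
          then show ?thesis
            using sq_supp[OF _ keys_bd[OF z]] S_setbas Suc by auto
        qed
      qed
      have "sq_fun \<omega> ` lookup ` {z. keys z \<subseteq> sq_elt \<omega> ` S (Suc i)} = cochains (setbas ?K) n"
      proof (intro equalityI subsetI)
        fix u assume "u \<in> sq_fun \<omega> ` lookup ` {z. keys z \<subseteq> sq_elt \<omega> ` S (Suc i)}"
        then show "u \<in> cochains (setbas ?K) n"
          using sq_supp unfolding cochains_def S_Suc[symmetric] by blast
      next
        fix u assume "u \<in> cochains (setbas ?K) n"
        then have "\<And>\<sigma>. u \<sigma> \<noteq> 0 \<Longrightarrow> \<sigma> \<in> S (Suc i)"
          unfolding S_Suc cochains_def by blast
        from \<psi>[OF this] show "u \<in> sq_fun \<omega> ` lookup ` {z. keys z \<subseteq> sq_elt \<omega> ` S (Suc i)}"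
          using keys_\<psi>[of "Suc i" u] by (intro image_eqI[of _ _ "lookup (\<psi> (Suc i) u)"] imageI CollectI) auto
      qed
      then have "coboundaries (setbas ?K) (\<lambda>n. setbd) ?n = (\<lambda>w \<sigma>. if \<sigma> \<in> setbas ?K (Suc n) then pairing w (setbd \<sigma>) else 0)
          ` sq_fun \<omega> ` lookup ` {z. keys z \<subseteq> sq_elt \<omega> ` S (Suc i)}"
        unfolding Suc coboundaries_Suc by simp
      then show ?thesis
        unfolding image_image using d by (auto intro!: image_cong)
    qed
    finally show ?thesis
      using True by (simp add: crank_def)
  qed
qed

text \<open>A multidegree without exponents of two or more is the indicator of its support, so only
  the subsets of size \<open>j\<close> contribute.\<close>

theorem hrank_kos:
  assumes K: "down_closed K" "\<And>I. I \<in> K \<Longrightarrow> I \<subseteq> {1..m}"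
  shows "hrank (kos_bas m K) (\<lambda>n. kos_deg) (\<lambda>n. kos_d K) i (2 * j)
    = (\<Sum>\<omega>\<in>{\<omega>. \<omega> \<subseteq> {1..m} \<and> card \<omega> = j}.
        if i \<le> j then crank (setbas {\<sigma>\<in>K. \<sigma> \<subseteq> \<omega>}) (\<lambda>n. setbd) (j - i) else 0)"
proof -
  let ?C = "{c. keys c \<subseteq> {1..m} \<and> mdeg c = j}" and ?W = "{\<omega>. \<omega> \<subseteq> {1..m} \<and> card \<omega> = j}"
  let ?f = "\<lambda>c. hrank (\<lambda>n. {b\<in>kos_bas m K n. kos_mdeg b = c}) (\<lambda>n. kos_deg) (\<lambda>n. kos_d K) i (2 * j)"
  have fin: "finite \<omega>" if "\<omega> \<in> ?W" for \<omega>
    using that finite_subset by blast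
  have "sum ?f ?C = sum ?f (ind ` ?W)"
  proof (rule sum.mono_neutral_right[OF finite_monomials])
    show "ind ` ?W \<subseteq> ?C"
    proof
      fix c assume "c \<in> ind ` ?W"
      then obtain \<omega> where "c = ind \<omega>" "\<omega> \<in> ?W"
        by blast
      then show "c \<in> ?C"
        using fin[of \<omega>] by (simp add: keys_ind mdeg_ind)
    qed
    show "\<forall>c\<in>?C - ind ` ?W. ?f c = 0"
    proof
      fix c assume c: "c \<in> ?C - ind ` ?W"
      have "\<exists>l. 2 \<le> lookup c l"
      proof (rule ccontr)
        assume "\<nexists>l. 2 \<le> lookup c l"
        then have l: "lookup c l < 2" for l
          by (simp add: not_le)
        have "c = ind (keys c)"
        proof (rule poly_mapping_eqI)
          fix k
          show "lookup c k = lookup (ind (keys c)) k"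
            unfolding lookup_ind[OF finite_keys] in_keys_iff using l[of k] by auto
        qed
        moreover from this have "mdeg c = card (keys c)"
          using mdeg_ind[OF finite_keys, of c] by simp
        then have "keys c \<in> ?W"
          using c by simp
        ultimately have "c \<in> ind ` ?W"
          by (rule image_eqI)
        then show False
          using c by blast
      qed
      then show "?f c = 0"
        using hrank_kos_nonsquarefree[OF K(2)] by blast
    qed
  qed
  also have "\<dots> = (\<Sum>\<omega>\<in>?W. ?f (ind \<omega>))"
  proof (rule sum.reindex[unfolded o_def], rule inj_onI)
    fix \<omega> \<omega>' assume "\<omega> \<in> ?W" "\<omega>' \<in> ?W" "ind \<omega> = ind \<omega>'"
    then show "\<omega> = \<omega>'"
      using keys_ind[OF fin] by metis
  qed
  also have "\<dots> = (\<Sum>\<omega>\<in>?W. if i \<le> j then crank (setbas {\<sigma>\<in>K. \<sigma> \<subseteq> \<omega>}) (\<lambda>n. setbd) (j - i) else 0)"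
    using hrank_kos_squarefree[OF K] by (intro sum.cong) auto
  finally have sum_eq: "sum ?f ?C = (\<Sum>\<omega>\<in>?W. if i \<le> j then crank (setbas {\<sigma>\<in>K. \<sigma> \<subseteq> \<omega>}) (\<lambda>n. setbd) (j - i) else 0)" .
  have "hrank (kos_bas m K) (\<lambda>n. kos_deg) (\<lambda>n. kos_d K) i (2 * j) = sum ?f ?C"
    by (rule hrank_kos_multidegree[OF K])
  then show ?thesis
    unfolding sum_eq .
qed

section \<open>Resolutions of the Stanley--Reisner ring\<close>

lemma mpoly_ring_simps [simp]:
  "monoid.mult (mpoly_ring m) = (*)" "one (mpoly_ring m) = 1" "ring.zero (mpoly_ring m) = 0" "ring.add (mpoly_ring m) = (+)"
  by (simp_all add: mpoly_ring_def)

lemma mpoly_carrier_iff: "p \<in> carrier (mpoly_ring m) \<longleftrightarrow> (\<forall>a. lookup p a \<noteq> 0 \<longrightarrow> keys a \<subseteq> {1..m})"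
  by (simp add: mpoly_ring_def Ball_def in_keys_iff)

lemma mpoly_carrier_0 [simp]: "0 \<in> carrier (mpoly_ring m)" and mpoly_carrier_1 [simp]: "1 \<in> carrier (mpoly_ring m)"
  by (auto simp: mpoly_carrier_iff lookup_one when_def)

lemma mpoly_carrier_add: "p \<in> carrier (mpoly_ring m) \<Longrightarrow> q \<in> carrier (mpoly_ring m) \<Longrightarrow> p + q \<in> carrier (mpoly_ring m)"
  unfolding mpoly_carrier_iff lookup_add by (metis add_0)

lemma mpoly_carrier_uminus: "p \<in> carrier (mpoly_ring m) \<Longrightarrow> - p \<in> carrier (mpoly_ring m)"
  unfolding mpoly_carrier_iff by simp

lemma mpoly_carrier_mult:
  assumes "p \<in> carrier (mpoly_ring m)" "q \<in> carrier (mpoly_ring m)"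
  shows "p * q \<in> carrier (mpoly_ring m)"
  unfolding mpoly_carrier_iff
proof (intro allI impI)
  fix a assume "lookup (p * q) a \<noteq> 0"
  then obtain s t where "lookup p s \<noteq> 0" "lookup q t \<noteq> 0" "a = s + t"
    by (rule lookup_mult_nonzero)
  moreover from this have "keys s \<subseteq> {1..m}" "keys t \<subseteq> {1..m}"
    using assms unfolding mpoly_carrier_iff by simp_all
  ultimately show "keys a \<subseteq> {1..m}"
    by (simp only: keys_add_nat Un_subset_iff simp_thms)
qed

lemma cring_mpoly_ring: "cring (mpoly_ring m)"
proof (rule cringI)
  show "abelian_group (mpoly_ring m)"
  proof (rule abelian_groupI)
    show "\<exists>y\<in>carrier (mpoly_ring m). y \<oplus>\<^bsub>mpoly_ring m\<^esub> x = \<zero>\<^bsub>mpoly_ring m\<^esub>" if "x \<in> carrier (mpoly_ring m)" for x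
      using mpoly_carrier_uminus[OF that] by (intro bexI[of _ "- x"]) simp_all
  qed (simp_all add: mpoly_carrier_add add_ac)
  show "comm_monoid (mpoly_ring m)"
    by (rule comm_monoidI) (simp_all add: mpoly_carrier_mult mult_ac)
qed (simp add: distrib_right)

lemma prod_poly_var: "finite s \<Longrightarrow> (\<Prod>k\<in>s. poly_var k) = single (ind s) 1"
  by (induction s rule: finite_induct) (simp_all add: ind_def poly_var_def mult_single ev_def)

text \<open>A monomial whose support is a non-face is divisible by the squarefree generator of that
  support, so all polynomials made of such monomials lie in the ideal. Conversely they form an
  ideal, because \<open>K\<close> is closed downwards.\<close>

lemma SR_ideal_eq:
  assumes K: "down_closed K"
  shows "SR_ideal m K = {p \<in> carrier (mpoly_ring m). red K p = 0}" and "ideal (SR_ideal m K) (mpoly_ring m)"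
proof -
  interpret R: cring "mpoly_ring m"
    by (rule cring_mpoly_ring)
  let ?G = "{\<Prod>k\<in>s. poly_var k | s. s \<subseteq> {1..m} \<and> s \<notin> K}" and ?J = "{p \<in> carrier (mpoly_ring m). red K p = 0}"
  have J: "ideal ?J (mpoly_ring m)"
  proof (rule idealI[OF R.ring_axioms])
    show "subgroup ?J (add_monoid (mpoly_ring m))"
    proof (rule R.add.subgroupI)
      show "?J \<noteq> {}"
        by (auto intro: exI[of _ 0])
      fix a b assume "a \<in> ?J" "b \<in> ?J"
      then show "a \<oplus>\<^bsub>mpoly_ring m\<^esub> b \<in> ?J"
        by (simp add: mpoly_carrier_add red_add)
    next
      fix a assume a: "a \<in> ?J"
      have "\<ominus>\<^bsub>mpoly_ring m\<^esub> a = - a"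
        using a mpoly_carrier_uminus[of a m] by (intro R.minus_equality) auto
      then show "\<ominus>\<^bsub>mpoly_ring m\<^esub> a \<in> ?J"
        using a mpoly_carrier_uminus[of a m] by (simp add: red_uminus)
    qed auto
    show "x \<otimes>\<^bsub>mpoly_ring m\<^esub> a \<in> ?J" "a \<otimes>\<^bsub>mpoly_ring m\<^esub> x \<in> ?J" if "a \<in> ?J" "x \<in> carrier (mpoly_ring m)" for a x
      using that red_mult_zero[OF K, of a x] by (simp_all add: mpoly_carrier_mult mult.commute[of a])
  qed
  have fin: "finite s" if "s \<subseteq> {1..m}" for s
    using that finite_subset by blast
  have G: "?G \<subseteq> ?J"
  proof
    fix p assume "p \<in> ?G"
    then obtain s where s: "p = (\<Prod>k\<in>s. poly_var k)" "s \<subseteq> {1..m}" "s \<notin> K"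
      by auto
    have "p = single (ind s) 1"
      using s(1) prod_poly_var[OF fin[OF s(2)]] by simp
    then show "p \<in> ?J"
      using s(2,3) keys_ind[OF fin[OF s(2)]]
      by (auto simp: mpoly_carrier_iff lookup_single when_def intro!: poly_mapping_eqI)
  qed
  then have Gc: "?G \<subseteq> carrier (mpoly_ring m)"
    by auto
  interpret I: ideal "SR_ideal m K" "mpoly_ring m"
    unfolding SR_ideal_def by (rule R.genideal_ideal[OF Gc])
  show "ideal (SR_ideal m K) (mpoly_ring m)"
    by (rule I.ideal_axioms)
  show "SR_ideal m K = ?J"
  proof
    show "SR_ideal m K \<subseteq> ?J"
      unfolding SR_ideal_def by (rule R.genideal_minimal[OF J G])
    show "?J \<subseteq> SR_ideal m K"
    proof
      fix p assume p: "p \<in> ?J"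
      have sum: "sum f A \<in> SR_ideal m K" if "\<And>t. t \<in> A \<Longrightarrow> f t \<in> SR_ideal m K" for f :: "(nat \<Rightarrow>\<^sub>0 nat) \<Rightarrow> int_mpoly" and A
        using that
      proof (induction A rule: infinite_finite_induct)
        case (insert x F)
        then show ?case
          using I.a_closed[of "f x" "sum f F"] by simp
      qed (use I.zero_closed in simp_all)
      have "p = (\<Sum>t\<in>keys p. single t (lookup p t))"
        using lin_bas[of p, symmetric] by (simp only: lin_def smul_single mult_1_right)
      also have "\<dots> \<in> SR_ideal m K"
      proof (rule sum)
        fix t assume t: "t \<in> keys p"
        let ?s = "keys t"
        have tm: "?s \<subseteq> {1..m}"
          using p t by (auto simp: mpoly_carrier_iff in_keys_iff)
        have "lookup (red K p) t = 0"
          using p by simp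
        then have "?s \<notin> K"
          using t by (auto simp: in_keys_iff)
        then have "single (ind ?s) 1 \<in> ?G"
          using tm by (intro CollectI exI[of _ ?s] conjI prod_poly_var[OF finite_keys, symmetric])
        then have "single (ind ?s) 1 \<in> SR_ideal m K"
          using R.genideal_self[OF Gc] unfolding SR_ideal_def by blast
        moreover have "single (t - ind ?s) (lookup p t) \<in> carrier (mpoly_ring m)"
          using tm by (auto simp: mpoly_carrier_iff lookup_single when_def in_keys_iff lookup_minus split: if_splits)
        ultimately have "single (t - ind ?s) (lookup p t) * single (ind ?s) 1 \<in> SR_ideal m K"
          using I.I_l_closed by simp
        moreover have "t - ind ?s + ind ?s = t"
          by (intro poly_mapping_eqI) (auto simp: lookup_add lookup_minus lookup_ind in_keys_iff)
        ultimately show "single t (lookup p t) \<in> SR_ideal m K"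
          by (simp add: mult_single)
      qed
      finally show "p \<in> SR_ideal m K" .
    qed
  qed
qed

lemma SR_proj_eq:
  assumes K: "down_closed K" and p: "p \<in> carrier (mpoly_ring m)"
  shows "SR_proj m K p = {q \<in> carrier (mpoly_ring m). red K q = red K p}"
proof -
  have "SR_proj m K p = (\<lambda>h. h + p) ` {h \<in> carrier (mpoly_ring m). red K h = 0}"
    unfolding SR_proj_def a_r_coset_def' SR_ideal_eq(1)[OF K] by auto
  also have "\<dots> = {q \<in> carrier (mpoly_ring m). red K q = red K p}"
  proof (intro equalityI subsetI)
    fix q assume q: "q \<in> {q \<in> carrier (mpoly_ring m). red K q = red K p}"
    then have "q + - p \<in> carrier (mpoly_ring m)" "red K (q + - p) = 0"
      using p by (simp_all only: mpoly_carrier_add mpoly_carrier_uminus mem_Collect_eq red_add red_uminus) simp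
    then show "q \<in> (\<lambda>h. h + p) ` {h \<in> carrier (mpoly_ring m). red K h = 0}"
      by (intro image_eqI[of _ _ "q + - p"]) simp_all
  qed (use p in \<open>auto simp: mpoly_carrier_add red_add\<close>)
  finally show ?thesis .
qed

lemma SR_proj_eq_iff:
  assumes K: "down_closed K" and p: "p \<in> carrier (mpoly_ring m)" "q \<in> carrier (mpoly_ring m)"
  shows "SR_proj m K p = SR_proj m K q \<longleftrightarrow> red K p = red K q"
  unfolding SR_proj_eq[OF K p(1)] SR_proj_eq[OF K p(2)] using p by auto

text \<open>All members of a residue class have the same reduction when \<open>K\<close> is closed
  downwards, so the choice of a representative does not matter.\<close>

definition SR_nf :: "nat set set \<Rightarrow> int_mpoly set \<Rightarrow> int_mpoly" where
  "SR_nf K C = red K (SOME p. p \<in> C)"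

lemma SR_nf_proj:
  assumes K: "down_closed K" and p: "p \<in> carrier (mpoly_ring m)"
  shows "SR_nf K (SR_proj m K p) = red K p"
proof -
  have "p \<in> SR_proj m K p"
    using p by (simp add: SR_proj_eq[OF K p])
  then have "(SOME q. q \<in> SR_proj m K p) \<in> SR_proj m K p"
    by (rule someI)
  then show ?thesis
    by (simp add: SR_nf_def SR_proj_eq[OF K p])
qed

lemma SR_module_ops:
  assumes K: "down_closed K"
  shows "carrier (SR_module m K) = SR_proj m K ` carrier (mpoly_ring m)"
    and "\<And>p q. p \<in> carrier (mpoly_ring m) \<Longrightarrow> q \<in> carrier (mpoly_ring m) \<Longrightarrow>
      SR_proj m K p \<oplus>\<^bsub>SR_module m K\<^esub> SR_proj m K q = SR_proj m K (p + q)"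
    and "\<And>r p. r \<in> carrier (mpoly_ring m) \<Longrightarrow> p \<in> carrier (mpoly_ring m) \<Longrightarrow>
      r \<odot>\<^bsub>SR_module m K\<^esub> SR_proj m K p = SR_proj m K (r * p)"
    and "\<zero>\<^bsub>SR_module m K\<^esub> = SR_proj m K 0"
proof -
  interpret I: ideal "SR_ideal m K" "mpoly_ring m"
    by (rule SR_ideal_eq(2)[OF K])
  show "carrier (SR_module m K) = SR_proj m K ` carrier (mpoly_ring m)"
    by (auto simp: SR_module_def module_via_def SR_ring_def FactRing_def A_RCOSETS_def' SR_proj_def)
  show "SR_proj m K p \<oplus>\<^bsub>SR_module m K\<^esub> SR_proj m K q = SR_proj m K (p + q)"
    if "p \<in> carrier (mpoly_ring m)" "q \<in> carrier (mpoly_ring m)" for p q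
    using I.a_rcos_sum[OF that] by (simp add: SR_module_def module_via_def SR_ring_def FactRing_def SR_proj_def)
  show "r \<odot>\<^bsub>SR_module m K\<^esub> SR_proj m K p = SR_proj m K (r * p)"
    if "r \<in> carrier (mpoly_ring m)" "p \<in> carrier (mpoly_ring m)" for r p
    using I.rcoset_mult_add[OF that] by (simp add: SR_module_def module_via_def SR_ring_def FactRing_def SR_proj_def)
  have "\<zero>\<^bsub>SR_module m K\<^esub> = SR_ideal m K"
    by (simp add: SR_module_def module_via_def SR_ring_def FactRing_def)
  then show "\<zero>\<^bsub>SR_module m K\<^esub> = SR_proj m K 0"
    unfolding SR_proj_eq[OF K mpoly_carrier_0] SR_ideal_eq(1)[OF K] by simp
qed

section \<open>Free modules as chains with polynomial coefficients\<close>

definition mod_chains :: "nat \<Rightarrow> 'b set \<Rightarrow> ('b \<Rightarrow>\<^sub>0 int_mpoly) set" where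
  "mod_chains m B = {c. \<forall>b a. lookup (lookup c b) a \<noteq> 0 \<longrightarrow> b \<in> B \<and> keys a \<subseteq> {1..m}}"

lemma mod_chains_iff:
  "c \<in> mod_chains m B \<longleftrightarrow> keys c \<subseteq> B \<and> (\<forall>b. lookup c b \<in> carrier (mpoly_ring m))"
proof -
  have keys: "keys c \<subseteq> B \<longleftrightarrow> (\<forall>b a. lookup (lookup c b) a \<noteq> 0 \<longrightarrow> b \<in> B)"
    by (auto simp: in_keys_iff poly_mapping_eq_iff fun_eq_iff subset_iff)
  show ?thesis
    unfolding mod_chains_def mpoly_carrier_iff mem_Collect_eq keys by meson
qed

lemma hom_chains_subset: "hom_chains m B \<delta> k \<subseteq> mod_chains m B"
  unfolding hom_chains_def mod_chains_def by blast

lemma carrier_free_module: "carrier (free_module (mpoly_ring m) B) = lookup ` mod_chains m B"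
proof (intro equalityI subsetI)
  fix f assume f: "f \<in> carrier (free_module (mpoly_ring m) B)"
  then have fin: "finite {b. f b \<noteq> 0}"
    by (simp add: free_module_def)
  have "f b \<in> carrier (mpoly_ring m)" for b
    using f by (cases "b \<in> B") (auto simp: free_module_def)
  then have "Abs_poly_mapping f \<in> mod_chains m B"
    using f by (auto simp: mod_chains_iff in_keys_iff lookup_Abs_poly_mapping[OF fin] free_module_def)
  then show "f \<in> lookup ` mod_chains m B"
    by (rule rev_image_eqI) (simp add: lookup_Abs_poly_mapping[OF fin])
next
  fix f assume "f \<in> lookup ` mod_chains m B"
  then obtain c where c: "f = lookup c" "keys c \<subseteq> B" "\<And>b. lookup c b \<in> carrier (mpoly_ring m)"
    by (auto simp: mod_chains_iff)
  have "finite {b. f b \<noteq> 0}"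
    using finite_keys[of c] by (simp add: c(1) keys.rep_eq)
  moreover have "f b = 0" if "b \<notin> B" for b
    using that c(2) by (auto simp: c(1) in_keys_iff)
  ultimately show "f \<in> carrier (free_module (mpoly_ring m) B)"
    using c(3) by (simp add: free_module_def c(1))
qed

lemma mpoly_grading_iff: "p \<in> mpoly_grading m n \<longleftrightarrow> (\<forall>a. lookup p a \<noteq> 0 \<longrightarrow> keys a \<subseteq> {1..m} \<and> 2 * mdeg a = n)"
  unfolding mpoly_grading_def mem_Collect_eq mpoly_carrier_iff mdeg_def Ball_def in_keys_iff by blast

lemma free_grading_eq: "free_grading (mpoly_ring m) (mpoly_grading m) B \<delta> k = lookup ` hom_chains m B \<delta> k"
proof -
  have "lookup c \<in> free_grading (mpoly_ring m) (mpoly_grading m) B \<delta> k \<longleftrightarrow> c \<in> hom_chains m B \<delta> k"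
    if c: "c \<in> mod_chains m B" for c
  proof -
    \<comment> \<open>Degrees are natural numbers, so \<open>\<delta> b > k\<close> is a case of its
      own: the truncated difference would be 0 instead of negative.\<close>
    have grade: "(if \<delta> b \<le> k then lookup c b \<in> mpoly_grading m (k - \<delta> b) else lookup c b = 0)
        \<longleftrightarrow> (\<forall>a. lookup (lookup c b) a \<noteq> 0 \<longrightarrow> keys a \<subseteq> {1..m} \<and> \<delta> b + 2 * mdeg a = k)" for b
    proof (cases "\<delta> b \<le> k")
      case True
      then have "2 * mdeg a = k - \<delta> b \<longleftrightarrow> \<delta> b + 2 * mdeg a = k" for a :: "nat \<Rightarrow>\<^sub>0 nat"
        by auto
      then show ?thesis
        using True by (simp add: mpoly_grading_iff)
    next
      case False
      then have "\<delta> b + 2 * mdeg a \<noteq> k" for a :: "nat \<Rightarrow>\<^sub>0 nat"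
        by auto
      then show ?thesis
        using False by (auto simp: poly_mapping_eq_iff fun_eq_iff)
    qed
    have supp: "lookup (lookup c b) a \<noteq> 0 \<Longrightarrow> b \<in> B" for b a
      using c unfolding mod_chains_def by blast
    have "lookup c \<in> free_grading (mpoly_ring m) (mpoly_grading m) B \<delta> k \<longleftrightarrow>
        (\<forall>b\<in>B. \<forall>a. lookup (lookup c b) a \<noteq> 0 \<longrightarrow> keys a \<subseteq> {1..m} \<and> \<delta> b + 2 * mdeg a = k)"
      unfolding free_grading_def mem_Collect_eq mpoly_ring_simps grade carrier_free_module using c by simp
    also have "\<dots> \<longleftrightarrow> c \<in> hom_chains m B \<delta> k"
      unfolding hom_chains_def mem_Collect_eq using supp by meson
    finally show ?thesis .
  qed
  then show ?thesis
    using hom_chains_subset[of m B \<delta> k] unfolding carrier_free_module free_grading_def by blast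
qed

lemma free_module_ops:
  "\<zero>\<^bsub>free_module (mpoly_ring m) B\<^esub> = lookup 0"
  "lookup c \<oplus>\<^bsub>free_module (mpoly_ring m) B\<^esub> lookup d = lookup (c + d)"
  "r \<odot>\<^bsub>free_module (mpoly_ring m) B\<^esub> lookup c = lookup (smul r c)"
  by (auto simp: free_module_def lookup_add fun_eq_iff)

lemma mod_chains_add: "c \<in> mod_chains m B \<Longrightarrow> d \<in> mod_chains m B \<Longrightarrow> c + d \<in> mod_chains m B"
  unfolding mod_chains_iff using keys_add_subset[of c B d] by (simp add: lookup_add mpoly_carrier_add)

lemma mod_chains_smul: "r \<in> carrier (mpoly_ring m) \<Longrightarrow> c \<in> mod_chains m B \<Longrightarrow> smul r c \<in> mod_chains m B"
  unfolding mod_chains_iff using keys_smul[of r c] by (auto simp: mpoly_carrier_mult)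

lemma mod_chains_0 [simp]: "0 \<in> mod_chains m B"
  by (simp add: mod_chains_def)

lemma mod_chains_bas: "b \<in> B \<Longrightarrow> bas b \<in> mod_chains m B"
  by (auto simp: mod_chains_iff lookup_single when_def)

lemma mod_chains_sum: "(\<And>i. i \<in> I \<Longrightarrow> f i \<in> mod_chains m B) \<Longrightarrow> sum f I \<in> mod_chains m B"
  by (induction I rule: infinite_finite_induct) (simp_all add: mod_chains_add)

lemma lin_mod_chains:
  assumes "c \<in> mod_chains m B" "\<And>b. b \<in> B \<Longrightarrow> d b \<in> mod_chains m B'"
  shows "lin d c \<in> mod_chains m B'"
  unfolding lin_def using assms by (intro mod_chains_sum mod_chains_smul) (auto simp: mod_chains_iff)

text \<open>The map \<open>L\<close> reads off an element of \<open>N\<close> in an additive group, such as the normal form of a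
  residue class; \<open>S\<close> is the scalar multiplication seen there.\<close>

lemma module_hom_free:
  fixes L :: "'x \<Rightarrow> 'g::ab_group_add"
  assumes f: "f \<in> module_hom (mpoly_ring m) (free_module (mpoly_ring m) B) N"
    and add: "\<And>x y. x \<in> carrier N \<Longrightarrow> y \<in> carrier N \<Longrightarrow> L (x \<oplus>\<^bsub>N\<^esub> y) = L x + L y"
    and smult: "\<And>r x. r \<in> carrier (mpoly_ring m) \<Longrightarrow> x \<in> carrier N \<Longrightarrow> L (r \<odot>\<^bsub>N\<^esub> x) = S r (L x)"
    and c: "c \<in> mod_chains m B"
  shows "L (f (lookup c)) = (\<Sum>b\<in>keys c. S (lookup c b) (L (f (lookup (bas b)))))"
proof -
  let ?M = "free_module (mpoly_ring m) B"
  have f': "f x \<in> carrier N" "f (x \<oplus>\<^bsub>?M\<^esub> y) = f x \<oplus>\<^bsub>N\<^esub> f y" "f (r \<odot>\<^bsub>?M\<^esub> x) = r \<odot>\<^bsub>N\<^esub> f x"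
    if "x \<in> carrier ?M" "y \<in> carrier ?M" "r \<in> carrier (mpoly_ring m)" for x y r
    using f that unfolding module_hom_def by auto
  have carr: "lookup d \<in> carrier ?M" if "d \<in> mod_chains m B" for d
    using that by (simp add: carrier_free_module)
  have L_add: "L (f (lookup (x + y))) = L (f (lookup x)) + L (f (lookup y))"
    if "x \<in> mod_chains m B" "y \<in> mod_chains m B" for x y
    using f'[OF carr carr mpoly_carrier_0] add that unfolding free_module_ops by metis
  have L0: "L (f (lookup 0)) = 0"
    using L_add[of 0 0] by simp
  have "L (f (lookup (\<Sum>b\<in>A. smul (lookup c b) (bas b))))
      = (\<Sum>b\<in>A. S (lookup c b) (L (f (lookup (bas b)))))" if "A \<subseteq> B" "finite A" for A
    using that(2,1)
  proof (induction A rule: finite_induct)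
    case (insert b A)
    have r: "lookup c b \<in> carrier (mpoly_ring m)" for b
      using c by (simp add: mod_chains_iff)
    have b: "bas b \<in> mod_chains m B"
      using insert.prems by (intro mod_chains_bas) auto
    have mem: "smul (lookup c b) (bas b) \<in> mod_chains m B"
      "(\<Sum>b\<in>A. smul (lookup c b) (bas b)) \<in> mod_chains m B"
      using insert.prems r by (auto intro!: mod_chains_sum mod_chains_smul mod_chains_bas simp del: smul_single)
    have "L (f (lookup (smul (lookup c b) (bas b)))) = S (lookup c b) (L (f (lookup (bas b))))"
      using f'(1,3)[OF carr[OF b] carr[OF b] r] smult[OF r] by (metis free_module_ops(3))
    then show ?case
      using insert mem L_add[OF mem] by (simp del: smul_single)
  qed (simp add: L0)
  note sum = this
  have c_eq: "c = (\<Sum>b\<in>keys c. smul (lookup c b) (bas b))"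
    using lin_bas[of c, symmetric] unfolding lin_def .
  have "keys c \<subseteq> B"
    using c by (simp add: mod_chains_iff)
  from sum[OF this finite_keys] show ?thesis
    unfolding c_eq[symmetric] .
qed

section \<open>Homogeneous parts\<close>

definition hom_part :: "('b \<Rightarrow> nat) \<Rightarrow> nat \<Rightarrow> ('b \<Rightarrow>\<^sub>0 int_mpoly) \<Rightarrow> 'b \<Rightarrow>\<^sub>0 int_mpoly" where
  "hom_part \<delta> k c = unflat (restr (\<lambda>(b, a). \<delta> b + 2 * mdeg a = k) (flat c))"

lemma lookup_hom_part: "lookup (lookup (hom_part \<delta> k c) b) a
    = (if \<delta> b + 2 * mdeg a = k then lookup (lookup c b) a else 0)"
  by (simp add: hom_part_def lookup_unflat lookup_restr lookup_flat)

lemma hom_part_hom_chains: "c \<in> mod_chains m B \<Longrightarrow> hom_part \<delta> k c \<in> hom_chains m B \<delta> k"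
  unfolding hom_chains_def mod_chains_def mem_Collect_eq lookup_hom_part by auto

lemma hom_part_id: "c \<in> hom_chains m B \<delta> k \<Longrightarrow> hom_part \<delta> k c = c"
  by (rule mpoly_chain_eqI) (auto simp: lookup_hom_part hom_chains_def)

lemma hom_part_0 [simp]: "hom_part \<delta> k 0 = 0"
  by (rule mpoly_chain_eqI) (simp add: lookup_hom_part)

text \<open>A chain has finitely many nonzero homogeneous parts. The index \<open>k\<close> is put
  into \<open>D\<close> so that the part of degree \<open>k\<close> occurs in the sum even when it
  is zero.\<close>

lemma hom_part_sum:
  obtains D where "finite D" "k \<in> D" "c = (\<Sum>l\<in>D. hom_part \<delta> l c)"
proof
  let ?D = "insert k ((\<lambda>(b, a). \<delta> b + 2 * mdeg a) ` keys (flat c))"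
  show "finite ?D" "k \<in> ?D"
    by simp_all
  show "c = (\<Sum>k\<in>?D. hom_part \<delta> k c)"
  proof (rule mpoly_chain_eqI)
    fix b a
    have "lookup (lookup (\<Sum>k\<in>?D. hom_part \<delta> k c) b) a
        = (\<Sum>k\<in>?D. if \<delta> b + 2 * mdeg a = k then lookup (lookup c b) a else 0)"
      unfolding lookup_sum lookup_hom_part ..
    also have "\<dots> = lookup (lookup c b) a"
    proof (cases "lookup (lookup c b) a = 0")
      case False
      then have "(b, a) \<in> keys (flat c)"
        by (simp add: in_keys_iff lookup_flat)
      then have "\<delta> b + 2 * mdeg a \<in> ?D"
        by force
      then show ?thesis
        using \<open>finite ?D\<close> by (simp only: sum.delta' if_True)
    qed simp
    finally show "lookup (lookup c b) a = lookup (lookup (\<Sum>k\<in>?D. hom_part \<delta> k c) b) a" ..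
  qed
qed

text \<open>Decompose \<open>c\<close> into homogeneous parts: of their images, \<open>P\<close>
  keeps the one of degree \<open>k\<close> and kills the others. An abstract projection
  \<open>P\<close> serves the maps between free modules as well as the augmentation to
  \<int>[K].\<close>

lemma hom_part_commute:
  fixes L :: "('b \<Rightarrow>\<^sub>0 int_mpoly) \<Rightarrow> 'g::ab_group_add"
  assumes c: "c \<in> mod_chains m B"
    and L: "\<And>x y. L (x + y) = L x + L y" and P: "\<And>x y. P (x + y) = P x + P y"
    and deg: "\<And>l x. x \<in> hom_chains m B \<delta> l \<Longrightarrow> P (L x) = (if l = k then L x else 0)"
  shows "L (hom_part \<delta> k c) = P (L c)"
proof -
  have L0: "L 0 = 0" and P0: "P 0 = 0"
    using L[of 0 0] P[of 0 0] by simp_all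
  have L_sum: "L (sum f A) = (\<Sum>l\<in>A. L (f l))" and P_sum: "P (sum g A) = (\<Sum>l\<in>A. P (g l))"
    for f and g :: "nat \<Rightarrow> 'g" and A :: "nat set"
    by (induction A rule: infinite_finite_induct) (simp_all add: L P L0 P0)
  obtain D where D: "finite D" "k \<in> D" "c = (\<Sum>l\<in>D. hom_part \<delta> l c)"
    by (rule hom_part_sum)
  have "P (L (\<Sum>l\<in>D. hom_part \<delta> l c)) = (\<Sum>l\<in>D. if l = k then L (hom_part \<delta> l c) else 0)"
    unfolding L_sum P_sum by (intro sum.cong refl deg hom_part_hom_chains[OF c])
  also have "\<dots> = L (hom_part \<delta> k c)"
    using D(1,2) by (simp add: sum.delta)
  finally show ?thesis
    by (simp flip: D(3))
qed

lemma lin_hom_part: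
  assumes c: "c \<in> mod_chains m B" and d: "\<And>b. b \<in> B \<Longrightarrow> d b \<in> hom_chains m B' \<delta>' (\<delta> b)"
  shows "lin d (hom_part \<delta> k c) = hom_part \<delta>' k (lin d c)"
proof (rule hom_part_commute[OF c])
  show "hom_part \<delta>' k (x + y) = hom_part \<delta>' k x + hom_part \<delta>' k y" for x y
    by (rule mpoly_chain_eqI) (simp add: lookup_hom_part lookup_add)
  fix l x assume "x \<in> hom_chains m B \<delta> l"
  then have h: "lin d x \<in> hom_chains m B' \<delta>' l"
    using d by (rule lin_hom_chains)
  show "hom_part \<delta>' k (lin d x) = (if l = k then lin d x else 0)"
  proof (cases "l = k")
    case True
    then show ?thesis
      using hom_part_id[OF h] by simp
  next
    case False
    have "hom_part \<delta>' k (lin d x) = 0"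
    proof (rule mpoly_chain_eqI)
      fix b a
      show "lookup (lookup (hom_part \<delta>' k (lin d x)) b) a = lookup (lookup 0 b) a"
        using h False unfolding lookup_hom_part hom_chains_def by auto
    qed
    then show ?thesis
      using False by simp
  qed
qed (rule lin_add)

lemma aug_of_hom_chains:
  assumes c: "c \<in> hom_chains m B \<delta> k" and ag: "\<And>b. b \<in> B \<Longrightarrow> ag b \<in> nf_grading K (\<delta> b)"
  shows "aug_of K ag c \<in> nf_grading K k"
  unfolding nf_grading_def mem_Collect_eq
proof (intro allI impI)
  fix a assume a: "lookup (aug_of K ag c) a \<noteq> 0"
  then have "(\<Sum>b\<in>keys c. lookup (red K (lookup c b * ag b)) a) \<noteq> 0"
    by (simp add: aug_of_def lookup_sum)
  then obtain b where "b \<in> keys c" and b: "lookup (red K (lookup c b * ag b)) a \<noteq> 0"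
    by (rule sum.not_neutral_contains_not_neutral)
  then have aK: "keys a \<in> K" and "lookup (lookup c b * ag b) a \<noteq> 0"
    by (auto split: if_splits)
  from this(2) obtain s t where st: "lookup (lookup c b) s \<noteq> 0" "lookup (ag b) t \<noteq> 0" "a = s + t"
    by (rule lookup_mult_nonzero)
  have "b \<in> B" "\<delta> b + 2 * mdeg s = k"
    using c st(1) unfolding hom_chains_def by blast+
  moreover from this have "2 * mdeg t = \<delta> b"
    using ag[of b] st(2) unfolding nf_grading_def by blast
  ultimately show "keys a \<in> K \<and> 2 * mdeg a = k"
    using aK by (simp add: st(3) mdeg_add)
qed

lemma aug_of_hom_part:
  assumes c: "c \<in> mod_chains m B" and ag: "\<And>b. b \<in> B \<Longrightarrow> ag b \<in> nf_grading K (\<delta> b)"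
  shows "aug_of K ag (hom_part \<delta> k c) = restr (\<lambda>a. 2 * mdeg a = k) (aug_of K ag c)"
proof (rule hom_part_commute[OF c])
  show "restr (\<lambda>a. 2 * mdeg a = k) (x + y) = restr (\<lambda>a. 2 * mdeg a = k) x + restr (\<lambda>a. 2 * mdeg a = k) y" for x y :: int_mpoly
    by (simp add: restr_def lin_add)
  fix l x assume "x \<in> hom_chains m B \<delta> l"
  then have "aug_of K ag x \<in> nf_grading K l"
    using ag by (rule aug_of_hom_chains)
  then have "2 * mdeg a = l" if "a \<in> keys (aug_of K ag x)" for a
    using that unfolding nf_grading_def in_keys_iff by blast
  then show "restr (\<lambda>a. 2 * mdeg a = k) (aug_of K ag x) = (if l = k then aug_of K ag x else 0)"
    using restr_id[of "aug_of K ag x" "\<lambda>a. 2 * mdeg a = k"] restr_none[of "aug_of K ag x" "\<lambda>a. 2 * mdeg a = k"]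
    by (cases "l = k") auto
qed (rule aug_of_add)

text \<open>The indices of the differentials are shifted by one: \<open>res_d F i\<close> is only used for \<open>i > 0\<close>.\<close>

definition res_d :: "(int_mpoly, 'a) resolution \<Rightarrow> nat \<Rightarrow> nat \<Rightarrow> nat \<Rightarrow>\<^sub>0 int_mpoly" where
  "res_d F i b = Abs_poly_mapping (res_diff F (i - 1) (lookup (bas b)))"

lemma Abs_lookup_free:
  assumes "f \<in> carrier (free_module (mpoly_ring m) B)"
  shows "lookup (Abs_poly_mapping f) = f" and "Abs_poly_mapping f \<in> mod_chains m B"
proof -
  obtain c where "f = lookup c" "c \<in> mod_chains m B"
    using assms unfolding carrier_free_module by blast
  then show "lookup (Abs_poly_mapping f) = f" "Abs_poly_mapping f \<in> mod_chains m B"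
    by simp_all
qed

lemma module_hom_lin:
  assumes f: "f \<in> module_hom (mpoly_ring m) (free_module (mpoly_ring m) B) (free_module (mpoly_ring m) B')"
    and c: "c \<in> mod_chains m B"
  shows "f (lookup c) = lookup (lin (\<lambda>b. Abs_poly_mapping (f (lookup (bas b)))) c)"
proof -
  let ?N = "free_module (mpoly_ring m) B'"
  have "Abs_poly_mapping (f (lookup c))
      = (\<Sum>b\<in>keys c. smul (lookup c b) (Abs_poly_mapping (f (lookup (bas b)))))"
  proof (rule module_hom_free[OF f _ _ c])
    show "Abs_poly_mapping (x \<oplus>\<^bsub>?N\<^esub> y) = Abs_poly_mapping x + Abs_poly_mapping y" if "x \<in> carrier ?N" "y \<in> carrier ?N" for x y
      using that unfolding carrier_free_module by (auto simp: free_module_ops)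
    show "Abs_poly_mapping (r \<odot>\<^bsub>?N\<^esub> x) = smul r (Abs_poly_mapping x)" if "x \<in> carrier ?N" for r x
      using that unfolding carrier_free_module by (auto simp: free_module_ops)
  qed
  moreover have "f (lookup c) \<in> carrier ?N"
    using f c unfolding module_hom_def carrier_free_module by blast
  ultimately show ?thesis
    using Abs_lookup_free(1) unfolding lin_def by metis
qed

lemma module_hom_SR:
  assumes K: "down_closed K" and f: "f \<in> module_hom (mpoly_ring m) (free_module (mpoly_ring m) B) (SR_module m K)"
    and c: "c \<in> mod_chains m B"
  shows "SR_nf K (f (lookup c)) = aug_of K (\<lambda>b. SR_nf K (f (lookup (bas b)))) c"
proof -
  note ops = SR_module_ops[OF K]
  have "SR_nf K (f (lookup c))
      = (\<Sum>b\<in>keys c. red K (lookup c b * SR_nf K (f (lookup (bas b)))))"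
  proof (rule module_hom_free[OF f _ _ c])
    show "SR_nf K (x \<oplus>\<^bsub>SR_module m K\<^esub> y) = SR_nf K x + SR_nf K y"
      if "x \<in> carrier (SR_module m K)" "y \<in> carrier (SR_module m K)" for x y
      using that unfolding ops(1) by (auto simp: ops(2) SR_nf_proj[OF K] mpoly_carrier_add red_add)
    show "SR_nf K (r \<odot>\<^bsub>SR_module m K\<^esub> x) = red K (r * SR_nf K x)"
      if "r \<in> carrier (mpoly_ring m)" "x \<in> carrier (SR_module m K)" for r x
      using that unfolding ops(1) by (auto simp: ops(3) SR_nf_proj[OF K] mpoly_carrier_mult red_mult_red[OF K])
  qed
  then show ?thesis
    by (simp add: aug_of_def)
qed

lemma SR_nf_eq_0:
  assumes K: "down_closed K" and x: "x \<in> carrier (SR_module m K)"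
  shows "SR_nf K x = 0 \<longleftrightarrow> x = \<zero>\<^bsub>SR_module m K\<^esub>"
proof -
  obtain p where p: "x = SR_proj m K p" "p \<in> carrier (mpoly_ring m)"
    using x unfolding SR_module_ops(1)[OF K] by blast
  show ?thesis
    unfolding p(1) SR_module_ops(4)[OF K] SR_nf_proj[OF K p(2)] SR_proj_eq_iff[OF K p(2) mpoly_carrier_0] by simp
qed

lemma red_mpoly_grading: "p \<in> mpoly_grading m k \<Longrightarrow> red K p \<in> nf_grading K k"
  unfolding mpoly_grading_iff nf_grading_def by auto

lemma nf_grading_subset:
  assumes "\<And>I. I \<in> K \<Longrightarrow> I \<subseteq> {1..m}"
  shows "nf_grading K k \<subseteq> mpoly_grading m k"
  using assms unfolding mpoly_grading_iff nf_grading_def subset_eq[of "nf_grading K k"] by (auto simp: nf_grading_def mpoly_grading_iff)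

text \<open>A resolution is exact regardless of the grading. As its maps are graded, the homogeneous
  part of a preimage of a homogeneous element is again a preimage, whence exactness degree by
  degree.\<close>

lemma graded_free_resolution_based:
  fixes F :: "(int_mpoly, int_mpoly set) resolution"
  assumes K: "down_closed K" and Km: "\<And>I. I \<in> K \<Longrightarrow> I \<subseteq> {1..m}"
    and F: "graded_free_resolution (mpoly_ring m) (mpoly_grading m) (SR_module m K) (SR_grading m K) F"
  shows "based_resolution m K (res_basis F) (res_deg F) (res_d F) (\<lambda>b. SR_nf K (res_aug F (lookup (bas b))))"
    and "\<And>i c. c \<in> mod_chains m (res_basis F (Suc i)) \<Longrightarrow>
      res_diff F i (lookup c) = lookup (lin (res_d F (Suc i)) c)"
proof -
  let ?R = "mpoly_ring m" and ?B = "res_basis F" and ?\<delta> = "res_deg F"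
  let ?ag = "\<lambda>b. SR_nf K (res_aug F (lookup (bas b)))"
  note F' = F[unfolded graded_free_resolution_def res_module_def res_grading_def graded_hom_def free_grading_eq]
  have aug_hom: "res_aug F \<in> module_hom ?R (free_module ?R (?B 0)) (SR_module m K)"
    and aug_deg: "\<And>n. res_aug F ` (lookup ` hom_chains m (?B 0) (?\<delta> 0) n) \<subseteq> SR_grading m K n"
    and diff_hom: "\<And>i. res_diff F i \<in> module_hom ?R (free_module ?R (?B (Suc i))) (free_module ?R (?B i))"
    and diff_deg: "\<And>i n. res_diff F i ` (lookup ` hom_chains m (?B (Suc i)) (?\<delta> (Suc i)) n) \<subseteq> lookup ` hom_chains m (?B i) (?\<delta> i) n"
    and aug_surj: "res_aug F ` carrier (free_module ?R (?B 0)) = carrier (SR_module m K)"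
    and ex0: "res_diff F 0 ` carrier (free_module ?R (?B 1)) = {x \<in> carrier (free_module ?R (?B 0)). res_aug F x = \<zero>\<^bsub>SR_module m K\<^esub>}"
    and ex: "\<And>i. res_diff F (Suc i) ` carrier (free_module ?R (?B (Suc (Suc i)))) =
       {x \<in> carrier (free_module ?R (?B (Suc i))). res_diff F i x = \<zero>\<^bsub>free_module ?R (?B i)\<^esub>}"
    using F' by simp_all
  show diff_lin: "res_diff F i (lookup c) = lookup (lin (res_d F (Suc i)) c)"
    if "c \<in> mod_chains m (?B (Suc i))" for i c
    using module_hom_lin[OF diff_hom that] unfolding res_d_def[abs_def] by simp
  have aug_lin: "SR_nf K (res_aug F (lookup c)) = aug_of K ?ag c" if "c \<in> mod_chains m (?B 0)" for c
    by (rule module_hom_SR[OF K aug_hom that])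
  have aug_carr: "res_aug F (lookup c) \<in> carrier (SR_module m K)" if "c \<in> mod_chains m (?B 0)" for c
    using aug_surj that unfolding carrier_free_module by blast
  have d_hom: "res_d F (Suc n) b \<in> hom_chains m (?B n) (?\<delta> n) (?\<delta> (Suc n) b)" if b: "b \<in> ?B (Suc n)" for n b
  proof -
    have "res_diff F n (lookup (bas b)) \<in> lookup ` hom_chains m (?B n) (?\<delta> n) (?\<delta> (Suc n) b)"
      using diff_deg[of n "?\<delta> (Suc n) b"] bas_hom_chains[OF b, of m "?\<delta> (Suc n)"] by blast
    then show ?thesis
      by (auto simp: res_d_def)
  qed
  have ag_hom: "?ag b \<in> nf_grading K (?\<delta> 0 b)" if b: "b \<in> ?B 0" for b
  proof -
    have "res_aug F (lookup (bas b)) \<in> SR_grading m K (?\<delta> 0 b)"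
      using aug_deg[of "?\<delta> 0 b"] bas_hom_chains[OF b, of m "?\<delta> 0"] by blast
    then obtain p where p: "res_aug F (lookup (bas b)) = SR_proj m K p" "p \<in> mpoly_grading m (?\<delta> 0 b)"
      unfolding SR_grading_def by blast
    moreover from p(2) have "p \<in> carrier ?R"
      by (simp add: mpoly_grading_def)
    ultimately show ?thesis
      using red_mpoly_grading[OF p(2), of K] by (simp add: SR_nf_proj[OF K])
  qed
  have d_mod: "lin (res_d F (Suc n)) c \<in> mod_chains m (?B n)" if "c \<in> mod_chains m (?B (Suc n))" for n c
    using that d_hom hom_chains_subset by (intro lin_mod_chains) blast+
  have lin_ex: "\<exists>y\<in>mod_chains m (?B (Suc (Suc n))). lin (res_d F (Suc (Suc n))) y = z"
    if z: "z \<in> mod_chains m (?B (Suc n))" "lin (res_d F (Suc n)) z = 0" for n z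
  proof -
    have "lookup z \<in> {x \<in> carrier (free_module ?R (?B (Suc n))). res_diff F n x = \<zero>\<^bsub>free_module ?R (?B n)\<^esub>}"
      unfolding mem_Collect_eq diff_lin[OF z(1)] free_module_ops carrier_free_module using z by simp
    then have "lookup z \<in> res_diff F (Suc n) ` carrier (free_module ?R (?B (Suc (Suc n))))"
      unfolding ex .
    then show ?thesis
      using diff_lin[of _ "Suc n"] unfolding carrier_free_module by auto
  qed
  have lin_ex0: "\<exists>y\<in>mod_chains m (?B (Suc 0)). lin (res_d F (Suc 0)) y = z"
    if z: "z \<in> mod_chains m (?B 0)" "aug_of K ?ag z = 0" for z
  proof -
    have "res_aug F (lookup z) = \<zero>\<^bsub>SR_module m K\<^esub>"
      using SR_nf_eq_0[OF K aug_carr[OF z(1)]] aug_lin[OF z(1)] z(2) by simp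
    then have "lookup z \<in> {x \<in> carrier (free_module ?R (?B 0)). res_aug F x = \<zero>\<^bsub>SR_module m K\<^esub>}"
      unfolding mem_Collect_eq carrier_free_module using z(1) by simp
    then have "lookup z \<in> res_diff F 0 ` carrier (free_module ?R (?B 1))"
      unfolding ex0 .
    then show ?thesis
      using diff_lin[of _ 0] unfolding carrier_free_module by auto
  qed
  show "based_resolution m K ?B ?\<delta> (res_d F) ?ag"
    unfolding based_resolution_def
  proof (intro conjI allI ballI impI)
    show "res_d F (Suc n) b \<in> hom_chains m (?B n) (?\<delta> n) (?\<delta> (Suc n) b)" if "b \<in> ?B (Suc n)" for n b
      using that by (rule d_hom)
    show "lin (res_d F (Suc n)) (res_d F (Suc (Suc n)) b) = 0" if b: "b \<in> ?B (Suc (Suc n))" for n b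
    proof -
      have "res_diff F (Suc n) (lookup (bas b)) \<in> {x \<in> carrier (free_module ?R (?B (Suc n))). res_diff F n x = \<zero>\<^bsub>free_module ?R (?B n)\<^esub>}"
        unfolding ex[symmetric] unfolding carrier_free_module by (intro imageI mod_chains_bas b)
      then have "res_diff F n (lookup (lin (res_d F (Suc (Suc n))) (bas b))) = lookup 0"
        unfolding diff_lin[OF mod_chains_bas[OF b]] free_module_ops by simp
      then show ?thesis
        unfolding diff_lin[OF d_mod[OF mod_chains_bas[OF b]]] by simp
    qed
    show "\<exists>y\<in>hom_chains m (?B (Suc (Suc n))) (?\<delta> (Suc (Suc n))) k. lin (res_d F (Suc (Suc n))) y = z"
      if z: "z \<in> hom_chains m (?B (Suc n)) (?\<delta> (Suc n)) k" "lin (res_d F (Suc n)) z = 0" for n k z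
    proof -
      obtain y where y: "y \<in> mod_chains m (?B (Suc (Suc n)))" "lin (res_d F (Suc (Suc n))) y = z"
        using lin_ex[OF subsetD[OF hom_chains_subset z(1)] z(2)] by blast
      have "lin (res_d F (Suc (Suc n))) (hom_part (?\<delta> (Suc (Suc n))) k y) = hom_part (?\<delta> (Suc n)) k z"
        unfolding y(2)[symmetric] by (rule lin_hom_part[OF y(1) d_hom])
      also have "\<dots> = z"
        by (rule hom_part_id[OF z(1)])
      finally show ?thesis
        by (rule bexI[OF _ hom_part_hom_chains[OF y(1)]])
    qed
    show "?ag b \<in> nf_grading K (?\<delta> 0 b)" if "b \<in> ?B 0" for b
      using that by (rule ag_hom)
    show "aug_of K ?ag (res_d F (Suc 0) b) = 0" if b: "b \<in> ?B (Suc 0)" for b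
    proof -
      have "res_diff F 0 (lookup (bas b)) \<in> {x \<in> carrier (free_module ?R (?B 0)). res_aug F x = \<zero>\<^bsub>SR_module m K\<^esub>}"
        unfolding ex0[symmetric] unfolding carrier_free_module One_nat_def by (intro imageI mod_chains_bas b)
      then have "res_aug F (lookup (res_d F (Suc 0) b)) = \<zero>\<^bsub>SR_module m K\<^esub>"
        using diff_lin[OF mod_chains_bas[OF b]] by simp
      moreover have m: "res_d F (Suc 0) b \<in> mod_chains m (?B 0)"
        using d_hom[OF b] hom_chains_subset by blast
      ultimately show ?thesis
        using SR_nf_eq_0[OF K aug_carr[OF m]] aug_lin[OF m] by simp
    qed
    show "\<exists>c\<in>hom_chains m (?B 0) (?\<delta> 0) k. aug_of K ?ag c = x" if x: "x \<in> nf_grading K k" for k x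
    proof -
      have xm: "x \<in> carrier ?R"
        using x nf_grading_subset[OF Km, where k = k] by (auto simp: mpoly_grading_def)
      then have "SR_proj m K x \<in> res_aug F ` carrier (free_module ?R (?B 0))"
        unfolding aug_surj SR_module_ops(1)[OF K] by blast
      then obtain c where c: "c \<in> mod_chains m (?B 0)" "SR_proj m K x = res_aug F (lookup c)"
        unfolding carrier_free_module by blast
      have "aug_of K ?ag c = red K x"
        unfolding aug_lin[OF c(1), symmetric] c(2)[symmetric] by (rule SR_nf_proj[OF K xm])
      also have "\<dots> = x"
        by (rule nf_grading_red[OF x])
      finally have "aug_of K ?ag (hom_part (?\<delta> 0) k c) = restr (\<lambda>a. 2 * mdeg a = k) x"
        using aug_of_hom_part[OF c(1), where ag = ?ag and \<delta> = "?\<delta> 0" and K = K and k = k] ag_hom by simp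
      also have "\<dots> = x"
        using x by (intro restr_id) (auto simp: nf_grading_def in_keys_iff)
      finally show ?thesis
        by (rule bexI[OF _ hom_part_hom_chains[OF c(1)]])
    qed
    show "\<exists>y\<in>hom_chains m (?B (Suc 0)) (?\<delta> (Suc 0)) k. lin (res_d F (Suc 0)) y = z"
      if z: "z \<in> hom_chains m (?B 0) (?\<delta> 0) k" "aug_of K ?ag z = 0" for k z
    proof -
      obtain y where y: "y \<in> mod_chains m (?B (Suc 0))" "lin (res_d F (Suc 0)) y = z"
        using lin_ex0[OF subsetD[OF hom_chains_subset z(1)] z(2)] by blast
      have "lin (res_d F (Suc 0)) (hom_part (?\<delta> (Suc 0)) k y) = hom_part (?\<delta> 0) k z"
        unfolding y(2)[symmetric] by (rule lin_hom_part[OF y(1) d_hom])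
      also have "\<dots> = z"
        by (rule hom_part_id[OF z(1)])
      finally show ?thesis
        by (rule bexI[OF _ hom_part_hom_chains[OF y(1)]])
    qed
  qed
qed

section \<open>Existence of a resolution with bases of natural numbers\<close>

lemma based_resolution_exact:
  assumes F: "based_resolution m K B \<delta> d ag"
  shows "\<And>n z. z \<in> mod_chains m (B (Suc n)) \<Longrightarrow> lin (d (Suc n)) z = 0 \<Longrightarrow>
      \<exists>y\<in>mod_chains m (B (Suc (Suc n))). lin (d (Suc (Suc n))) y = z"
    and "\<And>z. z \<in> mod_chains m (B 0) \<Longrightarrow> aug_of K ag z = 0 \<Longrightarrow> \<exists>y\<in>mod_chains m (B (Suc 0)). lin (d (Suc 0)) y = z"
proof -
  note F' = based_resolutionD[OF F]
  \<comment> \<open>Preimages of the finitely many homogeneous parts are added up, which lifts the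
    restriction to homogeneous chains.\<close>
  have glue: "\<exists>y\<in>mod_chains m B'. lin D y = z"
    if parts: "\<And>k. \<exists>y\<in>hom_chains m B' \<delta>' k. lin D y = hom_part \<epsilon> k z" for z :: "'b \<Rightarrow>\<^sub>0 int_mpoly" and B' \<delta>' D \<epsilon>
  proof -
    obtain y where y: "\<And>k. y k \<in> hom_chains m B' \<delta>' k" "\<And>k. lin D (y k) = hom_part \<epsilon> k z"
      using parts by metis
    obtain E where E: "finite E" "z = (\<Sum>k\<in>E. hom_part \<epsilon> k z)"
      by (rule hom_part_sum)
    have "lin D (\<Sum>k\<in>E. y k) = z"
      using E(2) by (simp add: lin_sum y(2))
    moreover have "(\<Sum>k\<in>E. y k) \<in> mod_chains m B'"
      using y(1) hom_chains_subset by (intro mod_chains_sum) blast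
    ultimately show ?thesis
      by blast
  qed
  show "\<exists>y\<in>mod_chains m (B (Suc (Suc n))). lin (d (Suc (Suc n))) y = z"
    if z: "z \<in> mod_chains m (B (Suc n))" "lin (d (Suc n)) z = 0" for n z
  proof (rule glue)
    fix k
    have "lin (d (Suc n)) (hom_part (\<delta> (Suc n)) k z) = 0"
      using lin_hom_part[OF z(1) F'(1), where k = k] z(2) by simp
    then show "\<exists>y\<in>hom_chains m (B (Suc (Suc n))) (\<delta> (Suc (Suc n))) k. lin (d (Suc (Suc n))) y = hom_part (\<delta> (Suc n)) k z"
      by (rule F'(3)[OF hom_part_hom_chains[OF z(1)]])
  qed
  show "\<exists>y\<in>mod_chains m (B (Suc 0)). lin (d (Suc 0)) y = z"
    if z: "z \<in> mod_chains m (B 0)" "aug_of K ag z = 0" for z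
  proof (rule glue)
    fix k
    have "aug_of K ag (hom_part (\<delta> 0) k z) = 0"
      using aug_of_hom_part[OF z(1) F'(4), where k = k] z(2) by (simp add: restr_def)
    then show "\<exists>y\<in>hom_chains m (B (Suc 0)) (\<delta> (Suc 0)) k. lin (d (Suc 0)) y = hom_part (\<delta> 0) k z"
      by (rule F'(7)[OF hom_part_hom_chains[OF z(1)]])
  qed
qed

text \<open>Transport along injections \<open>e n\<close> of the bases, with inverses
  \<open>r n\<close>. This moves the Koszul resolution, whose basis consists of pairs, to bases of
  natural numbers.\<close>

lemma based_resolution_reindex:
  fixes e :: "nat \<Rightarrow> 'b \<Rightarrow> 'c"
  assumes K: "down_closed K" and F: "based_resolution m K B \<delta> d ag" and e: "\<And>n. inj_on (e n) (B n)"
  defines "r \<equiv> \<lambda>n. inv_into (B n) (e n)"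
  shows "based_resolution m K (\<lambda>n. e n ` B n) (\<lambda>n b. \<delta> n (r n b))
    (\<lambda>n b. lin (\<lambda>b. bas (e (n - 1) b)) (d n (r n b))) (\<lambda>b. ag (r 0 b))"
proof -
  note F' = based_resolutionD[OF F]
  let ?B = "\<lambda>n. e n ` B n" and ?\<delta> = "\<lambda>n b. \<delta> n (r n b)" and ?ag = "\<lambda>b. ag (r 0 b)"
  let ?E = "\<lambda>n. lin (\<lambda>b. bas (e n b)) :: ('b \<Rightarrow>\<^sub>0 int_mpoly) \<Rightarrow> _" and ?R = "\<lambda>n. lin (\<lambda>b. bas (r n b)) :: ('c \<Rightarrow>\<^sub>0 int_mpoly) \<Rightarrow> _"
  let ?d = "\<lambda>n b. ?E (n - 1) (d n (r n b))"
  have re: "r n (e n b) = b" if "b \<in> B n" for n b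
    using e[of n] that by (simp add: r_def)
  have r_mem: "r n x \<in> B n" "e n (r n x) = x" if "x \<in> ?B n" for n x
    using that re by auto
  have RE: "?R n (?E n c) = c" if c: "keys c \<subseteq> B n" for n c
  proof -
    have "?R n (?E n c) = lin bas c"
      unfolding lin_lin using c re by (intro lin_cong) auto
    then show ?thesis
      by simp
  qed
  have ER: "?E n (?R n c) = c" if c: "keys c \<subseteq> ?B n" for n c
  proof -
    have "?E n (?R n c) = lin bas c"
      unfolding lin_lin using c r_mem by (intro lin_cong) auto
    then show ?thesis
      by simp
  qed
  have E_hom: "?E n c \<in> hom_chains m (?B n) (?\<delta> n) k" if "c \<in> hom_chains m (B n) (\<delta> n) k" for n c k
    using that
  proof (rule lin_hom_chains)
    fix b assume "b \<in> B n"
    then show "bas (e n b) \<in> hom_chains m (?B n) (?\<delta> n) (\<delta> n b)"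
      using bas_hom_chains[of "e n b" "?B n" m "?\<delta> n"] re by simp
  qed
  have R_hom: "?R n c \<in> hom_chains m (B n) (\<delta> n) k" if "c \<in> hom_chains m (?B n) (?\<delta> n) k" for n c k
    using that
  proof (rule lin_hom_chains)
    fix b assume "b \<in> ?B n"
    then show "bas (r n b) \<in> hom_chains m (B n) (\<delta> n) (?\<delta> n b)"
      using bas_hom_chains[of "r n b" "B n" m "\<delta> n"] r_mem by simp
  qed
  have d_E: "lin (?d (Suc n)) (?E (Suc n) c) = ?E n (lin (d (Suc n)) c)" if c: "keys c \<subseteq> B (Suc n)" for n c
  proof -
    have "lin (?d (Suc n)) (?E (Suc n) c) = lin (\<lambda>b. ?E n (d (Suc n) b)) c"
      unfolding lin_lin using c re by (intro lin_cong) auto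
    then show ?thesis
      by (simp only: lin_lin)
  qed
  have aug_E: "aug_of K ?ag (?E 0 c) = aug_of K ag c" if c: "keys c \<subseteq> B 0" for c
    unfolding aug_of_lin[OF K]
  proof (rule aug_of_cong)
    fix b assume "b \<in> keys c"
    then have "b \<in> B 0"
      using c by blast
    then show "aug_of K ?ag (bas (e 0 b)) = ag b"
      using nf_grading_red[OF F'(4)] by (simp add: re)
  qed
  note keys = keys_hom_chains
  show ?thesis
    unfolding based_resolution_def
  proof (intro conjI allI ballI impI)
    show "?d (Suc n) b \<in> hom_chains m (?B n) (?\<delta> n) (?\<delta> (Suc n) b)" if "b \<in> ?B (Suc n)" for n b
      using E_hom[OF F'(1)[OF r_mem(1)[OF that]]] by simp
    show "lin (?d (Suc n)) (?d (Suc (Suc n)) b) = 0" if b: "b \<in> ?B (Suc (Suc n))" for n b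
      using d_E[OF keys[OF F'(1)[OF r_mem(1)[OF b]]]] F'(2)[OF r_mem(1)[OF b]] by simp
    show "\<exists>y\<in>hom_chains m (?B (Suc (Suc n))) (?\<delta> (Suc (Suc n))) k. lin (?d (Suc (Suc n))) y = z"
      if z: "z \<in> hom_chains m (?B (Suc n)) (?\<delta> (Suc n)) k" "lin (?d (Suc n)) z = 0" for n k z
    proof -
      note Rz = R_hom[OF z(1)]
      have "?E n (lin (d (Suc n)) (?R (Suc n) z)) = 0"
        using d_E[OF keys[OF Rz]] ER[OF keys[OF z(1)]] z(2) by simp
      then have "?R n (?E n (lin (d (Suc n)) (?R (Suc n) z))) = 0"
        by simp
      moreover have "keys (lin (d (Suc n)) (?R (Suc n) z)) \<subseteq> B n"
        by (rule keys[OF lin_hom_chains[OF Rz F'(1)]])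
      ultimately have "lin (d (Suc n)) (?R (Suc n) z) = 0"
        using RE by simp
      then obtain y where y: "y \<in> hom_chains m (B (Suc (Suc n))) (\<delta> (Suc (Suc n))) k" "lin (d (Suc (Suc n))) y = ?R (Suc n) z"
        using F'(3)[OF Rz] by blast
      have "lin (?d (Suc (Suc n))) (?E (Suc (Suc n)) y) = z"
        using d_E[OF keys[OF y(1)]] y(2) ER[OF keys[OF z(1)]] by simp
      then show ?thesis
        using E_hom[OF y(1)] by blast
    qed
    show "?ag b \<in> nf_grading K (?\<delta> 0 b)" if "b \<in> ?B 0" for b
      by (rule F'(4)[OF r_mem(1)[OF that]])
    show "aug_of K ?ag (?d (Suc 0) b) = 0" if b: "b \<in> ?B (Suc 0)" for b
      using aug_E[OF keys[OF F'(1)[OF r_mem(1)[OF b]]]] F'(5)[OF r_mem(1)[OF b]] by simp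
    show "\<exists>c\<in>hom_chains m (?B 0) (?\<delta> 0) k. aug_of K ?ag c = x" if x: "x \<in> nf_grading K k" for k x
    proof -
      obtain c where c: "c \<in> hom_chains m (B 0) (\<delta> 0) k" "aug_of K ag c = x"
        using F'(6)[OF x] by blast
      then show ?thesis
        using E_hom[OF c(1)] aug_E[OF keys[OF c(1)]] by blast
    qed
    show "\<exists>y\<in>hom_chains m (?B (Suc 0)) (?\<delta> (Suc 0)) k. lin (?d (Suc 0)) y = z"
      if z: "z \<in> hom_chains m (?B 0) (?\<delta> 0) k" "aug_of K ?ag z = 0" for k z
    proof -
      note Rz = R_hom[OF z(1)]
      have "aug_of K ag (?R 0 z) = 0"
        using aug_E[OF keys[OF Rz]] ER[OF keys[OF z(1)]] z(2) by simp
      then obtain y where y: "y \<in> hom_chains m (B (Suc 0)) (\<delta> (Suc 0)) k" "lin (d (Suc 0)) y = ?R 0 z"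
        using F'(7)[OF Rz] by blast
      have "lin (?d (Suc 0)) (?E (Suc 0) y) = z"
        using d_E[OF keys[OF y(1)]] y(2) ER[OF keys[OF z(1)]] by simp
      then show ?thesis
        using E_hom[OF y(1)] by blast
    qed
  qed
qed

lemma graded_free_resolution_of_based:
  assumes K: "down_closed K" and Km: "\<And>I. I \<in> K \<Longrightarrow> I \<subseteq> {1..m}" and F: "based_resolution m K B \<delta> d ag"
  shows "graded_free_resolution (mpoly_ring m) (mpoly_grading m) (SR_module m K) (SR_grading m K)
    \<lparr>res_basis = B, res_deg = \<delta>,
     res_diff = (\<lambda>i f. lookup (lin (d (Suc i)) (Abs_poly_mapping f))),
     res_aug = (\<lambda>f. SR_proj m K (aug_of K ag (Abs_poly_mapping f)))\<rparr>"
proof -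
  let ?R = "mpoly_ring m"
  note F' = based_resolutionD[OF F] and ops = SR_module_ops[OF K] and exact = based_resolution_exact[OF F]
  have d_mod: "lin (d (Suc n)) c \<in> mod_chains m (B n)" if "c \<in> mod_chains m (B (Suc n))" for n c
    using that F'(1) hom_chains_subset by (intro lin_mod_chains) blast+
  have red_carr: "red K p \<in> carrier ?R" for p
    using Km by (auto simp: mpoly_carrier_iff simp del: One_nat_def split: if_splits)
  have red_aug: "red K (aug_of K ag c) = aug_of K ag c" for c
    by (simp add: aug_of_def red_sum)
  have aug_carr: "aug_of K ag c \<in> carrier ?R" for c
    using red_carr[of "aug_of K ag c"] by (simp add: red_aug)
  have aug_eq_0: "SR_proj m K (aug_of K ag c) = \<zero>\<^bsub>SR_module m K\<^esub> \<longleftrightarrow> aug_of K ag c = 0" for c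
    unfolding ops(4) SR_proj_eq_iff[OF K aug_carr mpoly_carrier_0] by (simp add: red_aug)
  have dd: "lin (d (Suc n)) (lin (d (Suc (Suc n))) c) = 0" if c: "c \<in> mod_chains m (B (Suc (Suc n)))" for n c
  proof -
    have "lin (d (Suc n)) (lin (d (Suc (Suc n))) c) = lin (\<lambda>_. 0) c"
      unfolding lin_lin using c F'(2) by (intro lin_cong) (auto simp: mod_chains_iff)
    then show ?thesis
      by simp
  qed
  have aug_d: "aug_of K ag (lin (d (Suc 0)) c) = 0" if c: "c \<in> mod_chains m (B (Suc 0))" for c
  proof -
    have "aug_of K ag (lin (d (Suc 0)) c) = aug_of K (\<lambda>b. 0) c"
      unfolding aug_of_lin[OF K] using c F'(5) by (intro aug_of_cong) (auto simp: mod_chains_iff)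
    then show ?thesis
      by (simp add: aug_of_def)
  qed
  have diff_hom: "(\<lambda>f. lookup (lin (d (Suc n)) (Abs_poly_mapping f)))
      \<in> graded_hom ?R (free_module ?R (B (Suc n))) (free_grading ?R (mpoly_grading m) (B (Suc n)) (\<delta> (Suc n)))
        (free_module ?R (B n)) (free_grading ?R (mpoly_grading m) (B n) (\<delta> n))" for n
    unfolding graded_hom_def module_hom_def free_grading_eq carrier_free_module mem_Collect_eq
  proof (intro conjI ballI allI)
    show "(\<lambda>f. lookup (lin (d (Suc n)) (Abs_poly_mapping f))) ` lookup ` hom_chains m (B (Suc n)) (\<delta> (Suc n)) k
        \<subseteq> lookup ` hom_chains m (B n) (\<delta> n) k" for k
    proof (clarsimp simp: image_image)
      fix c assume "c \<in> hom_chains m (B (Suc n)) (\<delta> (Suc n)) k"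
      from lin_hom_chains[OF this, where f = "d (Suc n)" and B' = "B n" and \<delta>' = "\<delta> n"] show "lookup (lin (d (Suc n)) c) \<in> lookup ` hom_chains m (B n) (\<delta> n) k"
        using F'(1) by blast
    qed
  qed (use d_mod in \<open>auto simp: free_module_ops lin_add lin_smul\<close>)
  have aug_hom: "(\<lambda>f. SR_proj m K (aug_of K ag (Abs_poly_mapping f)))
      \<in> graded_hom ?R (free_module ?R (B 0)) (free_grading ?R (mpoly_grading m) (B 0) (\<delta> 0)) (SR_module m K) (SR_grading m K)"
    unfolding graded_hom_def module_hom_def free_grading_eq carrier_free_module mem_Collect_eq
  proof (intro conjI ballI allI)
    show "(\<lambda>f. SR_proj m K (aug_of K ag (Abs_poly_mapping f))) \<in> lookup ` mod_chains m (B 0) \<rightarrow> carrier (SR_module m K)"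
      using aug_carr by (auto simp: ops(1))
    show "SR_proj m K (aug_of K ag (Abs_poly_mapping (x \<oplus>\<^bsub>free_module ?R (B 0)\<^esub> y)))
        = SR_proj m K (aug_of K ag (Abs_poly_mapping x)) \<oplus>\<^bsub>SR_module m K\<^esub> SR_proj m K (aug_of K ag (Abs_poly_mapping y))"
      if "x \<in> lookup ` mod_chains m (B 0)" "y \<in> lookup ` mod_chains m (B 0)" for x y
      using that by (auto simp: free_module_ops aug_of_add ops(2)[OF aug_carr aug_carr])
    show "SR_proj m K (aug_of K ag (Abs_poly_mapping (r \<odot>\<^bsub>free_module ?R (B 0)\<^esub> x)))
        = r \<odot>\<^bsub>SR_module m K\<^esub> SR_proj m K (aug_of K ag (Abs_poly_mapping x))"
      if r: "r \<in> carrier ?R" and "x \<in> lookup ` mod_chains m (B 0)" for r x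
    proof -
      obtain c where c: "x = lookup c"
        using \<open>x \<in> _\<close> by blast
      show ?thesis
        unfolding c free_module_ops lookup_inverse aug_of_smul[OF K] ops(3)[OF r aug_carr]
          SR_proj_eq_iff[OF K red_carr mpoly_carrier_mult[OF r aug_carr]] by simp
    qed
    show "(\<lambda>f. SR_proj m K (aug_of K ag (Abs_poly_mapping f))) ` lookup ` hom_chains m (B 0) (\<delta> 0) n \<subseteq> SR_grading m K n" for n
    proof -
      have "aug_of K ag c \<in> mpoly_grading m n" if "c \<in> hom_chains m (B 0) (\<delta> 0) n" for c
        using aug_of_hom_chains[OF that F'(4)] nf_grading_subset[OF Km] by blast
      then show ?thesis
        unfolding SR_grading_def by auto
    qed
  qed
  show ?thesis
    unfolding graded_free_resolution_def res_module_def res_grading_def resolution.simps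
  proof (intro conjI allI)
    show "(\<lambda>f. SR_proj m K (aug_of K ag (Abs_poly_mapping f))) ` carrier (free_module ?R (B 0)) = carrier (SR_module m K)"
      unfolding ops(1) carrier_free_module image_image lookup_inverse
    proof (intro equalityI subsetI)
      fix x assume "x \<in> SR_proj m K ` carrier ?R"
      then obtain p where p: "x = SR_proj m K p" "p \<in> carrier ?R"
        by blast
      \<comment> \<open>Preimages are known to exist for homogeneous elements, and a single monomial
        is homogeneous, so a preimage is assembled monomial by monomial.\<close>
      have "\<exists>c\<in>mod_chains m (B 0). aug_of K ag c = single t (lookup p t)" if t: "keys t \<in> K" for t
      proof -
        have "single t (lookup p t) \<in> nf_grading K (2 * mdeg t)"
          using t by (auto simp: nf_grading_def lookup_single when_def split: if_splits)
        then show ?thesis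
          using F'(6) hom_chains_subset by blast
      qed
      then obtain c where c: "\<And>t. keys t \<in> K \<Longrightarrow> c t \<in> mod_chains m (B 0)"
        "\<And>t. keys t \<in> K \<Longrightarrow> aug_of K ag (c t) = single t (lookup p t)"
        by metis
      let ?A = "keys (red K p)"
      have A: "keys t \<in> K" if "t \<in> ?A" for t
        using that by (auto simp: in_keys_iff split: if_splits)
      have "aug_of K ag (\<Sum>t\<in>?A. c t) = (\<Sum>t\<in>?A. smul (lookup (red K p) t) (bas t))"
        unfolding aug_of_sum using A c(2) by (intro sum.cong) auto
      also have "\<dots> = red K p"
        using lin_bas[of "red K p"] unfolding lin_def .
      finally have "x = SR_proj m K (aug_of K ag (\<Sum>t\<in>?A. c t))"
        unfolding p(1) by (simp add: SR_proj_eq_iff[OF K p(2) red_carr])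
      moreover have "(\<Sum>t\<in>?A. c t) \<in> mod_chains m (B 0)"
        using A c(1) by (intro mod_chains_sum) auto
      ultimately show "x \<in> (\<lambda>c. SR_proj m K (aug_of K ag c)) ` mod_chains m (B 0)"
        by (rule image_eqI)
    qed (use aug_carr in auto)
    show "(\<lambda>f. lookup (lin (d (Suc 0)) (Abs_poly_mapping f))) ` carrier (free_module ?R (B 1))
        = {x \<in> carrier (free_module ?R (B 0)). SR_proj m K (aug_of K ag (Abs_poly_mapping x)) = \<zero>\<^bsub>SR_module m K\<^esub>}"
      unfolding aug_eq_0 carrier_free_module image_image lookup_inverse One_nat_def
    proof (intro equalityI subsetI)
      fix x assume "x \<in> {x \<in> lookup ` mod_chains m (B 0). aug_of K ag (Abs_poly_mapping x) = 0}"
      then obtain c where "x = lookup c" "c \<in> mod_chains m (B 0)" "aug_of K ag c = 0"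
        by auto
      then show "x \<in> (\<lambda>c. lookup (lin (d (Suc 0)) c)) ` mod_chains m (B (Suc 0))"
        using exact(2)[of c] by auto
    qed (use d_mod aug_d in auto)
    show "(\<lambda>f. lookup (lin (d (Suc (Suc i))) (Abs_poly_mapping f))) ` carrier (free_module ?R (B (Suc (Suc i))))
        = {x \<in> carrier (free_module ?R (B (Suc i))). lookup (lin (d (Suc i)) (Abs_poly_mapping x)) = \<zero>\<^bsub>free_module ?R (B i)\<^esub>}" for i
      unfolding carrier_free_module image_image lookup_inverse free_module_ops lookup_inject
    proof (intro equalityI subsetI)
      fix x assume "x \<in> {x \<in> lookup ` mod_chains m (B (Suc i)). lin (d (Suc i)) (Abs_poly_mapping x) = 0}"
      then obtain c where "x = lookup c" "c \<in> mod_chains m (B (Suc i))" "lin (d (Suc i)) c = 0"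
        by auto
      then show "x \<in> (\<lambda>c. lookup (lin (d (Suc (Suc i))) c)) ` mod_chains m (B (Suc (Suc i)))"
        using exact(1)[of c i] by auto
    qed (use d_mod dd in auto)
  qed (use aug_hom diff_hom in simp_all)
qed

lemma countable_kos_bas:
  assumes Km: "\<And>I. I \<in> K \<Longrightarrow> I \<subseteq> {1..m}"
  shows "countable (kos_bas m K n)"
proof -
  let ?T = "{t :: nat \<Rightarrow>\<^sub>0 nat. keys t \<subseteq> {1..m}}"
  have "?T = (\<Union>j. {t. keys t \<subseteq> {1..m} \<and> mdeg t = j})"
    by auto
  also have "countable \<dots>"
    using countable_finite[OF finite_monomials] by (intro countable_UN) auto
  finally have "countable ?T" .
  then have "countable (Pow {1..m} \<times> ?T)"
    using countable_finite[of "Pow {1..m}"] by (intro countable_SIGMA) auto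
  moreover have "kos_bas m K n \<subseteq> Pow {1..m} \<times> ?T"
  proof
    fix b assume "b \<in> kos_bas m K n"
    then show "b \<in> Pow {1..m} \<times> ?T"
      using Km[of "keys (snd b)"] by (cases b) (simp add: kos_bas_def)
  qed
  ultimately show ?thesis
    by (rule countable_subset[rotated])
qed

text \<open>This makes the choice in \<open>graded_Tor\<close> the choice of a genuine resolution.
  The Koszul bases are countable, so they embed into the natural numbers.\<close>

lemma graded_free_resolution_exists:
  assumes K: "down_closed K" and Km: "\<And>I. I \<in> K \<Longrightarrow> I \<subseteq> {1..m}"
  shows "\<exists>F. graded_free_resolution (mpoly_ring m) (mpoly_grading m) (SR_module m K) (SR_grading m K) F"
  using graded_free_resolution_of_based[OF K Km
      based_resolution_reindex[OF K kos_based_resolution[OF K Km], where e = "\<lambda>n. to_nat_on (kos_bas m K n)"]]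
    inj_on_to_nat_on[OF countable_kos_bas[OF Km]] by blast

section \<open>Tensoring with the integers\<close>

abbreviation fmod :: "nat \<Rightarrow> 'b set \<Rightarrow> (int_mpoly, 'b \<Rightarrow> int_mpoly) module" where
  "fmod m B \<equiv> free_module (mpoly_ring m) B"

text \<open>The isomorphism of the tensor product of a free module with the integers onto the free abelian
  group on the basis.\<close>

definition eps :: "('b \<Rightarrow> int_mpoly) \<times> int \<Rightarrow> 'b \<Rightarrow>\<^sub>0 int" where
  "eps = (\<lambda>(x, n). smul n (mod_aug (Abs_poly_mapping x)))"

text \<open>These fibres turn out to be the cosets of the tensor relations, so calculating in the
  tensor product is calculating with \<open>g\<close>.\<close>

definition tens_fibre :: "nat \<Rightarrow> 'b set \<Rightarrow> ('b \<Rightarrow>\<^sub>0 int) \<Rightarrow> (('b \<Rightarrow> int_mpoly) \<times> int \<Rightarrow>\<^sub>0 int) set" where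
  "tens_fibre m B g = {w. keys w \<subseteq> carrier (fmod m B) \<times> UNIV \<and> lin eps w = g}"

lemma int_module_simps [simp]:
  "carrier int_module = UNIV" "x \<oplus>\<^bsub>int_module\<^esub> y = x + y" "r \<odot>\<^bsub>int_module\<^esub> x = augmentation r * x"
  by (simp_all add: int_module_def module_via_def)

lemma eps_lookup [simp]: "eps (lookup c, n) = smul n (mod_aug c)"
  by (simp add: eps_def)

lemma mod_aug_smul: "mod_aug (smul r c) = smul (augmentation r) (mod_aug c)"
  by (intro poly_mapping_eqI) (simp add: augmentation_mult)

lemma smul_add_left: "smul (r + s) c = smul r c + smul s c"
  by (intro poly_mapping_eqI) (simp add: lookup_add distrib_right)

lemma pair_group_simps [simp]:
  "carrier (pair_group M int_module) = {w. keys w \<subseteq> carrier M \<times> UNIV}"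
  "monoid.mult (pair_group M int_module) = (+)" "\<one>\<^bsub>pair_group M int_module\<^esub> = 0"
  by (auto simp: pair_group_def free_Abelian_group_def)

lemma comm_group_pair_group: "comm_group (pair_group M int_module)"
  unfolding pair_group_def by (rule abelian_free_Abelian_group)

lemma inv_pair_group: "keys w \<subseteq> carrier M \<times> UNIV \<Longrightarrow> inv\<^bsub>pair_group M int_module\<^esub> w = - w"
  by (simp add: pair_group_def)

text \<open>The relations are killed by \<open>eps\<close>. Conversely each pair is congruent,
  modulo the relations, to its image under \<open>eps\<close> followed by the section
  \<open>?S\<close>, which sends a basis element to its pair with 1; on the kernel of
  \<open>eps\<close> that image is zero.\<close>

lemma tensor_relations_eq: "tensor_relations (mpoly_ring m) (fmod m B) int_module = tens_fibre m B 0"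
  (is "?T = _")
  and subgroup_tensor_relations: "subgroup (tensor_relations (mpoly_ring m) (fmod m B) int_module) (pair_group (fmod m B) int_module)"
proof -
  let ?R = "mpoly_ring m" and ?M = "fmod m B" and ?P = "pair_group (fmod m B) int_module"
  interpret P: comm_group ?P
    by (rule comm_group_pair_group)
  define G where "G = {frag_of (x \<oplus>\<^bsub>?M\<^esub> x', y) - frag_of (x, y) - frag_of (x', y) | x x' y.
         x \<in> carrier ?M \<and> x' \<in> carrier ?M \<and> y \<in> carrier int_module} \<union>
      {frag_of (x, y \<oplus>\<^bsub>int_module\<^esub> y') - frag_of (x, y) - frag_of (x, y') | x y y'.
         x \<in> carrier ?M \<and> y \<in> carrier int_module \<and> y' \<in> carrier int_module} \<union>
      {frag_of (r \<odot>\<^bsub>?M\<^esub> x, y) - frag_of (x, r \<odot>\<^bsub>int_module\<^esub> y) | r x y.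
         r \<in> carrier ?R \<and> x \<in> carrier ?M \<and> y \<in> carrier int_module}"
  have T: "?T = generate ?P G"
    by (simp add: tensor_relations_def G_def)
  have sub: "subgroup (tens_fibre m B 0) ?P"
  proof (rule P.subgroupI)
    show "tens_fibre m B 0 \<noteq> {}"
      by (auto simp: tens_fibre_def intro: exI[of _ 0])
    fix a b assume "a \<in> tens_fibre m B 0" "b \<in> tens_fibre m B 0"
    then show "a \<otimes>\<^bsub>?P\<^esub> b \<in> tens_fibre m B 0"
      by (simp add: tens_fibre_def lin_add keys_add_subset)
  qed (auto simp: tens_fibre_def inv_pair_group lin_uminus)
  have G_sub: "G \<subseteq> tens_fibre m B 0"
  proof
    fix w assume "w \<in> G"
    then consider (add_l) c d y where "c \<in> mod_chains m B" "d \<in> mod_chains m B"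
        "w = bas (lookup (c + d), y) - bas (lookup c, y) - bas (lookup d, y)"
      | (add_r) c y y' where "c \<in> mod_chains m B"
        "w = bas (lookup c, y + y') - bas (lookup c, y) - bas (lookup c, y')"
      | (smult) r c y where "c \<in> mod_chains m B" "r \<in> carrier ?R"
        "w = bas (lookup (smul r c), y) - bas (lookup c, augmentation r * y)"
      unfolding G_def carrier_free_module by (auto simp: free_module_ops)
    then show "w \<in> tens_fibre m B 0"
    proof cases
      case add_l
      have "keys w \<subseteq> carrier ?M \<times> UNIV"
        unfolding add_l(3) carrier_free_module using add_l(1,2) by (intro keys_diff_subset) (auto intro: mod_chains_add)
      moreover have "lin eps w = 0"
        by (simp add: add_l(3) lin_diff mod_aug_add smul_add)
      ultimately show ?thesis
        by (simp add: tens_fibre_def)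
    next
      case add_r
      have "keys w \<subseteq> carrier ?M \<times> UNIV"
        unfolding add_r(2) carrier_free_module using add_r(1) by (intro keys_diff_subset) auto
      moreover have "lin eps w = 0"
        by (simp add: add_r(2) lin_diff smul_add_left)
      ultimately show ?thesis
        by (simp add: tens_fibre_def)
    next
      case smult
      have "keys w \<subseteq> carrier ?M \<times> UNIV"
        unfolding smult(3) carrier_free_module using smult(1,2) by (intro keys_diff_subset) (auto intro: mod_chains_smul)
      moreover have "lin eps w = 0"
        by (simp add: smult(3) lin_diff mod_aug_smul smul_smul mult.commute)
      ultimately show ?thesis
        by (simp add: tens_fibre_def)
    qed
  qed
  have GP: "G \<subseteq> carrier ?P"
    using G_sub by (auto simp: tens_fibre_def)
  show T_sub: "subgroup ?T ?P"
    unfolding T by (rule P.generate_is_subgroup[OF GP])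
  have T_0: "0 \<in> ?T"
    using subgroup.one_closed[OF T_sub] by simp
  have T_add: "x + y \<in> ?T" if "x \<in> ?T" "y \<in> ?T" for x y
    using subgroup.m_closed[OF T_sub that] by simp
  have T_carr: "keys x \<subseteq> carrier ?M \<times> UNIV" if "x \<in> ?T" for x
    using subgroup.mem_carrier[OF T_sub that] by simp
  have T_uminus: "- x \<in> ?T" if "x \<in> ?T" for x
    using subgroup.m_inv_closed[OF T_sub that] inv_pair_group[OF T_carr[OF that]] by simp
  have T_diff: "x - y \<in> ?T" if "x \<in> ?T" "y \<in> ?T" for x y
    using T_add[OF that(1) T_uminus[OF that(2)]] by simp
  have T_smul: "smul k x \<in> ?T" if x: "x \<in> ?T" for k x
  proof -
    have nat: "smul (int n) x \<in> ?T" for n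
      by (induction n) (simp_all add: T_0 smul_add_left T_add x)
    have neg: "smul (- int n) x = - smul (int n) x" for n
      by (intro poly_mapping_eqI) simp
    show ?thesis
      by (cases k rule: int_cases2) (simp_all only: nat neg T_uminus)
  qed
  have T_gen: "w \<in> ?T" if "w \<in> G" for w
    unfolding T using that by (rule generate.incl)
  have carr: "lookup c \<in> carrier ?M" if "c \<in> mod_chains m B" for c
    using that by (simp add: carrier_free_module)
  have add_l: "bas (lookup (c + d), y) - bas (lookup c, y) - bas (lookup d, y) \<in> ?T"
    if "c \<in> mod_chains m B" "d \<in> mod_chains m B" for c d y
    unfolding free_module_ops(2)[where B = B and m = m, symmetric]
    using carr that by (intro T_gen) (auto simp: G_def)
  have add_r: "bas (lookup c, y + y') - bas (lookup c, y) - bas (lookup c, y') \<in> ?T"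
    if "c \<in> mod_chains m B" for c y y'
    unfolding int_module_simps(2)[symmetric]
    using carr that by (intro T_gen) (auto simp: G_def simp del: int_module_simps(2))
  have smult: "bas (lookup (smul r c), y) - bas (lookup c, augmentation r * y) \<in> ?T"
    if "c \<in> mod_chains m B" "r \<in> carrier ?R" for r c y
    unfolding free_module_ops(3)[where B = B and m = m, symmetric] int_module_simps(3)[symmetric]
    using carr that by (intro T_gen) (auto simp: G_def simp del: int_module_simps(3))
  let ?S = "lin (\<lambda>b. bas (lookup (bas b :: 'b \<Rightarrow>\<^sub>0 int_mpoly), 1)) :: ('b \<Rightarrow>\<^sub>0 int) \<Rightarrow> _ \<Rightarrow>\<^sub>0 int"
  \<comment> \<open>Additivity in the integer argument is extended to positive and negative
    multiples by induction; \<open>g\<close> measures the defect.\<close>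
  have int_mult: "bas (lookup c, k) - smul k (bas (lookup c, 1)) \<in> ?T" if c: "c \<in> mod_chains m B" for c k
  proof -
    define g where "g k = bas (lookup c, k) - smul k (bas (lookup c, 1) :: _ \<Rightarrow>\<^sub>0 int)" for k
    have g_add: "g (k + l) - g k - g l \<in> ?T" for k l
    proof -
      have "g (k + l) - g k - g l = bas (lookup c, k + l) - bas (lookup c, k) - bas (lookup c, l)"
        unfolding g_def smul_add_left by simp
      then show ?thesis
        using add_r[OF c] by simp
    qed
    have g0: "g 0 \<in> ?T"
      using T_uminus[OF g_add[of 0 0]] by simp
    have g_nat: "g (int n) \<in> ?T" for n
    proof (induction n)
      case (Suc n)
      have "g (1 + int n) = (g (1 + int n) - g 1 - g (int n)) + g (int n) + 0"
        by (simp add: g_def)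
      also have "\<dots> \<in> ?T"
        using Suc g_add by (intro T_add T_0)
      finally show ?case
        by simp
    qed (use g0 in simp)
    have "g (- int n) \<in> ?T" for n
    proof -
      have "g (- int n) = g (- int n + int n) - g (int n) - (g (- int n + int n) - g (- int n) - g (int n))"
        by simp
      also have "\<dots> \<in> ?T"
        by (intro T_diff g_nat g_add) (simp add: g0)
      finally show ?thesis .
    qed
    then have "g k \<in> ?T"
      using g_nat by (cases k rule: int_cases2) (simp_all only:)
    then show ?thesis
      by (simp add: g_def)
  qed
  have step: "bas (lookup c, n) - ?S (eps (lookup c, n)) \<in> ?T" if c: "c \<in> mod_chains m B" for c n
  proof -
    \<comment> \<open>The defect of \<open>c\<close> passes to sums, so it suffices to treat the
      multiples of single basis elements.\<close>
    let ?Q = "\<lambda>c. bas (lookup c, n) - ?S (eps (lookup c, n))"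
    have Q0: "?Q 0 \<in> ?T"
      using T_uminus[OF add_l[of 0 0 n]] by simp
    have Q_add: "?Q (c + d) \<in> ?T" if cd: "c \<in> mod_chains m B" "d \<in> mod_chains m B" "?Q c \<in> ?T" "?Q d \<in> ?T" for c d
    proof -
      have "?Q (c + d) = (bas (lookup (c + d), n) - bas (lookup c, n) - bas (lookup d, n)) + ?Q c + ?Q d"
        by (simp add: mod_aug_add smul_add lin_add)
      also have "\<dots> \<in> ?T"
        using cd by (intro T_add add_l)
      finally show ?thesis .
    qed
    have Q_bas: "?Q (smul r (bas b)) \<in> ?T" if "b \<in> B" "r \<in> carrier ?R" for b r
    proof -
      have b: "bas b \<in> mod_chains m B"
        using that(1) by (rule mod_chains_bas)
      have "?Q (smul r (bas b)) = (bas (lookup (smul r (bas b)), n) - bas (lookup (bas b), augmentation r * n))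
          + (bas (lookup (bas b), augmentation r * n) - smul (augmentation r * n) (bas (lookup (bas b), 1)))"
        unfolding eps_lookup mod_aug_smul mod_aug_bas lin_smul smul_smul by (simp add: mult.commute del: smul_single)
      also have "\<dots> \<in> ?T"
        using that b by (intro T_add smult int_mult)
      finally show ?thesis .
    qed
    have "?Q (\<Sum>b\<in>A. smul (lookup c b) (bas b)) \<in> ?T" if "finite A" "A \<subseteq> B" for A
      using that
    proof (induction A rule: finite_induct)
      case (insert b A)
      have r: "lookup c b \<in> carrier ?R" for b
        using c by (simp add: mod_chains_iff)
      have "?Q (smul (lookup c b) (bas b) + (\<Sum>b\<in>A. smul (lookup c b) (bas b))) \<in> ?T"
        using insert r by (intro Q_add Q_bas mod_chains_sum mod_chains_smul mod_chains_bas) auto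
      then show ?case
        using insert.hyps by (simp del: smul_single)
    qed (use Q0 in simp)
    note Q_sum = this
    have c_eq: "c = (\<Sum>b\<in>keys c. smul (lookup c b) (bas b))"
      using lin_bas[of c, symmetric] unfolding lin_def .
    have "keys c \<subseteq> B"
      using c by (simp add: mod_chains_iff)
    from Q_sum[OF finite_keys this] show ?thesis
      unfolding c_eq[symmetric] .
  qed
  have T_sum: "sum f A \<in> ?T" if "\<And>p. p \<in> A \<Longrightarrow> f p \<in> ?T" for f :: "('b \<Rightarrow> int_mpoly) \<times> int \<Rightarrow> _" and A
    using that by (induction A rule: infinite_finite_induct) (simp_all add: T_0 T_add)
  show "?T = tens_fibre m B 0"
  proof
    show "?T \<subseteq> tens_fibre m B 0"
      unfolding T by (rule P.generate_subgroup_incl[OF G_sub sub])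
    show "tens_fibre m B 0 \<subseteq> ?T"
    proof
      fix z assume z: "z \<in> tens_fibre m B 0"
      have "z = z - ?S (lin eps z)"
        using z by (simp add: tens_fibre_def)
      also have "\<dots> = lin (\<lambda>p. bas p - ?S (eps p)) z"
        by (simp add: lin_fun_diff lin_lin)
      also have "\<dots> \<in> ?T"
        unfolding lin_def[of "\<lambda>p. bas p - ?S (eps p)"]
      proof (intro T_sum T_smul)
        fix p assume "p \<in> keys z"
        then have "fst p \<in> lookup ` mod_chains m B"
          using z by (auto simp: tens_fibre_def carrier_free_module)
        then obtain c where "p = (lookup c, snd p)" "c \<in> mod_chains m B"
          by (metis imageE prod.collapse)
        then show "bas p - ?S (eps p) \<in> ?T"
          using step[of c "snd p"] by simp
      qed
      finally show "z \<in> ?T" .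
    qed
  qed
qed

section \<open>Cosets of the tensor relations as fibres\<close>

lemma tens_fibre_nonempty: "keys g \<subseteq> B \<Longrightarrow> tens_fibre m B g \<noteq> {}"
proof -
  assume g: "keys g \<subseteq> B"
  let ?w = "lin (\<lambda>b. bas (lookup (bas b :: 'a \<Rightarrow>\<^sub>0 int_mpoly), 1)) g :: _ \<Rightarrow>\<^sub>0 int"
  have "keys ?w \<subseteq> carrier (fmod m B) \<times> UNIV"
  proof (rule keys_lin_subset)
    fix b assume "b \<in> keys g"
    then have "(bas b :: 'a \<Rightarrow>\<^sub>0 int_mpoly) \<in> mod_chains m B"
      using g by (intro mod_chains_bas) auto
    then show "keys (bas (lookup (bas b :: 'a \<Rightarrow>\<^sub>0 int_mpoly), 1) :: _ \<Rightarrow>\<^sub>0 int) \<subseteq> carrier (fmod m B) \<times> UNIV"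
      by (simp add: carrier_free_module)
  qed
  moreover have "lin eps ?w = g"
    by (simp add: lin_lin)
  ultimately have "?w \<in> tens_fibre m B g"
    by (simp add: tens_fibre_def)
  then show ?thesis
    by blast
qed

lemma keys_lin_eps:
  assumes "keys w \<subseteq> carrier (fmod m B) \<times> UNIV"
  shows "keys (lin eps w) \<subseteq> B"
proof (rule keys_lin_subset)
  fix p assume "p \<in> keys w"
  then have "fst p \<in> lookup ` mod_chains m B"
    using assms by (auto simp: carrier_free_module)
  then obtain c where c: "p = (lookup c, snd p)" "c \<in> mod_chains m B"
    by (metis imageE prod.collapse)
  have "keys (smul (snd p) (mod_aug c)) \<subseteq> keys c"
    by (rule subset_trans[OF keys_smul keys_mod_aug])
  then show "keys (eps p) \<subseteq> B"
    using c(2) by (subst c(1)) (auto simp: mod_chains_iff)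
qed

lemma tensor_coset:
  assumes w: "keys w \<subseteq> carrier (fmod m B) \<times> UNIV"
  shows "tensor_relations (mpoly_ring m) (fmod m B) int_module #>\<^bsub>pair_group (fmod m B) int_module\<^esub> w = tens_fibre m B (lin eps w)"
  unfolding r_coset_def tensor_relations_eq
proof (intro equalityI subsetI)
  fix v assume "v \<in> tens_fibre m B (lin eps w)"
  then have "v - w \<in> tens_fibre m B 0"
    using w by (simp add: tens_fibre_def lin_diff keys_diff_subset)
  then show "v \<in> (\<Union>h\<in>tens_fibre m B 0. {h \<otimes>\<^bsub>pair_group (fmod m B) int_module\<^esub> w})"
    by (intro UN_I[of "v - w"]) simp_all
next
  fix v assume "v \<in> (\<Union>h\<in>tens_fibre m B 0. {h \<otimes>\<^bsub>pair_group (fmod m B) int_module\<^esub> w})"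
  then obtain h where "h \<in> tens_fibre m B 0" "v = h + w"
    by auto
  then show "v \<in> tens_fibre m B (lin eps w)"
    using w by (simp add: tens_fibre_def lin_add keys_add_subset)
qed

lemma tensor_group_simps:
  fixes m :: nat and B :: "'b set"
  defines "G \<equiv> tensor_group (mpoly_ring m) (fmod m B) int_module"
  shows "comm_group G" and "carrier G = tens_fibre m B ` {g. keys g \<subseteq> B}"
    and "\<And>g h. keys g \<subseteq> B \<Longrightarrow> keys h \<subseteq> B \<Longrightarrow> tens_fibre m B g \<otimes>\<^bsub>G\<^esub> tens_fibre m B h = tens_fibre m B (g + h)"
    and "\<one>\<^bsub>G\<^esub> = tens_fibre m B 0"
proof -
  let ?P = "pair_group (fmod m B) int_module" and ?T = "tensor_relations (mpoly_ring m) (fmod m B) int_module"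
  interpret P: comm_group ?P
    by (rule comm_group_pair_group)
  have normal: "?T \<lhd> ?P"
    by (rule P.subgroup_imp_normal[OF subgroup_tensor_relations])
  show "comm_group G"
    unfolding G_def tensor_group_def by (rule P.abelian_FactGroup[OF subgroup_tensor_relations])
  have fibre: "\<exists>w. keys w \<subseteq> carrier (fmod m B) \<times> UNIV \<and> lin eps w = g" if "keys g \<subseteq> B" for g :: "'b \<Rightarrow>\<^sub>0 int"
    using tens_fibre_nonempty[OF that, of m] by (auto simp: tens_fibre_def)
  show "carrier G = tens_fibre m B ` {g. keys g \<subseteq> B}"
  proof (intro equalityI subsetI)
    fix C assume "C \<in> carrier G"
    then obtain w where w: "keys w \<subseteq> carrier (fmod m B) \<times> UNIV" "C = ?T #>\<^bsub>?P\<^esub> w"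
      by (auto simp: G_def tensor_group_def FactGroup_def RCOSETS_def)
    then show "C \<in> tens_fibre m B ` {g. keys g \<subseteq> B}"
      unfolding w(2) tensor_coset[OF w(1)] by (intro imageI CollectI keys_lin_eps)
  next
    fix C assume "C \<in> tens_fibre m B ` {g. keys g \<subseteq> B}"
    then obtain w where w: "keys w \<subseteq> carrier (fmod m B) \<times> UNIV" "C = tens_fibre m B (lin eps w)"
      using fibre by auto
    then have "C = ?T #>\<^bsub>?P\<^esub> w"
      using tensor_coset[OF w(1)] by simp
    then show "C \<in> carrier G"
      using w(1) by (auto simp: G_def tensor_group_def FactGroup_def RCOSETS_def)
  qed
  show "tens_fibre m B g \<otimes>\<^bsub>G\<^esub> tens_fibre m B h = tens_fibre m B (g + h)"
    if g: "keys g \<subseteq> B" and h: "keys h \<subseteq> B" for g h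
  proof -
    obtain v w where v: "keys v \<subseteq> carrier (fmod m B) \<times> UNIV" "lin eps v = g"
      and w: "keys w \<subseteq> carrier (fmod m B) \<times> UNIV" "lin eps w = h"
      using fibre[OF g] fibre[OF h] by blast
    have "tens_fibre m B g \<otimes>\<^bsub>G\<^esub> tens_fibre m B h = (?T #>\<^bsub>?P\<^esub> v) <#>\<^bsub>?P\<^esub> (?T #>\<^bsub>?P\<^esub> w)"
      unfolding tensor_coset[OF v(1)] tensor_coset[OF w(1)] v(2) w(2) by (simp add: G_def tensor_group_def FactGroup_def)
    also have "\<dots> = ?T #>\<^bsub>?P\<^esub> (v \<otimes>\<^bsub>?P\<^esub> w)"
      using v(1) w(1) by (intro normal.rcos_sum[OF normal]) simp_all
    also have "\<dots> = tens_fibre m B (g + h)"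
      using tensor_coset[OF keys_add_subset[OF v(1) w(1)]] v(2) w(2) by (simp add: lin_add)
    finally show ?thesis .
  qed
  show "\<one>\<^bsub>G\<^esub> = tens_fibre m B 0"
    by (simp add: G_def tensor_group_def FactGroup_def tensor_relations_eq)
qed

lemma tens_fibre_inj: "tens_fibre m B g = tens_fibre m B h \<Longrightarrow> keys g \<subseteq> B \<Longrightarrow> g = h"
  using tens_fibre_nonempty[of g B m] by (auto simp: tens_fibre_def)

lemma subgroup_tens_fibre:
  fixes m :: nat and B :: "'b set"
  defines "G \<equiv> tensor_group (mpoly_ring m) (fmod m B) int_module"
  assumes C: "C \<subseteq> {g. keys g \<subseteq> B}" "0 \<in> C" "\<And>x y. x \<in> C \<Longrightarrow> y \<in> C \<Longrightarrow> x - y \<in> C"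
  shows "subgroup (tens_fibre m B ` C) G"
proof -
  note G = tensor_group_simps[where m = m and B = B, folded G_def]
  interpret G: comm_group G
    by (rule G(1))
  have uminus: "- x \<in> C" if "x \<in> C" for x
    using C(3)[OF C(2) that] by simp
  have add: "x + y \<in> C" if "x \<in> C" "y \<in> C" for x y
    using C(3)[OF that(1) uminus[OF that(2)]] by simp
  show ?thesis
  proof (rule G.subgroupI)
    show "tens_fibre m B ` C \<subseteq> carrier G"
      unfolding G(2) using C(1) by (rule image_mono)
    show "tens_fibre m B ` C \<noteq> {}"
      using C(2) by blast
    fix a assume "a \<in> tens_fibre m B ` C"
    then obtain g where g: "a = tens_fibre m B g" "g \<in> C" "keys g \<subseteq> B"
      using C(1) by blast
    have "inv\<^bsub>G\<^esub> a = tens_fibre m B (- g)"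
    proof (rule G.inv_equality)
      show "tens_fibre m B (- g) \<otimes>\<^bsub>G\<^esub> a = \<one>\<^bsub>G\<^esub>"
        using G(3)[of "- g" g] g(1,3) by (simp add: G(4))
    qed (use g in \<open>auto simp: G(2)\<close>)
    then show "inv\<^bsub>G\<^esub> a \<in> tens_fibre m B ` C"
      using uminus[OF g(2)] by simp
    fix b assume "b \<in> tens_fibre m B ` C"
    then obtain h where h: "b = tens_fibre m B h" "h \<in> C" "keys h \<subseteq> B"
      using C(1) by blast
    show "a \<otimes>\<^bsub>G\<^esub> b \<in> tens_fibre m B ` C"
      using G(3)[OF g(3) h(3)] add[OF g(2) h(2)] g(1) h(1) by simp
  qed
qed

section \<open>Grading, induced maps and homology of the tensor product\<close>

lemma tensor_grading_eq:
  "tensor_grading (mpoly_ring m) (fmod m B) (free_grading (mpoly_ring m) (mpoly_grading m) B \<delta>) int_module int_grading n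
    = tens_fibre m B ` {g. keys g \<subseteq> {b\<in>B. \<delta> b = n}}"
proof -
  define G where "G = tensor_group (mpoly_ring m) (fmod m B) int_module"
  note G = tensor_group_simps[where m = m and B = B, folded G_def]
  interpret G: comm_group G
    by (rule G(1))
  let ?C = "{g :: 'a \<Rightarrow>\<^sub>0 int. keys g \<subseteq> {b\<in>B. \<delta> b = n}}"
  define S where "S = {tensor_elem (mpoly_ring m) (fmod m B) int_module x y | x y.
    \<exists>k l. k + l = n \<and> x \<in> free_grading (mpoly_ring m) (mpoly_grading m) B \<delta> k \<and> y \<in> int_grading l}"
  have elem: "tensor_elem (mpoly_ring m) (fmod m B) int_module (lookup c) y = tens_fibre m B (smul y (mod_aug c))"
    if "c \<in> mod_chains m B" for c y
    unfolding tensor_elem_def using that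
    by (subst tensor_coset) (auto simp: carrier_free_module)
  have sub: "subgroup (tens_fibre m B ` ?C) G"
    unfolding G_def
  proof (rule subgroup_tens_fibre)
    show "?C \<subseteq> {g. keys g \<subseteq> B}"
      by blast
  qed (simp_all add: keys_diff_subset)
  have "S \<subseteq> tens_fibre m B ` ?C"
  proof
    fix z assume "z \<in> S"
    then obtain c y k l where z: "z = tensor_elem (mpoly_ring m) (fmod m B) int_module (lookup c) y"
      "k + l = n" "c \<in> hom_chains m B \<delta> k" "y \<in> int_grading l"
      unfolding S_def free_grading_eq by blast
    have cm: "c \<in> mod_chains m B"
      using z(3) hom_chains_subset by blast
    have "keys (smul y (mod_aug c)) \<subseteq> {b\<in>B. \<delta> b = n}"
    \<comment> \<open>The integers sit in degree 0: either the first factor carries the whole degree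
      or the second factor is zero.\<close>
    proof (cases "l = 0")
      case True
      then show ?thesis
        using keys_smul[of y "mod_aug c"] keys_mod_aug_hom_chains[OF z(3)] z(2) by auto
    next
      case False
      then have "y = 0"
        using z(4) by (simp add: int_grading_def)
      then show ?thesis
        by simp
    qed
    then show "z \<in> tens_fibre m B ` ?C"
      unfolding z(1) elem[OF cm] by blast
  qed
  then have "generate G S \<subseteq> tens_fibre m B ` ?C"
    using sub by (rule G.generate_subgroup_incl)
  moreover have "tens_fibre m B g \<in> generate G S" if g: "keys g \<subseteq> {b\<in>B. \<delta> b = n}" for g
  proof -
    have single: "tens_fibre m B (single b k) \<in> generate G S" if "b \<in> B" "\<delta> b = n" for b k
    proof -
      have "tensor_elem (mpoly_ring m) (fmod m B) int_module (lookup (bas b)) k \<in> S"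
        using bas_hom_chains[OF that(1), of m \<delta>] that(2) unfolding S_def free_grading_eq int_grading_def by force
      then show ?thesis
        unfolding elem[OF mod_chains_bas[OF that(1)]] by (simp add: generate.incl)
    qed
    have "tens_fibre m B (\<Sum>b\<in>A. single b (lookup g b)) \<in> generate G S"
      if "finite A" "A \<subseteq> {b\<in>B. \<delta> b = n}" for A
      using that
    proof (induction A rule: finite_induct)
      case empty
      then show ?case
        using generate.one[of G S] by (simp add: G(4))
    next
      case (insert b A)
      have "tens_fibre m B (single b (lookup g b)) \<otimes>\<^bsub>G\<^esub>
          tens_fibre m B (\<Sum>b\<in>A. single b (lookup g b)) \<in> generate G S"
        using insert by (intro generate.eng single) auto
      moreover have "keys (\<Sum>b\<in>A. single b (lookup g b)) \<subseteq> B"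
        using insert.prems by (intro keys_sum_subset) auto
      ultimately show ?case
        using insert G(3)[of "single b (lookup g b)"] by (auto split: if_splits)
    qed
    from this[OF finite_keys g] show ?thesis
      using lin_bas[of g] by (simp only: lin_def smul_single mult_1_right)
  qed
  ultimately show ?thesis
    unfolding tensor_grading_def G_def[symmetric] S_def[symmetric] by blast
qed

text \<open>Under \<open>eps\<close> the induced map becomes the map with reduced coefficients, so
  it takes a fibre into a single fibre, which adding the relations exhausts.\<close>

lemma tensor_map_eq:
  assumes f: "f ` carrier (fmod m B) \<subseteq> carrier (fmod m B')"
    and lin: "\<And>c. c \<in> mod_chains m B \<Longrightarrow> f (lookup c) = lookup (lin d c)"
    and g: "keys g \<subseteq> B"
  shows "tensor_map (mpoly_ring m) (fmod m B') int_module f (tens_fibre m B g) = tens_fibre m B' (lin (\<lambda>b. mod_aug (d b)) g)"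
proof -
  let ?D = "lin (\<lambda>b. mod_aug (d b))" and ?\<phi> = "lin (\<lambda>(x, y). bas (f x, y)) :: _ \<Rightarrow> _ \<Rightarrow>\<^sub>0 int"
  have \<phi>: "keys (?\<phi> w) \<subseteq> carrier (fmod m B') \<times> UNIV" "lin eps (?\<phi> w) = ?D (lin eps w)"
    if w: "keys w \<subseteq> carrier (fmod m B) \<times> UNIV" for w
  proof -
    show "keys (?\<phi> w) \<subseteq> carrier (fmod m B') \<times> UNIV"
    proof (rule keys_lin_subset)
      fix p assume "p \<in> keys w"
      then have "fst p \<in> carrier (fmod m B)"
        using w by auto
      then have "f (fst p) \<in> carrier (fmod m B')"
        using f by blast
      then show "keys ((case p of (x, y) \<Rightarrow> bas (f x, y)) :: _ \<Rightarrow>\<^sub>0 int) \<subseteq> carrier (fmod m B') \<times> UNIV"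
        by (simp add: case_prod_unfold)
    qed
    show "lin eps (?\<phi> w) = ?D (lin eps w)"
      unfolding lin_lin
    proof (rule lin_cong)
      fix p assume "p \<in> keys w"
      then have "fst p \<in> lookup ` mod_chains m B"
        using w by (auto simp: carrier_free_module)
      then obtain c where c: "p = (lookup c, snd p)" "c \<in> mod_chains m B"
        by (metis imageE prod.collapse)
      show "lin eps (case p of (x, y) \<Rightarrow> bas (f x, y)) = ?D (eps p)"
        by (subst (1 2) c(1)) (simp add: lin[OF c(2)] mod_aug_lin lin_smul)
    qed
  qed
  obtain w0 where w0: "w0 \<in> tens_fibre m B g"
    using tens_fibre_nonempty[OF g, of m] by blast
  have "tensor_map (mpoly_ring m) (fmod m B') int_module f (tens_fibre m B g) = {t + ?\<phi> w | t w. t \<in> tens_fibre m B' 0 \<and> w \<in> tens_fibre m B g}"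
    unfolding tensor_map_def tensor_relations_eq set_mult_def frag_extend_eq_lin by auto
  also have "\<dots> = tens_fibre m B' (?D g)"
  proof (intro equalityI subsetI)
    fix v assume "v \<in> {t + ?\<phi> w | t w. t \<in> tens_fibre m B' 0 \<and> w \<in> tens_fibre m B g}"
    then obtain t w where "v = t + ?\<phi> w" "t \<in> tens_fibre m B' 0" "w \<in> tens_fibre m B g"
      by blast
    then show "v \<in> tens_fibre m B' (?D g)"
      using \<phi>[of w] by (simp add: tens_fibre_def lin_add keys_add_subset)
  next
    fix v assume "v \<in> tens_fibre m B' (?D g)"
    then have "v - ?\<phi> w0 \<in> tens_fibre m B' 0"
      using \<phi>[of w0] w0 by (simp add: tens_fibre_def lin_diff keys_diff_subset)
    moreover have "v = (v - ?\<phi> w0) + ?\<phi> w0"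
      by simp
    ultimately show "v \<in> {t + ?\<phi> w | t w. t \<in> tens_fibre m B' 0 \<and> w \<in> tens_fibre m B g}"
      using w0 by blast
  qed
  finally show ?thesis .
qed

lemma abelian_rank_resolution_homology:
  assumes K: "down_closed K" and Km: "\<And>I. I \<in> K \<Longrightarrow> I \<subseteq> {1..m}"
    and F: "graded_free_resolution (mpoly_ring m) (mpoly_grading m) (SR_module m K) (SR_grading m K) F"
  shows "abelian_rank (resolution_homology (mpoly_ring m) (mpoly_grading m) F int_module int_grading i n)
    = hrank (res_basis F) (res_deg F) (res_d F) i n"
proof -
  let ?R = "mpoly_ring m" and ?B = "res_basis F" and ?\<delta> = "res_deg F"
  define G where "G = tensor_group ?R (fmod m (?B i)) int_module"
  note G = tensor_group_simps[where m = m and B = "?B i", folded G_def]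
  have based: "based_resolution m K ?B ?\<delta> (res_d F) (\<lambda>b. SR_nf K (res_aug F (lookup (bas b))))"
    by (rule graded_free_resolution_based(1)[OF K Km F])
  have diff_lin: "res_diff F k (lookup c) = lookup (lin (res_d F (Suc k)) c)"
    if "c \<in> mod_chains m (?B (Suc k))" for k c
    by (rule graded_free_resolution_based(2)[OF K Km F that])
  have grading: "tensor_grading ?R (res_module ?R F k) (res_grading ?R (mpoly_grading m) F k) int_module int_grading n
      = tens_fibre m (?B k) ` {g. keys g \<subseteq> {b\<in>?B k. ?\<delta> k b = n}}" for k
    unfolding res_module_def res_grading_def by (rule tensor_grading_eq)
  have diff: "tensor_map ?R (res_module ?R F k) int_module (res_diff F k) (tens_fibre m (?B (Suc k)) g)
      = tens_fibre m (?B k) (lin (\<lambda>b. mod_aug (res_d F (Suc k) b)) g)" if g: "keys g \<subseteq> ?B (Suc k)" for k g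
    unfolding res_module_def
  proof (rule tensor_map_eq[OF _ diff_lin g])
    show "res_diff F k ` carrier (fmod m (?B (Suc k))) \<subseteq> carrier (fmod m (?B k))"
    proof -
      have "res_diff F k \<in> carrier (fmod m (?B (Suc k))) \<rightarrow> carrier (fmod m (?B k))"
        using F by (simp add: graded_free_resolution_def graded_hom_def module_hom_def res_module_def)
      then show ?thesis
        by blast
    qed
  qed
  have cycles: "tensor_cycles ?R (mpoly_grading m) F int_module int_grading i n
      = tens_fibre m (?B i) ` cycle_chains ?B ?\<delta> (res_d F) i n"
  proof (cases i)
    case 0
    then show ?thesis
      by (simp add: tensor_cycles_def grading cycle_chains_def)
  next
    case (Suc k)
    have keys_d: "keys (lin (\<lambda>b. mod_aug (res_d F (Suc k) b)) g) \<subseteq> ?B k"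
      if g: "keys g \<subseteq> {b\<in>?B (Suc k). ?\<delta> (Suc k) b = n}" for g
    proof (rule keys_lin_subset)
      fix b assume "b \<in> keys g"
      then show "keys (mod_aug (res_d F (Suc k) b)) \<subseteq> ?B k"
        using g keys_mod_aug_hom_chains[OF based_resolutionD(1)[OF based, of b k]] by blast
    qed
    have "tensor_map ?R (res_module ?R F k) int_module (res_diff F k) (tens_fibre m (?B (Suc k)) g)
        = \<one>\<^bsub>tensor_group ?R (res_module ?R F k) int_module\<^esub> \<longleftrightarrow> lin (\<lambda>b. mod_aug (res_d F (Suc k) b)) g = 0"
      if g: "keys g \<subseteq> {b\<in>?B (Suc k). ?\<delta> (Suc k) b = n}" for g
    proof -
      have "keys g \<subseteq> ?B (Suc k)"
        using g by blast
      then show ?thesis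
        using tens_fibre_inj[OF _ keys_d[OF g], where m = m] unfolding diff[OF \<open>keys g \<subseteq> ?B (Suc k)\<close>]
        unfolding res_module_def tensor_group_simps(4) by (intro iffI) (blast, simp only:)
    qed
    then show ?thesis
      unfolding tensor_cycles_def grading cycle_chains_def Suc by auto
  qed
  have boundaries: "tensor_boundaries ?R (mpoly_grading m) F int_module int_grading i n
      = tens_fibre m (?B i) ` boundary_chains ?B ?\<delta> (res_d F) i n"
    unfolding tensor_boundaries_def grading boundary_chains_def image_image
    by (intro image_cong refl diff) blast
  let ?Z = "cycle_chains ?B ?\<delta> (res_d F) i n" and ?N = "boundary_chains ?B ?\<delta> (res_d F) i n"
  \<comment> \<open>Coordinates of a coset: the unique \<open>g\<close> supported in the basis whose
    fibre it is.\<close>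
  define e where "e C = lookup (SOME g. keys g \<subseteq> ?B i \<and> C = tens_fibre m (?B i) g)" for C
  have e: "e (tens_fibre m (?B i) g) = lookup g" if g: "keys g \<subseteq> ?B i" for g
  proof -
    have "(SOME h. keys h \<subseteq> ?B i \<and> tens_fibre m (?B i) g = tens_fibre m (?B i) h) = g"
    proof (rule some_equality)
      show "keys g \<subseteq> ?B i \<and> tens_fibre m (?B i) g = tens_fibre m (?B i) g"
        using g by simp
    qed (use tens_fibre_inj[OF _ g, where m = m] in auto)
    then show ?thesis
      by (simp add: e_def)
  qed
  have NZ: "?N \<subseteq> ?Z"
    by (rule based_resolution_boundaries_subset[OF based])
  have ZB: "?Z \<subseteq> {g. keys g \<subseteq> ?B i}"
    by (auto simp: cycle_chains_def)
  have chain_subgroup: "0 \<in> C \<and> (\<forall>x\<in>C. \<forall>y\<in>C. x - y \<in> C)"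
    if C: "fun_subgroup (lookup ` C)" for C :: "(nat \<Rightarrow>\<^sub>0 int) set"
  proof -
    have "lookup 0 \<in> lookup ` C"
      using fun_subgroup_zero[OF C] by (simp add: zero_poly_mapping.rep_eq)
    moreover have "lookup (x - y) \<in> lookup ` C" if "x \<in> C" "y \<in> C" for x y
      using fun_subgroup_diff[OF C, of "lookup x" "lookup y"] that by (simp add: minus_poly_mapping.rep_eq)
    ultimately show ?thesis
      by (auto simp: image_iff)
  qed
  have "abelian_rank (subgroup_generated G (tens_fibre m (?B i) ` ?Z) Mod tens_fibre m (?B i) ` ?N)
      = qrank (e ` tens_fibre m (?B i) ` ?Z) (e ` tens_fibre m (?B i) ` ?N)"
  proof (rule abelian_rank_quotient[OF G(1)])
    show "subgroup (tens_fibre m (?B i) ` ?Z) G"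
      unfolding G_def
      using chain_subgroup[OF fun_subgroup_cycle_chains[of ?B ?\<delta> "res_d F" i n]] by (intro subgroup_tens_fibre ZB) simp_all
    show "subgroup (tens_fibre m (?B i) ` ?N) G"
      unfolding G_def
      using chain_subgroup[OF fun_subgroup_boundary_chains[of ?B ?\<delta> "res_d F" i n]]
      by (intro subgroup_tens_fibre subset_trans[OF NZ ZB]) simp_all
    show "tens_fibre m (?B i) ` ?N \<subseteq> tens_fibre m (?B i) ` ?Z"
      using NZ by (rule image_mono)
    show "e (x \<otimes>\<^bsub>G\<^esub> y) = (\<lambda>b. e x b + e y b)" if "x \<in> tens_fibre m (?B i) ` ?Z" "y \<in> tens_fibre m (?B i) ` ?Z" for x y
    proof -
      obtain g h where "x = tens_fibre m (?B i) g" "keys g \<subseteq> ?B i" "y = tens_fibre m (?B i) h" "keys h \<subseteq> ?B i"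
        using \<open>x \<in> _\<close> \<open>y \<in> _\<close> ZB by blast
      then show ?thesis
        by (simp add: G(3) e keys_add_subset plus_poly_mapping.rep_eq)
    qed
    show "inj_on e (tens_fibre m (?B i) ` ?Z)"
    proof (rule inj_onI)
      fix x y assume xy: "x \<in> tens_fibre m (?B i) ` ?Z" "y \<in> tens_fibre m (?B i) ` ?Z" "e x = e y"
      obtain g h where "x = tens_fibre m (?B i) g" "keys g \<subseteq> ?B i" "y = tens_fibre m (?B i) h" "keys h \<subseteq> ?B i"
        using xy(1,2) ZB by blast
      then show "x = y"
        using xy(3) by (simp add: e)
    qed
  qed
  moreover have "e ` tens_fibre m (?B i) ` C = lookup ` C" if "C \<subseteq> ?Z" for C
    unfolding image_image using that ZB e by (intro image_cong) auto
  ultimately show ?thesis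
    unfolding resolution_homology_def cycles boundaries hrank_def using NZ
    by (simp add: G_def res_module_def)
qed

theorem betti_eq_sum_crank:
  assumes K: "down_closed K" and Km: "\<And>I. I \<in> K \<Longrightarrow> I \<subseteq> {1..m}"
  shows "betti m K i j = (\<Sum>\<omega>\<in>{\<omega>. \<omega> \<subseteq> {1..m} \<and> card \<omega> = j}.
    if i \<le> j then crank (setbas {\<sigma>\<in>K. \<sigma> \<subseteq> \<omega>}) (\<lambda>n. setbd) (j - i) else 0)"
proof -
  define F where "F = (SOME F. graded_free_resolution (mpoly_ring m) (mpoly_grading m) (SR_module m K) (SR_grading m K) F)"
  have F: "graded_free_resolution (mpoly_ring m) (mpoly_grading m) (SR_module m K) (SR_grading m K) F"
    unfolding F_def by (rule someI_ex[OF graded_free_resolution_exists[OF K Km]])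
  note res = graded_free_resolution_based(1)[OF K Km F] and kos = kos_based_resolution[OF K Km]
  have "betti m K i j = hrank (res_basis F) (res_deg F) (res_d F) i (2 * j)"
    unfolding betti_def graded_Tor_def F_def[symmetric] by (rule abelian_rank_resolution_homology[OF K Km F])
  also have "\<dots> = hrank (kos_bas m K) (\<lambda>n. kos_deg) (\<lambda>n. kos_d K) i (2 * j)"
    by (intro antisym hrank_le[OF K res kos] hrank_le[OF K kos res])
  also have "\<dots> = (\<Sum>\<omega>\<in>{\<omega>. \<omega> \<subseteq> {1..m} \<and> card \<omega> = j}.
      if i \<le> j then crank (setbas {\<sigma>\<in>K. \<sigma> \<subseteq> \<omega>}) (\<lambda>n. setbd) (j - i) else 0)"
    by (rule hrank_kos[OF K Km])
  finally show ?thesis .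
qed

theorem proposition1:
  fixes P :: "'a::euclidean_space set" and F :: "nat \<Rightarrow> 'a set" and m i j :: nat
  assumes "polytope P"
    and "bij_betw F {1..m} {G. G facet_of P}"
    and "i \<le> m" and "j \<le> m"
  shows "polytope_betti m F i j =
    (\<Sum>\<omega>\<in>{\<omega>. \<omega> \<subseteq> {1..m} \<and> card \<omega> = j}.
       abelian_rank (reduced_cohomology_group (int j - int i - 1) (top_of_set (\<Union>k\<in>\<omega>. F k))))"
proof -
  let ?K = "facet_complex m F"
  have K: "down_closed ?K"
    unfolding down_closed_def facet_complex_def by auto blast
  have Km: "I \<subseteq> {1..m}" if "I \<in> ?K" for I
    using that by (auto simp: facet_complex_def)
  have F: "compact (F k)" "convex (F k)" "F k \<noteq> {}" if "k \<in> {1..m}" for k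
  proof -
    have "F k facet_of P"
      using assms(2) that by (auto simp: bij_betw_def)
    then show "compact (F k)" "convex (F k)" "F k \<noteq> {}"
      using assms(1) by (auto simp: facet_of_def polytope_imp_compact polytope_imp_convex face_of_polytope_polytope)
  qed
  have "abelian_rank (reduced_cohomology_group (int j - int i - 1) (top_of_set (\<Union>k\<in>\<omega>. F k)))
      = (if i \<le> j then crank (setbas {\<sigma>\<in>?K. \<sigma> \<subseteq> \<omega>}) (\<lambda>n. setbd) (j - i) else 0)"
    if \<omega>: "\<omega> \<subseteq> {1..m}" for \<omega>
  proof (cases "i \<le> j")
    case True
    \<comment> \<open>The full subcomplex on \<open>\<omega>\<close> is the nerve of the facets
      indexed by \<open>\<omega>\<close>. The empty \<open>\<omega>\<close> is included: the empty
      simplex alone then matches the augmentation term of the empty space.\<close>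
    have K\<omega>: "{\<sigma>\<in>?K. \<sigma> \<subseteq> \<omega>} = insert {} {J. J \<subseteq> \<omega> \<and> J \<noteq> {} \<and> (\<Inter>k\<in>J. F k) \<noteq> {}}"
      using \<omega> by (auto simp: facet_complex_def)
    have "int j - int i - 1 = int (j - i) - 1"
      using True by simp
    then have "abelian_rank (reduced_cohomology_group (int j - int i - 1) (top_of_set (\<Union>k\<in>\<omega>. F k)))
        = crank (sbas (top_of_set (\<Union>k\<in>\<omega>. F k))) sbd (j - i)"
      by (simp only: abelian_rank_reduced_cohomology)
    also have "\<dots> = crank (setbas {\<sigma>\<in>?K. \<sigma> \<subseteq> \<omega>}) (\<lambda>n. setbd) (j - i)"
      unfolding K\<omega> using \<omega> F finite_subset[OF \<omega>] by (intro crank_compact_convex_cover) auto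
    finally show ?thesis
      using True by simp
  next
    case False
    then show ?thesis
      by (simp add: abelian_rank_reduced_cohomology_neg)
  qed
  moreover have "polytope_betti m F i j = (\<Sum>\<omega>\<in>{\<omega>. \<omega> \<subseteq> {1..m} \<and> card \<omega> = j}.
      if i \<le> j then crank (setbas {\<sigma>\<in>?K. \<sigma> \<subseteq> \<omega>}) (\<lambda>n. setbd) (j - i) else 0)"
    unfolding polytope_betti_def by (rule betti_eq_sum_crank[OF K Km])
  ultimately show ?thesis
    by simp
qed

end
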